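(* Let $G$ be a finitely presented group. Then the following are equivalent: (i) $G$ is large; (ii) there exist a sequence of finite index subgroups $G \geq G_1 \triangleright G_2 \triangleright \dots$ of $G$ and a prime $p$ such that (1) $G_{i+1}$ is normal in $G_i$ and has index a power of $p$ in $G_i$, for each $i$; (2) $G$ does not have Property $(\tau)$ with respect to $\{G_i\}$; and (3) $\{G_i\}$ has linear growth of mod $p$ homology.
   Context: For a group $H$ and prime $p$, $d_p(H)$ denotes the dimension of $H_1(H;\mathbb{F}_p)$ over the field $\mathbb{F}_p$ of order $p$. A collection $\{G_i\}$ of finite index subgroups of $G$ has linear growth of mod $p$ homology if $\inf_i d_p(G_i)/[G:G_i] > 0$. A group is large if it has a finite index subgroup that admits a surjective homomorphism onto a non-abelian free group. Property $(\tau)$: for a finite graph $X$ with vertex set $V(X)$ (loops and multiple edges allowed) and $A \subset V(X)$, $\partial A$ is the set of edges with one endpoint in $A$ and one not in $A$. The Cheeger constant is $h(X) = \min\{|\partial A|/|A| : A \subset V(X),\ 0<|A|\leq |V(X)|/2\}$ (a one-vertex graph is given $h=+\infty$). For a finite generating set $S$ of $G$ and a finite index subgroup $G_i$, $X(G/G_i;S)$ is the Schreier coset graph: vertices are the right cosets $G_i g$, with one edge from $G_i g$ to $G_i g s$ for each coset and each $s\in S$. A finitely generated group $G$ has Property $(\tau)$ with respect to a collection $\{G_i\}$ of finite index subgroups if $\inf_i h(X(G/G_i;S))>0$ for some (equivalently, any) finite generating set $S$ of $G$. *)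

theory Defs
  imports
    "HOL-Algebra.Generated_Groups"
    "HOL-Number_Theory.Residues"
    "HOL-Library.Extended_Real"
    "Jordan_Normal_Form.Missing_VectorSpace"
    "Graph_Theory.Digraph"
begin

section \<open>Free groups\<close>

text \<open>A letter is a generator together with a sign, \<open>(x, True)\<close> standing for \<open>x\<close> and
  \<open>(x, False)\<close> for the inverse of \<open>x\<close>.  Elements of the free group are reduced words; the product
  of \<open>u\<close> and \<open>v\<close> is the reduced form of \<open>u @ v\<close>, obtained by putting the letters of \<open>u\<close> one at a
  time in front of the reduced word \<open>v\<close>.\<close>

definition inv_letter :: "'x \<times> bool \<Rightarrow> 'x \<times> bool" where
  "inv_letter a = (fst a, \<not> snd a)"

definition reduced :: "('x \<times> bool) list \<Rightarrow> bool" where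
  "reduced w \<longleftrightarrow> successively (\<lambda>a b. b \<noteq> inv_letter a) w"

fun push_letter :: "'x \<times> bool \<Rightarrow> ('x \<times> bool) list \<Rightarrow> ('x \<times> bool) list" where
  "push_letter a [] = [a]"
| "push_letter a (b # w) = (if b = inv_letter a then w else a # b # w)"

definition free_group :: "'x set \<Rightarrow> ('x \<times> bool) list monoid" where
  "free_group X =
    \<lparr>carrier = {w. reduced w \<and> fst ` set w \<subseteq> X},
     monoid.mult = (\<lambda>u v. foldr push_letter u v),
     one = []\<rparr>"

lemma inv_letter_simps [simp]:
  "inv_letter (inv_letter a) = a" "fst (inv_letter a) = fst a"
  by (simp_all add: inv_letter_def)

lemma reduced_Cons: "reduced (a # w) \<Longrightarrow> reduced w"
  by (cases w) (auto simp: reduced_def)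

lemma reduced_push_letter: "reduced w \<Longrightarrow> reduced (push_letter a w)"
  by (cases w) (auto simp: reduced_def successively_Cons)

lemma set_push_letter: "fst ` set (push_letter a w) \<subseteq> insert (fst a) (fst ` set w)"
  by (cases w) auto

lemma reduced_foldr: "reduced w \<Longrightarrow> reduced (foldr push_letter u w)"
  by (induction u) (auto intro: reduced_push_letter)

lemma set_foldr: "fst ` set (foldr push_letter u w) \<subseteq> fst ` set u \<union> fst ` set w"
proof (induction u)
  case (Cons a u)
  have "fst ` set (foldr push_letter (a # u) w) \<subseteq> insert (fst a) (fst ` set (foldr push_letter u w))"
    using set_push_letter[of a "foldr push_letter u w"] by simp
  also have "\<dots> \<subseteq> insert (fst a) (fst ` set u \<union> fst ` set w)"
    using Cons.IH by (rule insert_mono)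
  finally show ?case by simp
qed simp

lemma push_inv_push: "reduced w \<Longrightarrow> push_letter (inv_letter a) (push_letter a w) = w"
proof (cases w)
  case (Cons b v)
  assume "reduced w"
  then show ?thesis using Cons by (cases v) (auto simp: reduced_def)
qed simp

lemma foldr_push_letter:
  assumes "reduced w"
  shows "foldr push_letter (push_letter a v) w = push_letter a (foldr push_letter v w)"
proof (cases v)
  case (Cons b v')
  show ?thesis
    using Cons push_inv_push[OF reduced_foldr[OF assms], of "inv_letter a"] by auto
qed simp

lemma foldr_assoc:
  assumes "reduced w"
  shows "foldr push_letter (foldr push_letter u v) w = foldr push_letter u (foldr push_letter v w)"
  by (induction u) (simp_all add: foldr_push_letter assms)

lemma foldr_inverse: "foldr push_letter (rev (map inv_letter u)) u = []"
  by (induction u) auto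

lemma reduced_inverse: "reduced u \<Longrightarrow> reduced (rev (map inv_letter u))"
  unfolding reduced_def successively_rev successively_map
  by (erule successively_mono) auto

lemma foldr_one: "reduced u \<Longrightarrow> foldr push_letter u [] = u"
proof (induction u)
  case (Cons a u)
  then show ?case by (cases u) (auto simp: reduced_def)
qed simp

lemma group_free_group: "group (free_group X)"
proof (rule groupI)
  fix u v assume uv: "u \<in> carrier (free_group X)" "v \<in> carrier (free_group X)"
  then have "fst ` set u \<union> fst ` set v \<subseteq> X"
    by (simp add: free_group_def)
  with set_foldr have "fst ` set (foldr push_letter u v) \<subseteq> X"
    by (rule order_trans)
  with uv show "u \<otimes>\<^bsub>free_group X\<^esub> v \<in> carrier (free_group X)"
    by (simp add: free_group_def reduced_foldr)
next
  fix u assume u: "u \<in> carrier (free_group X)"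
  show "\<exists>v\<in>carrier (free_group X). v \<otimes>\<^bsub>free_group X\<^esub> u = \<one>\<^bsub>free_group X\<^esub>"
    using u reduced_inverse[of u] foldr_inverse[of u]
    by (intro bexI[of _ "rev (map inv_letter u)"]) (auto simp: free_group_def)
qed (auto simp: free_group_def foldr_assoc reduced_def)


section \<open>Finite index, finite presentations and largeness\<close>

definition index :: "('a, 'b) monoid_scheme \<Rightarrow> 'a set \<Rightarrow> nat" where
  "index G H = card (rcosets\<^bsub>G\<^esub> H)"

definition finite_index_subgroup :: "'a set \<Rightarrow> ('a, 'b) monoid_scheme \<Rightarrow> bool" where
  "finite_index_subgroup H G \<longleftrightarrow> subgroup H G \<and> finite (rcosets\<^bsub>G\<^esub> H)"

definition normal_closure :: "('a, 'b) monoid_scheme \<Rightarrow> 'a set \<Rightarrow> 'a set" where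
  "normal_closure G R = \<Inter> {N. N \<lhd> G \<and> R \<subseteq> N}"

definition finitely_presented :: "('a, 'b) monoid_scheme \<Rightarrow> bool" where
  "finitely_presented G \<longleftrightarrow>
    (\<exists>(X :: nat set) R. finite X \<and> finite R \<and> R \<subseteq> carrier (free_group X) \<and>
       G \<cong> free_group X Mod normal_closure (free_group X) R)"

text \<open>No free group is lost by drawing the basis \<open>X\<close> from the type of the elements of \<open>G\<close>:
  a free quotient of a subgroup of \<open>G\<close> has a basis of cardinality at most that of \<open>carrier G\<close>.\<close>

definition large :: "('a, 'b) monoid_scheme \<Rightarrow> bool" where
  "large G \<longleftrightarrow>
    (\<exists>H (X :: 'a set). finite_index_subgroup H G \<and> \<not> comm_group (free_group X) \<and>
       epi (G\<lparr>carrier := H\<rparr>) (free_group X) \<noteq> {})"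


section \<open>Group homology and mod p homology growth\<close>

text \<open>Homology with trivial coefficients, computed by the inhomogeneous bar complex: \<open>n\<close>-chains are
  finitely supported \<open>R\<close>-valued functions on the \<open>n\<close>-tuples of elements of \<open>G\<close>, and
  \[ \partial [g_1|\dots|g_n] = [g_2|\dots|g_n] + \sum_{i=1}^{n-1} (-1)^i [g_1|\dots|g_i g_{i+1}|\dots|g_n]
       + (-1)^n [g_1|\dots|g_{n-1}]. \]
  The ring multiplication fields of the module records are irrelevant and left unspecified.\<close>

definition bar_chains ::
    "('r, 'c) ring_scheme \<Rightarrow> ('a, 'b) monoid_scheme \<Rightarrow> nat \<Rightarrow> ('r, 'a list \<Rightarrow> 'r) module" where
  "bar_chains R G n =
    \<lparr>carrier = {c. (\<forall>l. c l \<in> carrier R) \<and> finite {l. c l \<noteq> \<zero>\<^bsub>R\<^esub>} \<and>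
                   (\<forall>l. c l \<noteq> \<zero>\<^bsub>R\<^esub> \<longrightarrow> length l = n \<and> set l \<subseteq> carrier G)},
     monoid.mult = undefined, one = undefined,
     zero = (\<lambda>l. \<zero>\<^bsub>R\<^esub>), add = (\<lambda>c d l. c l \<oplus>\<^bsub>R\<^esub> d l),
     smult = (\<lambda>a c l. a \<otimes>\<^bsub>R\<^esub> c l)\<rparr>"

definition bar_face :: "('a, 'b) monoid_scheme \<Rightarrow> nat \<Rightarrow> 'a list \<Rightarrow> 'a list" where
  "bar_face G i l =
    (if i = 0 then tl l
     else if i = length l then butlast l
     else take (i - 1) l @ (l ! (i - 1) \<otimes>\<^bsub>G\<^esub> l ! i) # drop (i + 1) l)"

definition bar_boundary ::
    "('r, 'c) ring_scheme \<Rightarrow> ('a, 'b) monoid_scheme \<Rightarrow> ('a list \<Rightarrow> 'r) \<Rightarrow> 'a list \<Rightarrow> 'r" where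
  "bar_boundary R G c t =
    (\<Oplus>\<^bsub>R\<^esub>l \<in> {l. c l \<noteq> \<zero>\<^bsub>R\<^esub> \<and> l \<noteq> []}.
      \<Oplus>\<^bsub>R\<^esub>i \<in> {i. i \<le> length l \<and> bar_face G i l = t}.
        if even i then c l else \<ominus>\<^bsub>R\<^esub> c l)"

definition quotient_module :: "('r, 'm, 'x) module_scheme \<Rightarrow> 'm set \<Rightarrow> ('r, 'm set) module" where
  "quotient_module M N =
    \<lparr>carrier = a_rcosets\<^bsub>M\<^esub> N,
     monoid.mult = undefined, one = undefined,
     zero = N, add = (\<lambda>U V. U <+>\<^bsub>M\<^esub> V),
     smult = (\<lambda>a U. \<Union>u\<in>U. N +>\<^bsub>M\<^esub> (a \<odot>\<^bsub>M\<^esub> u))\<rparr>"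

definition group_homology ::
    "('r, 'c) ring_scheme \<Rightarrow> ('a, 'b) monoid_scheme \<Rightarrow> nat \<Rightarrow> ('r, ('a list \<Rightarrow> 'r) set) module" where
  "group_homology R G n =
    quotient_module
      ((bar_chains R G n)\<lparr>carrier :=
         {c \<in> carrier (bar_chains R G n). bar_boundary R G c = (\<lambda>t. \<zero>\<^bsub>R\<^esub>)}\<rparr>)
      (bar_boundary R G ` carrier (bar_chains R G (Suc n)))"

lemma (in cring) module_bar_chains: "module R (bar_chains R G n)"
proof (rule moduleI)
  show "abelian_group (bar_chains R G n)"
  proof (rule abelian_groupI)
    fix c d assume c: "c \<in> carrier (bar_chains R G n)" and d: "d \<in> carrier (bar_chains R G n)"
    have sub: "{l. c l \<oplus> d l \<noteq> \<zero>} \<subseteq> {l. c l \<noteq> \<zero>} \<union> {l. d l \<noteq> \<zero>}" by auto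
    have "finite {l. c l \<oplus> d l \<noteq> \<zero>}"
      using c d by (intro finite_subset[OF sub]) (auto simp: bar_chains_def)
    moreover have "length l = n \<and> set l \<subseteq> carrier G" if "c l \<oplus> d l \<noteq> \<zero>" for l
    proof -
      have "c l \<noteq> \<zero> \<or> d l \<noteq> \<zero>" using that sub by blast
      then show ?thesis using c d by (auto simp: bar_chains_def)
    qed
    ultimately show "c \<oplus>\<^bsub>bar_chains R G n\<^esub> d \<in> carrier (bar_chains R G n)"
      using c d by (auto simp: bar_chains_def)
  next
    fix c assume c: "c \<in> carrier (bar_chains R G n)"
    then have "{l. \<ominus> c l \<noteq> \<zero>} = {l. c l \<noteq> \<zero>}"
      by (auto simp: bar_chains_def)
    with c have "(\<lambda>l. \<ominus> c l) \<in> carrier (bar_chains R G n)"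
      by (auto simp: bar_chains_def)
    with c show "\<exists>d\<in>carrier (bar_chains R G n). d \<oplus>\<^bsub>bar_chains R G n\<^esub> c = \<zero>\<^bsub>bar_chains R G n\<^esub>"
      by (intro bexI[of _ "\<lambda>l. \<ominus> c l"]) (auto simp: bar_chains_def l_neg)
  qed (auto simp: bar_chains_def a_ac)
next
  fix a c assume a: "a \<in> carrier R" and c: "c \<in> carrier (bar_chains R G n)"
  have sub: "{l. a \<otimes> c l \<noteq> \<zero>} \<subseteq> {l. c l \<noteq> \<zero>}" using a by auto
  have "finite {l. a \<otimes> c l \<noteq> \<zero>}"
    using c by (intro finite_subset[OF sub]) (auto simp: bar_chains_def)
  then show "a \<odot>\<^bsub>bar_chains R G n\<^esub> c \<in> carrier (bar_chains R G n)"
    using a c sub by (auto simp: bar_chains_def)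
qed (auto simp: bar_chains_def l_distr r_distr m_assoc intro: cring_axioms)

lemma (in cring) bar_boundary_eq:
  assumes c: "c \<in> carrier (bar_chains R G n)" and S: "finite S" "{l. c l \<noteq> \<zero>} \<subseteq> S"
  shows "bar_boundary R G c t =
    (\<Oplus>l \<in> S - {[]}. \<Oplus>i \<in> {i. i \<le> length l \<and> bar_face G i l = t}.
        if even i then c l else \<ominus> c l)"
  unfolding bar_boundary_def
proof (rule add.finprod_mono_neutral_cong_left)
  fix l assume "l \<in> S - {[]} - {l. c l \<noteq> \<zero> \<and> l \<noteq> []}"
  then have "c l = \<zero>" by auto
  then show "(\<Oplus>i \<in> {i. i \<le> length l \<and> bar_face G i l = t}.
        if even i then c l else \<ominus> c l) = \<zero>"
    by (intro add.finprod_one_eqI) auto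
qed (use c S in \<open>auto simp: bar_chains_def intro!: finsum_closed\<close>)

lemma (in cring) bar_boundary_closed:
  assumes c: "c \<in> carrier (bar_chains R G n)"
  shows "bar_boundary R G c t \<in> carrier R"
  using c unfolding bar_boundary_def by (intro finsum_closed) (auto simp: bar_chains_def intro!: finsum_closed)

lemma (in cring) bar_boundary_add:
  assumes c: "c \<in> carrier (bar_chains R G n)" and d: "d \<in> carrier (bar_chains R G n)"
  shows "bar_boundary R G (c \<oplus>\<^bsub>bar_chains R G n\<^esub> d) t =
    bar_boundary R G c t \<oplus> bar_boundary R G d t"
proof -
  interpret C: module R "bar_chains R G n" by (rule module_bar_chains)
  let ?S = "{l. c l \<noteq> \<zero>} \<union> {l. d l \<noteq> \<zero>}"
  let ?I = "\<lambda>l. {i. i \<le> length l \<and> bar_face G i l = t}"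
  have cR [simp]: "c l \<in> carrier R" and dR [simp]: "d l \<in> carrier R" for l
    using c d by (auto simp: bar_chains_def)
  have eq: "c \<oplus>\<^bsub>bar_chains R G n\<^esub> d = (\<lambda>l. c l \<oplus> d l)"
    by (simp add: bar_chains_def)
  have fin: "finite ?S" using c d by (auto simp: bar_chains_def)
  have inner: "(\<Oplus>i\<in>?I l. if even i then c l \<oplus> d l else \<ominus> (c l \<oplus> d l)) =
     (\<Oplus>i\<in>?I l. if even i then c l else \<ominus> c l) \<oplus> (\<Oplus>i\<in>?I l. if even i then d l else \<ominus> d l)" for l
  proof -
    have "(\<Oplus>i\<in>?I l. if even i then c l \<oplus> d l else \<ominus> (c l \<oplus> d l)) =
      (\<Oplus>i\<in>?I l. (if even i then c l else \<ominus> c l) \<oplus> (if even i then d l else \<ominus> d l))"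
      by (intro add.finprod_cong') (auto simp: minus_add)
    also have "\<dots> = (\<Oplus>i\<in>?I l. if even i then c l else \<ominus> c l) \<oplus> (\<Oplus>i\<in>?I l. if even i then d l else \<ominus> d l)"
      by (intro finsum_addf) auto
    finally show ?thesis .
  qed
  have "bar_boundary R G (c \<oplus>\<^bsub>bar_chains R G n\<^esub> d) t =
      (\<Oplus>l\<in>?S - {[]}. \<Oplus>i\<in>?I l. if even i then c l \<oplus> d l else \<ominus> (c l \<oplus> d l))"
    using C.M.a_closed[OF c d] unfolding eq by (intro bar_boundary_eq fin) auto
  also have "\<dots> = (\<Oplus>l\<in>?S - {[]}. \<Oplus>i\<in>?I l. if even i then c l else \<ominus> c l) \<oplus>
      (\<Oplus>l\<in>?S - {[]}. \<Oplus>i\<in>?I l. if even i then d l else \<ominus> d l)"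
    unfolding inner by (intro finsum_addf) (auto intro!: finsum_closed)
  also have "\<dots> = bar_boundary R G c t \<oplus> bar_boundary R G d t"
    by (subst (1 2) bar_boundary_eq[OF _ fin]) (use c d in auto)
  finally show ?thesis .
qed

lemma (in cring) bar_boundary_smult:
  assumes a: "a \<in> carrier R" and c: "c \<in> carrier (bar_chains R G n)"
  shows "bar_boundary R G (a \<odot>\<^bsub>bar_chains R G n\<^esub> c) t = a \<otimes> bar_boundary R G c t"
proof -
  interpret C: module R "bar_chains R G n" by (rule module_bar_chains)
  let ?S = "{l. c l \<noteq> \<zero>}"
  let ?I = "\<lambda>l. {i. i \<le> length l \<and> bar_face G i l = t}"
  have cR [simp]: "c l \<in> carrier R" for l
    using c by (auto simp: bar_chains_def)
  have eq: "a \<odot>\<^bsub>bar_chains R G n\<^esub> c = (\<lambda>l. a \<otimes> c l)"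
    by (simp add: bar_chains_def)
  have fin: "finite ?S" using c by (auto simp: bar_chains_def)
  have inner: "(\<Oplus>i\<in>?I l. if even i then a \<otimes> c l else \<ominus> (a \<otimes> c l)) =
     a \<otimes> (\<Oplus>i\<in>?I l. if even i then c l else \<ominus> c l)" for l
    using a by (subst finsum_rdistr) (auto intro!: add.finprod_cong' simp: r_minus)
  have "bar_boundary R G (a \<odot>\<^bsub>bar_chains R G n\<^esub> c) t =
      (\<Oplus>l\<in>?S - {[]}. \<Oplus>i\<in>?I l. if even i then a \<otimes> c l else \<ominus> (a \<otimes> c l))"
    using C.smult_closed[OF a c] a unfolding eq by (intro bar_boundary_eq fin) auto
  also have "\<dots> = a \<otimes> (\<Oplus>l\<in>?S - {[]}. \<Oplus>i\<in>?I l. if even i then c l else \<ominus> c l)"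
    unfolding inner using a fin by (subst finsum_rdistr) (auto intro!: finsum_closed)
  also have "\<dots> = a \<otimes> bar_boundary R G c t"
    by (subst bar_boundary_eq[OF c fin]) auto
  finally show ?thesis .
qed

lemma bar_face_closed:
  assumes "\<And>x y. x \<in> carrier G \<Longrightarrow> y \<in> carrier G \<Longrightarrow> x \<otimes>\<^bsub>G\<^esub> y \<in> carrier G"
    and "l \<noteq> []" "set l \<subseteq> carrier G" "i \<le> length l"
  shows "length (bar_face G i l) = length l - 1" "set (bar_face G i l) \<subseteq> carrier G"
proof -
  show "length (bar_face G i l) = length l - 1"
    using assms by (auto simp: bar_face_def)
  have "l ! (i - 1) \<otimes>\<^bsub>G\<^esub> l ! i \<in> carrier G" if "i \<noteq> 0" "i \<noteq> length l"
    using that assms by (intro assms(1)) (auto simp: subset_iff)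
  then show "set (bar_face G i l) \<subseteq> carrier G"
    using assms
    by (auto simp: bar_face_def subset_iff dest: in_set_takeD in_set_dropD in_set_butlastD list.set_sel(2))
qed

lemma (in cring) bar_boundary_in_chains:
  assumes mult: "\<And>x y. x \<in> carrier G \<Longrightarrow> y \<in> carrier G \<Longrightarrow> x \<otimes>\<^bsub>G\<^esub> y \<in> carrier G"
    and c: "c \<in> carrier (bar_chains R G (Suc n))"
  shows "bar_boundary R G c \<in> carrier (bar_chains R G n)"
proof -
  let ?T = "\<Union>l\<in>{l. c l \<noteq> \<zero>}. (\<lambda>i. bar_face G i l) ` {..length l}"
  have 1: "bar_boundary R G c t = \<zero>" if "t \<notin> ?T" for t
    unfolding bar_boundary_def
  proof (rule add.finprod_one_eqI)
    fix l assume "l \<in> {l. c l \<noteq> \<zero> \<and> l \<noteq> []}"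
    then have "{i. i \<le> length l \<and> bar_face G i l = t} = {}" using that by auto
    then show "(\<Oplus>i \<in> {i. i \<le> length l \<and> bar_face G i l = t}.
        if even i then c l else \<ominus> c l) = \<zero>" by (simp only: finsum_empty)
  qed
  have 2: "finite ?T" using c by (auto simp: bar_chains_def)
  have 3: "length t = n \<and> set t \<subseteq> carrier G" if "t \<in> ?T" for t
  proof -
    from that obtain l i where li: "c l \<noteq> \<zero>" "i \<le> length l" "t = bar_face G i l" by auto
    with c have l: "length l = Suc n" "set l \<subseteq> carrier G" by (auto simp: bar_chains_def)
    then have "l \<noteq> []" by auto
    from bar_face_closed[OF mult this l(2) li(2)] li l show ?thesis by simp
  qed
  have "finite {t. bar_boundary R G c t \<noteq> \<zero>}"
    by (rule finite_subset[OF _ 2]) (use 1 in blast)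
  moreover have "length t = n \<and> set t \<subseteq> carrier G" if "bar_boundary R G c t \<noteq> \<zero>" for t
    using 1 3 that by blast
  ultimately show ?thesis
    using bar_boundary_closed[OF c] by (simp add: bar_chains_def)
qed

lemma (in cring) bar_boundary_1:
  assumes c: "c \<in> carrier (bar_chains R G 1)"
  shows "bar_boundary R G c = (\<lambda>t. \<zero>)"
proof
  fix t
  show "bar_boundary R G c t = \<zero>"
    unfolding bar_boundary_def
  proof (rule add.finprod_one_eqI)
    fix l assume "l \<in> {l. c l \<noteq> \<zero> \<and> l \<noteq> []}"
    with c obtain g where l: "l = [g]" by (auto simp: bar_chains_def length_Suc_conv)
    have cl: "c [g] \<in> carrier R" using c by (auto simp: bar_chains_def)
    have "{i. i \<le> length l \<and> bar_face G i l = t} = (if t = [] then {0, 1} else {})"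
      by (auto simp: l bar_face_def le_Suc_eq)
    with cl show "(\<Oplus>i \<in> {i. i \<le> length l \<and> bar_face G i l = t}.
        if even i then c l else \<ominus> c l) = \<zero>" by (auto simp: l r_neg)
  qed
qed

lemma (in module) module_quotient_module:
  assumes "submodule R N M"
  shows "module R (quotient_module M N)"
proof -
  interpret N: submodule R N M by fact
  have inv: "\<ominus>\<^bsub>M\<^esub> x \<in> N" if "x \<in> N" for x
  proof -
    have "\<ominus> \<one> \<odot>\<^bsub>M\<^esub> x \<in> N" using that by (intro N.smult_closed) auto
    then show ?thesis using that N.subset by (metis smult_minus_1 subset_iff)
  qed
  have "additive_subgroup N M"
    using N.subset inv by (intro additive_subgroup.intro subgroup.intro) (auto simp flip: a_inv_def)
  then interpret N: abelian_subgroup N M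
    by (intro abelian_subgroupI3 M.abelian_group_axioms)
  let ?Q = "quotient_module M N"
  have carr: "carrier ?Q = (\<lambda>x. N +>\<^bsub>M\<^esub> x) ` carrier M"
    by (auto simp: quotient_module_def A_RCOSETS_def')
  have add: "(N +>\<^bsub>M\<^esub> x) \<oplus>\<^bsub>?Q\<^esub> (N +>\<^bsub>M\<^esub> y) = N +>\<^bsub>M\<^esub> (x \<oplus>\<^bsub>M\<^esub> y)"
    if "x \<in> carrier M" "y \<in> carrier M" for x y
    using N.a_rcos_sum[OF that] by (simp add: quotient_module_def)
  have zero: "\<zero>\<^bsub>?Q\<^esub> = N +>\<^bsub>M\<^esub> \<zero>\<^bsub>M\<^esub>"
    using N.subset by (simp add: quotient_module_def M.a_coset_add_zero)
  have smult: "a \<odot>\<^bsub>?Q\<^esub> (N +>\<^bsub>M\<^esub> x) = N +>\<^bsub>M\<^esub> (a \<odot>\<^bsub>M\<^esub> x)"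
    if a: "a \<in> carrier R" and x: "x \<in> carrier M" for a x
  proof -
    have "N +>\<^bsub>M\<^esub> (a \<odot>\<^bsub>M\<^esub> u) = N +>\<^bsub>M\<^esub> (a \<odot>\<^bsub>M\<^esub> x)" if "u \<in> N +>\<^bsub>M\<^esub> x" for u
    proof -
      from that obtain h where h: "h \<in> N" "u = h \<oplus>\<^bsub>M\<^esub> x" by (auto simp: a_r_coset_def')
      then have "a \<odot>\<^bsub>M\<^esub> u = (a \<odot>\<^bsub>M\<^esub> h) \<oplus>\<^bsub>M\<^esub> (a \<odot>\<^bsub>M\<^esub> x)"
        using a x N.subset by (auto simp: smult_r_distr)
      then have "a \<odot>\<^bsub>M\<^esub> u \<in> N +>\<^bsub>M\<^esub> (a \<odot>\<^bsub>M\<^esub> x)"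
        using N.smult_closed[OF a h(1)] by (auto simp: a_r_coset_def')
      then show ?thesis using M.a_repr_independence[OF _ smult_closed[OF a x] N.a_subgroup] by simp
    qed
    moreover have "x \<in> N +>\<^bsub>M\<^esub> x" using N.a_rcos_self[OF x] .
    ultimately have "(\<Union>u\<in>N +>\<^bsub>M\<^esub> x. N +>\<^bsub>M\<^esub> (a \<odot>\<^bsub>M\<^esub> u)) = N +>\<^bsub>M\<^esub> (a \<odot>\<^bsub>M\<^esub> x)"
      by (intro SUP_eq_const) blast+
    then show ?thesis by (simp add: quotient_module_def)
  qed
  show ?thesis
  proof (rule moduleI)
    show "abelian_group ?Q"
    proof (rule abelian_groupI)
      fix U assume "U \<in> carrier ?Q"
      then obtain x where x: "x \<in> carrier M" "U = N +>\<^bsub>M\<^esub> x" by (auto simp: carr)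
      then show "\<exists>V\<in>carrier ?Q. V \<oplus>\<^bsub>?Q\<^esub> U = \<zero>\<^bsub>?Q\<^esub>"
        by (intro bexI[of _ "N +>\<^bsub>M\<^esub> (\<ominus>\<^bsub>M\<^esub> x)"]) (auto simp: carr add zero M.l_neg)
    qed (auto simp: carr add zero M.a_ac)
  qed (auto simp: carr add smult smult_l_distr smult_r_distr smult_assoc1 intro: R.cring_axioms)
qed

lemma (in cring) bar_boundary_hom:
  assumes "\<And>x y. x \<in> carrier G \<Longrightarrow> y \<in> carrier G \<Longrightarrow> x \<otimes>\<^bsub>G\<^esub> y \<in> carrier G"
  shows "bar_boundary R G \<in> module_hom R (bar_chains R G (Suc n)) (bar_chains R G n)"
proof -
  have add_bar: "c \<oplus>\<^bsub>bar_chains R G n\<^esub> d = (\<lambda>l. c l \<oplus> d l)" for c d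
    by (simp add: bar_chains_def)
  have smult_bar: "a \<odot>\<^bsub>bar_chains R G n\<^esub> c = (\<lambda>l. a \<otimes> c l)" for a c
    by (simp add: bar_chains_def)
  show ?thesis
    unfolding module_hom_def add_bar smult_bar
    by (auto intro!: bar_boundary_in_chains bar_boundary_add bar_boundary_smult ext assms)
qed

lemma (in cring) group_homology_1:
  "group_homology R G 1 =
    quotient_module (bar_chains R G 1) (bar_boundary R G ` carrier (bar_chains R G (Suc 1)))"
proof -
  have "{c \<in> carrier (bar_chains R G 1). bar_boundary R G c = (\<lambda>t. \<zero>)} = carrier (bar_chains R G 1)"
    using bar_boundary_1 by blast
  then show ?thesis unfolding group_homology_def by simp
qed

lemma (in field) vectorspace_group_homology_1:
  assumes "group G"
  shows "vectorspace R (group_homology R G 1)"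
proof -
  interpret C: module R "bar_chains R G 1" by (rule module_bar_chains)
  have "mod_hom R (bar_chains R G (Suc 1)) (bar_chains R G 1) (bar_boundary R G)"
    using assms
    by (intro mod_hom.intro module_bar_chains mod_hom_axioms.intro bar_boundary_hom)
      (simp add: group_def monoid.m_closed)
  then have "submodule R (bar_boundary R G ` carrier (bar_chains R G (Suc 1))) (bar_chains R G 1)"
    using mod_hom.im_is_submodule by (metis mod_hom.im_def)
  from C.module_quotient_module[OF this] show ?thesis
    unfolding group_homology_1 by (intro vectorspace.intro field_axioms)
qed

definition mod_p_rank :: "nat \<Rightarrow> ('a, 'b) monoid_scheme \<Rightarrow> nat" where
  "mod_p_rank p H =
    vectorspace.dim (residue_ring (int p)) (group_homology (residue_ring (int p)) H 1)"

definition linear_mod_p_growth ::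
    "nat \<Rightarrow> ('a, 'b) monoid_scheme \<Rightarrow> 'a set set \<Rightarrow> bool" where
  "linear_mod_p_growth p G \<C> \<longleftrightarrow>
    (INF H\<in>\<C>. ereal (real (mod_p_rank p (G\<lparr>carrier := H\<rparr>)) / real (index G H))) > 0"


section \<open>Cheeger constants and Property \<open>(\<tau>)\<close>\<close>

text \<open>Finite graphs with loops and multiple edges are represented by multi-digraphs whose
  orientation is ignored.\<close>

definition edge_boundary :: "('v, 'e) pre_digraph \<Rightarrow> 'v set \<Rightarrow> 'e set" where
  "edge_boundary X A = {e \<in> arcs X. (tail X e \<in> A) \<noteq> (head X e \<in> A)}"

text \<open>The infimum ranges over finitely many values and hence is a minimum, except that for a graph
  with one vertex it is the infimum of the empty set, which is \<open>\<infinity>\<close>.\<close>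

definition cheeger :: "('v, 'e) pre_digraph \<Rightarrow> ereal" where
  "cheeger X =
    (INF A\<in>{A. A \<subseteq> verts X \<and> 0 < card A \<and> 2 * card A \<le> card (verts X)}.
       ereal (real (card (edge_boundary X A)) / real (card A)))"

definition schreier_graph ::
    "('a, 'b) monoid_scheme \<Rightarrow> 'a set \<Rightarrow> 'a set \<Rightarrow> ('a set, 'a set \<times> 'a) pre_digraph" where
  "schreier_graph G H S =
    \<lparr>verts = rcosets\<^bsub>G\<^esub> H, arcs = (rcosets\<^bsub>G\<^esub> H) \<times> S,
     tail = (\<lambda>(U, s). U), head = (\<lambda>(U, s). U #>\<^bsub>G\<^esub> s)\<rparr>"

definition property_tau :: "('a, 'b) monoid_scheme \<Rightarrow> 'a set set \<Rightarrow> bool" where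
  "property_tau G \<C> \<longleftrightarrow>
    (\<exists>S. finite S \<and> S \<subseteq> carrier G \<and> generate G S = carrier G \<and>
       (INF H\<in>\<C>. cheeger (schreier_graph G H S)) > 0)"

end

theory Submission
  imports Defs "HOL-Computational_Algebra.Polynomial" "HOL-Algebra.Sylow"
begin

text \<open>From (ii) to (i): on the coset graph of a finite index subgroup, with the relators attached as
  cells, consider mod \<open>p\<close> cocycles supported on the edges inside a vertex set \<open>B\<close>, and let \<open>\<zeta>(B)\<close> be the
  dimension of their space.  A bound \<open>\<zeta>(B) \<le> a|B| + b|\<partial>B|\<close> for all \<open>B\<close> passes from a subgroup to its
  normal subgroups of \<open>p\<close>-power index: in a cyclic cover of degree \<open>p\<close> with deck transformation \<open>\<sigma>\<close>, the
  graded pieces of the filtration by powers of \<open>\<sigma> - 1\<close> live downstairs.  Start from a level at which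
  \<open>\<zeta>(V)/|V|\<close> is almost minimal, with \<open>a\<close> this ratio.  Without \<open>(\<tau>)\<close>, the first later level that has a set
  \<open>D\<close> with \<open>|\<partial>D| < \<epsilon>|D|\<close>, \<open>2|D| \<le> |V|\<close> has one with \<open>|V| < 4|D|\<close> as well, since otherwise a minimizer
  of \<open>|\<partial>D| - \<epsilon>|D|\<close> would descend to the level before.  As neither side of this cut can have more cocycles
  than its share and linear growth makes the total exceed \<open>|V|\<close> by a definite proportion, the space
  of cocycles on either side that vanish near the cut has dimension more than the size of that side plus
  \<open>|\<partial>D|\<close>.  So both sides carry independent classes, and these give a finite cover that
  maps onto a graph with non-abelian free fundamental group.

  From (i) to (ii): if \<open>H\<close> maps onto a free group on at least two generators, take the subgroups of \<open>H\<close> on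
  which the exponent sum of one generator is divisible by \<open>2\<^sup>i\<close>.\<close>

section \<open>Finite differences modulo a prime\<close>

text \<open>Cocycles are counted, not cohomology classes: coboundaries contribute |V| - 1
  dimensions, so linear growth keeps \<zeta>(V) above (1 + c)|V| - 1, while on a connected piece S
  potentials account for at most |S| dimensions. A surplus over |S| therefore yields closed walks
  with non-zero sums. The bound has to hold for all vertex sets, at the price of a boundary term,
  because it is applied to one side of a cut in order to bound the other side from below. Index a
  power of p enters through (\<sigma> - 1)^p = \<sigma>^p - 1 = 0 modulo p: the filtration has p
  steps, and the step of order n lives over the vertices whose fibre meets B in at least p - n
  points. The obstacle is the order of the choices. As b grows with the size of the starting level,
  \<epsilon> can only be fixed afterwards; it is then taken so small that no level up to the
  starting one admits such a cut, so the first level that does lies above the start, where the bound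
  is available. The balance |V| < 4|D| is needed because the error in the almost minimal ratio is a
  fraction of |V| and has to be paid for by either side alone.\<close>

lemma poly_roots_mod_prime:
  fixes q :: "int poly"
  assumes "prime p" "degree q \<le> r" "finite S" "r < card S"
    and "\<And>s t. s \<in> S \<Longrightarrow> t \<in> S \<Longrightarrow> p dvd s - t \<Longrightarrow> s = t"
    and "\<And>s. s \<in> S \<Longrightarrow> p dvd poly q s"
  shows "p dvd coeff q i"
  using assms(2-)
proof (induction r arbitrary: q S i)
  case 0
  then obtain s where "s \<in> S" by (metis card_gt_0_iff ex_in_conv)
  moreover obtain c where "q = [:c:]" using 0 by (meson degree_eq_zeroE le_zero_eq)
  ultimately show ?case using 0 by (cases i) auto
next
  case (Suc r)
  then obtain s where s: "s \<in> S" by fastforce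
  \<comment> \<open>Splitting off the root s leaves a quotient of smaller degree that vanishes at
    the other points of S, since their differences from s are units modulo p.\<close>
  define q' where "q' = synthetic_div q s"
  have q: "q + smult s q' = pCons (poly q s) q'"
    unfolding q'_def by (rule synthetic_div_correct)
  have val: "poly q x = (x - s) * poly q' x + poly q s" for x
    using arg_cong[OF q, of "\<lambda>u. poly u x"] by (simp add: algebra_simps)
  have q': "p dvd coeff q' j" for j
  proof (rule Suc.IH[of q' "S - {s}"])
    show "degree q' \<le> r" using Suc.prems(1) by (simp add: q'_def degree_synthetic_div)
    show "r < card (S - {s})" using Suc.prems(2,3) s by simp
  next
    fix t assume t: "t \<in> S - {s}"
    have "p dvd (t - s) * poly q' t"
      using val[of t] Suc.prems(5)[of t] Suc.prems(5)[OF s] t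
      by (metis DiffD1 add_diff_cancel_right' dvd_diff)
    moreover have "\<not> p dvd t - s" using Suc.prems(4)[of t s] s t by auto
    ultimately show "p dvd poly q' t" using \<open>prime p\<close> by (simp add: prime_dvd_mult_iff)
  qed (use Suc.prems in auto)
  have "coeff q i = coeff (pCons (poly q s) q') i - s * coeff q' i"
    using arg_cong[OF q, of "\<lambda>u. coeff u i"] by simp
  then show ?case using q' Suc.prems(5)[OF s] by (cases i) auto
qed

definition fdiff :: "(nat \<Rightarrow> int) \<Rightarrow> nat \<Rightarrow> int" where
  "fdiff f k = f (Suc k) - f k"

lemma fdiff_Suc: "(fdiff ^^ n) f (Suc k) = (fdiff ^^ n) f k + (fdiff ^^ Suc n) f k"
  by (simp add: fdiff_def)

lemma newton_forward: "f k = (\<Sum>i\<le>k. int (k choose i) * (fdiff ^^ i) f 0)"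
proof -
  \<comment> \<open>Claimed for all orders n at once: passing from k to Suc k involves both the n-th
    and the (n+1)-st difference, and Pascal's rule recombines the two sums.\<close>
  have "(fdiff ^^ n) f k = (\<Sum>i\<le>k. int (k choose i) * (fdiff ^^ (n + i)) f 0)" for n
  proof (induction k arbitrary: n)
    case (Suc k)
    have "(fdiff ^^ n) f (Suc k) =
        (\<Sum>i\<le>k. int (k choose i) * (fdiff ^^ (n + i)) f 0) +
        (\<Sum>i\<le>k. int (k choose i) * (fdiff ^^ (n + Suc i)) f 0)"
      by (simp add: fdiff_Suc[of n] Suc.IH Suc.IH[of "Suc n", simplified])
    also have "(\<Sum>i\<le>k. int (k choose i) * (fdiff ^^ (n + i)) f 0) =
        (\<Sum>i\<le>Suc k. int (k choose i) * (fdiff ^^ (n + i)) f 0)" by simp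
    also have "\<dots> = (fdiff ^^ n) f 0 + (\<Sum>i\<le>k. int (k choose Suc i) * (fdiff ^^ (n + Suc i)) f 0)"
      by (subst sum.atMost_Suc_shift) simp
    also have "\<dots> + (\<Sum>i\<le>k. int (k choose i) * (fdiff ^^ (n + Suc i)) f 0) =
        (fdiff ^^ n) f 0 + (\<Sum>i\<le>k. int (Suc k choose Suc i) * (fdiff ^^ (n + Suc i)) f 0)"
      by (simp add: sum.distrib algebra_simps)
    also have "\<dots> = (\<Sum>i\<le>Suc k. int (Suc k choose i) * (fdiff ^^ (n + i)) f 0)"
      by (subst sum.atMost_Suc_shift) simp
    finally show ?case .
  qed simp
  from this[of 0] show ?thesis by simp
qed

lemma fdiff_funpow: "(fdiff ^^ n) f k = (\<Sum>i\<le>n. (- 1) ^ (n - i) * int (n choose i) * f (k + i))"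
proof (induction n arbitrary: k)
  case (Suc n)
  have "(fdiff ^^ Suc n) f k =
      (\<Sum>i\<le>n. (- 1) ^ (n - i) * int (n choose i) * f (k + Suc i)) -
      (\<Sum>i\<le>n. (- 1) ^ (n - i) * int (n choose i) * f (k + i))"
    by (simp add: fdiff_def Suc.IH)
  also have "(\<Sum>i\<le>n. (- 1) ^ (n - i) * int (n choose i) * f (k + i)) =
      (\<Sum>i\<le>Suc n. (- 1) ^ (n - i) * int (n choose i) * f (k + i))" by simp
  also have "\<dots> = (- 1) ^ n * f k +
      (\<Sum>i\<le>n. (- 1) ^ (n - Suc i) * int (n choose Suc i) * f (k + Suc i))"
    by (subst sum.atMost_Suc_shift) simp
  also have "(\<Sum>i\<le>n. (- 1) ^ (n - Suc i) * int (n choose Suc i) * f (k + Suc i)) =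
      - (\<Sum>i\<le>n. (- 1) ^ (n - i) * int (n choose Suc i) * f (k + Suc i))"
    unfolding sum_negf[symmetric]
  proof (rule sum.cong)
    fix i assume "i \<in> {..n}"
    then show "(- 1) ^ (n - Suc i) * int (n choose Suc i) * f (k + Suc i) =
        - ((- 1) ^ (n - i) * int (n choose Suc i) * f (k + Suc i))"
      by (cases "i = n") (auto simp: Suc_diff_Suc[symmetric])
  qed simp
  also have "(\<Sum>i\<le>n. (- 1) ^ (n - i) * int (n choose i) * f (k + Suc i)) -
      ((- 1) ^ n * f k + - (\<Sum>i\<le>n. (- 1) ^ (n - i) * int (n choose Suc i) * f (k + Suc i))) =
      (- 1) ^ Suc n * f k + (\<Sum>i\<le>n. (- 1) ^ (n - i) * int (Suc n choose Suc i) * f (k + Suc i))"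
    by (simp add: sum.distrib algebra_simps)
  also have "\<dots> = (\<Sum>i\<le>Suc n. (- 1) ^ (Suc n - i) * int (Suc n choose i) * f (k + i))"
    by (subst sum.atMost_Suc_shift) simp
  finally show ?case .
qed simp

text \<open>With T the shift operator this is (T - 1)^p = T^p - 1 modulo p: the inner binomial
  coefficients are divisible by p, and periodicity merges the two end terms.\<close>

lemma fdiff_prime_periodic:
  assumes p: "prime p" and per: "\<And>k. f (k + p) = f k"
  shows "int p dvd (fdiff ^^ p) f k"
proof -
  have "p > 0" using p prime_gt_0_nat by blast
  have "(fdiff ^^ p) f k = (\<Sum>i\<in>{0, p} \<union> {0<..<p}. (- 1) ^ (p - i) * int (p choose i) * f (k + i))"
    unfolding fdiff_funpow by (intro sum.cong) auto
  also have "\<dots> = (\<Sum>i\<in>{0, p}. (- 1) ^ (p - i) * int (p choose i) * f (k + i)) +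
      (\<Sum>i\<in>{0<..<p}. (- 1) ^ (p - i) * int (p choose i) * f (k + i))"
    by (intro sum.union_disjoint) auto
  also have "(\<Sum>i\<in>{0, p}. (- 1) ^ (p - i) * int (p choose i) * f (k + i)) = ((- 1) ^ p + 1) * f k"
    using \<open>p > 0\<close> per[of k] by (simp add: algebra_simps)
  finally have eq: "(fdiff ^^ p) f k = ((- 1) ^ p + 1) * f k +
      (\<Sum>i\<in>{0<..<p}. (- 1) ^ (p - i) * int (p choose i) * f (k + i))" .
  \<comment> \<open>For odd p the end terms cancel; for p = 2 they add up to twice a value.\<close>
  have "int p dvd (- 1) ^ p + 1"
  proof (cases "even p")
    case True
    then have "p = 2" using p by (metis prime_nat_iff two_is_prime_nat primes_dvd_imp_eq)
    then show ?thesis by simp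
  qed simp
  moreover have "int p dvd (\<Sum>i\<in>{0<..<p}. (- 1) ^ (p - i) * int (p choose i) * f (k + i))"
  proof (rule dvd_sum)
    fix i assume "i \<in> {0<..<p}"
    then have "p dvd p choose i" using p by (intro dvd_choose_prime) auto
    then show "int p dvd (- 1) ^ (p - i) * int (p choose i) * f (k + i)" by simp
  qed
  ultimately show ?thesis unfolding eq by simp
qed

text \<open>Since \<open>r < p\<close>, the Newton series makes \<open>r! f\<close> a polynomial of degree \<open>r\<close> modulo \<open>p\<close>, whose
  leading coefficient is the \<open>r\<close>-th difference; so \<open>f\<close> has at most \<open>r\<close> zeros modulo \<open>p\<close>.\<close>

lemma card_nonzero_fdiff:
  fixes p :: nat
  assumes p: "prime p" and r: "r < p" and van: "\<And>k. int p dvd (fdiff ^^ Suc r) f k"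
    and lead: "\<not> int p dvd (fdiff ^^ r) f 0"
  shows "p - r \<le> card {k. k < p \<and> \<not> int p dvd f k}"
proof (rule ccontr)
  assume "\<not> ?thesis"
  moreover have "card {k. k < p \<and> \<not> int p dvd f k} + card {k. k < p \<and> int p dvd f k} = p"
  proof -
    have "card {k. k < p \<and> \<not> int p dvd f k} + card {k. k < p \<and> int p dvd f k} =
        card ({k. k < p \<and> \<not> int p dvd f k} \<union> {k. k < p \<and> int p dvd f k})"
      by (intro card_Un_disjoint[symmetric]) auto
    also have "{k. k < p \<and> \<not> int p dvd f k} \<union> {k. k < p \<and> int p dvd f k} = {..<p}" by auto
    finally show ?thesis by simp
  qed
  ultimately have card: "r < card {k. k < p \<and> int p dvd f k}" by linarith
  \<comment> \<open>Falling factorials: integral, monic, and equal to i! times the binomial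
    coefficient at k, so that multiplying the Newton series by r! clears its denominators.\<close>
  define P :: "nat \<Rightarrow> int poly" where "P i = (\<Prod>j<i. [:- int j, 1:])" for i
  have P1: "degree (P i) = i" for i
    by (simp add: P_def degree_prod_eq_sum_degree)
  have "lead_coeff (P i) = 1" for i
    unfolding P_def lead_coeff_prod by simp
  with P1 have P: "degree (P i) = i" "lead_coeff (P i) = 1" for i
    by auto
  have polyP: "poly (P i) (int k) = fact i * int (k choose i)" for i k
  proof -
    have "real_of_int (poly (P i) (int k)) = (\<Prod>j = 0..<i. real k - real j)"
      by (simp add: P_def poly_prod atLeast0LessThan)
    also have "\<dots> = fact i * (real k gchoose i)" by (simp add: gbinomial_mult_fact)
    also have "\<dots> = real_of_int (fact i * int (k choose i))" by (simp add: binomial_gbinomial)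
    finally show ?thesis by linarith
  qed
  have van': "int p dvd (fdiff ^^ i) f k" if "r < i" for i k
    using that
  proof (induction i arbitrary: k)
    case (Suc i)
    show ?case
    proof (cases "r = i")
      case False
      with Suc have "int p dvd (fdiff ^^ i) f (Suc k)" "int p dvd (fdiff ^^ i) f k" by simp_all
      then show ?thesis using fdiff_Suc[of i f k] by (metis add_diff_cancel_left' dvd_diff)
    qed (use van in blast)
  qed simp
  \<comment> \<open>The factor r!/i! is integral for i \<le> r and equals 1 for i = r, so the
    coefficient of degree r is the r-th difference itself.\<close>
  define q where "q = (\<Sum>i\<le>r. smult ((fact r div fact i) * (fdiff ^^ i) f 0) (P i))"
  have q: "int p dvd poly q (int k)" if "int p dvd f k" for k
  proof -
    have "fact r * f k = (\<Sum>i\<le>k. fact r * int (k choose i) * (fdiff ^^ i) f 0)"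
      by (subst newton_forward) (simp add: sum_distrib_left mult.assoc)
    also have "\<dots> = (\<Sum>i\<le>k + r. fact r * int (k choose i) * (fdiff ^^ i) f 0)"
      by (intro sum.mono_neutral_left) (auto simp: binomial_eq_0)
    also have "\<dots> = (\<Sum>i\<le>r. fact r * int (k choose i) * (fdiff ^^ i) f 0) +
        (\<Sum>i\<in>{r<..k + r}. fact r * int (k choose i) * (fdiff ^^ i) f 0)"
      by (subst sum.union_disjoint[symmetric]) (auto intro!: sum.cong)
    also have "(\<Sum>i\<le>r. fact r * int (k choose i) * (fdiff ^^ i) f 0) = poly q (int k)"
      unfolding q_def poly_sum poly_smult polyP
    proof (rule sum.cong)
      fix i assume "i \<in> {..r}"
      then have "fact r = (fact r div fact i :: int) * fact i" by (simp add: fact_dvd)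
      then show "fact r * int (k choose i) * (fdiff ^^ i) f 0 =
          fact r div fact i * (fdiff ^^ i) f 0 * (fact i * int (k choose i))"
        by (metis (no_types, opaque_lifting) mult.assoc mult.commute)
    qed simp
    finally have "poly q (int k) = fact r * f k -
        (\<Sum>i\<in>{r<..k + r}. fact r * int (k choose i) * (fdiff ^^ i) f 0)" by simp
    moreover have "int p dvd (\<Sum>i\<in>{r<..k + r}. fact r * int (k choose i) * (fdiff ^^ i) f 0)"
      by (intro dvd_sum) (auto intro: dvd_mult van')
    ultimately show ?thesis using that by (simp add: dvd_diff)
  qed
  have deg: "degree q \<le> r"
    unfolding q_def
  proof (rule degree_sum_le)
    fix i assume "i \<in> {..r}"
    then show "degree (smult ((fact r div fact i) * (fdiff ^^ i) f 0) (P i)) \<le> r"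
      using degree_smult_le[of _ "P i"] P(1)[of i] by (metis atMost_iff order_trans)
  qed simp
  have "int p dvd coeff q r"
  proof (rule poly_roots_mod_prime[of "int p" _ _ "int ` {k. k < p \<and> int p dvd f k}"])
    show "s = t" if "s \<in> int ` {k. k < p \<and> int p dvd f k}" "t \<in> int ` {k. k < p \<and> int p dvd f k}"
      "int p dvd s - t" for s t
    proof -
      from that obtain a b where st: "s = int a" "t = int b" "a < p" "b < p" by auto
      with that(3) have "int a mod int p = int b mod int p" by (metis mod_eq_dvd_iff)
      with st show ?thesis by simp
    qed
  qed (use p card q deg in \<open>auto simp: card_image\<close>)
  moreover have "coeff q r = (fdiff ^^ r) f 0"
  proof -
    have "coeff q r = (\<Sum>i\<le>r. (fact r div fact i) * (fdiff ^^ i) f 0 * coeff (P i) r)"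
      by (simp add: q_def coeff_sum)
    also have "\<dots> = (\<Sum>i\<in>{r}. (fact r div fact i) * (fdiff ^^ i) f 0 * coeff (P i) r)"
      using P(1) by (intro sum.mono_neutral_right) (auto simp: coeff_eq_0)
    also have "\<dots> = (fdiff ^^ r) f 0" using P[of r] by simp
    finally show ?thesis .
  qed
  ultimately show False using lead by simp
qed

section \<open>Cochains on finite sets with an action of words\<close>

text \<open>A letter \<open>(x, True)\<close> acts on the vertices as a generator \<open>x\<close>, and \<open>(x, False)\<close> as its inverse,
  so that every vertex \<open>v\<close> carries an oriented edge \<open>(v, x)\<close> for each \<open>x\<close>.  A cochain is a function
  on the edges; it is a cocycle if it sums to zero along all closed paths given by relators.\<close>

fun edge_of :: "('x \<times> bool \<Rightarrow> 'v \<Rightarrow> 'v) \<Rightarrow> 'v \<Rightarrow> 'x \<times> bool \<Rightarrow> 'v \<times> 'x" where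
  "edge_of act v (x, s) = (if s then v else act (x, False) v, x)"

fun trail :: "('x \<times> bool \<Rightarrow> 'v \<Rightarrow> 'v) \<Rightarrow> 'v \<Rightarrow> ('x \<times> bool) list \<Rightarrow> ('v \<times> 'x) list" where
  "trail act v [] = []"
| "trail act v (a # w) = edge_of act v a # trail act (act a v) w"

fun psum :: "('x \<times> bool \<Rightarrow> 'v \<Rightarrow> 'v) \<Rightarrow> ('v \<times> 'x \<Rightarrow> int) \<Rightarrow> 'v \<Rightarrow> ('x \<times> bool) list \<Rightarrow> int" where
  "psum act z v [] = 0"
| "psum act z v (a # w) =
    (if snd a then 1 else - 1) * z (edge_of act v a) + psum act z (act a v) w"

fun walk :: "('x \<times> bool \<Rightarrow> 'v \<Rightarrow> 'v) \<Rightarrow> 'v set \<Rightarrow> 'v \<Rightarrow> ('x \<times> bool) list \<Rightarrow> bool" where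
  "walk act A v [] \<longleftrightarrow> v \<in> A"
| "walk act A v (a # w) \<longleftrightarrow> v \<in> A \<and> walk act A (act a v) w"

abbreviation inv_word :: "('x \<times> bool) list \<Rightarrow> ('x \<times> bool) list" where
  "inv_word w \<equiv> rev (map inv_letter w)"

definition words :: "'x set \<Rightarrow> ('x \<times> bool) list set" where
  "words X = lists (X \<times> UNIV)"

text \<open>Elements of the field with p elements are represented by their least non-negative
  residues, and functions vanish outside E. Spaces thus become finite sets of integer functions with
  p ^ card E elements. The same sets serve for functions on vertices, on dual bases and for the
  sheets of a cover.\<close>

definition cochains :: "nat \<Rightarrow> 'e set \<Rightarrow> ('e \<Rightarrow> int) set" where
  "cochains p E = {z. \<forall>e. z e \<in> (if e \<in> E then {0..<int p} else {0})}"

definition boundary :: "'x set \<Rightarrow> ('x \<times> bool \<Rightarrow> 'v \<Rightarrow> 'v) \<Rightarrow> 'v set \<Rightarrow> 'v set \<Rightarrow> ('v \<times> 'x) set" where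
  "boundary X act V B = {(v, x). v \<in> V \<and> x \<in> X \<and> (v \<in> B) \<noteq> (act (x, True) v \<in> B)}"

definition inner_edges :: "'x set \<Rightarrow> ('x \<times> bool \<Rightarrow> 'v \<Rightarrow> 'v) \<Rightarrow> 'v set \<Rightarrow> ('v \<times> 'x) set" where
  "inner_edges X act B = {(v, x). v \<in> B \<and> x \<in> X \<and> act (x, True) v \<in> B}"

text \<open>The relator condition is imposed at every vertex of V, not only at those of B: these are
  the cocycles of the whole complex with support inside B, so that the spaces grow with B.\<close>

definition cocycles_on ::
    "nat \<Rightarrow> 'x set \<Rightarrow> ('x \<times> bool) list set \<Rightarrow> ('x \<times> bool \<Rightarrow> 'v \<Rightarrow> 'v) \<Rightarrow> 'v set \<Rightarrow> 'v set \<Rightarrow> ('v \<times> 'x \<Rightarrow> int) set"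
  where "cocycles_on p X R act V B =
    {z \<in> cochains p (inner_edges X act B). \<forall>v\<in>V. \<forall>r\<in>R. int p dvd psum act z v r}"

lemma words_simps [simp]:
  "[] \<in> words X" "a # w \<in> words X \<longleftrightarrow> fst a \<in> X \<and> w \<in> words X"
  "u @ w \<in> words X \<longleftrightarrow> u \<in> words X \<and> w \<in> words X" "inv_word w \<in> words X \<longleftrightarrow> w \<in> words X"
  unfolding words_def by (auto simp: inv_letter_def in_lists_conv_set mem_Times_iff)

lemma inv_word_inv_word [simp]: "inv_word (inv_word w) = w"
  by (simp add: rev_map o_def)

lemma psum_append: "psum act z v (u @ w) = psum act z v u + psum act z (fold act u v) w"
  by (induction u arbitrary: v) auto

lemma walk_append: "walk act A v (u @ w) \<longleftrightarrow> walk act A v u \<and> walk act A (fold act u v) w"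
  by (induction u arbitrary: v) (auto, (metis list.exhaust walk.simps)+)

lemma walk_start: "walk act A v w \<Longrightarrow> v \<in> A"
  by (cases w) auto

lemma walk_end: "walk act A v w \<Longrightarrow> fold act w v \<in> A"
  by (induction w arbitrary: v) auto

lemma walk_mono: "walk act A v w \<Longrightarrow> A \<subseteq> B \<Longrightarrow> walk act B v w"
  by (induction w arbitrary: v) auto

lemma cochainsI:
  "(\<And>e. e \<in> E \<Longrightarrow> 0 \<le> z e \<and> z e < int p) \<Longrightarrow> (\<And>e. e \<notin> E \<Longrightarrow> z e = 0) \<Longrightarrow> z \<in> cochains p E"
  by (simp add: cochains_def)

lemma cochains_outside: "z \<in> cochains p E \<Longrightarrow> e \<notin> E \<Longrightarrow> z e = 0"
  unfolding cochains_def by (drule CollectD, drule spec[of _ e]) simp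

lemma cochains_range: "z \<in> cochains p E \<Longrightarrow> p > 0 \<Longrightarrow> 0 \<le> z e \<and> z e < int p"
  unfolding cochains_def by (drule CollectD, drule spec[of _ e]) (simp split: if_splits)

lemma cochains_diff_mod:
  assumes "z \<in> cochains p E" "z' \<in> cochains p E" "p > 0"
  shows "(\<lambda>e. (z e - z' e) mod int p) \<in> cochains p E"
  using assms by (intro cochainsI) (auto simp: cochains_outside)

lemma cochains_mono: "E \<subseteq> F \<Longrightarrow> p > 0 \<Longrightarrow> cochains p E \<subseteq> cochains p F"
  by (fastforce simp: cochains_def split: if_splits)

lemma cochains_bij:
  "bij_betw (\<lambda>z. restrict z E) (cochains p E) (E \<rightarrow>\<^sub>E {0..<int p})"
proof (rule bij_betw_byWitness[where f' = "\<lambda>z e. if e \<in> E then z e else 0"])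
  show "(\<lambda>z. restrict z E) ` cochains p E \<subseteq> E \<rightarrow>\<^sub>E {0..<int p}"
    by (auto simp: cochains_def split: if_splits)
  show "(\<lambda>z e. if e \<in> E then z e else 0) ` (E \<rightarrow>\<^sub>E {0..<int p}) \<subseteq> cochains p E"
    by (auto simp: cochains_def PiE_iff)
qed (auto simp: cochains_def fun_eq_iff PiE_iff extensional_def split: if_splits)

lemma card_cochains: "finite E \<Longrightarrow> card (cochains p E) = p ^ card E"
  using bij_betw_same_card[OF cochains_bij[where E = E and p = p]] by (simp add: card_PiE)

lemma finite_cochains: "finite E \<Longrightarrow> finite (cochains p E)"
  using bij_betw_finite[OF cochains_bij[where E = E and p = p]] by (auto intro: finite_PiE)

lemma cochains_eqI:
  assumes "z \<in> cochains p E" "z' \<in> cochains p E" "\<And>e. e \<in> E \<Longrightarrow> int p dvd z e - z' e"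
  shows "z = z'"
proof
  fix e
  show "z e = z' e"
  proof (cases "e \<in> E")
    case True
    then have "z e mod int p = z' e mod int p" using assms(3) by (simp add: mod_eq_dvd_iff)
    moreover have "z e \<in> {0..<int p}" "z' e \<in> {0..<int p}"
      using assms(1,2) True unfolding cochains_def by (metis (mono_tags, lifting) mem_Collect_eq)+
    ultimately show ?thesis by simp
  next
    case False
    with assms(1,2) have "z e = 0" "z' e = 0" by (auto simp: cochains_def dest: spec[of _ e])
    then show ?thesis by simp
  qed
qed

text \<open>Counting by the fibres of a map, each of which injects into \<open>K\<close> by subtracting a fixed element.\<close>

lemma card_le_by_differences:
  fixes M K :: "('e \<Rightarrow> int) set"
  assumes "p > 0" and M: "M \<subseteq> cochains p E" and fin: "finite E" "finite N" "finite K" and f: "f \<in> M \<rightarrow> N"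
    and K: "\<And>z z'. z \<in> M \<Longrightarrow> z' \<in> M \<Longrightarrow> f z = f z' \<Longrightarrow> (\<lambda>e. (z e - z' e) mod int p) \<in> K"
  shows "card M \<le> card N * card K"
proof -
  have finM: "finite M" using M finite_cochains[OF fin(1)] finite_subset by blast
  have "card M = card (\<Union>n\<in>N. {z \<in> M. f z = n})"
    using f by (intro arg_cong[of _ _ card]) auto
  also have "\<dots> \<le> (\<Sum>n\<in>N. card {z \<in> M. f z = n})"
    by (rule card_UN_le[OF fin(2)])
  also have "\<dots> \<le> (\<Sum>n\<in>N. card K)"
  proof (rule sum_mono)
    fix n assume "n \<in> N"
    show "card {z \<in> M. f z = n} \<le> card K"
    proof (cases "{z \<in> M. f z = n} = {}")
      case False
      then obtain z0 where z0: "z0 \<in> M" "f z0 = n" by auto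
      show ?thesis
      proof (rule card_inj_on_le[of "\<lambda>z e. (z e - z0 e) mod int p"])
        show "inj_on (\<lambda>z e. (z e - z0 e) mod int p) {z \<in> M. f z = n}"
        proof (rule inj_onI)
          fix z z' assume z: "z \<in> {z \<in> M. f z = n}" "z' \<in> {z \<in> M. f z = n}"
            and eq: "(\<lambda>e. (z e - z0 e) mod int p) = (\<lambda>e. (z' e - z0 e) mod int p)"
          show "z = z'"
          proof (rule cochains_eqI[of _ p E])
            fix e
            have "(z e - z0 e) mod int p = (z' e - z0 e) mod int p" by (rule fun_cong[OF eq])
            then show "int p dvd z e - z' e" by (simp add: mod_eq_dvd_iff)
          qed (use z M in auto)
        qed
      qed (use K z0 fin in auto)
    qed (metis card.empty le0)
  qed
  finally show ?thesis by simp
qed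

lemma dvd_of_dvd_diff: "(d::int) dvd a - b \<Longrightarrow> d dvd b \<Longrightarrow> d dvd a"
  using dvd_add[of d "a - b" b] by simp

section \<open>Invertible letter actions on a finite vertex set\<close>

locale word_action =
  fixes p :: nat and X :: "'x set" and act :: "'x \<times> bool \<Rightarrow> 'v \<Rightarrow> 'v" and V :: "'v set"
  assumes prime: "prime p" and finite_X: "finite X" and finite_V: "finite V"
    and act_closed: "\<And>a v. fst a \<in> X \<Longrightarrow> v \<in> V \<Longrightarrow> act a v \<in> V"
    and act_inv: "\<And>a v. fst a \<in> X \<Longrightarrow> v \<in> V \<Longrightarrow> act (inv_letter a) (act a v) = v"
begin

lemma p_pos: "p > 0" using prime prime_gt_0_nat by blast

lemma act_inv': "fst a \<in> X \<Longrightarrow> v \<in> V \<Longrightarrow> act a (act (inv_letter a) v) = v"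
  using act_inv[of "inv_letter a" v] by simp

lemma act_inj: "fst a \<in> X \<Longrightarrow> inj_on (act a) V"
  by (rule inj_onI) (metis act_inv)

lemma fold_closed: "w \<in> words X \<Longrightarrow> v \<in> V \<Longrightarrow> fold act w v \<in> V"
  by (induction w arbitrary: v) (auto intro: act_closed)

lemma fold_inv_word: "w \<in> words X \<Longrightarrow> v \<in> V \<Longrightarrow> fold act (inv_word w) (fold act w v) = v"
  by (induction w arbitrary: v) (auto simp: act_closed act_inv)

lemma edge_of_inv: "fst a \<in> X \<Longrightarrow> v \<in> V \<Longrightarrow> edge_of act (act a v) (inv_letter a) = edge_of act v a"
  using act_inv[of a v] by (cases a) (auto simp: inv_letter_def)

lemma edge_of_closed: "fst a \<in> X \<Longrightarrow> v \<in> V \<Longrightarrow> edge_of act v a \<in> V \<times> X"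
  using act_closed[of a v] by (cases a) auto

lemma edge_of_inj: "fst a \<in> X \<Longrightarrow> inj_on (\<lambda>v. edge_of act v a) V"
  using act_inj[of a] by (cases a) (auto simp: inj_on_def)

lemma psum_inv_word:
  "w \<in> words X \<Longrightarrow> v \<in> V \<Longrightarrow> psum act z (fold act w v) (inv_word w) = - psum act z v w"
  by (induction w arbitrary: v)
    (auto simp: psum_append fold_inv_word act_closed edge_of_inv inv_letter_def[of "(_, _)"])

lemma walk_inv_word:
  "w \<in> words X \<Longrightarrow> v \<in> V \<Longrightarrow> walk act A v w \<Longrightarrow> walk act A (fold act w v) (inv_word w)"
  by (induction w arbitrary: v) (auto simp: walk_append fold_inv_word act_closed act_inv walk_start)

lemma trail_closed: "w \<in> words X \<Longrightarrow> v \<in> V \<Longrightarrow> set (trail act v w) \<subseteq> V \<times> X"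
  by (induction w arbitrary: v) (auto simp: act_closed dest!: edge_of_closed)

text \<open>Letters act injectively, so a given edge is the i-th edge of the path w from at most one
  base point. This limits the number of relator paths that can meet a small cut.\<close>

lemma trail_inj: "w \<in> words X \<Longrightarrow> i < length w \<Longrightarrow> inj_on (\<lambda>v. trail act v w ! i) V"
proof (induction w arbitrary: i)
  case (Cons a w)
  then have a: "fst a \<in> X" by simp
  show ?case
  proof (cases i)
    case (Suc j)
    then have "inj_on (\<lambda>v. trail act v w ! j) V" using Cons by simp
    then have "inj_on ((\<lambda>v. trail act v w ! j) \<circ> act a) V"
      using act_closed[OF a] by (intro comp_inj_on act_inj a) (auto intro: inj_on_subset)
    then show ?thesis using Suc by (simp add: o_def)
  qed (use edge_of_inj[OF a] in simp)
qed simp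

lemma length_trail [simp]: "length (trail act v w) = length w"
  by (induction w arbitrary: v) auto

lemma mem_boundary_edge_of:
  assumes "fst a \<in> X" "v \<in> V"
  shows "edge_of act v a \<in> boundary X act V B \<longleftrightarrow> (v \<in> B) \<noteq> (act a v \<in> B)"
proof (cases a)
  case (Pair x s)
  then show ?thesis
    using assms act_closed[of a v] act_inv[of a v] by (cases s) (auto simp: boundary_def inv_letter_def)
qed

lemma edge_of_inner:
  assumes "fst a \<in> X" "v \<in> V"
  shows "edge_of act v a \<in> inner_edges X act B \<longleftrightarrow> v \<in> B \<and> act a v \<in> B"
proof (cases a)
  case (Pair x s)
  then show ?thesis
    using assms act_closed[of a v] act_inv[of a v] by (cases s) (auto simp: inner_edges_def inv_letter_def)
qed

lemma finite_boundary: "finite (boundary X act V B)"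
  by (rule finite_subset[OF _ finite_cartesian_product[OF finite_V finite_X]]) (auto simp: boundary_def)

lemma finite_inner: "B \<subseteq> V \<Longrightarrow> finite (inner_edges X act B)"
  by (rule finite_subset[OF _ finite_cartesian_product[OF finite_V finite_X]]) (auto simp: inner_edges_def)

lemma card_inner: "B \<subseteq> V \<Longrightarrow> card (inner_edges X act B) \<le> card X * card B"
proof -
  assume "B \<subseteq> V"
  then have "finite (B \<times> X)" using finite_V finite_X finite_subset by blast
  then have "card (inner_edges X act B) \<le> card (B \<times> X)"
    by (rule card_mono) (auto simp: inner_edges_def)
  then show ?thesis by (simp add: card_cartesian_product mult.commute)
qed

lemma finite_cocycles: "B \<subseteq> V \<Longrightarrow> finite (cocycles_on p X R act V B)"
  by (rule finite_subset[OF _ finite_cochains[OF finite_inner]]) (auto simp: cocycles_on_def)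

lemma psum_zero [simp]: "psum act (\<lambda>e. 0) v w = 0"
  by (induction w arbitrary: v) auto

lemma zero_cocycle: "(\<lambda>e. 0) \<in> cocycles_on p X R act V B"
  using p_pos by (auto simp: cocycles_on_def cochains_def)

lemma card_cocycles_pos: "B \<subseteq> V \<Longrightarrow> card (cocycles_on p X R act V B) > 0"
  using finite_cocycles zero_cocycle by (metis card_gt_0_iff empty_iff)

lemma psum_diff: "psum act (\<lambda>e. z e - z' e) v w = psum act z v w - psum act z' v w"
  by (induction w arbitrary: v) (auto simp: algebra_simps)

lemma psum_cong_mod:
  assumes "w \<in> words X" "v \<in> V" "\<And>e. e \<in> set (trail act v w) \<Longrightarrow> int p dvd z e - z' e"
  shows "int p dvd psum act z v w - psum act z' v w"
  using assms
proof (induction w arbitrary: v)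
  case (Cons a w)
  have "int p dvd z (edge_of act v a) - z' (edge_of act v a)" using Cons.prems by simp
  moreover have "int p dvd psum act z (act a v) w - psum act z' (act a v) w"
    using Cons by (auto simp: act_closed)
  ultimately have "int p dvd (if snd a then 1 else - 1) * (z (edge_of act v a) - z' (edge_of act v a)) +
      (psum act z (act a v) w - psum act z' (act a v) w)"
    by (intro dvd_add dvd_mult)
  then show ?case by (simp add: algebra_simps split: if_splits)
qed simp

lemma psum_mod:
  assumes "w \<in> words X" "v \<in> V"
  shows "int p dvd psum act (\<lambda>e. z e mod int p) v w \<longleftrightarrow> int p dvd psum act z v w"
proof -
  have "int p dvd psum act (\<lambda>e. z e mod int p) v w - psum act z v w"
    using assms by (rule psum_cong_mod) (simp add: mod_eq_dvd_iff[symmetric])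
  then show ?thesis using dvd_of_dvd_diff dvd_diff_commute by metis
qed

end

section \<open>Cocycles in cyclic covers of prime degree\<close>

locale word_complex = word_action +
  fixes R :: "('a \<times> bool) list set"
  assumes finite_R: "finite R" and R_words: "R \<subseteq> words X"
    and R_trivial: "\<And>r v. r \<in> R \<Longrightarrow> v \<in> V \<Longrightarrow> fold act r v = v"

text \<open>The dimension over the field with p elements, obtained from the cardinality. Injections
  then give inequalities of dimensions, and counting fibres of a map replaces the rank-nullity
  theorem.\<close>

definition cocycle_dim ::
    "nat \<Rightarrow> 'x set \<Rightarrow> ('x \<times> bool) list set \<Rightarrow> ('x \<times> bool \<Rightarrow> 'v \<Rightarrow> 'v) \<Rightarrow> 'v set \<Rightarrow> 'v set \<Rightarrow> real" where
  "cocycle_dim p X R act V B = log (real p) (real (card (cocycles_on p X R act V B)))"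

definition linear_bound ::
    "nat \<Rightarrow> 'x set \<Rightarrow> ('x \<times> bool) list set \<Rightarrow> ('x \<times> bool \<Rightarrow> 'v \<Rightarrow> 'v) \<Rightarrow> 'v set \<Rightarrow> real \<Rightarrow> real \<Rightarrow> bool" where
  "linear_bound p X R act V a b \<longleftrightarrow>
    (\<forall>B\<subseteq>V. cocycle_dim p X R act V B \<le> a * real (card B) + b * real (card (boundary X act V B)))"

locale cyclic_cover =
  up: word_complex p X act V' R + down: word_complex p X act V R
  for p :: nat and X :: "'x set" and act :: "'x \<times> bool \<Rightarrow> 'v \<Rightarrow> 'v" and V' V :: "'v set"
    and R :: "('x \<times> bool) list set" +
  fixes \<tau> \<pi> :: "'v \<Rightarrow> 'v"
  assumes \<tau>_closed: "\<And>v. v \<in> V' \<Longrightarrow> \<tau> v \<in> V'"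
    and \<tau>_act: "\<And>a v. fst a \<in> X \<Longrightarrow> v \<in> V' \<Longrightarrow> act a (\<tau> v) = \<tau> (act a v)"
    and \<tau>_period: "\<And>v. v \<in> V' \<Longrightarrow> (\<tau> ^^ p) v = v"
    and \<tau>_inj: "\<And>v. v \<in> V' \<Longrightarrow> inj_on (\<lambda>k. (\<tau> ^^ k) v) {..<p}"
    and \<pi>_image: "\<pi> ` V' = V"
    and \<pi>_\<tau>: "\<And>v. v \<in> V' \<Longrightarrow> \<pi> (\<tau> v) = \<pi> v"
    and \<pi>_act: "\<And>a v. fst a \<in> X \<Longrightarrow> v \<in> V' \<Longrightarrow> \<pi> (act a v) = act a (\<pi> v)"
    and \<pi>_fibre: "\<And>v v'. v \<in> V' \<Longrightarrow> v' \<in> V' \<Longrightarrow> \<pi> v = \<pi> v' \<Longrightarrow> \<exists>k<p. v' = (\<tau> ^^ k) v"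
begin

abbreviation "Z' \<equiv> cocycles_on p X R act V'"
abbreviation "Z \<equiv> cocycles_on p X R act V"

definition dif :: "('v \<times> 'x \<Rightarrow> int) \<Rightarrow> 'v \<times> 'x \<Rightarrow> int" where
  "dif z = (\<lambda>(v, x). z (\<tau> v, x) - z (v, x))"

lemma \<tau>_pow_closed: "v \<in> V' \<Longrightarrow> (\<tau> ^^ k) v \<in> V'"
  by (induction k) (auto intro: \<tau>_closed)

lemma \<tau>_pow_act: "fst a \<in> X \<Longrightarrow> v \<in> V' \<Longrightarrow> act a ((\<tau> ^^ k) v) = (\<tau> ^^ k) (act a v)"
  by (induction k) (auto simp: \<tau>_act \<tau>_pow_closed)

lemma \<pi>_\<tau>_pow: "v \<in> V' \<Longrightarrow> \<pi> ((\<tau> ^^ k) v) = \<pi> v"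
  by (induction k) (auto simp: \<pi>_\<tau> \<tau>_pow_closed)

lemma \<pi>_closed: "v \<in> V' \<Longrightarrow> \<pi> v \<in> V" using \<pi>_image by auto

text \<open>Along an orbit of \<open>\<tau>\<close> the operator \<open>dif\<close>, which is
  \<sigma> - 1 on cochains, becomes the difference operator on sequences. Both facts on finite
  differences modulo p are transported by this identity.\<close>

lemma fdiff_dif: "(fdiff ^^ n) (\<lambda>k. z ((\<tau> ^^ k) v, x)) k = (dif ^^ n) z ((\<tau> ^^ k) v, x)"
  by (induction n arbitrary: k) (auto simp: fdiff_def dif_def)

lemma dif_Suc: "(dif ^^ n) z (\<tau> v, x) = (dif ^^ n) z (v, x) + (dif ^^ Suc n) z (v, x)"
  by (simp add: dif_def)

lemma edge_of_\<tau>: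
  assumes "fst a \<in> X" "v \<in> V'"
  shows "edge_of act (\<tau> v) a = (\<tau> (fst (edge_of act v a)), snd (edge_of act v a))"
  using assms \<tau>_act[of "(fst a, False)" v] by (cases a) auto

lemma edge_of_\<pi>:
  assumes "fst a \<in> X" "v \<in> V'"
  shows "edge_of act (\<pi> v) a = (\<pi> (fst (edge_of act v a)), snd (edge_of act v a))"
  using assms \<pi>_act[of "(fst a, False)" v] by (cases a) auto

lemma psum_dif:
  "w \<in> words X \<Longrightarrow> v \<in> V' \<Longrightarrow> psum act (dif z) v w = psum act z (\<tau> v) w - psum act z v w"
proof (induction w arbitrary: v)
  case (Cons a w)
  have "dif z (edge_of act v a) = z (edge_of act (\<tau> v) a) - z (edge_of act v a)"
    using Cons.prems by (simp add: edge_of_\<tau> dif_def split_beta del: edge_of.simps)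
  moreover have "psum act (dif z) (act a v) w = psum act z (act a (\<tau> v)) w - psum act z (act a v) w"
    using Cons by (simp add: up.act_closed \<tau>_act)
  ultimately show ?case by (simp add: algebra_simps)
qed simp

lemma psum_\<pi>:
  "w \<in> words X \<Longrightarrow> v \<in> V' \<Longrightarrow> psum act s (\<pi> v) w = psum act (\<lambda>e. s (\<pi> (fst e), snd e)) v w"
proof (induction w arbitrary: v)
  case (Cons a w)
  have "psum act s (act a (\<pi> v)) w = psum act (\<lambda>e. s (\<pi> (fst e), snd e)) (act a v) w"
    using Cons by (simp add: up.act_closed \<pi>_act[symmetric])
  then show ?case using Cons.prems by (simp add: edge_of_\<pi> del: edge_of.simps)
qed simp

lemma dif_cocycle:
  assumes "\<And>v r. v \<in> V' \<Longrightarrow> r \<in> R \<Longrightarrow> int p dvd psum act z v r" "v \<in> V'" "r \<in> R"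
  shows "int p dvd psum act ((dif ^^ n) z) v r"
  using assms(2)
proof (induction n arbitrary: v)
  case (Suc n)
  have "r \<in> words X" using assms(3) up.R_words by auto
  with Suc show ?case by (auto simp: psum_dif \<tau>_closed intro: dvd_diff)
qed (use assms in auto)

lemma dif_cong:
  assumes "\<And>v. v \<in> V' \<Longrightarrow> int p dvd g (v, x) - h (v, x)" "v \<in> V'"
  shows "int p dvd (dif ^^ n) g (v, x) - (dif ^^ n) h (v, x)"
  using assms(2)
proof (induction n arbitrary: v)
  case (Suc n)
  have "int p dvd ((dif ^^ n) g (\<tau> v, x) - (dif ^^ n) h (\<tau> v, x)) - ((dif ^^ n) g (v, x) - (dif ^^ n) h (v, x))"
    by (rule dvd_diff) (use Suc \<tau>_closed in blast)+
  also have "((dif ^^ n) g (\<tau> v, x) - (dif ^^ n) h (\<tau> v, x)) - ((dif ^^ n) g (v, x) - (dif ^^ n) h (v, x)) =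
      (dif ^^ Suc n) g (v, x) - (dif ^^ Suc n) h (v, x)"
    unfolding dif_Suc by linarith
  finally show ?case .
qed (use assms in auto)

lemma dif_minus: "(dif ^^ n) (\<lambda>e. z e - z' e) = (\<lambda>e. (dif ^^ n) z e - (dif ^^ n) z' e)"
  by (induction n) (auto simp: dif_def)

text \<open>The powers of \<open>dif\<close> filter the cocycles of the cover; the symbols of the graded pieces are
  invariant under \<open>\<tau>\<close> and therefore descend to the base.\<close>

definition filt :: "'v set \<Rightarrow> nat \<Rightarrow> ('v \<times> 'x \<Rightarrow> int) set" where
  "filt B n = {z \<in> Z' B. \<forall>v\<in>V'. \<forall>x\<in>X. int p dvd (dif ^^ n) z (v, x)}"

definition symbol :: "nat \<Rightarrow> ('v \<times> 'x \<Rightarrow> int) \<Rightarrow> 'v \<times> 'x \<Rightarrow> int" where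
  "symbol n z = (\<lambda>(u, x). if u \<in> V \<and> x \<in> X then (dif ^^ n) z (SOME v. v \<in> V' \<and> \<pi> v = u, x) mod int p else 0)"

definition mult :: "'v set \<Rightarrow> 'v \<Rightarrow> nat" where
  "mult B u = card {v \<in> B. \<pi> v = u}"

text \<open>The threshold p - n is the least number of non-zero values, over one period, of a
  sequence whose n-th difference is a non-zero constant modulo p. So n = 0 selects the vertices with
  full fibre in B, and n = p - 1 those whose fibre meets B at all.\<close>

definition level :: "'v set \<Rightarrow> nat \<Rightarrow> 'v set" where
  "level B n = {u \<in> V. p - n \<le> mult B u}"

lemma symbol_\<pi>:
  assumes z: "z \<in> filt B (Suc n)" and v: "v \<in> V'" and x: "x \<in> X"
  shows "symbol n z (\<pi> v, x) = (dif ^^ n) z (v, x) mod int p"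
proof -
  define v0 where "v0 = (SOME v'. v' \<in> V' \<and> \<pi> v' = \<pi> v)"
  have v0: "v0 \<in> V'" "\<pi> v0 = \<pi> v"
    using someI[of "\<lambda>v'. v' \<in> V' \<and> \<pi> v' = \<pi> v" v] v by (auto simp: v0_def)
  then obtain k where k: "v = (\<tau> ^^ k) v0" using \<pi>_fibre v by metis
  have "(dif ^^ n) z ((\<tau> ^^ k) v0, x) mod int p = (dif ^^ n) z (v0, x) mod int p"
  proof (induction k)
    case (Suc k)
    have "int p dvd (dif ^^ Suc n) z ((\<tau> ^^ k) v0, x)"
      using z x \<tau>_pow_closed[OF v0(1)] by (auto simp: filt_def)
    then have "(dif ^^ n) z (\<tau> ((\<tau> ^^ k) v0), x) mod int p = (dif ^^ n) z ((\<tau> ^^ k) v0, x) mod int p"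
      unfolding dif_Suc by (metis add.right_neutral dvd_imp_mod_0 mod_add_right_eq)
    with Suc show ?case by simp
  qed simp
  then show ?thesis
    using \<pi>_closed[OF v] x by (simp add: symbol_def v0_def[symmetric] k[symmetric])
qed

lemma finite_sub_V': "B \<subseteq> V' \<Longrightarrow> finite B" using up.finite_V finite_subset by blast

text \<open>The values of z on the orbit of the edge form a sequence with vanishing (n+1)-st and
  non-vanishing n-th difference modulo p, hence at least p - n of them are non-zero. Each such value
  puts both endpoints of a translate of the edge into B.\<close>

lemma symbol_support:
  assumes z: "z \<in> filt B (Suc n)" and B: "B \<subseteq> V'" and n: "n < p" and v: "v \<in> V'" and x: "x \<in> X"
    and nz: "\<not> int p dvd (dif ^^ n) z (v, x)"
  shows "p - n \<le> mult B (\<pi> v)" "p - n \<le> mult B (act (x, True) (\<pi> v))"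
proof -
  let ?K = "{k. k < p \<and> \<not> int p dvd z ((\<tau> ^^ k) v, x)}"
  have K: "p - n \<le> card ?K"
  proof (rule card_nonzero_fdiff[OF up.prime n])
    show "int p dvd (fdiff ^^ Suc n) (\<lambda>k. z ((\<tau> ^^ k) v, x)) k" for k
      using z x \<tau>_pow_closed[OF v] unfolding fdiff_dif by (simp add: filt_def del: funpow.simps)
    show "\<not> int p dvd (fdiff ^^ n) (\<lambda>k. z ((\<tau> ^^ k) v, x)) 0"
      using nz unfolding fdiff_dif by simp
  qed
  have zB: "z e = 0" if "e \<notin> inner_edges X act B" for e
    using z that by (auto simp: filt_def cocycles_on_def intro: cochains_outside)
  have inner: "(\<tau> ^^ k) v \<in> B \<and> (\<tau> ^^ k) (act (x, True) v) \<in> B" if "k \<in> ?K" for k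
  proof -
    have "z ((\<tau> ^^ k) v, x) \<noteq> 0" using that by auto
    then have "((\<tau> ^^ k) v, x) \<in> inner_edges X act B" using zB by blast
    then show ?thesis using \<tau>_pow_act[of "(x, True)" v k] v x by (simp add: inner_edges_def)
  qed
  have K_sub: "?K \<subseteq> {..<p}" by auto
  have "card ?K \<le> mult B (\<pi> v)" unfolding mult_def
  proof (rule card_inj_on_le)
    show "inj_on (\<lambda>k. (\<tau> ^^ k) v) ?K" by (rule inj_on_subset[OF \<tau>_inj[OF v] K_sub])
    show "(\<lambda>k. (\<tau> ^^ k) v) ` ?K \<subseteq> {v' \<in> B. \<pi> v' = \<pi> v}" using inner \<pi>_\<tau>_pow[OF v] by blast
    show "finite {v' \<in> B. \<pi> v' = \<pi> v}" using finite_sub_V'[OF B] by simp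
  qed
  with K show "p - n \<le> mult B (\<pi> v)" by simp
  have av: "act (x, True) v \<in> V'" using x v by (intro up.act_closed) auto
  have "card ?K \<le> mult B (\<pi> (act (x, True) v))" unfolding mult_def
  proof (rule card_inj_on_le)
    let ?v = "act (x, True) v"
    show "inj_on (\<lambda>k. (\<tau> ^^ k) ?v) ?K" by (rule inj_on_subset[OF \<tau>_inj[OF av] K_sub])
    show "(\<lambda>k. (\<tau> ^^ k) ?v) ` ?K \<subseteq> {v' \<in> B. \<pi> v' = \<pi> ?v}" using inner \<pi>_\<tau>_pow[OF av] by blast
    show "finite {v' \<in> B. \<pi> v' = \<pi> ?v}" using finite_sub_V'[OF B] by simp
  qed
  with K show "p - n \<le> mult B (act (x, True) (\<pi> v))" using \<pi>_act[of "(x, True)" v] v x by simp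
qed

lemma symbol_cocycle:
  assumes z: "z \<in> filt B (Suc n)" and B: "B \<subseteq> V'" and n: "n < p"
  shows "symbol n z \<in> Z (level B n)"
  unfolding cocycles_on_def
proof (intro CollectI conjI ballI)
  have "symbol n z (u, x) = 0" if "(u, x) \<notin> inner_edges X act (level B n)" for u x
  proof (rule ccontr)
    assume nz: "symbol n z (u, x) \<noteq> 0"
    then have ux: "u \<in> V" "x \<in> X" by (auto simp: symbol_def split: if_splits)
    then obtain v where v: "v \<in> V'" "u = \<pi> v" using \<pi>_image by auto
    have "\<not> int p dvd (dif ^^ n) z (v, x)" using nz symbol_\<pi>[OF z v(1) ux(2)] v(2) by auto
    from symbol_support[OF z B n v(1) ux(2) this] that ux v down.act_closed[of "(x, True)" u]
    show False by (auto simp: inner_edges_def level_def)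
  qed
  moreover have "symbol n z (u, x) \<in> {0..<int p}" for u x
    using up.p_pos by (auto simp: symbol_def)
  ultimately show "symbol n z \<in> cochains p (inner_edges X act (level B n))"
    unfolding cochains_def by (auto simp del: atLeastLessThan_iff)
next
  fix u r assume u: "u \<in> V" and r: "r \<in> R"
  then obtain v where v: "v \<in> V'" "u = \<pi> v" using \<pi>_image by auto
  have rw: "r \<in> words X" using r up.R_words by auto
  have "int p dvd psum act (\<lambda>e. symbol n z (\<pi> (fst e), snd e)) v r - psum act ((dif ^^ n) z) v r"
  proof (rule up.psum_cong_mod[OF rw v(1)])
    fix e assume "e \<in> set (trail act v r)"
    then have e: "fst e \<in> V'" "snd e \<in> X" using up.trail_closed[OF rw v(1)] by auto
    show "int p dvd symbol n z (\<pi> (fst e), snd e) - (dif ^^ n) z e"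
      using symbol_\<pi>[OF z e] by (simp add: mod_eq_dvd_iff[symmetric])
  qed
  moreover have "int p dvd psum act ((dif ^^ n) z) v r"
    using z v(1) r by (intro dif_cocycle) (auto simp: filt_def cocycles_on_def)
  ultimately show "int p dvd psum act (symbol n z) u r"
    unfolding v(2) psum_\<pi>[OF rw v(1)] by (rule dvd_of_dvd_diff)
qed

lemma level_sub: "level B n \<subseteq> V" by (auto simp: level_def)

text \<open>Two cocycles with equal symbols of order n differ by one that \<open>dif ^^ n\<close>
  kills: the graded piece embeds into the cocycles downstairs.\<close>

lemma card_filt_Suc:
  assumes B: "B \<subseteq> V'" and n: "n < p"
  shows "card (filt B (Suc n)) \<le> card (Z (level B n)) * card (filt B n)"
proof (rule card_le_by_differences[where f = "symbol n" and p = p and E = "inner_edges X act B"])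
  show "finite (filt B n)"
    by (rule finite_subset[OF _ up.finite_cocycles[OF B, of R]]) (auto simp: filt_def)
  show "symbol n \<in> filt B (Suc n) \<rightarrow> Z (level B n)" using symbol_cocycle[OF _ B n] by auto
  fix z z' assume z: "z \<in> filt B (Suc n)" "z' \<in> filt B (Suc n)" and eq: "symbol n z = symbol n z'"
  let ?d = "\<lambda>e. (z e - z' e) mod int p"
  have "?d \<in> Z' B" unfolding cocycles_on_def
  proof (intro CollectI conjI ballI)
    show "?d \<in> cochains p (inner_edges X act B)"
      using z up.p_pos by (intro cochains_diff_mod) (auto simp: filt_def cocycles_on_def)
    fix v r assume "v \<in> V'" "r \<in> R"
    moreover from this have "r \<in> words X" using up.R_words by auto
    ultimately show "int p dvd psum act ?d v r"
      using z by (subst up.psum_mod) (auto simp: up.psum_diff filt_def cocycles_on_def)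
  qed
  moreover have "int p dvd (dif ^^ n) ?d (v, x)" if v: "v \<in> V'" and x: "x \<in> X" for v x
  proof -
    have "int p dvd (dif ^^ n) ?d (v, x) - (dif ^^ n) (\<lambda>e. z e - z' e) (v, x)"
      using v by (intro dif_cong) (auto simp: mod_eq_dvd_iff[symmetric])
    moreover have "int p dvd (dif ^^ n) (\<lambda>e. z e - z' e) (v, x)"
      using symbol_\<pi>[OF z(1) v x] symbol_\<pi>[OF z(2) v x] eq
      by (simp add: dif_minus mod_eq_dvd_iff[symmetric])
    ultimately show ?thesis by (rule dvd_of_dvd_diff)
  qed
  ultimately show "?d \<in> filt B n" by (auto simp: filt_def)
qed (use B up.p_pos up.finite_inner[OF B] down.finite_cocycles[OF level_sub] in
  \<open>simp_all add: filt_def cocycles_on_def subset_iff\<close>)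

text \<open>Since \<open>\<tau>\<close> has period p on V', the p-th power of \<sigma> - 1 vanishes
  modulo p, so the filtration exhausts all cocycles.\<close>

lemma filt_p: "filt B p = Z' B"
proof -
  have "int p dvd (dif ^^ p) z (v, x)" if v: "v \<in> V'" for z v x
  proof -
    have "int p dvd (fdiff ^^ p) (\<lambda>k. z ((\<tau> ^^ k) v, x)) 0"
      by (rule fdiff_prime_periodic[OF up.prime]) (simp add: funpow_add \<tau>_period[OF v])
    then show ?thesis unfolding fdiff_dif by simp
  qed
  then show ?thesis by (auto simp: filt_def)
qed

lemma filt_0:
  assumes "B \<subseteq> V'"
  shows "filt B 0 \<subseteq> {\<lambda>e. 0}"
proof
  fix z assume z: "z \<in> filt B 0"
  have "z = (\<lambda>e. 0)"
  proof (rule cochains_eqI)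
    show "z \<in> cochains p (inner_edges X act B)" using z by (simp add: filt_def cocycles_on_def)
    show "(\<lambda>e. 0) \<in> cochains p (inner_edges X act B)" using up.p_pos by (intro cochainsI) auto
    show "int p dvd z e - 0" if "e \<in> inner_edges X act B" for e
      using that z assms by (auto simp: filt_def inner_edges_def)
  qed
  then show "z \<in> {\<lambda>e. 0}" by simp
qed

lemma card_filt: "B \<subseteq> V' \<Longrightarrow> n \<le> p \<Longrightarrow> card (filt B n) \<le> (\<Prod>i<n. card (Z (level B i)))"
proof (induction n)
  case 0
  then show ?case using card_mono[OF _ filt_0[OF 0(1)]] by simp
next
  case (Suc n)
  then have "card (filt B (Suc n)) \<le> card (Z (level B n)) * card (filt B n)"
    by (intro card_filt_Suc) auto
  also have "\<dots> \<le> card (Z (level B n)) * (\<Prod>i<n. card (Z (level B i)))"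
    using Suc by (intro mult_le_mono2) auto
  finally show ?case by (simp add: mult.commute)
qed

section \<open>Sizes and boundaries of the layers\<close>

lemma mult_le: "B \<subseteq> V' \<Longrightarrow> mult B u \<le> p"
proof (cases "{v \<in> B. \<pi> v = u} = {}")
  case False
  assume B: "B \<subseteq> V'"
  from False obtain v where v: "v \<in> B" "\<pi> v = u" by auto
  have "{v' \<in> B. \<pi> v' = u} \<subseteq> (\<lambda>k. (\<tau> ^^ k) v) ` {..<p}"
  proof
    fix v' assume "v' \<in> {v' \<in> B. \<pi> v' = u}"
    then obtain k where "k < p" "v' = (\<tau> ^^ k) v" using \<pi>_fibre[of v v'] v B by auto
    then show "v' \<in> (\<lambda>k. (\<tau> ^^ k) v) ` {..<p}" by blast
  qed
  then have "mult B u \<le> card ((\<lambda>k. (\<tau> ^^ k) v) ` {..<p})"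
    unfolding mult_def by (intro card_mono) auto
  also have "\<dots> \<le> p" using card_image_le[of "{..<p}"] by simp
  finally show ?thesis .
qed (metis mult_def card.empty le0)

text \<open>A vertex u lies in the layers with p - mult B u \<le> n < p, that is, in as many layers
  as its fibre has points in B.\<close>

lemma sum_card_level:
  assumes "B \<subseteq> V'"
  shows "(\<Sum>n<p. card (level B n)) = card B"
proof -
  have "(\<Sum>n<p. card (level B n)) = (\<Sum>n<p. \<Sum>u\<in>V. if p - n \<le> mult B u then 1 else 0)"
  proof (rule sum.cong)
    fix n
    have "level B n = V \<inter> {u. p - n \<le> mult B u}" by (auto simp: level_def)
    then show "card (level B n) = (\<Sum>u\<in>V. if p - n \<le> mult B u then 1 else 0)"
      using down.finite_V by (simp add: sum.If_cases)
  qed simp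
  also have "\<dots> = (\<Sum>u\<in>V. \<Sum>n<p. if p - n \<le> mult B u then 1 else 0)"
    by (rule sum.swap)
  also have "\<dots> = (\<Sum>u\<in>V. mult B u)"
  proof (rule sum.cong)
    fix u assume "u \<in> V"
    have "{..<p} \<inter> {n. p - n \<le> mult B u} = {p - mult B u..<p}" by auto
    then show "(\<Sum>n<p. if p - n \<le> mult B u then 1 else 0) = mult B u"
      using mult_le[OF assms, of u] by (simp add: sum.If_cases)
  qed simp
  also have "\<dots> = (\<Sum>u\<in>V. \<Sum>v\<in>{v \<in> B. \<pi> v = u}. 1)" by (simp add: mult_def)
  also have "\<dots> = (\<Sum>v\<in>B. 1)"
    using assms finite_sub_V' down.finite_V \<pi>_closed by (intro sum.group) auto
  finally show ?thesis by simp
qed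

lemma mult_act:
  assumes "B \<subseteq> V'" "u \<in> V" "x \<in> X"
  shows "mult B (act (x, True) u) = card {v \<in> V'. \<pi> v = u \<and> act (x, True) v \<in> B}"
proof -
  have "bij_betw (act (x, True)) {v \<in> V'. \<pi> v = u \<and> act (x, True) v \<in> B}
      {v \<in> B. \<pi> v = act (x, True) u}"
  proof (rule bij_betw_imageI)
    show "inj_on (act (x, True)) {v \<in> V'. \<pi> v = u \<and> act (x, True) v \<in> B}"
      using up.act_inj[of "(x, True)"] assms(3) by (auto intro: inj_on_subset)
    show "act (x, True) ` {v \<in> V'. \<pi> v = u \<and> act (x, True) v \<in> B} = {v \<in> B. \<pi> v = act (x, True) u}"
    proof (intro equalityI subsetI)
      fix w assume w: "w \<in> {v \<in> B. \<pi> v = act (x, True) u}"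
      let ?v = "act (x, False) w"
      have "w \<in> V'" using w assms(1) by auto
      then have "act (x, True) ?v = w" "?v \<in> V'" "\<pi> ?v = u"
        using up.act_inv'[of "(x, True)" w] up.act_closed[of "(x, False)" w] \<pi>_act[of "(x, False)" w]
          down.act_inv[of "(x, True)" u] assms(2,3) w by (auto simp: inv_letter_def)
      then show "w \<in> act (x, True) ` {v \<in> V'. \<pi> v = u \<and> act (x, True) v \<in> B}"
        using w by (intro image_eqI[of _ _ ?v]) auto
    qed (use \<pi>_act assms in auto)
  qed
  then show ?thesis unfolding mult_def by (rule bij_betw_same_card[symmetric])
qed

text \<open>The number of layers that separate the ends of an edge is the difference of the two
  multiplicities, and that difference is at most the number of lifts of the edge that leave or enter
  B.\<close>

lemma card_level_boundary:
  assumes B: "B \<subseteq> V'" and u: "u \<in> V" and x: "x \<in> X"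
  shows "card {n. n < p \<and> (u \<in> level B n) \<noteq> (act (x, True) u \<in> level B n)} \<le>
    card {v \<in> V'. \<pi> v = u \<and> (v \<in> B) \<noteq> (act (x, True) v \<in> B)}"
    (is "?l \<le> card ?D")
proof -
  let ?P = "{v \<in> V'. \<pi> v = u \<and> v \<in> B}" and ?Q = "{v \<in> V'. \<pi> v = u \<and> act (x, True) v \<in> B}"
  let ?m = "mult B u" and ?m' = "mult B (act (x, True) u)"
  have fin: "finite ?P" "finite ?Q" "finite ?D" using up.finite_V by auto
  have m: "?m = card ?P" unfolding mult_def using B by (intro arg_cong[of _ _ card]) auto
  have m': "?m' = card ?Q" using mult_act[OF B u x] .
  have "card ?P \<le> card (?Q \<union> ?D)" "card ?Q \<le> card (?P \<union> ?D)" using fin by (auto intro!: card_mono)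
  then have le: "?m \<le> ?m' + card ?D" "?m' \<le> ?m + card ?D"
    unfolding m m' using card_Un_le[of ?Q ?D] card_Un_le[of ?P ?D] by linarith+
  have au: "act (x, True) u \<in> V" using u x by (intro down.act_closed) auto
  have "{n. n < p \<and> (u \<in> level B n) \<noteq> (act (x, True) u \<in> level B n)} \<subseteq>
      {p - max ?m ?m'..<p - min ?m ?m'}"
  proof
    fix n assume "n \<in> {n. n < p \<and> (u \<in> level B n) \<noteq> (act (x, True) u \<in> level B n)}"
    then have "n < p" "(p - n \<le> ?m) \<noteq> (p - n \<le> ?m')" using u au by (auto simp: level_def)
    then show "n \<in> {p - max ?m ?m'..<p - min ?m ?m'}" unfolding atLeastLessThan_iff by linarith
  qed
  then have "?l \<le> card {p - max ?m ?m'..<p - min ?m ?m'}" by (intro card_mono) auto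
  also have "\<dots> \<le> card ?D" using le unfolding card_atLeastLessThan by linarith
  finally show ?thesis .
qed

lemma sum_card_boundary_level:
  assumes B: "B \<subseteq> V'"
  shows "(\<Sum>n<p. card (boundary X act V (level B n))) \<le> card (boundary X act V' B)"
proof -
  let ?f = "\<lambda>n e. if (fst e \<in> level B n) \<noteq> (act (snd e, True) (fst e) \<in> level B n) then 1 else 0 :: nat"
  have finVX: "finite (V \<times> X)" using down.finite_V up.finite_X by auto
  have "(\<Sum>n<p. card (boundary X act V (level B n))) = (\<Sum>n<p. \<Sum>e\<in>V \<times> X. ?f n e)"
  proof (rule sum.cong)
    fix n
    have "boundary X act V (level B n) =
        (V \<times> X) \<inter> {e. (fst e \<in> level B n) \<noteq> (act (snd e, True) (fst e) \<in> level B n)}"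
      by (auto simp: boundary_def)
    then show "card (boundary X act V (level B n)) = (\<Sum>e\<in>V \<times> X. ?f n e)"
      using finVX by (simp add: sum.If_cases)
  qed simp
  also have "\<dots> = (\<Sum>e\<in>V \<times> X. \<Sum>n<p. ?f n e)" by (rule sum.swap)
  also have "\<dots> \<le> (\<Sum>e\<in>V \<times> X. card {e' \<in> boundary X act V' B. (\<pi> (fst e'), snd e') = e})"
  proof (rule sum_mono)
    fix e assume e: "e \<in> V \<times> X"
    have "(\<Sum>n<p. ?f n e) =
        card {n. n < p \<and> (fst e \<in> level B n) \<noteq> (act (snd e, True) (fst e) \<in> level B n)}"
      by (simp add: sum.If_cases Int_def)
    also have "\<dots> \<le> card {v \<in> V'. \<pi> v = fst e \<and> (v \<in> B) \<noteq> (act (snd e, True) v \<in> B)}"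
      using card_level_boundary[OF B] e by auto
    also have "\<dots> \<le> card {e' \<in> boundary X act V' B. (\<pi> (fst e'), snd e') = e}"
      by (rule card_inj_on_le[of "\<lambda>v. (v, snd e)"])
        (use e in \<open>auto simp: up.finite_boundary inj_on_def, auto simp: boundary_def\<close>)
    finally show "(\<Sum>n<p. ?f n e) \<le> card {e' \<in> boundary X act V' B. (\<pi> (fst e'), snd e') = e}" .
  qed
  also have "\<dots> = (\<Sum>e\<in>V \<times> X. \<Sum>e'\<in>{e' \<in> boundary X act V' B. (\<pi> (fst e'), snd e') = e}. 1)"
    by simp
  also have "\<dots> = (\<Sum>e'\<in>boundary X act V' B. 1)"
  proof (rule sum.group[OF up.finite_boundary finVX])
    show "(\<lambda>e'. (\<pi> (fst e'), snd e')) ` boundary X act V' B \<subseteq> V \<times> X"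
      using \<pi>_closed by (auto simp: boundary_def)
  qed
  finally show ?thesis by simp
qed

text \<open>The constants survive unchanged because the layers partition the count of B exactly and
  their boundaries together do not exceed the boundary of B. The bound for subsets downstairs is
  essential here: even for simple B the layers are arbitrary subsets.\<close>

theorem linear_bound_lift:
  assumes bound: "linear_bound p X R act V a b" and b: "b \<ge> 0"
  shows "linear_bound p X R act V' a b"
  unfolding linear_bound_def
proof (intro allI impI)
  fix B assume B: "B \<subseteq> V'"
  have p1: "real p > 1" using prime_gt_1_nat[OF up.prime] by simp
  have pos: "card (Z (level B n)) > 0" for n by (rule down.card_cocycles_pos[OF level_sub])
  have "cocycle_dim p X R act V' B \<le> log (real p) (real (\<Prod>n<p. card (Z (level B n))))"
    unfolding cocycle_dim_def
    using card_filt[OF B order_refl] p1 up.card_cocycles_pos[OF B, of R] pos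
    by (subst log_le_cancel_iff) (auto simp: filt_p intro!: prod_pos simp del: of_nat_prod)
  also have "\<dots> = (\<Sum>n<p. cocycle_dim p X R act V (level B n))"
    unfolding cocycle_dim_def of_nat_prod log_def
    using pos by (subst ln_prod) (auto simp: sum_divide_distrib)
  also have "\<dots> \<le> (\<Sum>n<p. a * real (card (level B n)) + b * real (card (boundary X act V (level B n))))"
    using bound level_sub by (intro sum_mono) (auto simp: linear_bound_def)
  also have "\<dots> = a * real (\<Sum>n<p. card (level B n)) +
      b * real (\<Sum>n<p. card (boundary X act V (level B n)))"
    by (simp add: sum.distrib sum_distrib_left)
  also have "\<dots> \<le> a * real (card B) + b * real (card (boundary X act V' B))"
    using sum_card_boundary_level[OF B] b unfolding sum_card_level[OF B]
    by (intro add_left_mono mult_left_mono) (simp_all only: of_nat_le_iff)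
  finally show "cocycle_dim p X R act V' B \<le>
    a * real (card B) + b * real (card (boundary X act V' B))" .
qed

end

section \<open>Cutting a complex along a small boundary\<close>

locale connected_complex = word_complex +
  assumes connected: "\<And>v v'. v \<in> V \<Longrightarrow> v' \<in> V \<Longrightarrow> \<exists>w\<in>words X. fold act w v = v'"
begin

abbreviation "bd \<equiv> boundary X act V"
abbreviation "inner \<equiv> inner_edges X act"

lemma walk_or_walk_compl:
  assumes "w \<in> words X" "v \<in> V" "set (trail act v w) \<inter> bd S = {}"
  shows "v \<in> S \<Longrightarrow> walk act S v w" "v \<notin> S \<Longrightarrow> walk act (- S) v w"
proof -
  have "(v \<in> S \<longrightarrow> walk act S v w) \<and> (v \<notin> S \<longrightarrow> walk act (- S) v w)"
    using assms
  proof (induction w arbitrary: v)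
    case (Cons a w)
    have "(v \<in> S) = (act a v \<in> S)"
      using mem_boundary_edge_of[of a v S] Cons.prems by auto
    with Cons show ?case by (auto simp: act_closed)
  qed auto
  then show "v \<in> S \<Longrightarrow> walk act S v w" "v \<notin> S \<Longrightarrow> walk act (- S) v w" by auto
qed

lemma trail_walk:
  assumes "w \<in> words X" "v \<in> V"
  shows "walk act S v w \<Longrightarrow> set (trail act v w) \<subseteq> inner S"
    and "walk act (- S) v w \<Longrightarrow> set (trail act v w) \<inter> inner S = {}"
  using assms by (induction w arbitrary: v) (auto simp: edge_of_inner act_closed walk_start simp del: edge_of.simps)

lemma boundary_nonempty:
  assumes "S \<subseteq> V" "S \<noteq> {}" "S \<noteq> V"
  shows "bd S \<noteq> {}"
proof
  assume empty: "bd S = {}"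
  obtain v v' where v: "v \<in> S" "v' \<in> V" "v' \<notin> S" using assms by auto
  then obtain w where "w \<in> words X" "fold act w v = v'" using connected assms by blast
  with v assms empty walk_or_walk_compl(1)[of w v S] walk_end[of act S v w] show False by auto
qed

lemma boundary_compl: "bd (V - S) = bd S"
  using act_closed by (auto simp: boundary_def)

lemma card_boundary_pos: "S \<subseteq> V \<Longrightarrow> S \<noteq> {} \<Longrightarrow> S \<noteq> V \<Longrightarrow> card (bd S) > 0"
  using boundary_nonempty finite_boundary by (simp add: card_gt_0_iff)

text \<open>The edges of the cut together with all edges of relator paths that cross it. For a
  cochain that vanishes here, every relator path either stays on one side or sees only zeros, so the
  cochain may be cut off at the boundary and remain a cocycle.\<close>

definition crossing_edges :: "'b set \<Rightarrow> ('b \<times> 'a) set" where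
  "crossing_edges A = bd A \<union> (\<Union>r\<in>R. \<Union>u\<in>{u \<in> V. set (trail act u r) \<inter> bd A \<noteq> {}}. set (trail act u r))"

text \<open>An edge of the cut occurs at each position of a relator r from at most one base point,
  so it meets at most length r paths of r, each with length r edges; the summand 1 accounts for the
  edge itself.\<close>

definition relator_weight :: nat where
  "relator_weight = 1 + (\<Sum>r\<in>R. length r * length r)"

definition rel_cocycles :: "'b set \<Rightarrow> 'b set \<Rightarrow> ('b \<times> 'a \<Rightarrow> int) set" where
  "rel_cocycles A S = {z \<in> cocycles_on p X R act V S. \<forall>e\<in>crossing_edges A. z e = 0}"

text \<open>These are the sets obtained by assembling the pieces into which the edges of
  \<open>bd A\<close> cut V. Only the boundary of A matters, so A and its complement give the same
  notion.\<close>

definition saturated :: "'b set \<Rightarrow> 'b set \<Rightarrow> bool" where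
  "saturated A S \<longleftrightarrow> S \<subseteq> V \<and> bd S \<subseteq> bd A"

lemma R_word: "r \<in> R \<Longrightarrow> r \<in> words X" using R_words by auto

lemma crossing_edges_sub: "crossing_edges A \<subseteq> V \<times> X"
  using trail_closed R_word by (fastforce simp: crossing_edges_def boundary_def)

lemma finite_crossing: "finite (crossing_edges A)"
  by (rule finite_subset[OF crossing_edges_sub]) (use finite_V finite_X in auto)

lemma card_crossing_edges: "card (crossing_edges A) \<le> relator_weight * card (bd A)"
proof -
  let ?U = "\<lambda>r. {u \<in> V. set (trail act u r) \<inter> bd A \<noteq> {}}"
  have U: "card (?U r) \<le> length r * card (bd A)" if r: "r \<in> R" for r
  proof -
    have "?U r \<subseteq> (\<Union>i<length r. {u \<in> V. trail act u r ! i \<in> bd A})"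
    proof
      fix u assume "u \<in> ?U r"
      then obtain e where e: "u \<in> V" "e \<in> set (trail act u r)" "e \<in> bd A" by auto
      then obtain i where "i < length r" "trail act u r ! i = e" by (metis in_set_conv_nth length_trail)
      with e show "u \<in> (\<Union>i<length r. {u \<in> V. trail act u r ! i \<in> bd A})" by auto
    qed
    then have "card (?U r) \<le> card (\<Union>i<length r. {u \<in> V. trail act u r ! i \<in> bd A})"
      using finite_V by (intro card_mono) auto
    also have "\<dots> \<le> (\<Sum>i<length r. card {u \<in> V. trail act u r ! i \<in> bd A})"
      by (rule card_UN_le) simp
    also have "\<dots> \<le> (\<Sum>i<length r. card (bd A))"
    proof (rule sum_mono)
      fix i assume "i \<in> {..<length r}"
      then show "card {u \<in> V. trail act u r ! i \<in> bd A} \<le> card (bd A)"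
        using trail_inj[OF R_word[OF r], of i]
        by (intro card_inj_on_le[of "\<lambda>u. trail act u r ! i"])
          (auto simp: finite_boundary intro: inj_on_subset)
    qed
    finally show ?thesis by simp
  qed
  have UN: "card (\<Union>r\<in>R. \<Union>u\<in>?U r. set (trail act u r)) \<le> (\<Sum>r\<in>R. length r * length r) * card (bd A)"
  proof -
    have "card (\<Union>r\<in>R. \<Union>u\<in>?U r. set (trail act u r)) \<le> (\<Sum>r\<in>R. card (\<Union>u\<in>?U r. set (trail act u r)))"
      by (rule card_UN_le[OF finite_R])
    also have "\<dots> \<le> (\<Sum>r\<in>R. \<Sum>u\<in>?U r. card (set (trail act u r)))"
      by (intro sum_mono card_UN_le) (use finite_V in auto)
    also have "\<dots> \<le> (\<Sum>r\<in>R. \<Sum>u\<in>?U r. length r)"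
      by (intro sum_mono) (metis card_length length_trail)
    also have "\<dots> \<le> (\<Sum>r\<in>R. length r * length r * card (bd A))"
      using U by (intro sum_mono) (auto simp: mult.commute mult.left_commute)
    finally show ?thesis by (simp add: sum_distrib_right)
  qed
  have "card (crossing_edges A) \<le> card (bd A) + card (\<Union>r\<in>R. \<Union>u\<in>?U r. set (trail act u r))"
    unfolding crossing_edges_def by (rule card_Un_le)
  with UN show ?thesis by (simp add: relator_weight_def)
qed

lemma finite_rel_cocycles: "S \<subseteq> V \<Longrightarrow> finite (rel_cocycles A S)"
  by (rule finite_subset[OF _ finite_cocycles[of S R]]) (auto simp: rel_cocycles_def)

lemma rel_cocycles_cochains: "z \<in> rel_cocycles A S \<Longrightarrow> z \<in> cochains p (inner S)"
  by (simp add: rel_cocycles_def cocycles_on_def)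

lemma rel_cocycles_psum:
  "z \<in> rel_cocycles A S \<Longrightarrow> v \<in> V \<Longrightarrow> r \<in> R \<Longrightarrow> int p dvd psum act z v r"
  by (simp add: rel_cocycles_def cocycles_on_def)

lemma rel_cocycles_diff:
  assumes "z \<in> rel_cocycles A S" "z' \<in> rel_cocycles A S"
  shows "(\<lambda>e. (z e - z' e) mod int p) \<in> rel_cocycles A S"
  using assms R_word p_pos
  by (auto simp: rel_cocycles_def cocycles_on_def psum_mod psum_diff intro: cochains_diff_mod)

lemma rel_cocycles_mono: "S \<subseteq> T \<Longrightarrow> rel_cocycles A S \<subseteq> rel_cocycles A T"
  using cochains_mono[of "inner S" "inner T" p] p_pos
  by (auto simp: rel_cocycles_def cocycles_on_def inner_edges_def)

lemma card_cocycles_le: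
  "card (cocycles_on p X R act V V) \<le> p ^ card (crossing_edges A) * card (rel_cocycles A V)"
proof -
  have "card (cocycles_on p X R act V V) \<le>
      card (cochains p (crossing_edges A)) * card (rel_cocycles A V)"
  proof (rule card_le_by_differences[where p = p and E = "inner V"
        and f = "\<lambda>z e. if e \<in> crossing_edges A then z e else 0"])
    show "(\<lambda>z e. if e \<in> crossing_edges A then z e else 0) \<in>
        cocycles_on p X R act V V \<rightarrow> cochains p (crossing_edges A)"
      using p_pos cochains_range[of _ p "inner V"]
      by (auto simp: cocycles_on_def intro!: cochainsI)
  next
    fix z z' assume z: "z \<in> cocycles_on p X R act V V" "z' \<in> cocycles_on p X R act V V"
      and eq: "(\<lambda>e. if e \<in> crossing_edges A then z e else 0) = (\<lambda>e. if e \<in> crossing_edges A then z' e else 0)"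
    have "z e = z' e" if "e \<in> crossing_edges A" for e using fun_cong[OF eq, of e] that by simp
    with z show "(\<lambda>e. (z e - z' e) mod int p) \<in> rel_cocycles A V"
      using R_word p_pos
      by (auto simp: rel_cocycles_def cocycles_on_def psum_mod psum_diff intro: cochains_diff_mod)
  qed (use p_pos finite_inner finite_crossing finite_cochains finite_rel_cocycles in
      \<open>auto simp: cocycles_on_def\<close>)
  then show ?thesis by (simp add: card_cochains finite_crossing)
qed

definition restr :: "'b set \<Rightarrow> ('b \<times> 'a \<Rightarrow> int) \<Rightarrow> 'b \<times> 'a \<Rightarrow> int" where
  "restr S z = (\<lambda>e. if e \<in> inner S then z e else 0)"

text \<open>A relator path crosses the cut, stays in S, or avoids S. In the first case all its edges
  are crossing edges, where z is zero; in the second the sum is unchanged; in the third it is empty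
  of non-zero terms.\<close>

lemma restr_rel_cocycle:
  assumes z: "z \<in> rel_cocycles A V" and S: "saturated A S"
  shows "restr S z \<in> rel_cocycles A S"
  unfolding rel_cocycles_def cocycles_on_def
proof (intro CollectI conjI ballI)
  show "restr S z \<in> cochains p (inner S)"
    using cochains_range[OF rel_cocycles_cochains[OF z] p_pos] by (auto simp: restr_def intro!: cochainsI)
  show "restr S z e = 0" if "e \<in> crossing_edges A" for e
    using z that by (simp add: rel_cocycles_def restr_def)
  fix v r assume v: "v \<in> V" and r: "r \<in> R"
  consider "set (trail act v r) \<inter> bd A \<noteq> {}" | "walk act S v r" | "walk act (- S) v r"
    using walk_or_walk_compl[OF R_word[OF r] v, of S] S unfolding saturated_def by blast
  then show "int p dvd psum act (restr S z) v r"
  proof cases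
    case 1
    then have "\<forall>e\<in>set (trail act v r). z e = 0"
      using z v r by (auto simp: rel_cocycles_def crossing_edges_def)
    then have "int p dvd psum act (restr S z) v r - psum act (\<lambda>e. 0) v r"
      by (intro psum_cong_mod R_word r v) (auto simp: restr_def)
    then show ?thesis by simp
  next
    case 2
    have "int p dvd psum act (restr S z) v r - psum act z v r"
      using trail_walk(1)[OF R_word[OF r] v 2] by (intro psum_cong_mod R_word r v) (auto simp: restr_def)
    with rel_cocycles_psum[OF z v r] show ?thesis by (metis diff_add_cancel dvd_add)
  next
    case 3
    have "int p dvd psum act (restr S z) v r - psum act (\<lambda>e. 0) v r"
      using trail_walk(2)[OF R_word[OF r] v 3] by (intro psum_cong_mod R_word r v) (auto simp: restr_def)
    then show ?thesis by simp
  qed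
qed

lemma card_rel_cocycles_union:
  assumes S: "saturated A S1" "saturated A S2"
    and cover: "inner (S1 \<union> S2) \<subseteq> inner S1 \<union> inner S2 \<union> crossing_edges A"
  shows "card (rel_cocycles A (S1 \<union> S2)) \<le> card (rel_cocycles A S1) * card (rel_cocycles A S2)"
proof -
  have sub: "S1 \<subseteq> V" "S2 \<subseteq> V" using S by (auto simp: saturated_def)
  have "card (rel_cocycles A (S1 \<union> S2)) \<le> card (rel_cocycles A S1 \<times> rel_cocycles A S2)"
  proof (rule card_inj_on_le[of "\<lambda>z. (restr S1 z, restr S2 z)"])
    show "inj_on (\<lambda>z. (restr S1 z, restr S2 z)) (rel_cocycles A (S1 \<union> S2))"
    proof (rule inj_onI)
      fix z z' assume z: "z \<in> rel_cocycles A (S1 \<union> S2)" "z' \<in> rel_cocycles A (S1 \<union> S2)"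
        and eq: "(restr S1 z, restr S2 z) = (restr S1 z', restr S2 z')"
      have "restr S1 z e = restr S1 z' e" "restr S2 z e = restr S2 z' e" for e
        using eq by (auto dest: fun_cong)
      then have inner: "z e = z' e" if "e \<in> inner S1 \<union> inner S2" for e
        using that unfolding restr_def by (metis UnE)
      show "z = z'"
      proof (rule cochains_eqI[of _ p "inner (S1 \<union> S2)"])
        fix e assume "e \<in> inner (S1 \<union> S2)"
        with cover consider "e \<in> inner S1 \<union> inner S2" | "e \<in> crossing_edges A" by blast
        then show "int p dvd z e - z' e"
          using inner z by cases (auto simp: rel_cocycles_def)
      qed (use z rel_cocycles_cochains in auto)
    qed
    have "rel_cocycles A (S1 \<union> S2) \<subseteq> rel_cocycles A V" using sub by (intro rel_cocycles_mono) auto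
    then show "(\<lambda>z. (restr S1 z, restr S2 z)) ` rel_cocycles A (S1 \<union> S2) \<subseteq>
        rel_cocycles A S1 \<times> rel_cocycles A S2"
      using restr_rel_cocycle S by blast
  qed (use finite_rel_cocycles sub in auto)
  then show ?thesis by (simp add: card_cartesian_product)
qed

section \<open>Connected pieces with a surplus of cocycles\<close>

definition walk_connected :: "'b set \<Rightarrow> bool" where
  "walk_connected S \<longleftrightarrow> (\<forall>s\<in>S. \<forall>v\<in>S. \<exists>w\<in>words X. walk act S s w \<and> fold act w s = v)"

text \<open>A smallest saturated subset with surplus is connected: if no edge joined two parts of
  it, sizes and boundaries would add up and cocycles would embed into the product, so one of the
  parts would already have a surplus.\<close>

lemma connected_piece:
  assumes A: "saturated A A0" "A0 \<noteq> V"
    and large: "p ^ (card A0 + card (bd A0)) < card (rel_cocycles A A0)"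
  obtains S where "S \<subseteq> A0" "S \<noteq> {}" "saturated A S" "walk_connected S"
    "p ^ Suc (card S) < card (rel_cocycles A S)"
proof -
  let ?P = "\<lambda>S. S \<subseteq> A0 \<and> saturated A S \<and> p ^ (card S + card (bd S)) < card (rel_cocycles A S)"
  define S where "S = (ARG_MIN card S. ?P S)"
  have "?P A0" using A large by simp
  then have PS: "?P S" and min: "\<And>S'. ?P S' \<Longrightarrow> card S \<le> card S'"
    unfolding S_def using arg_min_nat_lemma[of ?P A0 card] by blast+
  have SV: "S \<subseteq> V" and finS: "finite S" using PS finite_V finite_subset by (auto simp: saturated_def)
  have "S \<noteq> {}"
  proof
    assume "S = {}"
    then have "rel_cocycles A S \<subseteq> {\<lambda>e. 0}"
      by (auto simp: rel_cocycles_def cocycles_on_def cochains_def inner_edges_def)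
    then have "card (rel_cocycles A S) \<le> 1"
      using card_mono[of "{\<lambda>e. 0}" "rel_cocycles A S"] by simp
    moreover have "p ^ (card S + card (bd S)) \<ge> 1" using p_pos by simp
    ultimately show False using PS by linarith
  qed
  moreover have "walk_connected S"
    unfolding walk_connected_def
  proof (rule ccontr)
    assume "\<not> (\<forall>s\<in>S. \<forall>v\<in>S. \<exists>w\<in>words X. walk act S s w \<and> fold act w s = v)"
    then obtain s v where sv: "s \<in> S" "v \<in> S" "\<not> (\<exists>w\<in>words X. walk act S s w \<and> fold act w s = v)"
      by blast
    define S1 where "S1 = {v. \<exists>w\<in>words X. walk act S s w \<and> fold act w s = v}"
    define S2 where "S2 = S - S1"
    have "s \<in> S1" unfolding S1_def by (intro CollectI bexI[of _ "[]"]) (use sv in auto)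
    have "S1 \<subseteq> S" using walk_end by (auto simp: S1_def)
    have closed: "act a u \<in> S1" if "u \<in> S1" "fst a \<in> X" "act a u \<in> S" for u a
    proof -
      from that obtain w where "w \<in> words X" "walk act S s w" "fold act w s = u" by (auto simp: S1_def)
      moreover have "u \<in> S" using that \<open>S1 \<subseteq> S\<close> by auto
      ultimately show ?thesis
        unfolding S1_def using that by (intro CollectI bexI[of _ "w @ [a]"]) (simp_all add: walk_append)
    qed
    have closed': "u \<in> S1" if "u \<in> S" "x \<in> X" "act (x, True) u \<in> S1" for u x
      using closed[of "act (x, True) u" "(x, False)"] act_inv[of "(x, True)" u] that SV
      by (auto simp: inv_letter_def)
    have dec: "S1 \<union> S2 = S" "S1 \<inter> S2 = {}" using \<open>S1 \<subseteq> S\<close> by (auto simp: S2_def)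
    have iff: "v \<in> S1 \<longleftrightarrow> act (x, True) v \<in> S1" if "v \<in> S" "act (x, True) v \<in> S" "x \<in> X" for v x
      using closed[of v "(x, True)"] closed'[of v x] that by auto
    have bd: "bd S1 \<subseteq> bd S" "bd S2 \<subseteq> bd S" "bd S1 \<inter> bd S2 = {}"
      using iff \<open>S1 \<subseteq> S\<close> unfolding boundary_def S2_def by blast+
    have sat: "saturated A S1" "saturated A S2" using bd dec PS by (auto simp: saturated_def)
    have proper: "S1 \<subset> S" "S2 \<subset> S" using sv \<open>s \<in> S1\<close> \<open>S1 \<subseteq> S\<close> by (auto simp: S2_def S1_def)
    have "\<not> ?P S1"
    proof
      assume "?P S1"
      from min[OF this] psubset_card_mono[OF finS proper(1)] show False by linarith
    qed
    moreover have "\<not> ?P S2"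
    proof
      assume "?P S2"
      from min[OF this] psubset_card_mono[OF finS proper(2)] show False by linarith
    qed
    ultimately have "card (rel_cocycles A S1) \<le> p ^ (card S1 + card (bd S1))"
      "card (rel_cocycles A S2) \<le> p ^ (card S2 + card (bd S2))"
      using sat dec PS by (auto simp: not_less)
    then have "card (rel_cocycles A S1) * card (rel_cocycles A S2) \<le>
        p ^ (card S1 + card (bd S1) + (card S2 + card (bd S2)))"
      by (simp add: power_add mult_le_mono)
    moreover have "card (rel_cocycles A S) \<le> card (rel_cocycles A S1) * card (rel_cocycles A S2)"
    proof -
      have "inner (S1 \<union> S2) \<subseteq> inner S1 \<union> inner S2 \<union> crossing_edges A"
      proof
        fix e assume "e \<in> inner (S1 \<union> S2)"
        then obtain v x where "e = (v, x)" "v \<in> S" "x \<in> X" "act (x, True) v \<in> S"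
          unfolding dec(1) by (auto simp: inner_edges_def)
        with iff[of v x] show "e \<in> inner S1 \<union> inner S2 \<union> crossing_edges A"
          by (simp add: inner_edges_def S2_def)
      qed
      from card_rel_cocycles_union[OF sat this] show ?thesis unfolding dec(1) .
    qed
    moreover have "card S1 + card S2 = card S"
      using card_Un_disjoint[of S1 S2] dec finS finite_subset[OF \<open>S1 \<subseteq> S\<close> finS] by (auto simp: S2_def)
    moreover have "card (bd S1) + card (bd S2) \<le> card (bd S)"
    proof -
      have "card (bd S1) + card (bd S2) = card (bd S1 \<union> bd S2)"
        using bd(3) finite_boundary by (intro card_Un_disjoint[symmetric]) auto
      also have "\<dots> \<le> card (bd S)" using bd finite_boundary by (intro card_mono) auto
      finally show ?thesis .
    qed
    moreover from calculation have "p ^ (card S1 + card (bd S1) + (card S2 + card (bd S2))) \<le>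
        p ^ (card S + card (bd S))"
      using p_pos by (intro power_increasing) linarith+
    ultimately have "card (rel_cocycles A S) \<le> p ^ (card S + card (bd S))" by linarith
    with PS show False by linarith
  qed
  moreover have "p ^ Suc (card S) < card (rel_cocycles A S)"
  proof -
    \<comment> \<open>Connectedness of V gives S at least one boundary edge. The boundary term in
      the surplus thus pays for one dimension more than the |S| potentials, which is what two
      independent classes require.\<close>
    have "S \<noteq> V" using PS A by (auto simp: saturated_def)
    then have "card (bd S) > 0" using card_boundary_pos SV \<open>S \<noteq> {}\<close> by blast
    then have "p ^ Suc (card S) \<le> p ^ (card S + card (bd S))"
      using p_pos by (intro power_increasing) auto
    with PS show ?thesis by linarith
  qed
  ultimately show ?thesis using PS that by blast
qed

definition loop_in :: "'b set \<Rightarrow> 'b \<Rightarrow> ('a \<times> bool) list \<Rightarrow> bool" where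
  "loop_in S s l \<longleftrightarrow> l \<in> words X \<and> walk act S s l \<and> fold act l s = s"

text \<open>A cocycle with trivial sums along all loops in \<open>S\<close> is determined by a potential on \<open>S\<close>.\<close>

lemma nontrivial_loop:
  assumes S: "S \<subseteq> V" "walk_connected S" "s \<in> S"
    and M: "M \<subseteq> cochains p (inner S)" "p ^ card S < card M"
  obtains z l where "z \<in> M" "loop_in S s l" "\<not> int p dvd psum act z s l"
proof -
  have finS: "finite S" using S finite_V finite_subset by blast
  have "\<exists>z\<in>M. \<exists>l. loop_in S s l \<and> \<not> int p dvd psum act z s l"
  proof (rule ccontr)
    assume "\<not> ?thesis"
    then have triv: "int p dvd psum act z s l" if "z \<in> M" "loop_in S s l" for z l using that by blast
    have "\<forall>v\<in>S. \<exists>w. w \<in> words X \<and> walk act S s w \<and> fold act w s = v"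
      using S(2,3) unfolding walk_connected_def by blast
    then obtain w where w: "\<And>v. v \<in> S \<Longrightarrow> w v \<in> words X \<and> walk act S s (w v) \<and> fold act (w v) s = v"
      by metis
    define f where "f z = (\<lambda>v. if v \<in> S then psum act z s (w v) mod int p else 0)" for z
    have edge: "int p dvd z (v, x) - (f z (act (x, True) v) - f z v)"
      if z: "z \<in> M" and e: "(v, x) \<in> inner S" for z v x
    proof -
      let ?v' = "act (x, True) v"
      have e': "v \<in> S" "?v' \<in> S" "x \<in> X" using e by (auto simp: inner_edges_def)
      let ?l = "w v @ [(x, True)] @ inv_word (w ?v')"
      have sV: "s \<in> V" using S by auto
      have ret: "fold act (inv_word (w ?v')) ?v' = s" "walk act S ?v' (inv_word (w ?v'))"
        "psum act z ?v' (inv_word (w ?v')) = - psum act z s (w ?v')"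
        using fold_inv_word[of "w ?v'" s] walk_inv_word[of "w ?v'" s S] psum_inv_word[of "w ?v'" s z]
          w[OF e'(2)] sV by auto
      have "loop_in S s ?l"
        unfolding loop_in_def using w[OF e'(1)] w[OF e'(2)] e' ret by (auto simp: walk_append)
      from triv[OF z this] have "int p dvd psum act z s (w v) + z (v, x) - psum act z s (w ?v')"
        using w[OF e'(1)] ret by (simp add: psum_append add_diff_eq)
      then have "(psum act z s (w v) + z (v, x)) mod int p = psum act z s (w ?v') mod int p"
        by (simp add: mod_eq_dvd_iff)
      then have "(z (v, x) + f z v) mod int p = f z ?v' mod int p"
        using e' by (simp add: f_def mod_add_right_eq add.commute)
      then show ?thesis by (simp add: mod_eq_dvd_iff algebra_simps)
    qed
    have "card M \<le> card (cochains p S)"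
    proof (rule card_inj_on_le[of f])
      show "inj_on f M"
      proof (rule inj_onI)
        fix z z' assume z: "z \<in> M" "z' \<in> M" and eq: "f z = f z'"
        show "z = z'"
        proof (rule cochains_eqI[of _ p "inner S"])
          fix e assume "e \<in> inner S"
          then have "int p dvd z e - (f z (act (snd e, True) (fst e)) - f z (fst e))"
            "int p dvd z' e - (f z' (act (snd e, True) (fst e)) - f z' (fst e))"
            using edge[OF z(1), of "fst e" "snd e"] edge[OF z(2), of "fst e" "snd e"] by simp_all
          from dvd_diff[OF this]
          show "int p dvd z e - z' e" by (simp add: eq)
        qed (use z M in auto)
      qed
      show "f ` M \<subseteq> cochains p S" using p_pos by (auto simp: f_def intro!: cochainsI)
    qed (simp add: finite_cochains finS)
    then show False using M(2) by (simp add: card_cochains finS)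
  qed
  then show ?thesis using that by blast
qed

text \<open>Evaluation on the first loop takes at most p values, so its kernel still has more than p
  ^ card S elements and provides the second cocycle. The resulting triangular pattern of values
  makes the two classes independent.\<close>

lemma two_nontrivial_loops:
  assumes S: "S \<subseteq> V" "walk_connected S" "s \<in> S" and large: "p ^ Suc (card S) < card (rel_cocycles A S)"
  obtains z1 z2 l1 l2 where "z1 \<in> rel_cocycles A S" "z2 \<in> rel_cocycles A S" "loop_in S s l1" "loop_in S s l2"
    "\<not> int p dvd psum act z1 s l1" "int p dvd psum act z2 s l1" "\<not> int p dvd psum act z2 s l2"
proof -
  have cochains: "rel_cocycles A S \<subseteq> cochains p (inner S)" using rel_cocycles_cochains by blast
  have "p ^ card S \<le> p ^ Suc (card S)" using p_pos by (intro power_increasing) auto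
  then have "p ^ card S < card (rel_cocycles A S)" using large by linarith
  then obtain z1 l1 where 1: "z1 \<in> rel_cocycles A S" "loop_in S s l1" "\<not> int p dvd psum act z1 s l1"
    using nontrivial_loop[OF S cochains] by blast
  define M where "M = {z \<in> rel_cocycles A S. int p dvd psum act z s l1}"
  have sV: "s \<in> V" and l1: "l1 \<in> words X" using S 1 by (auto simp: loop_in_def)
  have "card (rel_cocycles A S) \<le> card {0..<int p} * card M"
  proof (rule card_le_by_differences[where f = "\<lambda>z. psum act z s l1 mod int p" and p = p and E = "inner S"])
    fix z z' assume z: "z \<in> rel_cocycles A S" "z' \<in> rel_cocycles A S"
      and "psum act z s l1 mod int p = psum act z' s l1 mod int p"
    then show "(\<lambda>e. (z e - z' e) mod int p) \<in> M"
      using rel_cocycles_diff[OF z] sV l1 by (simp add: M_def psum_mod psum_diff mod_eq_dvd_iff)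
  qed (use p_pos cochains finite_inner[OF S(1)] finite_rel_cocycles[OF S(1)] in \<open>auto simp: M_def\<close>)
  from less_le_trans[OF large this] have "p ^ card S < card M" by simp
  then obtain z2 l2 where "z2 \<in> M" "loop_in S s l2" "\<not> int p dvd psum act z2 s l2"
    using nontrivial_loop[OF S, of M] cochains by (auto simp: M_def)
  with 1 show ?thesis using that[of z1 z2 l1 l2] by (auto simp: M_def)
qed

text \<open>The two connected pieces found on the sides of the cut need not be adjacent. Replacing T
  by its component B in the complement of S repairs this: every edge leaving B ends in S, so a walk
  from S to T enters B directly from S, and B is still connected and cut off by edges of the
  original cut.\<close>

lemma separating_component:
  assumes S: "saturated A S" "S \<noteq> {}" and T: "T \<subseteq> V" "walk_connected T" "T \<noteq> {}" and disj: "S \<inter> T = {}"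
  obtains B s a where "saturated A B" "T \<subseteq> B" "B \<inter> S = {}" "walk_connected B"
    "s \<in> S" "fst a \<in> X" "act a s \<in> B"
proof -
  have SV: "S \<subseteq> V" using S by (simp add: saturated_def)
  define B where "B = {v. \<exists>w\<in>words X. v \<in> V \<and> walk act (V - S) v w \<and> fold act w v \<in> T}"
  have TB: "T \<subseteq> B"
    using T disj by (auto simp: B_def intro!: bexI[of _ "[]"])
  have BS: "B \<subseteq> V" "B \<inter> S = {}" using walk_start by (fastforce simp: B_def)+
  have step: "v \<in> B" if "v \<in> V - S" "fst a \<in> X" "act a v \<in> B" for v a
  proof -
    from that(3) obtain w where "w \<in> words X" "walk act (V - S) (act a v) w" "fold act w (act a v) \<in> T"
      by (auto simp: B_def)
    with that show ?thesis unfolding B_def by (intro CollectI bexI[of _ "a # w"]) auto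
  qed
  have step': "act a v \<in> B" if "v \<in> B" "fst a \<in> X" "act a v \<notin> S" for v a
  proof (rule step)
    have "v \<in> V" using that BS by auto
    then show "act (inv_letter a) (act a v) \<in> B" "act a v \<in> V - S"
      using that act_inv act_closed by auto
    show "fst (inv_letter a) \<in> X" using that by simp
  qed
  have "bd B \<subseteq> bd S"
  proof
    fix e assume "e \<in> bd B"
    then obtain v x where e: "e = (v, x)" "v \<in> V" "x \<in> X" "(v \<in> B) \<noteq> (act (x, True) v \<in> B)"
      by (auto simp: boundary_def)
    then show "e \<in> bd S"
      using step[of v "(x, True)"] step'[of v "(x, True)"] BS by (auto simp: boundary_def)
  qed
  then have sat: "saturated A B" using S BS by (auto simp: saturated_def)
  have walkB: "walk act B v w" if "walk act (V - S) v w" "w \<in> words X" "v \<in> B" for v w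
    using that
  proof (induction w arbitrary: v)
    case (Cons a w)
    then have "act a v \<in> B" using step'[of v a] walk_start[of act "V - S" "act a v" w] by auto
    with Cons show ?case by auto
  qed auto
  have conB: "walk_connected B"
    unfolding walk_connected_def
  proof (intro ballI)
    fix u v assume u: "u \<in> B" and v: "v \<in> B"
    obtain w where w: "w \<in> words X" "walk act (V - S) u w" "fold act w u \<in> T" using u by (auto simp: B_def)
    obtain w' where w': "w' \<in> words X" "walk act (V - S) v w'" "fold act w' v \<in> T" using v by (auto simp: B_def)
    obtain t where t: "t \<in> words X" "walk act T (fold act w u) t" "fold act t (fold act w u) = fold act w' v"
      using T(2) w(3) w'(3) by (auto simp: walk_connected_def)
    have vV: "v \<in> V" using v BS by auto
    have ret: "fold act (inv_word w') (fold act w' v) = v" "walk act B (fold act w' v) (inv_word w')"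
      using fold_inv_word[OF w'(1) vV] walk_inv_word[OF w'(1) vV walkB[OF w'(2,1) v]] by auto
    show "\<exists>w\<in>words X. walk act B u w \<and> fold act w u = v"
    proof (intro bexI[of _ "w @ t @ inv_word w'"] conjI)
      show "walk act B u (w @ t @ inv_word w')"
        using walkB[OF w(2,1) u] walk_mono[OF t(2) TB] ret(2) t(3) by (simp add: walk_append)
      show "fold act (w @ t @ inv_word w') u = v" using t(3) ret(1) by simp
      show "w @ t @ inv_word w' \<in> words X" using w w' t by simp
    qed
  qed
  have cross: "v \<in> B \<or> (\<exists>s a. s \<in> S \<and> fst a \<in> X \<and> act a s \<in> B)"
    if "w \<in> words X" "v \<in> V" "fold act w v \<in> T" for v w
    using that
  proof (induction w arbitrary: v)
    case (Cons a w)
    then have "act a v \<in> B \<or> (\<exists>s a. s \<in> S \<and> fst a \<in> X \<and> act a s \<in> B)"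
      using act_closed by auto
    then show ?case
    proof
      assume "act a v \<in> B"
      then show ?case using Cons.prems step[of v a] by (cases "v \<in> S") (auto simp del: split_paired_Ex)
    qed simp
  qed (use TB in auto)
  obtain v t where vt: "v \<in> S" "t \<in> T" using S T by auto
  then obtain w where "w \<in> words X" "fold act w v = t" using connected SV T by blast
  with cross[of w v] vt SV BS have "\<exists>s a. s \<in> S \<and> fst a \<in> X \<and> act a s \<in> B" by blast
  then obtain s a where "s \<in> S" "fst a \<in> X" "act a s \<in> B" by blast
  with sat TB BS conB show ?thesis using that by blast
qed

end

section \<open>Groups presented by generators and relators\<close>

lemma free_group_simps [simp]:
  "u \<otimes>\<^bsub>free_group X\<^esub> v = foldr push_letter u v" "\<one>\<^bsub>free_group X\<^esub> = []"
  by (simp_all add: free_group_def)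

lemma carrier_free_group: "w \<in> carrier (free_group X) \<longleftrightarrow> reduced w \<and> w \<in> words X"
proof -
  have "w \<in> words X \<longleftrightarrow> fst ` set w \<subseteq> X"
    by (auto simp: words_def in_lists_conv_set mem_Times_iff)
  then show ?thesis by (simp add: free_group_def)
qed

lemma inv_free_group:
  assumes "w \<in> carrier (free_group X)"
  shows "inv\<^bsub>free_group X\<^esub> w = inv_word w"
proof (rule group.inv_equality[OF group_free_group])
  show "inv_word w \<otimes>\<^bsub>free_group X\<^esub> w = \<one>\<^bsub>free_group X\<^esub>" by (simp add: foldr_inverse)
qed (use assms in \<open>auto simp: carrier_free_group reduced_inverse\<close>)

lemma foldr_push_closed:
  assumes "u \<in> words X" "v \<in> carrier (free_group X)"
  shows "foldr push_letter u v \<in> carrier (free_group X)"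
proof -
  have *: "w \<in> words X \<longleftrightarrow> fst ` set w \<subseteq> X" for w :: "('a \<times> bool) list"
    by (auto simp: words_def in_lists_conv_set mem_Times_iff)
  have "fst ` set (foldr push_letter u v) \<subseteq> X"
    using order_trans[OF set_foldr[of u v]] assms by (simp add: carrier_free_group *)
  then show ?thesis using assms reduced_foldr[of v u] by (simp add: carrier_free_group *)
qed

lemma fold_push_letter:
  assumes inv: "\<And>a v. fst a \<in> X \<Longrightarrow> v \<in> \<Omega> \<Longrightarrow> act (inv_letter a) (act a v) = v"
    and "fst a \<in> X" "v \<in> \<Omega>"
  shows "fold act (push_letter a w) v = fold act w (act a v)"
  using inv[OF assms(2,3)] by (cases w) auto

lemma fold_foldr_push_letter:
  assumes closed: "\<And>a v. fst a \<in> X \<Longrightarrow> v \<in> \<Omega> \<Longrightarrow> act a v \<in> \<Omega>"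
    and inv: "\<And>a v. fst a \<in> X \<Longrightarrow> v \<in> \<Omega> \<Longrightarrow> act (inv_letter a) (act a v) = v"
    and "u \<in> words X" "v \<in> \<Omega>"
  shows "fold act (foldr push_letter u w) v = fold act w (fold act u v)"
  using assms(3,4)
proof (induction u arbitrary: v)
  case (Cons a u)
  then show ?case
    using fold_push_letter[of X \<Omega> act a v, OF inv] closed by simp
qed simp

text \<open>The words acting trivially form a normal subgroup of the free group.\<close>

lemma normal_closure_acts_trivially:
  assumes closed: "\<And>a v. fst a \<in> X \<Longrightarrow> v \<in> \<Omega> \<Longrightarrow> act a v \<in> \<Omega>"
    and inv: "\<And>a v. fst a \<in> X \<Longrightarrow> v \<in> \<Omega> \<Longrightarrow> act (inv_letter a) (act a v) = v"
    and R: "R \<subseteq> carrier (free_group X)" "\<And>r v. r \<in> R \<Longrightarrow> v \<in> \<Omega> \<Longrightarrow> fold act r v = v"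
    and w: "w \<in> normal_closure (free_group X) R" and v: "v \<in> \<Omega>"
  shows "fold act w v = v"
proof -
  interpret F: group "free_group X" by (rule group_free_group)
  define K where "K = {w \<in> carrier (free_group X). \<forall>v\<in>\<Omega>. fold act w v = v}"
  note fp = fold_foldr_push_letter[of X \<Omega> act, OF closed inv]
  have clos: "fold act u v \<in> \<Omega>" if "u \<in> words X" "v \<in> \<Omega>" for u v
    using that
  proof (induction u arbitrary: v)
    case (Cons a u)
    then show ?case using closed[of a v] by simp
  qed simp
  have ret: "fold act (inv_word u) (fold act u v) = v" if "u \<in> words X" "v \<in> \<Omega>" for u v
    using that
  proof (induction u arbitrary: v)
    case (Cons a u)
    then show ?case using closed[of a v] inv[of a v] by simp
  qed simp
  have "subgroup K (free_group X)"
  proof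
    fix u assume u: "u \<in> K"
    then have "u \<in> carrier (free_group X)" by (simp add: K_def)
    moreover have "fold act (inv_word u) v = v" if "v \<in> \<Omega>" for v
      using ret[of u v] u that by (simp add: K_def carrier_free_group)
    ultimately show "inv\<^bsub>free_group X\<^esub> u \<in> K"
      using F.inv_closed[of u] by (simp add: K_def inv_free_group)
  next
    fix u w assume "u \<in> K" "w \<in> K"
    then have "fold act (foldr push_letter u w) v = v" if "v \<in> \<Omega>" for v
      using fp[of u v w] that by (simp add: K_def carrier_free_group)
    then show "u \<otimes>\<^bsub>free_group X\<^esub> w \<in> K"
      using F.m_closed[of u w] \<open>u \<in> K\<close> \<open>w \<in> K\<close> by (simp add: K_def)
  next
    show "K \<subseteq> carrier (free_group X)" by (auto simp: K_def)
    show "\<one>\<^bsub>free_group X\<^esub> \<in> K" by (simp add: K_def carrier_free_group reduced_def)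
  qed
  then have "K \<lhd> free_group X"
  proof (rule F.normal_invI)
    fix u k assume u: "u \<in> carrier (free_group X)" and k: "k \<in> K"
    have ui: "inv\<^bsub>free_group X\<^esub> u = inv_word u" by (rule inv_free_group[OF u])
    have "fold act (foldr push_letter (foldr push_letter u k) (inv_word u)) v = v" if v: "v \<in> \<Omega>" for v
    proof -
      have kw: "k \<in> words X" "u \<in> words X" using u k by (auto simp: K_def carrier_free_group)
      then have "foldr push_letter u k \<in> words X"
        using F.m_closed[of u k] u k by (simp add: K_def carrier_free_group)
      then have "fold act (foldr push_letter (foldr push_letter u k) (inv_word u)) v =
          fold act (inv_word u) (fold act k (fold act u v))"
        using fp[of "foldr push_letter u k" v "inv_word u"] fp[of u v k] kw v by simp
      also have "fold act k (fold act u v) = fold act u v" using clos[of u v] kw v k by (simp add: K_def)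
      finally show ?thesis using ret[of u v] kw v by simp
    qed
    then show "u \<otimes>\<^bsub>free_group X\<^esub> k \<otimes>\<^bsub>free_group X\<^esub> inv\<^bsub>free_group X\<^esub> u \<in> K"
      using F.m_closed[OF F.m_closed[of u k] F.inv_closed[OF u]] u k by (simp add: K_def ui)
  qed
  moreover have "R \<subseteq> K" using R by (auto simp: K_def)
  ultimately have "K \<in> {N. N \<lhd> free_group X \<and> R \<subseteq> N}" by simp
  then have "normal_closure (free_group X) R \<subseteq> K" unfolding normal_closure_def by (rule Inter_lower)
  with w v show ?thesis by (auto simp: K_def)
qed

locale presented_group = group G
  for G :: "('a, 'b) monoid_scheme" (structure) +
  fixes X :: "'x set" and R :: "('x \<times> bool) list set" and \<pi> :: "('x \<times> bool) list \<Rightarrow> 'a"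
  assumes finite_X: "finite X" and finite_R: "finite R" and R_carrier: "R \<subseteq> carrier (free_group X)"
    and \<pi>_hom: "\<pi> \<in> hom (free_group X) G" and \<pi>_surj: "\<pi> ` carrier (free_group X) = carrier G"
    and \<pi>_kernel: "\<And>w. w \<in> carrier (free_group X) \<Longrightarrow> \<pi> w = \<one> \<longleftrightarrow> w \<in> normal_closure (free_group X) R"
begin

definition gen :: "'x \<times> bool \<Rightarrow> 'a" where
  "gen a = \<pi> [a]"

definition word_val :: "('x \<times> bool) list \<Rightarrow> 'a" where
  "word_val w = foldr (\<lambda>a g. gen a \<otimes> g) w \<one>"

definition coset_act :: "'x \<times> bool \<Rightarrow> 'a set \<Rightarrow> 'a set" where
  "coset_act a U = U #> gen a"

lemma letter_carrier: "fst a \<in> X \<Longrightarrow> [a] \<in> carrier (free_group X)"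
  by (simp add: carrier_free_group reduced_def)

lemma gen_closed [simp]: "fst a \<in> X \<Longrightarrow> gen a \<in> carrier G"
  unfolding gen_def using hom_carrier[OF \<pi>_hom] letter_carrier[of a] by blast

lemma \<pi>_mult:
  assumes "u \<in> carrier (free_group X)" "w \<in> carrier (free_group X)"
  shows "\<pi> (foldr push_letter u w) = \<pi> u \<otimes> \<pi> w"
  using hom_mult[OF \<pi>_hom assms] by simp

lemma \<pi>_one: "\<pi> [] = \<one>"
proof -
  have "group_hom (free_group X) G \<pi>"
    using \<pi>_hom group_free_group by (simp add: group_hom_def group_hom_axioms_def is_group)
  from group_hom.hom_one[OF this] show ?thesis by simp
qed

lemma gen_inv: "fst a \<in> X \<Longrightarrow> gen a \<otimes> gen (inv_letter a) = \<one>"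
  using \<pi>_mult[of "[a]" "[inv_letter a]"] letter_carrier[of a] letter_carrier[of "inv_letter a"] \<pi>_one
  by (simp add: gen_def)

lemma word_val_simps [simp]: "word_val [] = \<one>" "word_val (a # w) = gen a \<otimes> word_val w"
  by (simp_all add: word_val_def)

lemma word_val_closed [simp]: "w \<in> words X \<Longrightarrow> word_val w \<in> carrier G"
  by (induction w) auto

lemma word_val_append: "u \<in> words X \<Longrightarrow> w \<in> words X \<Longrightarrow> word_val (u @ w) = word_val u \<otimes> word_val w"
  by (induction u) (auto simp: m_assoc)

lemma word_val_inv_word: "w \<in> words X \<Longrightarrow> word_val (inv_word w) = inv (word_val w)"
proof (induction w)
  case (Cons a w)
  have "gen (inv_letter a) = inv (gen a)"
    using inv_equality[OF inv_comm[OF gen_inv[of a]]] Cons.prems by simp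
  with Cons show ?case by (simp add: word_val_append inv_mult_group)
qed simp

lemma word_val_\<pi>: "w \<in> carrier (free_group X) \<Longrightarrow> word_val w = \<pi> w"
proof (induction w)
  case (Cons a w)
  have w: "w \<in> carrier (free_group X)" "fst a \<in> X"
    using Cons.prems reduced_Cons[of a w] by (simp_all add: carrier_free_group)
  have "push_letter a w = a # w" using Cons.prems
    by (cases w) (auto simp: carrier_free_group reduced_def)
  then have "\<pi> (a # w) = \<pi> [a] \<otimes> \<pi> w"
    using \<pi>_mult[of "[a]" w] w letter_carrier[of a] by simp
  with Cons.IH w show ?case by (simp add: gen_def)
qed (simp add: \<pi>_one)

lemma word_val_surj: "g \<in> carrier G \<Longrightarrow> \<exists>w\<in>words X. word_val w = g"
proof -
  assume "g \<in> carrier G"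
  then obtain w where "w \<in> carrier (free_group X)" "\<pi> w = g" using \<pi>_surj by (metis imageE)
  then show ?thesis using word_val_\<pi> carrier_free_group by metis
qed

lemma R_words: "R \<subseteq> words X" using R_carrier by (auto simp: carrier_free_group)

lemma relator_in_closure: "r \<in> R \<Longrightarrow> r \<in> normal_closure (free_group X) R"
  by (auto simp: normal_closure_def)

lemma word_val_relator: "r \<in> R \<Longrightarrow> word_val r = \<one>"
  using word_val_\<pi>[of r] \<pi>_kernel[of r] R_carrier relator_in_closure[of r] by auto

text \<open>Von Dyck's principle for actions: if the relators act as the identity, the action
  factors through G. The word need not be reduced, so it is replaced by its reduced form, which has
  the same value and the same action.\<close>

lemma trivial_word_acts_trivially:
  assumes closed: "\<And>a v. fst a \<in> X \<Longrightarrow> v \<in> \<Omega> \<Longrightarrow> act a v \<in> \<Omega>"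
    and inv: "\<And>a v. fst a \<in> X \<Longrightarrow> v \<in> \<Omega> \<Longrightarrow> act (inv_letter a) (act a v) = v"
    and R: "\<And>r v. r \<in> R \<Longrightarrow> v \<in> \<Omega> \<Longrightarrow> fold act r v = v"
    and w: "w \<in> words X" "word_val w = \<one>" and v: "v \<in> \<Omega>"
  shows "fold act w v = v"
proof -
  let ?r = "foldr push_letter w []"
  have nil: "[] \<in> carrier (free_group X)" by (simp add: carrier_free_group reduced_def)
  have r: "?r \<in> carrier (free_group X)" by (rule foldr_push_closed[OF w(1) nil])
  have push: "word_val (push_letter a u) = gen a \<otimes> word_val u" if "fst a \<in> X" "u \<in> words X" for a u
    using that gen_inv[of a] by (cases u) (auto simp: m_assoc[symmetric])
  have "word_val (foldr push_letter u []) = word_val u" if "u \<in> words X" for u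
    using that
  proof (induction u)
    case (Cons a u)
    then show ?case using foldr_push_closed[OF _ nil, of u] push[of a]
      by (simp add: carrier_free_group)
  qed simp
  then have "\<pi> ?r = \<one>" using word_val_\<pi>[OF r] w by simp
  then have "?r \<in> normal_closure (free_group X) R" using \<pi>_kernel r by simp
  then have "fold act ?r v = v"
    by (intro normal_closure_acts_trivially[OF closed inv R_carrier R _ v]) auto
  moreover have "fold act ?r v = fold act w v"
    using fold_foldr_push_letter[of X \<Omega> act, OF closed inv w(1) v, of "[]"] by simp
  ultimately show ?thesis by simp
qed

lemma rcosets_sub: "subgroup H G \<Longrightarrow> U \<in> rcosets H \<Longrightarrow> U \<subseteq> carrier G"
  using rcosets_part_G[of H] by auto

lemma fold_coset_act:
  "U \<subseteq> carrier G \<Longrightarrow> w \<in> words X \<Longrightarrow> fold coset_act w U = U #> word_val w"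
proof (induction w arbitrary: U)
  case (Cons a w)
  have "U #> gen a \<subseteq> carrier G" using Cons.prems by (intro r_coset_subset_G) auto
  with Cons show ?case by (simp add: coset_act_def coset_mult_assoc)
qed (simp add: coset_mult_one)

text \<open>Topologically this is the finite cover of the presentation complex belonging to H:
  vertices are the cosets, and relators lift to closed paths.\<close>

lemma connected_complex_rcosets:
  assumes p: "prime p" and H: "finite_index_subgroup H G"
  shows "connected_complex p X coset_act (rcosets H) R"
proof -
  have sub: "subgroup H G" "finite (rcosets H)" using H by (auto simp: finite_index_subgroup_def)
  have Hc: "H \<subseteq> carrier G" using subgroup.subset[OF sub(1)] .
  have coset: "(H #> g) #> x = H #> (g \<otimes> x)" if "g \<in> carrier G" "x \<in> carrier G" for g x
    using Hc that by (simp add: coset_mult_assoc)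
  show ?thesis
  proof (unfold_locales)
    fix a :: "'x \<times> bool" and U assume a: "fst a \<in> X" and U: "U \<in> rcosets H"
    then obtain g where g: "g \<in> carrier G" "U = H #> g" by (auto simp: RCOSETS_def)
    show "coset_act a U \<in> rcosets H"
      using a g Hc by (auto simp: coset_act_def coset intro!: rcosetsI)
    show "coset_act (inv_letter a) (coset_act a U) = U"
      using a g gen_inv[OF a] by (simp add: coset_act_def coset m_assoc)
  next
    fix r U assume r: "r \<in> R" and U: "U \<in> rcosets H"
    then show "fold coset_act r U = U"
      using fold_coset_act[OF rcosets_sub[OF sub(1) U], of r] R_words rcosets_sub[OF sub(1) U]
      by (auto simp: word_val_relator coset_mult_one)
  next
    fix U U' assume "U \<in> rcosets H" "U' \<in> rcosets H"
    then obtain g g' where g: "g \<in> carrier G" "U = H #> g" "g' \<in> carrier G" "U' = H #> g'"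
      by (auto simp: RCOSETS_def)
    obtain w where w: "w \<in> words X" "word_val w = inv g \<otimes> g'" using word_val_surj g by (metis inv_closed m_closed)
    have "fold coset_act w U = U'"
      using g w Hc fold_coset_act[of U w] r_coset_subset_G[OF Hc g(1)]
      by (simp add: coset m_assoc[symmetric])
    with w show "\<exists>w\<in>words X. fold coset_act w U = U'" by blast
  qed (use p sub finite_X finite_R R_words in auto)
qed

end

lemma finitely_presented_imp_presented:
  assumes "group G" "finitely_presented G"
  obtains X :: "nat set" and R \<pi> where "presented_group G X R \<pi>"
proof -
  from assms(2) obtain X :: "nat set" and R where XR: "finite X" "finite R" "R \<subseteq> carrier (free_group X)"
    and iso: "G \<cong> free_group X Mod normal_closure (free_group X) R"
    unfolding finitely_presented_def by blast
  interpret G: group G by fact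
  interpret F: group "free_group X" by (rule group_free_group)
  let ?N = "normal_closure (free_group X) R"
  have "?N = \<Inter>{N. N \<lhd> free_group X \<and> R \<subseteq> N}" by (simp add: normal_closure_def)
  have carr_normal: "carrier (free_group X) \<lhd> free_group X"
    by (rule F.normal_invI[OF F.subgroup_self]) (intro F.m_closed F.inv_closed; assumption)
  have N: "?N \<lhd> free_group X"
  proof (rule F.normal_invI)
    show "subgroup ?N (free_group X)"
      unfolding normal_closure_def
      by (rule F.subgroups_Inter) (use carr_normal XR(3) in \<open>auto simp: normal_def\<close>)
    show "x \<otimes>\<^bsub>free_group X\<^esub> h \<otimes>\<^bsub>free_group X\<^esub> inv\<^bsub>free_group X\<^esub> x \<in> ?N"
      if "x \<in> carrier (free_group X)" "h \<in> ?N" for x h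
      unfolding normal_closure_def
    proof (rule InterI)
      fix M assume M: "M \<in> {N. N \<lhd> free_group X \<and> R \<subseteq> N}"
      then have "h \<in> M" using that(2) unfolding normal_closure_def by blast
      with M that(1) show "x \<otimes>\<^bsub>free_group X\<^esub> h \<otimes>\<^bsub>free_group X\<^esub> inv\<^bsub>free_group X\<^esub> x \<in> M"
        using normal.inv_op_closed2[of M "free_group X" x h] by blast
    qed
  qed
  interpret N: normal ?N "free_group X" by (rule N)
  have grp: "group (free_group X Mod ?N)" by (rule N.factorgroup_is_group)
  obtain \<phi> where \<phi>: "\<phi> \<in> iso (free_group X Mod ?N) G"
    using group.iso_sym[OF assms(1)] iso by (auto simp: is_iso_def)
  interpret \<phi>: group_hom "free_group X Mod ?N" G \<phi>
    using \<phi> grp assms(1) by (simp add: group_hom_def group_hom_axioms_def iso_def)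
  have bij: "bij_betw \<phi> (carrier (free_group X Mod ?N)) (carrier G)" using \<phi> by (simp add: iso_def)
  define \<pi> where "\<pi> w = \<phi> (?N #>\<^bsub>free_group X\<^esub> w)" for w
  have carr: "carrier (free_group X Mod ?N) = (\<lambda>w. ?N #>\<^bsub>free_group X\<^esub> w) ` carrier (free_group X)"
    by (auto simp: FactGroup_def RCOSETS_def)
  have "presented_group G X R \<pi>"
  proof
    show "\<pi> \<in> hom (free_group X) G"
    proof (rule homI)
      fix u v assume uv: "u \<in> carrier (free_group X)" "v \<in> carrier (free_group X)"
      have "?N #>\<^bsub>free_group X\<^esub> (u \<otimes>\<^bsub>free_group X\<^esub> v) =
          (?N #>\<^bsub>free_group X\<^esub> u) \<otimes>\<^bsub>free_group X Mod ?N\<^esub> (?N #>\<^bsub>free_group X\<^esub> v)"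
        using N.rcos_sum[OF uv] unfolding FactGroup_def by simp
      then show "\<pi> (u \<otimes>\<^bsub>free_group X\<^esub> v) = \<pi> u \<otimes>\<^bsub>G\<^esub> \<pi> v"
        unfolding \<pi>_def using \<phi>.hom_mult[of "?N #>\<^bsub>free_group X\<^esub> u" "?N #>\<^bsub>free_group X\<^esub> v"] uv
        unfolding carr by simp
    next
      fix w assume "w \<in> carrier (free_group X)"
      then have "?N #>\<^bsub>free_group X\<^esub> w \<in> carrier (free_group X Mod ?N)" unfolding carr by (rule imageI)
      then show "\<pi> w \<in> carrier G" unfolding \<pi>_def by (rule \<phi>.hom_closed)
    qed
    show "\<pi> ` carrier (free_group X) = carrier G"
      using bij_betw_imp_surj_on[OF bij] unfolding carr \<pi>_def image_image .
    fix w assume w: "w \<in> carrier (free_group X)"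
    have one: "\<one>\<^bsub>free_group X Mod ?N\<^esub> = ?N" by (simp add: FactGroup_def)
    have "\<phi> ?N = \<one>\<^bsub>G\<^esub>" using \<phi>.hom_one unfolding one .
    moreover have "?N \<in> carrier (free_group X Mod ?N)" using \<phi>.G.one_closed unfolding one .
    moreover have "?N #>\<^bsub>free_group X\<^esub> w \<in> carrier (free_group X Mod ?N)" using w unfolding carr by blast
    ultimately have "\<pi> w = \<one>\<^bsub>G\<^esub> \<longleftrightarrow> ?N #>\<^bsub>free_group X\<^esub> w = ?N"
      unfolding \<pi>_def using inj_onD[OF bij_betw_imp_inj_on[OF bij]] by metis
    also have "\<dots> \<longleftrightarrow> w \<in> ?N"
      using F.coset_join1[OF _ w N.subgroup_axioms] F.coset_join2[OF w N.subgroup_axioms] by blast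
    finally show "\<pi> w = \<one>\<^bsub>G\<^esub> \<longleftrightarrow> w \<in> ?N" .
  qed (use XR in auto)
  then show ?thesis by (rule that)
qed

section \<open>Free quotients from two disjoint cocycles\<close>

lemma (in group) telescope:
  assumes "x \<in> carrier G" "y \<in> carrier G" "z \<in> carrier G"
  shows "(inv x \<otimes> y) \<otimes> (inv y \<otimes> z) = inv x \<otimes> z"
proof -
  have "y \<otimes> (inv y \<otimes> z) = z" using assms by (simp add: m_assoc[symmetric])
  then show ?thesis using assms by (simp add: m_assoc)
qed

lemma generate_free_group:
  "generate (free_group X) ((\<lambda>x. [(x, True)]) ` X) = carrier (free_group X)" (is "generate ?F ?S = _")
proof
  interpret F: group ?F by (rule group_free_group)
  have S: "?S \<subseteq> carrier ?F" by (auto simp: carrier_free_group reduced_def)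
  then show "generate ?F ?S \<subseteq> carrier ?F" using F.generate_incl by blast
  show "carrier ?F \<subseteq> generate ?F ?S"
  proof
    fix w assume "w \<in> carrier ?F"
    then show "w \<in> generate ?F ?S"
    proof (induction w)
      case Nil
      then show ?case using generate.one[of ?F ?S] by simp
    next
      case (Cons a w)
      have w: "w \<in> carrier ?F" "fst a \<in> X" "push_letter a w = a # w"
        using Cons.prems reduced_Cons[of a w]
        by (cases w; simp add: carrier_free_group; simp add: reduced_def)+
      obtain x s where a: "a = (x, s)" by (cases a)
      have x: "[(x, True)] \<in> ?S" using w a by auto
      have "[a] \<in> generate ?F ?S"
      proof (cases s)
        case False
        have "[(x, True)] \<in> carrier ?F" using x S by blast
        then have "inv\<^bsub>?F\<^esub> [(x, True)] = [a]" by (simp add: inv_free_group a False inv_letter_def)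
        then show ?thesis using generate.inv[OF x, of ?F] by simp
      qed (use generate.incl[OF x, of ?F] a in simp)
      from generate.eng[OF this Cons.IH[OF w(1)]] show ?case using w(3) by simp
    qed
  qed
qed

context presented_group
begin

text \<open>Words act on pairs of a state and a label, multiplying the label on the right; the stabiliser of
  a state then maps to the group of labels.\<close>

lemma free_quotient_of_action:
  fixes \<sigma> :: "'x \<times> bool \<Rightarrow> 'w \<Rightarrow> 'w" and lab :: "'x \<times> bool \<Rightarrow> 'w \<Rightarrow> 'f" and F :: "('f, 'c) monoid_scheme"
  defines "ext \<equiv> \<lambda>a (\<omega>, y). (\<sigma> a \<omega>, y \<otimes>\<^bsub>F\<^esub> lab a \<omega>)"
  assumes F: "group F" and fin: "finite W" and base: "base \<in> W"
    and closed: "\<And>a \<omega>. fst a \<in> X \<Longrightarrow> \<omega> \<in> W \<Longrightarrow> \<sigma> a \<omega> \<in> W"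
    and lab_closed: "\<And>a \<omega>. fst a \<in> X \<Longrightarrow> \<omega> \<in> W \<Longrightarrow> lab a \<omega> \<in> carrier F"
    and inv: "\<And>a \<omega>. fst a \<in> X \<Longrightarrow> \<omega> \<in> W \<Longrightarrow> \<sigma> (inv_letter a) (\<sigma> a \<omega>) = \<omega>"
    and lab_inv: "\<And>a \<omega>. fst a \<in> X \<Longrightarrow> \<omega> \<in> W \<Longrightarrow> lab a \<omega> \<otimes>\<^bsub>F\<^esub> lab (inv_letter a) (\<sigma> a \<omega>) = \<one>\<^bsub>F\<^esub>"
    and rel: "\<And>r \<omega>. r \<in> R \<Longrightarrow> \<omega> \<in> W \<Longrightarrow> fold ext r (\<omega>, \<one>\<^bsub>F\<^esub>) = (\<omega>, \<one>\<^bsub>F\<^esub>)"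
    and gens: "generate F Y = carrier F"
      "\<And>y. y \<in> Y \<Longrightarrow> y \<in> carrier F \<and> (\<exists>w\<in>words X. fold ext w (base, \<one>\<^bsub>F\<^esub>) = (base, y))"
  shows "\<exists>K. finite_index_subgroup K G \<and> epi (G\<lparr>carrier := K\<rparr>) F \<noteq> {}"
proof -
  interpret F: group F by (rule F)
  let ?\<Omega> = "W \<times> carrier F"
  have ext_closed: "ext a v \<in> ?\<Omega>" if "fst a \<in> X" "v \<in> ?\<Omega>" for a v
    using that closed lab_closed by (cases v) (auto simp: ext_def)
  have ext_inv: "ext (inv_letter a) (ext a v) = v" if "fst a \<in> X" "v \<in> ?\<Omega>" for a v
  proof -
    from that(2) obtain \<omega> y where v: "v = (\<omega>, y)" "\<omega> \<in> W" "y \<in> carrier F" by auto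
    have "lab (inv_letter a) (\<sigma> a \<omega>) \<in> carrier F"
      using lab_closed[of "inv_letter a" "\<sigma> a \<omega>"] closed v that by simp
    then show ?thesis using v that inv[of a \<omega>] lab_inv[of a \<omega>] lab_closed[of a \<omega>]
      by (simp add: ext_def F.m_assoc)
  qed
  have fold_closed: "fold ext w v \<in> ?\<Omega>" if "w \<in> words X" "v \<in> ?\<Omega>" for w v
    using that
  proof (induction w arbitrary: v)
    case (Cons a w)
    then show ?case using ext_closed[of a v] by simp
  qed simp
  \<comment> \<open>Labels multiply on the right, so left multiplication commutes with every word.
    It is therefore enough that relators act trivially at the label one, and on the stabiliser of a
    state the label is multiplicative.\<close>
  have equi: "fold ext w (\<omega>, x \<otimes>\<^bsub>F\<^esub> y) =
      (fst (fold ext w (\<omega>, y)), x \<otimes>\<^bsub>F\<^esub> snd (fold ext w (\<omega>, y)))"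
    if "w \<in> words X" "\<omega> \<in> W" "x \<in> carrier F" "y \<in> carrier F" for w \<omega> x y
    using that
  proof (induction w arbitrary: \<omega> y)
    case (Cons a w)
    have "ext a (\<omega>, x \<otimes>\<^bsub>F\<^esub> y) = (\<sigma> a \<omega>, x \<otimes>\<^bsub>F\<^esub> (y \<otimes>\<^bsub>F\<^esub> lab a \<omega>))"
      using Cons.prems lab_closed[of a \<omega>] by (simp add: ext_def F.m_assoc)
    moreover have "ext a (\<omega>, y) = (\<sigma> a \<omega>, y \<otimes>\<^bsub>F\<^esub> lab a \<omega>)" by (simp add: ext_def)
    ultimately show ?case
      using Cons.IH[of "\<sigma> a \<omega>" "y \<otimes>\<^bsub>F\<^esub> lab a \<omega>"] Cons.prems closed[of a \<omega>] lab_closed[of a \<omega>] by simp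
  qed simp
  have rel': "fold ext r v = v" if "r \<in> R" "v \<in> ?\<Omega>" for r v
  proof -
    from that(2) obtain \<omega> y where v: "v = (\<omega>, y)" "\<omega> \<in> W" "y \<in> carrier F" by auto
    show ?thesis using equi[of r \<omega> y "\<one>\<^bsub>F\<^esub>"] rel[OF that(1) v(2)] v R_words that(1) by auto
  qed
  have triv: "fold ext w v = v" if "w \<in> words X" "word_val w = \<one>" "v \<in> ?\<Omega>" for w v
    by (rule trivial_word_acts_trivially[OF ext_closed ext_inv rel' that])
  have same: "fold ext u v = fold ext w v"
    if "u \<in> words X" "w \<in> words X" "word_val u = word_val w" "v \<in> ?\<Omega>" for u w v
  proof -
    have "fold ext (inv_word w @ w) v' = v'" if "v' \<in> ?\<Omega>" for v'
      using triv[of "inv_word w @ w"] \<open>w \<in> words X\<close> that by (simp add: word_val_append word_val_inv_word)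
    moreover have "fold ext (u @ inv_word w) v = v"
      using triv[of "u @ inv_word w"] that by (simp add: word_val_append word_val_inv_word)
    ultimately show ?thesis using fold_closed[of u v] that by (metis comp_apply fold_append)
  qed
  \<comment> \<open>Words with the same value act alike, so any chosen word may define the action of
    g.\<close>
  define wd where "wd g = (SOME w. w \<in> words X \<and> word_val w = g)" for g
  have wd: "wd g \<in> words X" "word_val (wd g) = g" if "g \<in> carrier G" for g
    using someI_ex[of "\<lambda>w. w \<in> words X \<and> word_val w = g"] word_val_surj[OF that]
    by (auto simp: wd_def)
  define \<beta> where "\<beta> g = fold ext (wd g)" for g
  have \<beta>_word: "fold ext w v = \<beta> (word_val w) v" if "w \<in> words X" "v \<in> ?\<Omega>" for w v
    unfolding \<beta>_def using same[of w "wd (word_val w)" v] wd[of "word_val w"] that by simp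
  have \<beta>_mult: "\<beta> (g \<otimes> h) v = \<beta> h (\<beta> g v)" if "g \<in> carrier G" "h \<in> carrier G" "v \<in> ?\<Omega>" for g h v
    using \<beta>_word[of "wd g @ wd h" v] wd[of g] wd[of h] that by (simp add: \<beta>_def word_val_append)
  have \<beta>_one: "\<beta> \<one> v = v" if "v \<in> ?\<Omega>" for v using \<beta>_word[of "[]" v] that by simp
  have \<beta>_inv: "\<beta> (inv g) (\<beta> g v) = v" if "g \<in> carrier G" "v \<in> ?\<Omega>" for g v
    using \<beta>_mult[of g "inv g" v] \<beta>_one that by simp
  have \<beta>_closed: "\<beta> g v \<in> ?\<Omega>" if "g \<in> carrier G" "v \<in> ?\<Omega>" for g v
    using fold_closed wd that by (simp add: \<beta>_def)
  have \<beta>_equi: "\<beta> g (\<omega>, x) = (fst (\<beta> g (\<omega>, \<one>\<^bsub>F\<^esub>)), x \<otimes>\<^bsub>F\<^esub> snd (\<beta> g (\<omega>, \<one>\<^bsub>F\<^esub>)))"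
    if "g \<in> carrier G" "\<omega> \<in> W" "x \<in> carrier F" for g \<omega> x
    using equi[of "wd g" \<omega> x "\<one>\<^bsub>F\<^esub>"] wd that by (simp add: \<beta>_def)
  let ?b = "(base, \<one>\<^bsub>F\<^esub>)"
  have b: "?b \<in> ?\<Omega>" using base by simp
  define st where "st g = fst (\<beta> g ?b)" for g
  define \<Phi> where "\<Phi> g = snd (\<beta> g ?b)" for g
  have \<beta>b: "\<beta> g ?b = (st g, \<Phi> g)" for g by (simp add: st_def \<Phi>_def)
  have st_closed: "st g \<in> W" "\<Phi> g \<in> carrier F" if "g \<in> carrier G" for g
    using \<beta>_closed[OF that b] by (simp_all add: \<beta>b)
  define K where "K = {g \<in> carrier G. st g = base}"
  have K_mult: "st (g \<otimes> h) = st h \<and> \<Phi> (g \<otimes> h) = \<Phi> g \<otimes>\<^bsub>F\<^esub> \<Phi> h" if "g \<in> K" "h \<in> carrier G" for g h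
  proof -
    have "\<beta> (g \<otimes> h) ?b = \<beta> h (base, \<Phi> g)" using \<beta>_mult[of g h ?b] that b \<beta>b[of g] by (simp add: K_def)
    also have "\<dots> = (st h, \<Phi> g \<otimes>\<^bsub>F\<^esub> \<Phi> h)"
      using \<beta>_equi[of h base "\<Phi> g"] that base st_closed(2)[of g] by (simp add: K_def \<beta>b)
    finally show ?thesis by (simp add: \<beta>b)
  qed
  have K_quot: "g \<otimes> inv h \<in> K" if "g \<in> carrier G" "h \<in> carrier G" "st g = st h" for g h
  proof -
    have "\<beta> (g \<otimes> inv h) ?b = \<beta> (inv h) (st h, \<Phi> g)"
      using \<beta>_mult[of g "inv h" ?b] that b by (simp add: \<beta>b)
    then have "st (g \<otimes> inv h) = fst (\<beta> (inv h) (st h, \<one>\<^bsub>F\<^esub>))"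
      using \<beta>_equi[of "inv h" "st h" "\<Phi> g"] that st_closed[of g] by (simp add: \<beta>b)
    also have "\<dots> = fst (\<beta> (inv h) (st h, \<Phi> h))"
      using \<beta>_equi[of "inv h" "st h" "\<Phi> h"] that st_closed[of h] by simp
    also have "\<dots> = base" using \<beta>_inv[of h ?b] that b by (simp add: \<beta>b)
    finally show ?thesis using that by (simp add: K_def)
  qed
  have one_K: "\<one> \<in> K" using \<beta>_one[OF b] by (simp add: K_def st_def)
  have sub: "subgroup K G"
  proof
    fix g assume "g \<in> K"
    then show "inv g \<in> K" using K_quot[of \<one> g] one_K by (simp add: K_def)
  qed (use K_mult one_K in \<open>auto simp: K_def\<close>)
  \<comment> \<open>A coset of the stabiliser is determined by the state to which it moves the base,
    so there are at most as many cosets as states.\<close>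
  have coset: "K #> g = K #> h" if "g \<in> carrier G" "h \<in> carrier G" "st g = st h" for g h
  proof -
    have "g = (g \<otimes> inv h) \<otimes> h" using that by (simp add: m_assoc)
    then have "g \<in> K #> h" using rcosI[OF K_quot[OF that] subgroup.subset[OF sub] that(2)] by simp
    then show ?thesis using repr_independence[OF _ that(2) sub] by simp
  qed
  have "rcosets K \<subseteq> (\<lambda>\<omega>. K #> (SOME g. g \<in> carrier G \<and> st g = \<omega>)) ` W"
  proof
    fix U assume "U \<in> rcosets K"
    then obtain g where g: "g \<in> carrier G" "U = K #> g" by (auto simp: RCOSETS_def)
    define h where "h = (SOME h. h \<in> carrier G \<and> st h = st g)"
    have "h \<in> carrier G \<and> st h = st g"
      unfolding h_def by (rule someI[of _ g]) (use g in simp)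
    then have "U = K #> h" using coset g by metis
    then show "U \<in> (\<lambda>\<omega>. K #> (SOME g. g \<in> carrier G \<and> st g = \<omega>)) ` W"
      unfolding h_def using st_closed(1)[OF g(1)] by blast
  qed
  then have "finite (rcosets K)" using fin finite_subset by blast
  then have fis: "finite_index_subgroup K G" using sub by (simp add: finite_index_subgroup_def)
  have hom: "\<Phi> \<in> hom (G\<lparr>carrier := K\<rparr>) F"
    using K_mult st_closed(2) by (auto simp: hom_def K_def)
  interpret \<Phi>: group_hom "G\<lparr>carrier := K\<rparr>" F \<Phi>
    using hom F subgroup.subgroup_is_group[OF sub is_group] by (simp add: group_hom_def group_hom_axioms_def)
  have "Y \<subseteq> \<Phi> ` K"
  proof
    fix y assume "y \<in> Y"
    then obtain w where w: "w \<in> words X" "fold ext w ?b = (base, y)" using gens(2) by blast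
    then have "st (word_val w) = base" "\<Phi> (word_val w) = y" using \<beta>_word[of w ?b] b by (simp_all add: \<beta>b)
    then show "y \<in> \<Phi> ` K" using w by (auto simp: K_def)
  qed
  moreover have "subgroup (\<Phi> ` K) F" using \<Phi>.img_is_subgroup by simp
  ultimately have "carrier F \<subseteq> \<Phi> ` K" using F.generate_subgroup_incl gens(1) by metis
  then have "\<Phi> \<in> epi (G\<lparr>carrier := K\<rparr>) F" using hom by (auto simp: epi_def hom_def)
  with fis show ?thesis by blast
qed

end

locale presented_complex =
  presented_group G X R \<pi> + C: connected_complex p X act V R
  for G :: "('a, 'b) monoid_scheme" (structure) and X :: "'x set" and R and \<pi>
    and p :: nat and act :: "'x \<times> bool \<Rightarrow> 'v \<Rightarrow> 'v" and V
begin

text \<open>Pass to the cover with group \<open>(\<int>/p)\<^sup>3\<close> given by two cocycles on one side of a cut and one on the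
  other, and label an edge that enters (leaves) the side \<open>B\<close> on sheet \<open>q\<close> by \<open>Y q\<close> (its inverse).  A relator
  that meets the cut runs through no edge on which a cocycle is non-zero, so it stays on one sheet and
  its label cancels.  Walks that change the sheet on one side, cross, and change it back on the other
  side realise both generators.\<close>

lemma free_quotient_of_cut:
  fixes y1 y2 :: 'y
  assumes A: "A \<subseteq> V" "A \<noteq> {}" "A \<noteq> V" and y12: "y1 \<noteq> y2"
    and large: "p ^ (card A + card (C.bd A)) < card (C.rel_cocycles A A)"
      "p ^ (card (V - A) + card (C.bd A)) < card (C.rel_cocycles A (V - A))"
  shows "\<exists>K. finite_index_subgroup K G \<and> epi (G\<lparr>carrier := K\<rparr>) (free_group {y1, y2}) \<noteq> {}"
proof -
  let ?F = "free_group {y1, y2}"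
  interpret F: group ?F by (rule group_free_group)
  have p1: "int p > 0" using C.p_pos by simp
  have "C.saturated A A" "C.saturated A (V - A)"
    using A C.boundary_compl[of A] by (auto simp: C.saturated_def)
  obtain S where S: "S \<subseteq> A" "S \<noteq> {}" "C.saturated A S" "C.walk_connected S"
    "p ^ Suc (card S) < card (C.rel_cocycles A S)"
    using C.connected_piece[OF \<open>C.saturated A A\<close> A(3) large(1)] by metis
  have "V - A \<noteq> V" using A by auto
  have large': "p ^ (card (V - A) + card (C.bd (V - A))) < card (C.rel_cocycles A (V - A))"
    using large(2) by (simp add: C.boundary_compl)
  obtain T where T: "T \<subseteq> V - A" "T \<noteq> {}" "C.saturated A T" "C.walk_connected T"
    "p ^ Suc (card T) < card (C.rel_cocycles A T)"
    using C.connected_piece[OF \<open>C.saturated A (V - A)\<close> \<open>V - A \<noteq> V\<close> large'] by metis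
  have SV: "S \<subseteq> V" and TV: "T \<subseteq> V" and disj: "S \<inter> T = {}" using S T A by auto
  \<comment> \<open>The component is formed relative to S itself, so its boundary lies in that of S
    and hence in that of A. From here on B, and not the complement of A, is the side whose boundary
    edges carry the labels.\<close>
  obtain B s a where B: "C.saturated S B" "T \<subseteq> B" "B \<inter> S = {}" "C.walk_connected B"
    and sa: "s \<in> S" "fst a \<in> X" "act a s \<in> B"
  proof -
    have "C.saturated S S" using SV by (simp add: C.saturated_def)
    from C.separating_component[OF this S(2) TV T(4) T(2) disj] show thesis using that by metis
  qed
  have BV: "B \<subseteq> V" and bdB: "C.bd B \<subseteq> C.bd A" using B(1) S(3) by (auto simp: C.saturated_def)
  have sV: "s \<in> V" using sa SV by auto
  define b where "b = act a s"
  have b: "b \<in> B" "b \<in> V" using sa BV by (auto simp: b_def)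
  obtain z1 z2 l1 l2 where z12: "z1 \<in> C.rel_cocycles A S" "z2 \<in> C.rel_cocycles A S"
    and l12: "C.loop_in S s l1" "C.loop_in S s l2"
    and val: "\<not> int p dvd psum act z1 s l1" "int p dvd psum act z2 s l1" "\<not> int p dvd psum act z2 s l2"
    using C.two_nontrivial_loops[OF SV S(4) sa(1) S(5)] by metis
  obtain t where t: "t \<in> T" using T by auto
  have "p ^ card T < card (C.rel_cocycles A T)"
    using T(5) power_increasing[of "card T" "Suc (card T)" p] C.p_pos by linarith
  moreover have "C.rel_cocycles A T \<subseteq> cochains p (C.inner T)" using C.rel_cocycles_cochains by blast
  ultimately obtain z3 l where z3: "z3 \<in> C.rel_cocycles A T" and l: "C.loop_in T t l" "\<not> int p dvd psum act z3 t l"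
    using C.nontrivial_loop[OF TV T(4) t] by metis
  \<comment> \<open>The loop found in T is carried to the entry point b by conjugating with a walk
    inside B; this does not change its sum.\<close>
  obtain l3 where l3: "C.loop_in B b l3" "\<not> int p dvd psum act z3 b l3"
  proof -
    obtain u where u: "u \<in> words X" "walk act B b u" "fold act u b = t"
      using B(2,4) b(1) t unfolding C.walk_connected_def by blast
    have "C.loop_in B b (u @ l @ inv_word u)"
      using u l(1) B(2) walk_mono[of act T t l B] C.walk_inv_word[OF u(1) b(2) u(2)] C.fold_inv_word[OF u(1) b(2)]
      by (simp add: C.loop_in_def walk_append)
    moreover have "psum act z3 b (u @ l @ inv_word u) = psum act z3 t l"
      using C.psum_inv_word[OF u(1) b(2), of z3] u(3) l(1) by (simp add: psum_append C.loop_in_def)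
    ultimately show ?thesis using that l(2) by metis
  qed
  \<comment> \<open>Sheets are triples of residues, written as functions on the natural numbers; the
    zero cochain for i \<ge> 3 keeps them inside \<open>Q\<close>.\<close>
  define zz where "zz i = (if i = 0 then z1 else if i = 1 then z2 else if i = 2 then z3 else (\<lambda>e. 0))" for i :: nat
  define nxt where "nxt a v q = (\<lambda>i. (q i + (if snd a then 1 else - 1) * zz i (edge_of act v a)) mod int p)"
    for a v q
  define \<sigma> where "\<sigma> a = (\<lambda>(v, q). (act a v, nxt a v q))" for a
  define q1 where "q1 = (\<lambda>i. psum act (zz i) s l1 mod int p)"
  define q2 where "q2 = (\<lambda>i. psum act (zz i) s l2 mod int p)"
  define Y where "Y q = (if q = q1 then [(y1, True)] else if q = q2 then [(y2, True)] else [])" for q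
  \<comment> \<open>On a fixed sheet the label is the coboundary of this potential, hence trivial
    along closed walks. Only a change of sheet between two crossings leaves a non-trivial
    product.\<close>
  define \<Psi> where "\<Psi> q v = (if v \<in> B then Y q else [])" for q v
  define lab where "lab a = (\<lambda>(v, q). inv\<^bsub>?F\<^esub> (\<Psi> q v) \<otimes>\<^bsub>?F\<^esub> \<Psi> q (act a v))" for a
  define Q where "Q = cochains p {..<3::nat}"
  define ext where "ext = (\<lambda>a (\<omega>, y). (\<sigma> a \<omega>, y \<otimes>\<^bsub>?F\<^esub> lab a \<omega>))"
  have inner: "e \<in> C.inner S \<or> e \<in> C.inner T" if "zz i e \<noteq> 0" for i e
    using that cochains_outside[OF C.rel_cocycles_cochains[OF z12(1)], of e]
      cochains_outside[OF C.rel_cocycles_cochains[OF z12(2)], of e]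
      cochains_outside[OF C.rel_cocycles_cochains[OF z3], of e] by (auto simp: zz_def split: if_splits)
  have crossing: "zz i e = 0" if "e \<in> C.crossing_edges A" for i e
    using that z12 z3 by (auto simp: zz_def C.rel_cocycles_def)
  \<comment> \<open>The cocycles are supported inside S, which avoids B, or inside T, which lies in
    B. So no edge changes both the sheet and the side.\<close>
  have side: "(v \<in> B) = (act a v \<in> B)" if "fst a \<in> X" "v \<in> V" "zz i (edge_of act v a) \<noteq> 0" for a v i
    using inner[OF that(3)] C.edge_of_inner[OF that(1,2)] B by blast
  have Yc: "Y q \<in> carrier ?F" for q by (auto simp: Y_def carrier_free_group reduced_def)
  have nil: "[] \<in> carrier ?F" using F.one_closed by simp
  have \<Psi>c: "\<Psi> q v \<in> carrier ?F" for q v using Yc nil by (simp add: \<Psi>_def)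
  have labc: "lab a \<omega> \<in> carrier ?F" for a \<omega>
    unfolding lab_def split_beta by (intro F.m_closed F.inv_closed \<Psi>c)
  have lab1: "lab a (v, q) = \<one>\<^bsub>?F\<^esub>" if "(v \<in> B) = (act a v \<in> B)" for a v q
  proof -
    have "\<Psi> q (act a v) = \<Psi> q v" using that by (simp add: \<Psi>_def)
    then show ?thesis unfolding lab_def by (simp only: prod.case F.l_inv[OF \<Psi>c])
  qed
  have nxtQ: "nxt a v q \<in> Q" if "q \<in> Q" for a v q
    unfolding Q_def
  proof (rule cochainsI)
    fix i :: nat assume "i \<notin> {..<3}"
    then show "nxt a v q i = 0" using cochains_outside[of q p "{..<3}" i] that by (simp add: nxt_def zz_def Q_def)
  qed (use p1 in \<open>simp add: nxt_def\<close>)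
  have q_mod: "q i mod int p = q i" if "q \<in> Q" for q i
    using cochains_range[of q p "{..<3}" i] that C.p_pos by (simp add: Q_def)
  have \<sigma>_fold: "fold \<sigma> w (v, q) = (fold act w v, \<lambda>i. (q i + psum act (zz i) v w) mod int p)"
    if "w \<in> words X" "v \<in> V" "q \<in> Q" for w v q
    using that
  proof (induction w arbitrary: v q)
    case (Cons a w)
    then show ?case using C.act_closed[of a v] nxtQ[of q a v]
      by (simp add: \<sigma>_def nxt_def mod_add_left_eq add.assoc del: edge_of.simps)
  qed (simp add: q_mod)
  have nxt_same: "nxt a v q = q" if "q \<in> Q" "\<And>i. zz i (edge_of act v a) = 0" for a v q
    using that q_mod[of q] by (simp add: nxt_def)
  have stay: "fold ext w ((v, q), y) = (fold \<sigma> w (v, q), y)"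
    if "walk act B v w \<or> walk act (- B) v w" "y \<in> carrier ?F" for w v q y
    using that
  proof (induction w arbitrary: v q)
    case (Cons a w)
    have "(v \<in> B) = (act a v \<in> B)" using Cons.prems walk_start[of act _ "act a v" w] by auto
    then have "ext a ((v, q), y) = (\<sigma> a (v, q), y)"
      using Cons.prems(2) unfolding ext_def by (simp only: prod.case lab1 F.r_one)
    moreover have "walk act B (act a v) w \<or> walk act (- B) (act a v) w" using Cons.prems by auto
    ultimately show ?case using Cons.IH Cons.prems(2) by (simp add: \<sigma>_def)
  qed simp
  \<comment> \<open>Away from the supports the sheet is constant and the labels telescope to a
    difference of potentials; this handles the relators that meet the cut.\<close>
  have vanish: "fold ext w ((v, q), y) =
      ((fold act w v, q), y \<otimes>\<^bsub>?F\<^esub> (inv\<^bsub>?F\<^esub> (\<Psi> q v) \<otimes>\<^bsub>?F\<^esub> \<Psi> q (fold act w v)))"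
    if "\<And>i e. e \<in> set (trail act v w) \<Longrightarrow> zz i e = 0" "w \<in> words X" "v \<in> V" "q \<in> Q" "y \<in> carrier ?F" for w v q y
    using that
  proof (induction w arbitrary: v y)
    case Nil
    then show ?case using \<Psi>c[of q v] by (simp only: fold_simps F.l_inv F.r_one)
  next
    case (Cons a w)
    let ?v = "act a v" and ?u = "fold act w (act a v)"
    have y: "y \<otimes>\<^bsub>?F\<^esub> lab a (v, q) \<in> carrier ?F" using Cons.prems(5) labc by (rule F.m_closed)
    have "ext a ((v, q), y) = ((?v, q), y \<otimes>\<^bsub>?F\<^esub> lab a (v, q))"
      using nxt_same[of q v a] Cons.prems by (simp add: ext_def \<sigma>_def del: free_group_simps)
    then have "fold ext (a # w) ((v, q), y) = ((?u, q), (y \<otimes>\<^bsub>?F\<^esub> lab a (v, q)) \<otimes>\<^bsub>?F\<^esub>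
        (inv\<^bsub>?F\<^esub> (\<Psi> q ?v) \<otimes>\<^bsub>?F\<^esub> \<Psi> q ?u))"
      using Cons.IH[OF _ _ _ Cons.prems(4) y, of ?v] Cons.prems C.act_closed[of a v] by (simp del: free_group_simps)
    also have "(y \<otimes>\<^bsub>?F\<^esub> lab a (v, q)) \<otimes>\<^bsub>?F\<^esub> (inv\<^bsub>?F\<^esub> (\<Psi> q ?v) \<otimes>\<^bsub>?F\<^esub> \<Psi> q ?u) =
        y \<otimes>\<^bsub>?F\<^esub> (inv\<^bsub>?F\<^esub> (\<Psi> q v) \<otimes>\<^bsub>?F\<^esub> \<Psi> q ?u)"
      unfolding F.m_assoc[OF Cons.prems(5) labc F.m_closed[OF F.inv_closed[OF \<Psi>c] \<Psi>c]]
      by (simp only: lab_def prod.case F.telescope[OF \<Psi>c \<Psi>c \<Psi>c])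
    finally show ?case by simp
  qed
  have ext_loop: "fold ext w ((u, q), y) = ((u, \<lambda>i. (q i + psum act (zz i) u w) mod int p), y)"
    if "C.loop_in U u w" "U \<subseteq> B \<or> U \<inter> B = {}" "u \<in> V" "q \<in> Q" "y \<in> carrier ?F" for U u w q y
  proof -
    have w: "w \<in> words X" "walk act U u w" "fold act w u = u" using that(1) by (auto simp: C.loop_in_def)
    have "walk act B u w \<or> walk act (- B) u w"
      using that(2) walk_mono[OF w(2), of B] walk_mono[OF w(2), of "- B"] by blast
    from stay[OF this that(5)] show ?thesis using \<sigma>_fold[OF w(1) that(3,4)] w(3) by simp
  qed
  have no_cross: "zz i (edge_of act s a) = 0" "zz i (edge_of act b (inv_letter a)) = 0" for i
  proof -
    have "s \<notin> B" using sa B by auto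
    then have "edge_of act s a \<in> C.bd B" using C.mem_boundary_edge_of[OF sa(2) sV] sa by blast
    then have "edge_of act s a \<in> C.crossing_edges A" using bdB by (auto simp: C.crossing_edges_def)
    then show "zz i (edge_of act s a) = 0" by (rule crossing)
    then show "zz i (edge_of act b (inv_letter a)) = 0"
      using C.edge_of_inv[OF sa(2) sV] by (simp add: b_def del: edge_of.simps)
  qed
  have sB: "s \<notin> B" using sa B by auto
  have inv_nil: "inv\<^bsub>?F\<^esub> [] = []" using inv_free_group[OF nil] by simp
  have go: "ext a ((s, q), y) = ((b, q), y \<otimes>\<^bsub>?F\<^esub> Y q)" if "q \<in> Q" for q y
    using nxt_same[OF that, of s a] no_cross sB b(1)
    by (simp add: ext_def \<sigma>_def lab_def \<Psi>_def b_def inv_nil)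
  have act_b: "act (inv_letter a) b = s" using C.act_inv[OF sa(2) sV] by (simp add: b_def)
  have return: "ext (inv_letter a) ((b, q), y) = ((s, q), y \<otimes>\<^bsub>?F\<^esub> inv\<^bsub>?F\<^esub> (Y q))"
    if "q \<in> Q" for q y
  proof -
    have "inv\<^bsub>?F\<^esub> (Y q) \<otimes>\<^bsub>?F\<^esub> [] = inv\<^bsub>?F\<^esub> (Y q)" using F.r_one[OF F.inv_closed[OF Yc]] by simp
    then show ?thesis using nxt_same[OF that, of b "inv_letter a"] no_cross sB b(1)
      by (simp add: ext_def \<sigma>_def lab_def \<Psi>_def act_b del: free_group_simps edge_of.simps)
  qed
  define M where "M i = psum act (zz i) b l3" for i
  have M2: "\<not> int p dvd M 2" using l3 by (simp add: M_def zz_def)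
  have P2: "psum act (zz 2) s w = 0" if "C.loop_in S s w" for w
  proof -
    have w: "w \<in> words X" "walk act S s w" using that by (auto simp: C.loop_in_def)
    have "psum act (zz 2) v u = 0" if "u \<in> words X" "v \<in> V" "walk act S v u" for v u
      using that
    proof (induction u arbitrary: v)
      case (Cons c u)
      then have "v \<in> S" "act c v \<in> S" using walk_start[of act S "act c v" u] by auto
      then have "edge_of act v c \<notin> C.inner T" using C.edge_of_inner[of c v T] Cons.prems disj by auto
      then have "zz 2 (edge_of act v c) = 0"
        using cochains_outside[OF C.rel_cocycles_cochains[OF z3]] by (simp add: zz_def del: edge_of.simps)
      with Cons show ?case using C.act_closed[of c v] by (simp del: edge_of.simps)
    qed simp
    with w sV show ?thesis by blast
  qed
  \<comment> \<open>The loop l moves from sheet 0 to the sheet of its sums, where the crossing picks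
    up the wanted label; \<open>l3\<close> then makes the third coordinate non-zero, so that the way
    back, the undoing of l and the second crossing are unlabelled. Undoing \<open>l3\<close> leads
    to sheet 0, from which the last return is unlabelled as well.\<close>
  define wg where "wg l = l @ [a] @ l3 @ [inv_letter a] @ inv_word l @ [a] @ inv_word l3 @ [inv_letter a]" for l
  have Q0: "(\<lambda>i. 0) \<in> Q" and Qm: "(\<lambda>i. f i mod int p) \<in> Q" if "\<And>i. i \<ge> 3 \<Longrightarrow> f i = 0" for f
    using that p1 unfolding Q_def by (intro cochainsI; simp)+
  have zz3: "zz i = (\<lambda>e. 0)" if "i \<ge> 3" for i using that by (auto simp: zz_def)
  \<comment> \<open>The third cocycle is zero inside S, so the two labelled sheets have third
    coordinate 0; they differ from sheet 0 in the first and second coordinate, respectively.\<close>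
  have Y_nil: "Y q = []" if "q 2 \<noteq> 0 \<or> q = (\<lambda>i. 0)" for q
  proof -
    have "q1 2 = 0" "q2 2 = 0" using P2 l12 by (simp_all add: q1_def q2_def)
    moreover have "q1 0 \<noteq> 0" "q2 1 \<noteq> 0" using val by (auto simp: q1_def q2_def zz_def)
    ultimately have "q \<noteq> q1" "q \<noteq> q2" using that by auto
    then show ?thesis by (simp add: Y_def)
  qed
  have main: "fold ext (wg l) ((s, \<lambda>i. 0), \<one>\<^bsub>?F\<^esub>) = ((s, \<lambda>i. 0), Y (\<lambda>i. psum act (zz i) s l mod int p))"
    if l: "C.loop_in S s l" for l
  proof -
    let ?P = "\<lambda>i. psum act (zz i) s l"
    let ?q = "\<lambda>i. ?P i mod int p"
    have lw: "l \<in> words X" "l3 \<in> words X" using l l3 by (auto simp: C.loop_in_def)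
    have l': "C.loop_in S s (inv_word l)" "C.loop_in B b (inv_word l3)"
      using l l3(1) C.walk_inv_word[OF lw(1) sV, of S] C.walk_inv_word[OF lw(2) b(2), of B]
        C.fold_inv_word[OF lw(1) sV] C.fold_inv_word[OF lw(2) b(2)] by (auto simp: C.loop_in_def)
    have P_inv: "psum act (zz i) s (inv_word l) = - ?P i" "psum act (zz i) b (inv_word l3) = - M i" for i
      using C.psum_inv_word[OF lw(1) sV, of "zz i"] C.psum_inv_word[OF lw(2) b(2), of "zz i"] l l3(1)
      by (simp_all add: C.loop_in_def M_def)
    have SB: "S \<subseteq> B \<or> S \<inter> B = {}" "B \<subseteq> B \<or> B \<inter> B = {}" using B by auto
    have QP: "?q \<in> Q" by (rule Qm) (simp add: zz3)
    have QPM: "(\<lambda>i. (?P i + M i) mod int p) \<in> Q" by (rule Qm) (simp add: zz3 M_def)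
    have QM: "(\<lambda>i. M i mod int p) \<in> Q" by (rule Qm) (simp add: zz3 M_def)
    have Q0': "(\<lambda>i. 0) \<in> Q" by (rule Q0) simp
    have "(\<lambda>i. (?P i + M i) mod int p) 2 \<noteq> 0" "(\<lambda>i. M i mod int p) 2 \<noteq> 0"
      using P2[OF l] M2 by auto
    then have YPM: "Y (\<lambda>i. (?P i + M i) mod int p) = []" and YM: "Y (\<lambda>i. M i mod int p) = []"
      by (auto intro!: Y_nil)
    have Y0: "Y (\<lambda>i. 0) = []" by (rule Y_nil) simp
    have Yq1: "y \<otimes>\<^bsub>?F\<^esub> [] = y" if "y \<in> carrier ?F" for y using F.r_one[OF that] by simp
    have "fold ext l ((s, \<lambda>i. 0), \<one>\<^bsub>?F\<^esub>) = ((s, ?q), \<one>\<^bsub>?F\<^esub>)"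
      using ext_loop[OF l SB(1) sV Q0' F.one_closed] by simp
    moreover have "ext a ((s, ?q), \<one>\<^bsub>?F\<^esub>) = ((b, ?q), Y ?q)"
      unfolding go[OF QP] F.l_one[OF Yc] by simp
    moreover have "fold ext l3 ((b, ?q), Y ?q) = ((b, \<lambda>i. (?P i + M i) mod int p), Y ?q)"
      using ext_loop[OF l3(1) SB(2) b(2) QP Yc[of ?q]] by (simp add: M_def mod_add_left_eq)
    moreover have "ext (inv_letter a) ((b, \<lambda>i. (?P i + M i) mod int p), Y ?q) =
        ((s, \<lambda>i. (?P i + M i) mod int p), Y ?q)"
      unfolding return[OF QPM] YPM inv_nil Yq1[OF Yc] by simp
    moreover have "fold ext (inv_word l) ((s, \<lambda>i. (?P i + M i) mod int p), Y ?q) =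
        ((s, \<lambda>i. M i mod int p), Y ?q)"
      using ext_loop[OF l'(1) SB(1) sV QPM Yc[of ?q]] unfolding P_inv by (simp add: mod_diff_left_eq)
    moreover have "ext a ((s, \<lambda>i. M i mod int p), Y ?q) = ((b, \<lambda>i. M i mod int p), Y ?q)"
      unfolding go[OF QM] YM Yq1[OF Yc] by simp
    moreover have "fold ext (inv_word l3) ((b, \<lambda>i. M i mod int p), Y ?q) = ((b, \<lambda>i. 0), Y ?q)"
      using ext_loop[OF l'(2) SB(2) b(2) QM Yc[of ?q]] unfolding P_inv by (simp add: mod_diff_left_eq)
    moreover have "ext (inv_letter a) ((b, \<lambda>i. 0), Y ?q) = ((s, \<lambda>i. 0), Y ?q)"
      unfolding return[OF Q0'] Y0 inv_nil Yq1[OF Yc] by simp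
    ultimately show ?thesis unfolding wg_def by simp
  qed
  have wgw: "wg l \<in> words X" if "C.loop_in S s l" for l
    using that l3 sa(2) by (simp add: wg_def C.loop_in_def)
  \<comment> \<open>The triangular choice of the loops separates the two labelled sheets, so the
    conditional in \<open>Y\<close> assigns a generator to each.\<close>
  have "q1 1 = 0" "q2 1 \<noteq> 0" using val by (auto simp: q1_def q2_def zz_def)
  then have "q1 \<noteq> q2" by auto
  then have Y12: "Y q1 = [(y1, True)]" "Y q2 = [(y2, True)]" by (simp_all add: Y_def)
  have gen: "generate ?F {[(y1, True)], [(y2, True)]} = carrier ?F"
    using generate_free_group[of "{y1, y2}"] by simp
  show ?thesis
  proof (rule free_quotient_of_action[where W = "V \<times> Q" and \<sigma> = \<sigma> and lab = lab and base = "(s, \<lambda>i. 0)", OF group_free_group _ _ _ _ _ _ _ gen])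
    show "finite (V \<times> Q)" using C.finite_V finite_cochains[of "{..<3::nat}" p] by (simp add: Q_def)
    show "(s, \<lambda>i. 0) \<in> V \<times> Q" using sV Q0[of "\<lambda>i. 0"] by simp
    show "\<sigma> a \<omega> \<in> V \<times> Q" if "fst a \<in> X" "\<omega> \<in> V \<times> Q" for a \<omega>
      using that C.act_closed[of a "fst \<omega>"] nxtQ[of "snd \<omega>" a "fst \<omega>"] by (simp add: \<sigma>_def split_beta mem_Times_iff)
    show "lab a \<omega> \<in> carrier ?F" for a \<omega> by (rule labc)
  next
    fix c :: "'x \<times> bool" and \<omega> assume c: "fst c \<in> X" and "\<omega> \<in> V \<times> Q"
    then obtain v q where v: "\<omega> = (v, q)" "v \<in> V" "q \<in> Q" by auto
    have ei: "edge_of act (act c v) (inv_letter c) = edge_of act v c" by (rule C.edge_of_inv[OF c v(2)])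
    have ai: "act (inv_letter c) (act c v) = v" by (rule C.act_inv[OF c v(2)])
    have "nxt (inv_letter c) (act c v) (nxt c v q) = q"
      unfolding nxt_def ei by (rule ext) (simp add: inv_letter_def mod_add_left_eq q_mod[OF v(3)] del: edge_of.simps)
    then show "\<sigma> (inv_letter c) (\<sigma> c \<omega>) = \<omega>" using ai by (simp add: \<sigma>_def v)
    show "lab c \<omega> \<otimes>\<^bsub>?F\<^esub> lab (inv_letter c) (\<sigma> c \<omega>) = \<one>\<^bsub>?F\<^esub>"
    proof (cases "\<forall>i. zz i (edge_of act v c) = 0")
      case True
      then have "\<sigma> c \<omega> = (act c v, q)" using nxt_same[OF v(3)] by (simp add: \<sigma>_def v del: edge_of.simps)
      then have "lab c \<omega> \<otimes>\<^bsub>?F\<^esub> lab (inv_letter c) (\<sigma> c \<omega>) =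
          (inv\<^bsub>?F\<^esub> (\<Psi> q v) \<otimes>\<^bsub>?F\<^esub> \<Psi> q (act c v)) \<otimes>\<^bsub>?F\<^esub> (inv\<^bsub>?F\<^esub> (\<Psi> q (act c v)) \<otimes>\<^bsub>?F\<^esub> \<Psi> q v)"
        by (simp add: lab_def v ai del: free_group_simps)
      also have "\<dots> = \<one>\<^bsub>?F\<^esub>"
        by (simp only: F.telescope[OF \<Psi>c \<Psi>c \<Psi>c] F.l_inv[OF \<Psi>c])
      finally show ?thesis .
    next
      case False
      then obtain i where "zz i (edge_of act v c) \<noteq> 0" by auto
      then have "(v \<in> B) = (act c v \<in> B)" by (rule side[OF c v(2)])
      then have "lab c \<omega> = \<one>\<^bsub>?F\<^esub>" "lab (inv_letter c) (\<sigma> c \<omega>) = \<one>\<^bsub>?F\<^esub>"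
        unfolding v \<sigma>_def prod.case by (auto intro!: lab1 simp: ai simp del: free_group_simps)
      then show ?thesis using F.r_one[OF F.one_closed] by simp
    qed
  next
    fix r \<omega> assume r: "r \<in> R" and "\<omega> \<in> V \<times> Q"
    then obtain v q where v: "\<omega> = (v, q)" "v \<in> V" "q \<in> Q" by auto
    have rw: "r \<in> words X" "fold act r v = v" using C.R_word[OF r] C.R_trivial[OF r v(2)] by auto
    have "fold ext r (\<omega>, \<one>\<^bsub>?F\<^esub>) = (\<omega>, \<one>\<^bsub>?F\<^esub>)"
    \<comment> \<open>A relator path that avoids the cut has sums divisible by p and returns to its
      sheet without labels; one that meets the cut runs over crossing edges only, where nothing
      changes the sheet.\<close>
    proof (cases "set (trail act v r) \<inter> C.bd B = {}")
      case True
      then have "walk act B v r \<or> walk act (- B) v r" using C.walk_or_walk_compl[OF rw(1) v(2)] by blast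
      moreover have "int p dvd psum act (zz i) v r" for i
        using C.rel_cocycles_psum[OF _ v(2) r] z12 z3 by (simp add: zz_def)
      then have "(q i + psum act (zz i) v r) mod int p = q i mod int p" for i by (simp add: mod_eq_dvd_iff)
      then have "(\<lambda>i. (q i + psum act (zz i) v r) mod int p) = q" by (simp only: q_mod[OF v(3)])
      ultimately show ?thesis
        using stay[of v r "\<one>\<^bsub>?F\<^esub>" q] \<sigma>_fold[OF rw(1) v(2,3)] rw(2) F.one_closed by (simp add: v del: free_group_simps)
    next
      case False
      then have "set (trail act v r) \<subseteq> C.crossing_edges A"
        using bdB r v(2) unfolding C.crossing_edges_def by blast
      then have "zz i e = 0" if "e \<in> set (trail act v r)" for i e using that crossing by blast
      from vanish[OF this rw(1) v(2,3) F.one_closed] rw(2) show ?thesis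
        using F.l_inv[OF \<Psi>c[of q v]] F.r_one[OF F.one_closed] by (simp add: v del: free_group_simps)
    qed
    then show "fold (\<lambda>a (\<omega>, y). (\<sigma> a \<omega>, y \<otimes>\<^bsub>?F\<^esub> lab a \<omega>)) r (\<omega>, \<one>\<^bsub>?F\<^esub>) = (\<omega>, \<one>\<^bsub>?F\<^esub>)"
      unfolding ext_def .
  next
    fix y assume "y \<in> {[(y1, True)], [(y2, True)]}"
    then consider "y = Y q1" | "y = Y q2" using Y12 by auto
    then have "\<exists>w\<in>words X. fold ext w ((s, \<lambda>i. 0), \<one>\<^bsub>?F\<^esub>) = ((s, \<lambda>i. 0), y)"
    proof cases
      case 1
      show ?thesis unfolding 1 q1_def by (rule bexI[where x = "wg l1"]) (rule main[OF l12(1)], rule wgw[OF l12(1)])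
    next
      case 2
      show ?thesis unfolding 2 q2_def by (rule bexI[where x = "wg l2"]) (rule main[OF l12(2)], rule wgw[OF l12(2)])
    qed
    moreover have "y \<in> carrier ?F" using \<open>y \<in> {[(y1, True)], [(y2, True)]}\<close> Yc Y12 by (metis insertE singletonD)
    ultimately show "y \<in> carrier ?F \<and> (\<exists>w\<in>words X. fold (\<lambda>a (\<omega>, y). (\<sigma> a \<omega>, y \<otimes>\<^bsub>?F\<^esub> lab a \<omega>)) w
        ((s, \<lambda>i. 0), \<one>\<^bsub>?F\<^esub>) = ((s, \<lambda>i. 0), y))"
      unfolding ext_def by simp
  qed
qed

end

section \<open>First homology and homomorphisms to the field with p elements\<close>

lemma (in module) submodule_imp_abelian_subgroup:
  assumes "submodule R N M"
  shows "abelian_subgroup N M"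
proof -
  interpret N: submodule R N M by fact
  have inv: "\<ominus>\<^bsub>M\<^esub> x \<in> N" if "x \<in> N" for x
  proof -
    have "\<ominus> \<one> \<odot>\<^bsub>M\<^esub> x \<in> N" using that by (intro N.smult_closed) auto
    moreover have "\<ominus> \<one> \<odot>\<^bsub>M\<^esub> x = \<ominus>\<^bsub>M\<^esub> x" using that N.subset by (intro smult_minus_1) auto
    ultimately show ?thesis by simp
  qed
  have "additive_subgroup N M"
    using N.subset inv by (intro additive_subgroup.intro subgroup.intro) (auto simp flip: a_inv_def)
  then show ?thesis by (intro abelian_subgroupI3 M.abelian_group_axioms)
qed

locale group_over_field = K: field K + H: group H
  for K :: "('r, 'c) ring_scheme" (structure) and H :: "('a, 'b) monoid_scheme"
begin

abbreviation "C n \<equiv> bar_chains K H n"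
abbreviation "B1 \<equiv> bar_boundary K H ` carrier (C (Suc 1))"
abbreviation "V \<equiv> group_homology K H 1"

section \<open>One-chains and the classes of group elements\<close>

definition single :: "'a list \<Rightarrow> 'a list \<Rightarrow> 'r" where
  "single l = (\<lambda>l'. if l' = l then \<one> else \<zero>)"

definition cls :: "'a \<Rightarrow> ('a list \<Rightarrow> 'r) set" where
  "cls g = B1 +>\<^bsub>C 1\<^esub> single [g]"

lemma C_simps [simp]:
  "c \<oplus>\<^bsub>C n\<^esub> d = (\<lambda>l. c l \<oplus> d l)" "a \<odot>\<^bsub>C n\<^esub> c = (\<lambda>l. a \<otimes> c l)" "\<zero>\<^bsub>C n\<^esub> = (\<lambda>l. \<zero>)"
  by (simp_all add: bar_chains_def)

lemma C_range: "c \<in> carrier (C n) \<Longrightarrow> c l \<in> carrier K"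
  and C_finite: "c \<in> carrier (C n) \<Longrightarrow> finite {l. c l \<noteq> \<zero>}"
  and C_support: "c \<in> carrier (C n) \<Longrightarrow> c l \<noteq> \<zero> \<Longrightarrow> length l = n \<and> set l \<subseteq> carrier H"
  by (auto simp: bar_chains_def)

lemma single_closed: "length l = n \<Longrightarrow> set l \<subseteq> carrier H \<Longrightarrow> single l \<in> carrier (C n)"
  by (auto simp: bar_chains_def single_def)

lemma chain_induct [consumes 1, case_names zero step]:
  assumes "c \<in> carrier (C n)" and zero: "P (\<lambda>l. \<zero>)"
    and step: "\<And>c a l. c \<in> carrier (C n) \<Longrightarrow> P c \<Longrightarrow> a \<in> carrier K \<Longrightarrow> length l = n \<Longrightarrow>
      set l \<subseteq> carrier H \<Longrightarrow> P (\<lambda>l'. c l' \<oplus> a \<otimes> single l l')"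
  shows "P c"
proof -
  have "P c" if "finite F" "{l. c l \<noteq> \<zero>} = F" "c \<in> carrier (C n)" for F c
    using that
  proof (induction F arbitrary: c)
    case empty
    then have "c = (\<lambda>l. \<zero>)" by auto
    then show ?case using zero by simp
  next
    case (insert l F)
    define c' where "c' = (\<lambda>l'. if l' = l then \<zero> else c l')"
    have supp: "{l. c' l \<noteq> \<zero>} = F" using insert by (auto simp: c'_def)
    have cR: "c l' \<in> carrier K" for l' using C_range[OF insert.prems(2)] .
    have c': "c' \<in> carrier (C n)"
      using supp insert.hyps(1) insert.prems(2) by (auto simp: bar_chains_def c'_def)
    have l: "length l = n \<and> set l \<subseteq> carrier H" using C_support[OF insert.prems(2), of l] insert.prems(1) by auto
    have "P (\<lambda>l'. c' l' \<oplus> c l \<otimes> single l l')"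
      using step[OF c' insert.IH[OF supp c'] cR] l by blast
    moreover have "(\<lambda>l'. c' l' \<oplus> c l \<otimes> single l l') = c"
      using cR by (auto simp: c'_def single_def)
    ultimately show ?case by simp
  qed
  from this[OF C_finite[OF assms(1)] refl assms(1)] show ?thesis .
qed

lemma boundary_single:
  assumes g: "g \<in> carrier H" and h: "h \<in> carrier H"
  shows "bar_boundary K H (single [g, h]) =
    (\<lambda>t. single [h] t \<oplus> (\<ominus> single [g \<otimes>\<^bsub>H\<^esub> h] t \<oplus> single [g] t))"
proof
  fix t
  have "{l. single [g, h] l \<noteq> \<zero> \<and> l \<noteq> []} = {[g, h]}" by (auto simp: single_def)
  then have "bar_boundary K H (single [g, h]) t =
      (\<Oplus>i\<in>{i. i \<le> 2 \<and> bar_face H i [g, h] = t}. if even i then \<one> else \<ominus> \<one>)"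
  proof -
    have "single [g, h] [g, h] = \<one>" by (simp add: single_def)
    then show ?thesis using \<open>{l. single [g, h] l \<noteq> \<zero> \<and> l \<noteq> []} = {[g, h]}\<close>
      unfolding bar_boundary_def by (simp add: numeral_2_eq_2 cong: if_cong)
  qed
  also have "\<dots> = (\<Oplus>i\<in>{0, 1, 2::nat}. if bar_face H i [g, h] = t then (if even i then \<one> else \<ominus> \<one>) else \<zero>)"
    by (rule K.add.finprod_mono_neutral_cong_left) auto
  also have "\<dots> = single [h] t \<oplus> (\<ominus> single [g \<otimes>\<^bsub>H\<^esub> h] t \<oplus> single [g] t)"
    by (auto simp: bar_face_def single_def numeral_2_eq_2)
  finally show "bar_boundary K H (single [g, h]) t =
      single [h] t \<oplus> (\<ominus> single [g \<otimes>\<^bsub>H\<^esub> h] t \<oplus> single [g] t)" .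
qed

lemma boundary_submodule: "submodule K B1 (C 1)"
proof -
  have "mod_hom K (C (Suc 1)) (C 1) (bar_boundary K H)"
    by (intro mod_hom.intro K.module_bar_chains mod_hom_axioms.intro K.bar_boundary_hom) simp
  then show ?thesis using mod_hom.im_is_submodule by (metis mod_hom.im_def)
qed

sublocale C1: module K "C 1" by (rule K.module_bar_chains)

sublocale V: vectorspace K V by (rule K.vectorspace_group_homology_1) (rule H.group_axioms)

lemma V_eq: "V = quotient_module (C 1) B1" by (rule K.group_homology_1)

lemma B1_subgroup: "abelian_subgroup B1 (C 1)"
  by (rule C1.submodule_imp_abelian_subgroup[OF boundary_submodule])

lemma carrier_V: "carrier V = (\<lambda>x. B1 +>\<^bsub>C 1\<^esub> x) ` carrier (C 1)"
  unfolding V_eq by (auto simp: quotient_module_def A_RCOSETS_def')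

lemma V_add:
  assumes "x \<in> carrier (C 1)" "y \<in> carrier (C 1)"
  shows "(B1 +>\<^bsub>C 1\<^esub> x) \<oplus>\<^bsub>V\<^esub> (B1 +>\<^bsub>C 1\<^esub> y) = B1 +>\<^bsub>C 1\<^esub> (x \<oplus>\<^bsub>C 1\<^esub> y)"
  using abelian_subgroup.a_rcos_sum[OF B1_subgroup assms] unfolding V_eq by (simp add: quotient_module_def)

lemma V_zero: "\<zero>\<^bsub>V\<^esub> = B1 +>\<^bsub>C 1\<^esub> \<zero>\<^bsub>C 1\<^esub>"
  unfolding V_eq using submodule.subset[OF boundary_submodule]
  by (simp only: quotient_module_def C1.M.a_coset_add_zero module.simps ring.simps)

lemma coset_eq: "u \<in> B1 +>\<^bsub>C 1\<^esub> x \<Longrightarrow> x \<in> carrier (C 1) \<Longrightarrow> B1 +>\<^bsub>C 1\<^esub> u = B1 +>\<^bsub>C 1\<^esub> x"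
  using C1.M.a_repr_independence[OF _ _ additive_subgroup.a_subgroup[OF abelian_subgroup.axioms(1)[OF B1_subgroup]]] by metis

lemma V_smult:
  assumes a: "a \<in> carrier K" and x: "x \<in> carrier (C 1)"
  shows "a \<odot>\<^bsub>V\<^esub> (B1 +>\<^bsub>C 1\<^esub> x) = B1 +>\<^bsub>C 1\<^esub> (a \<odot>\<^bsub>C 1\<^esub> x)"
proof -
  interpret N: submodule K B1 "C 1" by (rule boundary_submodule)
  have "B1 +>\<^bsub>C 1\<^esub> (a \<odot>\<^bsub>C 1\<^esub> u) = B1 +>\<^bsub>C 1\<^esub> (a \<odot>\<^bsub>C 1\<^esub> x)" if "u \<in> B1 +>\<^bsub>C 1\<^esub> x" for u
  proof -
    from that obtain h where h: "h \<in> B1" "u = h \<oplus>\<^bsub>C 1\<^esub> x" unfolding a_r_coset_def' by blast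
    then have "h \<in> carrier (C 1)" using N.subset by blast
    then have "a \<odot>\<^bsub>C 1\<^esub> u = (a \<odot>\<^bsub>C 1\<^esub> h) \<oplus>\<^bsub>C 1\<^esub> (a \<odot>\<^bsub>C 1\<^esub> x)"
      using C1.smult_r_distr[OF a] x h(2) by blast
    then have "a \<odot>\<^bsub>C 1\<^esub> u \<in> B1 +>\<^bsub>C 1\<^esub> (a \<odot>\<^bsub>C 1\<^esub> x)"
      using N.smult_closed[OF a h(1)] unfolding a_r_coset_def' by blast
    then show ?thesis using coset_eq C1.smult_closed[OF a x] by blast
  qed
  moreover have "x \<in> B1 +>\<^bsub>C 1\<^esub> x" using abelian_subgroup.a_rcos_self[OF B1_subgroup x] .
  ultimately have "(\<Union>u\<in>B1 +>\<^bsub>C 1\<^esub> x. B1 +>\<^bsub>C 1\<^esub> (a \<odot>\<^bsub>C 1\<^esub> u)) = B1 +>\<^bsub>C 1\<^esub> (a \<odot>\<^bsub>C 1\<^esub> x)"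
    by (intro SUP_eq_const) blast+
  then show ?thesis unfolding V_eq by (simp add: quotient_module_def del: C_simps)
qed

lemma cls_closed: "g \<in> carrier H \<Longrightarrow> cls g \<in> carrier V"
  unfolding carrier_V cls_def by (intro imageI single_closed) auto

text \<open>The boundary of [g|h] is [h] - [gh] + [g], so modulo boundaries the class map turns
  products into sums.\<close>

lemma cls_mult:
  assumes g: "g \<in> carrier H" and h: "h \<in> carrier H"
  shows "cls (g \<otimes>\<^bsub>H\<^esub> h) = cls g \<oplus>\<^bsub>V\<^esub> cls h"
proof -
  have gh: "single [g] \<in> carrier (C 1)" "single [h] \<in> carrier (C 1)" "single [g \<otimes>\<^bsub>H\<^esub> h] \<in> carrier (C 1)"
    using g h by (auto intro!: single_closed)
  have "bar_boundary K H (single [g, h]) \<in> B1" using g h by (intro imageI single_closed) auto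
  moreover have "(\<lambda>l. single [g] l \<oplus> single [h] l) =
      bar_boundary K H (single [g, h]) \<oplus>\<^bsub>C 1\<^esub> single [g \<otimes>\<^bsub>H\<^esub> h]"
  proof
    fix l
    have *: "single [g] l \<in> carrier K" "single [h] l \<in> carrier K" "single [g \<otimes>\<^bsub>H\<^esub> h] l \<in> carrier K"
      by (simp_all add: single_def)
    then have "single [h] l \<oplus> (\<ominus> single [g \<otimes>\<^bsub>H\<^esub> h] l \<oplus> single [g] l) \<oplus> single [g \<otimes>\<^bsub>H\<^esub> h] l =
        (single [g] l \<oplus> single [h] l) \<oplus> (\<ominus> single [g \<otimes>\<^bsub>H\<^esub> h] l \<oplus> single [g \<otimes>\<^bsub>H\<^esub> h] l)"
      by (simp add: K.a_ac)
    then show "single [g] l \<oplus> single [h] l =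
        (bar_boundary K H (single [g, h]) \<oplus>\<^bsub>C 1\<^esub> single [g \<otimes>\<^bsub>H\<^esub> h]) l"
      using * by (simp add: boundary_single[OF g h] K.l_neg)
  qed
  ultimately have "(single [g] \<oplus>\<^bsub>C 1\<^esub> single [h]) \<in> B1 +>\<^bsub>C 1\<^esub> single [g \<otimes>\<^bsub>H\<^esub> h]"
    unfolding a_r_coset_def' by auto
  from coset_eq[OF this gh(3)] show ?thesis using V_add[OF gh(1,2)] by (simp add: cls_def)
qed

lemma V_span_cls:
  assumes "S \<subseteq> carrier V" "cls ` carrier H \<subseteq> V.span S"
  shows "V.span S = carrier V"
proof
  have sub: "submodule K (V.span S) V" by (rule V.span_is_submodule[OF assms(1)])
  show "V.span S \<subseteq> carrier V" using submodule.subset[OF sub] .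
  have "B1 +>\<^bsub>C 1\<^esub> c \<in> V.span S" if "c \<in> carrier (C 1)" for c
    using that
  proof (induction rule: chain_induct)
    case zero
    have "\<zero>\<^bsub>V\<^esub> \<in> V.span S" using submodule.zero_closed[OF sub] by simp
    then show ?case using V_zero by simp
  next
    case (step c a l)
    then obtain g where g: "l = [g]" "g \<in> carrier H" by (auto simp: length_Suc_conv)
    have s: "single l \<in> carrier (C 1)" using step by (intro single_closed) auto
    have as: "a \<odot>\<^bsub>C 1\<^esub> single l \<in> carrier (C 1)" using C1.smult_closed[OF step.hyps(2) s] .
    have "a \<odot>\<^bsub>V\<^esub> cls g \<in> V.span S" using submodule.smult_closed[OF sub step.hyps(2)] assms(2) g(2) by blast
    then have "B1 +>\<^bsub>C 1\<^esub> (a \<odot>\<^bsub>C 1\<^esub> single l) \<in> V.span S"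
      using V_smult[OF step.hyps(2) s] g by (simp add: cls_def del: C_simps)
    then have "(B1 +>\<^bsub>C 1\<^esub> c) \<oplus>\<^bsub>V\<^esub> (B1 +>\<^bsub>C 1\<^esub> (a \<odot>\<^bsub>C 1\<^esub> single l)) \<in> V.span S"
      using submodule.m_closed[OF sub] step.IH by blast
    then show ?case unfolding V_add[OF step.hyps(1) as] by simp
  qed
  then show "carrier V \<subseteq> V.span S" unfolding carrier_V by blast
qed

section \<open>Pairing homomorphisms with first homology classes\<close>

definition chain_val :: "('a \<Rightarrow> 'r) \<Rightarrow> ('a list \<Rightarrow> 'r) \<Rightarrow> 'r" where
  "chain_val \<phi> c = (\<Oplus>l\<in>{l. c l \<noteq> \<zero>}. c l \<otimes> \<phi> (hd l))"

lemma hd_closed: "length l = 1 \<Longrightarrow> set l \<subseteq> carrier H \<Longrightarrow> \<phi> \<in> carrier H \<rightarrow> carrier K \<Longrightarrow> \<phi> (hd l) \<in> carrier K"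
  by (cases l) auto

lemma chain_val_superset:
  assumes \<phi>: "\<phi> \<in> carrier H \<rightarrow> carrier K" and c: "c \<in> carrier (C 1)" and F: "finite F" "{l. c l \<noteq> \<zero>} \<subseteq> F"
    "F \<subseteq> {l. length l = 1 \<and> set l \<subseteq> carrier H}"
  shows "chain_val \<phi> c = (\<Oplus>l\<in>F. c l \<otimes> \<phi> (hd l))"
proof -
  have hd: "\<phi> (hd l) \<in> carrier K" if "l \<in> F" for l
    using F(3) that \<phi> by (intro hd_closed) auto
  have cR: "c l \<in> carrier K" for l by (rule C_range[OF c])
  show ?thesis unfolding chain_val_def
  proof (rule K.add.finprod_mono_neutral_cong_left[OF F(1,2)])
    show "c i \<otimes> \<phi> (hd i) = \<zero>" if "i \<in> F - {l. c l \<noteq> \<zero>}" for i using hd[of i] that by simp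
    show "(\<lambda>l. c l \<otimes> \<phi> (hd l)) \<in> F \<rightarrow> carrier K" using hd cR by simp
  qed (rule refl)
qed

lemma chain_val_add:
  assumes \<phi>: "\<phi> \<in> carrier H \<rightarrow> carrier K" and c: "c \<in> carrier (C 1)" and d: "d \<in> carrier (C 1)"
  shows "chain_val \<phi> (\<lambda>l. c l \<oplus> d l) = chain_val \<phi> c \<oplus> chain_val \<phi> d"
proof -
  let ?F = "{l. c l \<noteq> \<zero>} \<union> {l. d l \<noteq> \<zero>}"
  have F: "finite ?F" "?F \<subseteq> {l. length l = 1 \<and> set l \<subseteq> carrier H}"
    using C_finite[OF c] C_finite[OF d] C_support[OF c] C_support[OF d] by (simp, blast)
  have cd: "(\<lambda>l. c l \<oplus> d l) \<in> carrier (C 1)" using C1.M.a_closed[OF c d] by simp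
  have hd: "\<phi> (hd l) \<in> carrier K" if "l \<in> ?F" for l
    using F(2) that \<phi> by (intro hd_closed) blast+
  have R: "c l \<in> carrier K" "d l \<in> carrier K" for l using C_range c d by auto
  have "chain_val \<phi> (\<lambda>l. c l \<oplus> d l) = (\<Oplus>l\<in>?F. (c l \<oplus> d l) \<otimes> \<phi> (hd l))"
    using F by (intro chain_val_superset \<phi> cd) auto
  also have "\<dots> = (\<Oplus>l\<in>?F. c l \<otimes> \<phi> (hd l) \<oplus> d l \<otimes> \<phi> (hd l))"
    using hd R by (intro K.add.finprod_cong') (auto simp: K.l_distr)
  also have "\<dots> = (\<Oplus>l\<in>?F. c l \<otimes> \<phi> (hd l)) \<oplus> (\<Oplus>l\<in>?F. d l \<otimes> \<phi> (hd l))"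
    using hd R by (intro K.finsum_addf) auto
  also have "\<dots> = chain_val \<phi> c \<oplus> chain_val \<phi> d"
    using chain_val_superset[OF \<phi> c F(1) _ F(2)] chain_val_superset[OF \<phi> d F(1) _ F(2)] by auto
  finally show ?thesis .
qed

lemma chain_val_smult_single:
  assumes \<phi>: "\<phi> \<in> carrier H \<rightarrow> carrier K" and a: "a \<in> carrier K" and g: "g \<in> carrier H"
  shows "chain_val \<phi> (\<lambda>l. a \<otimes> single [g] l) = a \<otimes> \<phi> g"
proof -
  have s: "single [g] \<in> carrier (C 1)" using g by (intro single_closed) auto
  have "(\<lambda>l. a \<otimes> single [g] l) \<in> carrier (C 1)" using C1.smult_closed[OF a s] by simp
  then have "chain_val \<phi> (\<lambda>l. a \<otimes> single [g] l) = (\<Oplus>l\<in>{[g]}. a \<otimes> single [g] l \<otimes> \<phi> (hd l))"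
    using g a by (intro chain_val_superset \<phi>) (auto simp: single_def)
  moreover have "\<phi> g \<in> carrier K" using \<phi> g by auto
  ultimately show ?thesis using a by (simp add: single_def)
qed

lemma chain_val_closed: "\<phi> \<in> carrier H \<rightarrow> carrier K \<Longrightarrow> c \<in> carrier (C 1) \<Longrightarrow> chain_val \<phi> c \<in> carrier K"
  unfolding chain_val_def
proof (rule K.finsum_closed, rule Pi_I)
  fix l assume \<phi>: "\<phi> \<in> carrier H \<rightarrow> carrier K" and c: "c \<in> carrier (C 1)" and "l \<in> {l. c l \<noteq> \<zero>}"
  then obtain g where "l = [g]" "g \<in> carrier H" using C_support[OF c, of l] by (auto simp: length_Suc_conv)
  then show "c l \<otimes> \<phi> (hd l) \<in> carrier K" using \<phi> C_range[OF c, of l] by auto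
qed

text \<open>On the boundary of [g|h] the linear extension takes the value \<phi>(h) - \<phi>(gh) +
  \<phi>(g), which is zero by additivity. Hence homomorphisms to the field are functionals on first
  homology.\<close>

lemma chain_val_boundary:
  assumes \<phi>: "\<phi> \<in> carrier H \<rightarrow> carrier K"
    and hom: "\<And>g h. g \<in> carrier H \<Longrightarrow> h \<in> carrier H \<Longrightarrow> \<phi> (g \<otimes>\<^bsub>H\<^esub> h) = \<phi> g \<oplus> \<phi> h"
    and c: "c \<in> carrier (C (Suc 1))"
  shows "chain_val \<phi> (bar_boundary K H c) = \<zero>"
  using c
proof (induction rule: chain_induct)
  case zero
  show ?case by (simp add: bar_boundary_def chain_val_def)
next
  case (step c a l)
  then obtain g h where l: "l = [g, h]" "g \<in> carrier H" "h \<in> carrier H" by (auto simp: length_Suc_conv)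
  have mult: "x \<otimes>\<^bsub>H\<^esub> y \<in> carrier H" if "x \<in> carrier H" "y \<in> carrier H" for x y using that by simp
  interpret C2: module K "C (Suc 1)" by (rule K.module_bar_chains)
  have s: "single l \<in> carrier (C (Suc 1))" using step by (intro single_closed) auto
  have as: "a \<odot>\<^bsub>C (Suc 1)\<^esub> single l \<in> carrier (C (Suc 1))" by (rule C2.smult_closed[OF step.hyps(2) s])
  have sg: "single [g] \<in> carrier (C 1)" "single [h] \<in> carrier (C 1)" "single [g \<otimes>\<^bsub>H\<^esub> h] \<in> carrier (C 1)"
    using l by (auto intro!: single_closed)
  have "bar_boundary K H (\<lambda>l'. c l' \<oplus> a \<otimes> single l l') =
      (\<lambda>t. bar_boundary K H c t \<oplus> a \<otimes> bar_boundary K H (single l) t)"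
    using K.bar_boundary_add[OF step.hyps(1) as] K.bar_boundary_smult[OF step.hyps(2) s] by auto
  also have "\<dots> = (\<lambda>t. bar_boundary K H c t \<oplus> (a \<otimes> single [h] t \<oplus>
      ((\<ominus> a) \<otimes> single [g \<otimes>\<^bsub>H\<^esub> h] t \<oplus> a \<otimes> single [g] t)))"
    using step.hyps(2) C_range[OF sg(1)] C_range[OF sg(2)] C_range[OF sg(3)]
    by (simp add: l boundary_single K.r_distr K.l_minus K.r_minus)
  finally have eq: "bar_boundary K H (\<lambda>l'. c l' \<oplus> a \<otimes> single l l') =
      (\<lambda>t. bar_boundary K H c t \<oplus> (a \<otimes> single [h] t \<oplus>
      ((\<ominus> a) \<otimes> single [g \<otimes>\<^bsub>H\<^esub> h] t \<oplus> a \<otimes> single [g] t)))" .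
  have "chain_val \<phi> (bar_boundary K H (\<lambda>l'. c l' \<oplus> a \<otimes> single l l')) = chain_val \<phi> (bar_boundary K H c) \<oplus>
      (a \<otimes> \<phi> h \<oplus> ((\<ominus> a) \<otimes> \<phi> (g \<otimes>\<^bsub>H\<^esub> h) \<oplus> a \<otimes> \<phi> g))"
  proof -
    have cl: "(\<lambda>t. x \<otimes> single [y] t) \<in> carrier (C 1)" if "x \<in> carrier K" "y \<in> carrier H" for x y
      using C1.smult_closed[OF that(1) single_closed[of "[y]" 1]] that(2) by simp
    have add: "(\<lambda>t. x t \<oplus> y t) \<in> carrier (C 1)" if "x \<in> carrier (C 1)" "y \<in> carrier (C 1)" for x y
      using C1.M.a_closed[OF that] by simp
    have bd: "bar_boundary K H c \<in> carrier (C 1)" by (rule K.bar_boundary_in_chains[OF mult step.hyps(1)])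
    note cl' = cl[OF step.hyps(2) l(3)] cl[OF step.hyps(2) l(2)]
      cl[OF K.a_inv_closed[OF step.hyps(2)] H.m_closed[OF l(2,3)]]
    show ?thesis
      unfolding eq using step.hyps(2) l
      by (simp add: chain_val_add[OF \<phi> bd add[OF cl'(1) add[OF cl'(3,2)]]] chain_val_add[OF \<phi> cl'(1) add[OF cl'(3,2)]]
          chain_val_add[OF \<phi> cl'(3,2)] chain_val_smult_single[OF \<phi>])
  qed
  also have "\<dots> = \<zero>"
  proof -
    have \<phi>R: "\<phi> g \<in> carrier K" "\<phi> h \<in> carrier K" using \<phi> l by auto
    then have aR: "a \<otimes> \<phi> g \<in> carrier K" "a \<otimes> \<phi> h \<in> carrier K" using step.hyps(2) by auto
    have *: "y \<oplus> (z \<oplus> x) = (x \<oplus> y) \<oplus> z"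
      if "x \<in> carrier K" "y \<in> carrier K" "z \<in> carrier K" for x y z
      using that by (simp add: K.a_ac)
    have "(\<ominus> a) \<otimes> \<phi> (g \<otimes>\<^bsub>H\<^esub> h) = \<ominus> (a \<otimes> \<phi> g \<oplus> a \<otimes> \<phi> h)"
      using step.hyps(2) \<phi>R l by (simp add: hom K.r_distr[symmetric] K.l_minus)
    then have "a \<otimes> \<phi> h \<oplus> ((\<ominus> a) \<otimes> \<phi> (g \<otimes>\<^bsub>H\<^esub> h) \<oplus> a \<otimes> \<phi> g) = \<zero>"
      using *[OF aR K.a_inv_closed[OF K.a_closed[OF aR]]] K.r_neg[OF K.a_closed[OF aR]] by simp
    then show ?thesis using step.IH by simp
  qed
  finally show ?case .
qed

context
  notes One_nat_def [simp del]
begin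

definition coset_val :: "('a \<Rightarrow> 'r) \<Rightarrow> ('a list \<Rightarrow> 'r) set \<Rightarrow> 'r" where
  "coset_val \<phi> U = chain_val \<phi> (SOME c. c \<in> carrier (C 1) \<and> B1 +>\<^bsub>C 1\<^esub> c = U)"

lemma coset_val_eq:
  assumes \<phi>: "\<phi> \<in> carrier H \<rightarrow> carrier K"
    and hom: "\<And>g h. g \<in> carrier H \<Longrightarrow> h \<in> carrier H \<Longrightarrow> \<phi> (g \<otimes>\<^bsub>H\<^esub> h) = \<phi> g \<oplus> \<phi> h"
    and c: "c \<in> carrier (C 1)"
  shows "coset_val \<phi> (B1 +>\<^bsub>C 1\<^esub> c) = chain_val \<phi> c"
proof -
  define d where "d = (SOME d. d \<in> carrier (C 1) \<and> B1 +>\<^bsub>C 1\<^esub> d = B1 +>\<^bsub>C 1\<^esub> c)"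
  have d: "d \<in> carrier (C 1) \<and> B1 +>\<^bsub>C 1\<^esub> d = B1 +>\<^bsub>C 1\<^esub> c"
    unfolding d_def by (rule someI[of _ c]) (use c in simp)
  then have "d \<in> B1 +>\<^bsub>C 1\<^esub> c" using abelian_subgroup.a_rcos_self[OF B1_subgroup, of d] by simp
  then obtain b where b: "b \<in> carrier (C (Suc 1))" "d = (\<lambda>l. bar_boundary K H b l \<oplus> c l)"
    unfolding a_r_coset_def' by auto
  have mult: "x \<otimes>\<^bsub>H\<^esub> y \<in> carrier H" if "x \<in> carrier H" "y \<in> carrier H" for x y using that by simp
  have "bar_boundary K H b \<in> carrier (C 1)" by (rule K.bar_boundary_in_chains[OF mult b(1)])
  then have "chain_val \<phi> d = chain_val \<phi> (bar_boundary K H b) \<oplus> chain_val \<phi> c"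
    unfolding b(2) by (rule chain_val_add[OF \<phi> _ c])
  then have "chain_val \<phi> d = \<zero> \<oplus> chain_val \<phi> c" using chain_val_boundary[OF \<phi> hom b(1)] by simp
  then show ?thesis unfolding coset_val_def d_def[symmetric] using chain_val_closed[OF \<phi> c] by simp
qed

text \<open>Applying the functional of b to a vanishing combination isolates the coefficient of the
  class of b. This is the device for bounding the homology from below.\<close>

lemma independent_classes:
  assumes fin: "V.fin_dim" and B: "B \<subseteq> carrier H" "finite B"
    and \<phi>: "\<And>b. b \<in> B \<Longrightarrow> \<phi> b \<in> carrier H \<rightarrow> carrier K"
    and hom: "\<And>b g h. b \<in> B \<Longrightarrow> g \<in> carrier H \<Longrightarrow> h \<in> carrier H \<Longrightarrow> \<phi> b (g \<otimes>\<^bsub>H\<^esub> h) = \<phi> b g \<oplus> \<phi> b h"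
    and dual: "\<And>b b'. b \<in> B \<Longrightarrow> b' \<in> B \<Longrightarrow> \<phi> b b' = (if b = b' then \<one> else \<zero>)"
  shows "card B \<le> V.dim"
proof -
  have val: "coset_val (\<phi> b) (cls b') = \<phi> b b'" if b: "b \<in> B" "b' \<in> B" for b b'
  proof -
    have b': "b' \<in> carrier H" using b B by auto
    moreover from this have "\<phi> b b' \<in> carrier K" using \<phi>[OF b(1)] by auto
    ultimately have "chain_val (\<phi> b) (single [b']) = \<phi> b b'"
      using chain_val_smult_single[OF \<phi>[OF b(1)] K.one_closed b'] \<phi>[OF b(1)] C_range[OF single_closed[of "[b']" 1]]
      by auto
    then show ?thesis
      using coset_val_eq[OF \<phi>[OF b(1)] hom[OF b(1)] single_closed[of "[b']" 1]] b' by (simp add: cls_def)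
  qed
  have inj: "inj_on cls B"
    using val dual by (intro inj_onI) (metis K.one_not_zero)
  have lin: "coset_val (\<phi> b) (V.lincomb a (cls ` A)) = (\<Oplus>b'\<in>A. a (cls b') \<otimes> \<phi> b b') \<and>
      V.lincomb a (cls ` A) \<in> carrier V"
    if "b \<in> B" "A \<subseteq> B" "a \<in> cls ` A \<rightarrow> carrier K" for A a b
  proof -
    have "finite A" using that(2) B(2) finite_subset by blast
    then show ?thesis using that
    proof (induction A)
      case empty
      have "coset_val (\<phi> b) \<zero>\<^bsub>V\<^esub> = chain_val (\<phi> b) \<zero>\<^bsub>C 1\<^esub>"
        unfolding V_zero by (rule coset_val_eq[OF \<phi>[OF empty(1)] hom[OF empty(1)] C1.M.zero_closed])
      then show ?case by (simp add: V.lincomb_def chain_val_def)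
    next
      case (insert x A)
      have xH: "x \<in> carrier H" "x \<in> B" and AH: "cls ` A \<subseteq> carrier V"
        using insert.prems B cls_closed by auto
      have ax: "a (cls x) \<in> carrier K" and aA: "a \<in> cls ` A \<rightarrow> carrier K" using insert.prems by auto
      have IH: "coset_val (\<phi> b) (V.lincomb a (cls ` A)) = (\<Oplus>b'\<in>A. a (cls b') \<otimes> \<phi> b b')"
        "V.lincomb a (cls ` A) \<in> carrier V"
        using insert.IH[OF insert.prems(1) _ aA] insert.prems(2) by auto
      have notin: "cls x \<notin> cls ` A" using inj insert.hyps insert.prems(2) by (auto dest: inj_onD)
      have ins: "V.lincomb a (cls ` insert x A) = a (cls x) \<odot>\<^bsub>V\<^esub> cls x \<oplus>\<^bsub>V\<^esub> V.lincomb a (cls ` A)"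
        using V.lincomb_insert[of "cls ` A" a "cls x"] insert.hyps(1) AH insert.prems(3) notin cls_closed[OF xH(1)]
        by simp
      obtain u where u: "u \<in> carrier (C 1)" "V.lincomb a (cls ` A) = B1 +>\<^bsub>C 1\<^esub> u"
        using IH(2) unfolding carrier_V by auto
      have sx: "single [x] \<in> carrier (C 1)" using xH by (intro single_closed) auto
      have ax': "a (cls x) \<odot>\<^bsub>C 1\<^esub> single [x] \<in> carrier (C 1)" by (rule C1.smult_closed[OF ax sx])
      have eq: "V.lincomb a (cls ` insert x A) = B1 +>\<^bsub>C 1\<^esub> (a (cls x) \<odot>\<^bsub>C 1\<^esub> single [x] \<oplus>\<^bsub>C 1\<^esub> u)"
        unfolding ins u(2) by (simp only: cls_def V_smult[OF ax sx, unfolded cls_def] V_add[OF ax' u(1), unfolded cls_def])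
      have "coset_val (\<phi> b) (V.lincomb a (cls ` insert x A)) =
          chain_val (\<phi> b) (a (cls x) \<odot>\<^bsub>C 1\<^esub> single [x] \<oplus>\<^bsub>C 1\<^esub> u)"
        unfolding eq by (rule coset_val_eq[OF \<phi> hom C1.M.a_closed[OF ax' u(1)]]) (use insert.prems in auto)
      also have "\<dots> = chain_val (\<phi> b) (a (cls x) \<odot>\<^bsub>C 1\<^esub> single [x]) \<oplus> chain_val (\<phi> b) u"
        using chain_val_add[OF \<phi> ax' u(1), of b] insert.prems(1) by simp
      also have "chain_val (\<phi> b) (a (cls x) \<odot>\<^bsub>C 1\<^esub> single [x]) = a (cls x) \<otimes> \<phi> b x"
        using chain_val_smult_single[OF \<phi> ax xH(1), of b] insert.prems(1) by simp
      also have "chain_val (\<phi> b) u = (\<Oplus>b'\<in>A. a (cls b') \<otimes> \<phi> b b')"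
        using coset_val_eq[OF \<phi> hom u(1), of b] IH(1) insert.prems(1) unfolding u(2) by simp
      also have "a (cls x) \<otimes> \<phi> b x \<oplus> (\<Oplus>b'\<in>A. a (cls b') \<otimes> \<phi> b b') =
          (\<Oplus>b'\<in>insert x A. a (cls b') \<otimes> \<phi> b b')"
      proof (rule K.finsum_insert[symmetric, OF insert.hyps])
        show "(\<lambda>b'. a (cls b') \<otimes> \<phi> b b') \<in> A \<rightarrow> carrier K"
        proof (rule Pi_I)
          fix b' assume "b' \<in> A"
          then show "a (cls b') \<otimes> \<phi> b b' \<in> carrier K"
            using \<phi>[OF insert.prems(1)] insert.prems(2) aA B(1) by (intro K.m_closed) auto
        qed
        show "a (cls x) \<otimes> \<phi> b x \<in> carrier K" using \<phi>[OF insert.prems(1)] xH ax by auto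
      qed
      finally show ?case unfolding eq carrier_V using C1.M.a_closed[OF ax' u(1)] by blast
    qed
  qed
  have "V.lin_indpt (cls ` B)"
  proof
    assume "V.lin_dep (cls ` B)"
    then obtain A' a v where A': "A' \<subseteq> cls ` B" "a \<in> A' \<rightarrow> carrier K" "V.lincomb a A' = \<zero>\<^bsub>V\<^esub>" "v \<in> A'" "a v \<noteq> \<zero>"
      unfolding V.lin_dep_def by blast
    then obtain A where A: "A \<subseteq> B" "A' = cls ` A" by (metis subset_imageE)
    then obtain b where b: "b \<in> A" "v = cls b" using A'(4) by auto
    have bB: "b \<in> B" using b A by auto
    have finA: "finite A" using A B finite_subset by blast
    have av: "a (cls b') \<in> carrier K" if "b' \<in> A" for b' using A' A that by auto
    have "coset_val (\<phi> b) \<zero>\<^bsub>V\<^esub> = (\<Oplus>b'\<in>A. a (cls b') \<otimes> \<phi> b b')"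
      using lin[OF bB A(1), of a] A' A by auto
    also have "\<dots> = (\<Oplus>b'\<in>A. if b = b' then a (cls b') else \<zero>)"
      using dual[OF bB] A(1) av by (intro K.add.finprod_cong') auto
    also have "\<dots> = a (cls b)"
      using K.add.finprod_singleton[OF b(1) finA, of "\<lambda>b'. a (cls b')"] av by auto
    finally have "coset_val (\<phi> b) \<zero>\<^bsub>V\<^esub> = a v" using b by simp
    moreover have "coset_val (\<phi> b) \<zero>\<^bsub>V\<^esub> = \<zero>"
      using lin[OF bB, of "{}" a] by (simp add: V.lincomb_def)
    ultimately show False using A'(5) by simp
  qed
  moreover have "cls ` B \<subseteq> carrier V" using B cls_closed by auto
  ultimately have "card (cls ` B) \<le> V.dim" using V.li_le_dim(2)[OF fin] by blast
  then show ?thesis using card_image[OF inj] by simp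
qed

text \<open>A basis can be selected among the classes of generators, so it consists of classes of
  group elements. Its coordinate functions, composed with the class map, are homomorphisms and form
  the dual family.\<close>

lemma dual_classes:
  assumes S: "finite S" "S \<subseteq> carrier H" "V.span (cls ` S) = carrier V"
  obtains B \<phi> where "B \<subseteq> carrier H" "finite B" "card B = V.dim"
    "\<And>b g. b \<in> B \<Longrightarrow> g \<in> carrier H \<Longrightarrow> \<phi> b g \<in> carrier K"
    "\<And>b g h. b \<in> B \<Longrightarrow> g \<in> carrier H \<Longrightarrow> h \<in> carrier H \<Longrightarrow> \<phi> b (g \<otimes>\<^bsub>H\<^esub> h) = \<phi> b g \<oplus> \<phi> b h"
    "\<And>b b'. b \<in> B \<Longrightarrow> b' \<in> B \<Longrightarrow> \<phi> b b' = (if b = b' then \<one> else \<zero>)"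
proof -
  have clsS: "cls ` S \<subseteq> carrier V" using S cls_closed by auto
  obtain T where T: "T \<subseteq> cls ` S" "minimal T (\<lambda>S. S \<subseteq> carrier V \<and> V.span S = carrier V)"
    using minimal_exists[of "cls ` S" "\<lambda>S. S \<subseteq> carrier V \<and> V.span S = carrier V"] S clsS by auto
  have basis: "V.basis T" by (rule V.min_gen_is_basis[OF T(2)])
  have finT: "finite T" by (rule finite_subset[OF T(1)]) (simp add: S)
  have TV: "T \<subseteq> carrier V" using T clsS by auto
  have ex1: "\<exists>!a. a \<in> T \<rightarrow>\<^sub>E carrier K \<and> V.lincomb a T = v" if "v \<in> carrier V" for v
    using V.basis_criterion[OF finT TV] basis that by blast
  define co where "co v = (THE a. a \<in> T \<rightarrow>\<^sub>E carrier K \<and> V.lincomb a T = v)" for v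
  have co: "co v \<in> T \<rightarrow>\<^sub>E carrier K" "V.lincomb (co v) T = v" if "v \<in> carrier V" for v
    using theI'[OF ex1[OF that]] by (simp_all add: co_def)
  have co_unique: "co v = a" if "v \<in> carrier V" "a \<in> T \<rightarrow>\<^sub>E carrier K" "V.lincomb a T = v" for v a
    using ex1[OF that(1)] co[OF that(1)] that by blast
  obtain B where B: "B \<subseteq> S" "inj_on cls B" "cls ` B = T" using T(1) by (metis subset_image_inj)
  define \<phi> where "\<phi> b g = co (cls g) (cls b)" for b g
  have BH: "B \<subseteq> carrier H" using B S by auto
  have clsT: "cls b \<in> T" if "b \<in> B" for b using B that by auto
  show ?thesis
  proof
    show "B \<subseteq> carrier H" by (rule BH)
    show "finite B" using B S finite_subset by auto
    show "card B = V.dim" using V.dim_basis[OF finT basis] card_image[OF B(2)] B(3) by simp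
    show "\<phi> b g \<in> carrier K" if "b \<in> B" "g \<in> carrier H" for b g
      using co(1)[OF cls_closed[OF that(2)]] clsT[OF that(1)] by (auto simp: \<phi>_def)
  next
    fix b g h assume b: "b \<in> B" and g: "g \<in> carrier H" and h: "h \<in> carrier H"
    note cg = co[OF cls_closed[OF g]] and ch = co[OF cls_closed[OF h]]
    define a where "a = restrict (\<lambda>t. co (cls g) t \<oplus> co (cls h) t) T"
    have a: "a \<in> T \<rightarrow>\<^sub>E carrier K" using cg(1) ch(1) by (auto simp: a_def PiE_iff)
    have in_T: "co (cls g) \<in> T \<rightarrow> carrier K" "co (cls h) \<in> T \<rightarrow> carrier K" using cg(1) ch(1) by auto
    have "V.lincomb a T = V.lincomb (\<lambda>t. co (cls g) t \<oplus> co (cls h) t) T"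
      unfolding V.lincomb_def
      by (rule V.M.add.finprod_cong') (use in_T TV in \<open>auto simp: a_def Pi_iff subset_iff\<close>)
    also have "\<dots> = V.lincomb (co (cls g)) T \<oplus>\<^bsub>V\<^esub> V.lincomb (co (cls h)) T"
      using V.lincomb_sum[OF finT TV in_T] by simp
    also have "\<dots> = cls (g \<otimes>\<^bsub>H\<^esub> h)" using cg(2) ch(2) cls_mult[OF g h] by simp
    finally have "co (cls (g \<otimes>\<^bsub>H\<^esub> h)) = a" using co_unique a cls_closed[OF H.m_closed[OF g h]] by blast
    then show "\<phi> b (g \<otimes>\<^bsub>H\<^esub> h) = \<phi> b g \<oplus> \<phi> b h" using clsT[OF b] by (simp add: \<phi>_def a_def)
  next
    fix b b' assume b: "b \<in> B" "b' \<in> B"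
    define a where "a = restrict (\<lambda>t. if t = cls b' then \<one> else \<zero>) T"
    have a: "a \<in> T \<rightarrow>\<^sub>E carrier K" by (auto simp: a_def)
    have v: "cls b' \<in> carrier V" using clsT[OF b(2)] TV by auto
    have "V.lincomb a T = (\<Oplus>\<^bsub>V\<^esub>t\<in>T. if cls b' = t then t else \<zero>\<^bsub>V\<^esub>)"
      unfolding V.lincomb_def
      by (rule V.M.add.finprod_cong') (use TV in \<open>auto simp: a_def subset_iff\<close>)
    also have "\<dots> = cls b'"
      using V.M.add.finprod_singleton[OF clsT[OF b(2)] finT, of "\<lambda>t. t"] TV by auto
    finally have "co (cls b') = a" using co_unique a v by blast
    then show "\<phi> b b' = (if b = b' then \<one> else \<zero>)"
      using clsT b B(2) by (auto simp: \<phi>_def a_def dest: inj_onD)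
  qed
qed

lemma span_cls:
  assumes S: "S \<subseteq> carrier H"
    and gen: "\<And>h. h \<in> carrier H \<Longrightarrow> \<exists>w. set w \<subseteq> S \<and> h = foldr (\<otimes>\<^bsub>H\<^esub>) w \<one>\<^bsub>H\<^esub>"
  shows "V.span (cls ` S) = carrier V"
proof (rule V_span_cls)
  show clsS: "cls ` S \<subseteq> carrier V" using S cls_closed by auto
  have sub: "submodule K (V.span (cls ` S)) V" by (rule V.span_is_submodule[OF clsS])
  have one: "cls \<one>\<^bsub>H\<^esub> = \<zero>\<^bsub>V\<^esub>"
  proof -
    have "cls \<one>\<^bsub>H\<^esub> \<oplus>\<^bsub>V\<^esub> cls \<one>\<^bsub>H\<^esub> = cls \<one>\<^bsub>H\<^esub>"
      using cls_mult[OF H.one_closed H.one_closed] by simp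
    then show ?thesis using V.M.add.l_cancel_one[OF cls_closed[OF H.one_closed] cls_closed[OF H.one_closed]] by simp
  qed
  have "foldr (\<otimes>\<^bsub>H\<^esub>) w \<one>\<^bsub>H\<^esub> \<in> carrier H \<and> cls (foldr (\<otimes>\<^bsub>H\<^esub>) w \<one>\<^bsub>H\<^esub>) \<in> V.span (cls ` S)" if "set w \<subseteq> S" for w
    using that
  proof (induction w)
    case Nil
    show ?case using one submodule.zero_closed[OF sub] by simp
  next
    case (Cons s w)
    then have s: "s \<in> carrier H" "cls s \<in> V.span (cls ` S)" using S V.in_own_span[OF clsS] by auto
    with Cons show ?case using submodule.m_closed[OF sub] by (simp add: cls_mult)
  qed
  note span = this
  show "cls ` carrier H \<subseteq> V.span (cls ` S)"
  proof (rule image_subsetI)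
    fix h assume "h \<in> carrier H"
    then obtain w where "set w \<subseteq> S" "h = foldr (\<otimes>\<^bsub>H\<^esub>) w \<one>\<^bsub>H\<^esub>" using gen by blast
    then show "cls h \<in> V.span (cls ` S)" using span[of w] by simp
  qed
qed

end

end

section \<open>Dual families of integer-valued functions\<close>

lemma mod_p_rank_dual:
  assumes p: "prime p" and H: "group H" and S: "finite S" "S \<subseteq> carrier H"
    and gen: "\<And>h. h \<in> carrier H \<Longrightarrow> \<exists>w. set w \<subseteq> S \<and> h = foldr (\<otimes>\<^bsub>H\<^esub>) w \<one>\<^bsub>H\<^esub>"
  obtains B and \<phi> :: "'a \<Rightarrow> 'a \<Rightarrow> int" where "B \<subseteq> carrier H" "finite B" "card B = mod_p_rank p H"
    "\<And>b g h. b \<in> B \<Longrightarrow> g \<in> carrier H \<Longrightarrow> h \<in> carrier H \<Longrightarrow> \<phi> b (g \<otimes>\<^bsub>H\<^esub> h) = (\<phi> b g + \<phi> b h) mod int p"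
    "\<And>b b'. b \<in> B \<Longrightarrow> b' \<in> B \<Longrightarrow> \<phi> b b' = (if b = b' then 1 else 0)"
proof -
  interpret r: residues_prime p "residue_ring (int p)" by (intro residues_prime.intro p) simp
  interpret L: group_over_field "residue_ring (int p)" H
    by (intro group_over_field.intro r.is_field H)
  show thesis
  proof (rule L.dual_classes[OF S L.span_cls[OF S(2) gen]])
    fix B \<phi>
    assume B: "B \<subseteq> carrier H" "finite B" "card B = L.V.dim"
      and hom: "\<And>b g h. b \<in> B \<Longrightarrow> g \<in> carrier H \<Longrightarrow> h \<in> carrier H \<Longrightarrow>
        \<phi> b (g \<otimes>\<^bsub>H\<^esub> h) = \<phi> b g \<oplus>\<^bsub>residue_ring (int p)\<^esub> \<phi> b h"
      and dual: "\<And>b b'. b \<in> B \<Longrightarrow> b' \<in> B \<Longrightarrow>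
        \<phi> b b' = (if b = b' then \<one>\<^bsub>residue_ring (int p)\<^esub> else \<zero>\<^bsub>residue_ring (int p)\<^esub>)"
    show thesis
    proof (rule that[OF B(1,2)])
      show "card B = mod_p_rank p H" using B(3) by (simp add: mod_p_rank_def)
      show "\<phi> b (g \<otimes>\<^bsub>H\<^esub> h) = (\<phi> b g + \<phi> b h) mod int p"
        if "b \<in> B" "g \<in> carrier H" "h \<in> carrier H" for b g h
        using hom[OF that] by (simp add: r.res_add_eq)
      show "\<phi> b b' = (if b = b' then 1 else 0)" if "b \<in> B" "b' \<in> B" for b b'
        using dual[OF that] by (simp add: r.res_one_eq r.res_zero_eq)
    qed
  qed
qed

text \<open>Integer-valued homomorphisms are reduced modulo p. Finite generation makes the homology
  finite-dimensional, without which the dimension would not bound the size of independent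
  sets.\<close>

lemma mod_p_rank_ge:
  fixes \<phi> :: "'a \<Rightarrow> 'a \<Rightarrow> int"
  assumes p: "prime p" and H: "group H" and S: "finite S" "S \<subseteq> carrier H"
    and gen: "\<And>h. h \<in> carrier H \<Longrightarrow> \<exists>w. set w \<subseteq> S \<and> h = foldr (\<otimes>\<^bsub>H\<^esub>) w \<one>\<^bsub>H\<^esub>"
    and B: "B \<subseteq> carrier H" "finite B"
    and hom: "\<And>b g h. b \<in> B \<Longrightarrow> g \<in> carrier H \<Longrightarrow> h \<in> carrier H \<Longrightarrow> \<phi> b (g \<otimes>\<^bsub>H\<^esub> h) = \<phi> b g + \<phi> b h"
    and dual: "\<And>b b'. b \<in> B \<Longrightarrow> b' \<in> B \<Longrightarrow> \<phi> b b' = (if b = b' then 1 else 0)"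
  shows "card B \<le> mod_p_rank p H"
proof -
  interpret r: residues_prime p "residue_ring (int p)" by (intro residues_prime.intro p) simp
  interpret L: group_over_field "residue_ring (int p)" H
    by (intro group_over_field.intro r.is_field H)
  have p1: "int p > 1" using prime_gt_1_nat[OF p] by simp
  have "L.cls ` S \<subseteq> carrier L.V" using S L.cls_closed by auto
  then have fin: "L.V.fin_dim"
    unfolding L.V.fin_dim_def using S(1) L.span_cls[OF S(2) gen] by blast
  have "card B \<le> L.V.dim"
  proof (rule L.independent_classes[OF fin B, of "\<lambda>b g. \<phi> b g mod int p"])
    fix b g h assume "b \<in> B" "g \<in> carrier H" "h \<in> carrier H"
    then show "\<phi> b (g \<otimes>\<^bsub>H\<^esub> h) mod int p = \<phi> b g mod int p \<oplus>\<^bsub>residue_ring (int p)\<^esub> \<phi> b h mod int p"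
      by (simp add: hom r.res_add_eq mod_add_eq)
  qed (use p1 dual in \<open>auto simp: r.res_carrier_eq r.res_one_eq r.res_zero_eq\<close>)
  then show ?thesis by (simp add: mod_p_rank_def)
qed

section \<open>Subgroups of prime power index\<close>

context group
begin

lemma rcos_eq_iff:
  assumes K: "subgroup K G" and a: "a \<in> carrier G" and b: "b \<in> carrier G"
  shows "K #> a = K #> b \<longleftrightarrow> a \<otimes> inv b \<in> K"
proof
  assume "K #> a = K #> b"
  then have "a \<in> K #> b" using rcos_self[OF a K] by simp
  then obtain k where "k \<in> K" "a = k \<otimes> b" by (auto simp: r_coset_def)
  moreover from this have "k \<in> carrier G" using subgroup.subset[OF K] by auto
  ultimately show "a \<otimes> inv b \<in> K" using b by (simp add: m_assoc)
next
  assume k: "a \<otimes> inv b \<in> K"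
  have "a = (a \<otimes> inv b) \<otimes> b" using a b by (simp add: m_assoc)
  then have "a \<in> K #> b" using rcosI[OF k subgroup.subset[OF K] b] by simp
  then show "K #> a = K #> b" using repr_independence[OF _ b K] by simp
qed

text \<open>Writes the projection from cosets of H to cosets of L as multiplication of sets by L, a
  form that is independent of representatives. It is the covering map used throughout.\<close>

lemma set_mult_rcos_absorb:
  assumes L: "subgroup L G" and H: "H \<subseteq> L" "\<one> \<in> H" and g: "g \<in> carrier G"
  shows "L <#> (H #> g) = L #> g"
proof
  have sub: "L \<subseteq> carrier G" using subgroup.subset[OF L] .
  show "L <#> (H #> g) \<subseteq> L #> g"
  proof
    fix u assume "u \<in> L <#> (H #> g)"
    then obtain l h where lh: "l \<in> L" "h \<in> H" "u = l \<otimes> (h \<otimes> g)" by (auto simp: set_mult_def r_coset_def)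
    then have "u = (l \<otimes> h) \<otimes> g" using sub H g by (metis m_assoc subsetD)
    moreover have "l \<otimes> h \<in> L" using lh H L by (auto intro: subgroup.m_closed)
    ultimately show "u \<in> L #> g" by (auto simp: r_coset_def)
  qed
  show "L #> g \<subseteq> L <#> (H #> g)"
  proof
    fix u assume "u \<in> L #> g"
    then obtain l where l: "l \<in> L" "u = l \<otimes> g" by (auto simp: r_coset_def)
    have "\<one> \<otimes> g \<in> H #> g" using H(2) unfolding r_coset_def by blast
    then have "g \<in> H #> g" using g by simp
    with l show "u \<in> L <#> (H #> g)" unfolding set_mult_def by blast
  qed
qed

lemma finite_index_supergroup:
  assumes H: "finite_index_subgroup H G" and K: "subgroup K G" "H \<subseteq> K"
  shows "finite_index_subgroup K G"
proof -
  have H': "subgroup H G" "finite (rcosets H)" using H by (auto simp: finite_index_subgroup_def)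
  have "rcosets K \<subseteq> (\<lambda>U. K <#> U) ` (rcosets H)"
  proof
    fix U assume "U \<in> rcosets K"
    then obtain g where g: "g \<in> carrier G" "U = K #> g" by (auto simp: RCOSETS_def)
    then have "U = K <#> (H #> g)" using set_mult_rcos_absorb[OF K subgroup.one_closed[OF H'(1)] g(1)] by simp
    then show "U \<in> (\<lambda>U. K <#> U) ` (rcosets H)" using g(1) by (auto simp: RCOSETS_def)
  qed
  then have "finite (rcosets K)" by (rule finite_subset) (simp add: H'(2))
  then show ?thesis using K by (simp add: finite_index_subgroup_def)
qed

text \<open>A subgroup \<open>M\<close> of index \<open>p\<close> in a \<open>p\<close>-group acts on its \<open>p\<close> right cosets and fixes one of them, so
  all orbits are singletons and \<open>M\<close> is normal.\<close>

lemma prime_index_normal: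
  assumes p: "prime p" and fin: "finite (carrier G)" and M: "subgroup M G"
    and card: "card M = p ^ k" "card (rcosets M) = p"
  shows "M \<lhd> G"
proof (rule normal_invI[OF M])
  fix x m assume x: "x \<in> carrier G" and m: "m \<in> M"
  have MG: "M \<subseteq> carrier G" using subgroup.subset[OF M] .
  have finM: "finite M" using MG fin finite_subset by blast
  show "x \<otimes> m \<otimes> inv x \<in> M"
  proof (cases "x \<in> M")
    case True
    then show ?thesis using m M by (auto intro: subgroup.m_closed subgroup.m_inv_closed)
  next
    case False
    define f where "f m = M #> (x \<otimes> m)" for m
    define St where "St = {m \<in> M. f m = f \<one>}"
    have f_eq: "f a = f b \<longleftrightarrow> x \<otimes> (a \<otimes> inv b) \<otimes> inv x \<in> M" if "a \<in> M" "b \<in> M" for a b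
    proof -
      have "a \<in> carrier G" "b \<in> carrier G" using that MG by auto
      then have "f a = f b \<longleftrightarrow> x \<otimes> a \<otimes> inv (x \<otimes> b) \<in> M"
        unfolding f_def using x by (intro rcos_eq_iff M) auto
      also have "x \<otimes> a \<otimes> inv (x \<otimes> b) = x \<otimes> (a \<otimes> inv b) \<otimes> inv x"
        using x \<open>a \<in> carrier G\<close> \<open>b \<in> carrier G\<close> by (simp add: inv_mult_group m_assoc)
      finally show ?thesis .
    qed
    have fibre: "card {m \<in> M. f m = U} = card St" if "U \<in> f ` M" for U
    proof -
      from that obtain m0 where m0: "m0 \<in> M" "U = f m0" by auto
      have "bij_betw (\<lambda>s. s \<otimes> m0) St {m \<in> M. f m = U}"
      proof (rule bij_betwI[where g = "\<lambda>m. m \<otimes> inv m0"])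
        show "(\<lambda>s. s \<otimes> m0) \<in> St \<rightarrow> {m \<in> M. f m = U}"
        proof
          fix s assume s: "s \<in> St"
          then have sM: "s \<in> M" "s \<in> carrier G" using MG by (auto simp: St_def)
          have m0c: "m0 \<in> carrier G" using m0 MG by auto
          have "s \<otimes> m0 \<in> M" using sM m0 M by (auto intro: subgroup.m_closed)
          moreover have "(s \<otimes> m0) \<otimes> inv m0 = s \<otimes> inv \<one>" using sM m0c by (simp add: m_assoc)
          ultimately show "s \<otimes> m0 \<in> {m \<in> M. f m = U}"
            using f_eq[of "s \<otimes> m0" m0] f_eq[of s \<one>] s m0 sM subgroup.one_closed[OF M] by (simp add: St_def)
        qed
        show "(\<lambda>m. m \<otimes> inv m0) \<in> {m \<in> M. f m = U} \<rightarrow> St"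
        proof
          fix m assume m: "m \<in> {m \<in> M. f m = U}"
          have "m \<otimes> inv m0 \<in> M" using m m0 M by (auto intro: subgroup.m_closed subgroup.m_inv_closed)
          then show "m \<otimes> inv m0 \<in> St"
            using f_eq[of m m0] f_eq[of "m \<otimes> inv m0" \<one>] m m0 MG subgroup.one_closed[OF M] by (auto simp: St_def)
        qed
        show "s \<otimes> m0 \<otimes> inv m0 = s" if "s \<in> St" for s
        proof -
          have "s \<in> carrier G" "m0 \<in> carrier G" using that m0 MG by (auto simp: St_def)
          then show ?thesis by (simp add: m_assoc)
        qed
        show "m \<otimes> inv m0 \<otimes> m0 = m" if "m \<in> {m \<in> M. f m = U}" for m
        proof -
          have "m \<in> carrier G" "m0 \<in> carrier G" using that m0 MG by auto
          then show ?thesis by (simp add: m_assoc)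
        qed
      qed
      then show ?thesis by (rule bij_betw_same_card[symmetric])
    qed
    have "card M = (\<Sum>U\<in>f ` M. card {m \<in> M. f m = U})"
      using sum.group[OF finM finite_imageI[OF finM], of f f "\<lambda>_. 1 :: nat"] by simp
    also have "\<dots> = card (f ` M) * card St" using fibre by simp
    finally have "card (f ` M) dvd p ^ k" unfolding card(1) by (rule dvdI)
    then obtain i where i: "card (f ` M) = p ^ i" using p divides_primepow_nat by blast
    \<comment> \<open>The orbit of M x under right multiplication by M misses the fixed coset M,
      because x is not in M. So it has fewer than p points, and a power of p below p is 1.\<close>
    have fM: "f ` M \<subseteq> rcosets M - {M}"
    proof
      fix U assume "U \<in> f ` M"
      then obtain b where b: "b \<in> M" "U = f b" by auto
      have "x \<otimes> b \<in> carrier G" using b x MG by auto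
      moreover have "x \<otimes> b \<notin> M"
      proof
        assume "x \<otimes> b \<in> M"
        then have "x \<otimes> b \<otimes> inv b \<in> M" using b M by (auto intro: subgroup.m_closed subgroup.m_inv_closed)
        moreover have "x \<otimes> b \<otimes> inv b = x" using x b MG by (auto simp: m_assoc subset_iff)
        ultimately show False using False by simp
      qed
      ultimately show "U \<in> rcosets M - {M}"
        using rcosetsI[OF MG] rcos_self[OF _ M] unfolding b(2) f_def by blast
    qed
    have "card (rcosets M) > 0" using card(2) prime_gt_0_nat[OF p] by simp
    then have "finite (rcosets M)" by (rule card_ge_0_finite)
    moreover have "M \<in> rcosets M" using rcosetsI[OF MG one_closed] coset_mult_one[OF MG] by simp
    moreover from calculation have "f ` M \<subset> rcosets M" using fM by blast
    ultimately have "card (f ` M) < card (rcosets M)" by (intro psubset_card_mono)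
    then have lt: "p ^ i < p" unfolding i card(2) .
    have "i = 0"
    proof (rule ccontr)
      assume "i \<noteq> 0"
      then have "p ^ 1 \<le> p ^ i" using prime_gt_1_nat[OF p] by (intro power_increasing) auto
      with lt show False by simp
    qed
    then obtain U where "f ` M = {U}" using i card_1_singletonE by auto
    then have "f m = f \<one>" using m subgroup.one_closed[OF M] by blast
    then show ?thesis using f_eq[OF m subgroup.one_closed[OF M]] m MG by (simp add: subset_iff)
  qed
qed

text \<open>Sylow's theorem provides a subgroup of order p^k in the quotient of order p^(k+1);
  having index p it is normal, and dividing by it gives the homomorphism onto a group of order p.
  Its kernel lies one step closer to H.\<close>

lemma prime_power_quotient:
  assumes p: "prime p" and H: "H \<lhd> G" and card: "card (rcosets H) = p ^ Suc k"
  obtains Y :: "'a set set monoid" and \<chi> where "group Y" "Coset.order Y = p" "\<chi> \<in> hom G Y" "\<chi> ` carrier G = carrier Y"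
    "H \<subseteq> {g \<in> carrier G. \<chi> g = \<one>\<^bsub>Y\<^esub>}"
    "card ((\<lambda>g. H #> g) ` {g \<in> carrier G. \<chi> g = \<one>\<^bsub>Y\<^esub>}) = p ^ k"
proof -
  interpret H: normal H G by (rule H)
  let ?Q = "G Mod H"
  interpret Q: group ?Q by (rule H.factorgroup_is_group)
  have carrQ: "carrier ?Q = rcosets H" by (simp add: FactGroup_def)
  have p0: "p > 0" using p prime_gt_0_nat by blast
  have finQ: "finite (carrier ?Q)" using card p0 by (metis carrQ card.infinite power_not_zero less_irrefl)
  have "Coset.order ?Q = p ^ k * p" using card by (simp add: Coset.order_def carrQ mult.commute)
  from sylow_thm[OF p Q.group_axioms this finQ] obtain P where P: "subgroup P ?Q" "card P = p ^ k" by blast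
  have "card (rcosets\<^bsub>?Q\<^esub> P) * card P = Coset.order ?Q" by (rule Q.lagrange[OF P(1)])
  then have idx: "card (rcosets\<^bsub>?Q\<^esub> P) = p" using \<open>Coset.order ?Q = p ^ k * p\<close> P(2) p0 by simp
  have norm: "P \<lhd> ?Q" by (rule Q.prime_index_normal[OF p finQ P idx])
  interpret P: normal P ?Q by (rule norm)
  let ?Y = "?Q Mod P"
  interpret Y: group ?Y by (rule P.factorgroup_is_group)
  define \<chi> where "\<chi> g = P #>\<^bsub>?Q\<^esub> (H #> g)" for g
  have inQ: "H #> g \<in> carrier ?Q" if "g \<in> carrier G" for g using that H.subset by (simp add: carrQ rcosetsI)
  have ker: "\<chi> g = \<one>\<^bsub>?Y\<^esub> \<longleftrightarrow> H #> g \<in> P" if "g \<in> carrier G" for g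
    using Q.coset_join1[OF _ inQ[OF that] P(1)] Q.coset_join2[OF inQ[OF that] P(1)]
    by (auto simp: \<chi>_def FactGroup_def)
  show ?thesis
  proof (rule that[of ?Y \<chi>])
    show "group ?Y" by (rule Y.group_axioms)
    show "Coset.order ?Y = p" using idx by (simp add: Coset.order_def FactGroup_def)
    show "\<chi> \<in> hom G ?Y"
    proof (rule homI)
      fix a b assume ab: "a \<in> carrier G" "b \<in> carrier G"
      have "H #> (a \<otimes> b) = (H #> a) \<otimes>\<^bsub>?Q\<^esub> (H #> b)" using H.rcos_sum[OF ab] by (simp add: FactGroup_def)
      then show "\<chi> (a \<otimes> b) = \<chi> a \<otimes>\<^bsub>?Y\<^esub> \<chi> b"
        using P.rcos_sum[OF inQ[OF ab(1)] inQ[OF ab(2)]] by (simp add: \<chi>_def FactGroup_def)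
    next
      fix a assume "a \<in> carrier G"
      then show "\<chi> a \<in> carrier ?Y" using Q.rcosetsI[OF P.subset inQ] unfolding \<chi>_def by (simp add: FactGroup_def)
    qed
    show "\<chi> ` carrier G = carrier ?Y"
      unfolding \<chi>_def by (auto simp: FactGroup_def RCOSETS_def)
    show "H \<subseteq> {g \<in> carrier G. \<chi> g = \<one>\<^bsub>?Y\<^esub>}"
    proof
      fix h assume h: "h \<in> H"
      have "H #> h = \<one>\<^bsub>?Q\<^esub>" using coset_join2[OF _ H.subgroup_axioms h] h H.subset by (auto simp: FactGroup_def)
      then show "h \<in> {g \<in> carrier G. \<chi> g = \<one>\<^bsub>?Y\<^esub>}"
        using ker[of h] h H.subset subgroup.one_closed[OF P(1)] by auto
    qed
    have "(\<lambda>g. H #> g) ` {g \<in> carrier G. \<chi> g = \<one>\<^bsub>?Y\<^esub>} = P"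
    proof
      show "(\<lambda>g. H #> g) ` {g \<in> carrier G. \<chi> g = \<one>\<^bsub>?Y\<^esub>} \<subseteq> P" using ker by auto
      show "P \<subseteq> (\<lambda>g. H #> g) ` {g \<in> carrier G. \<chi> g = \<one>\<^bsub>?Y\<^esub>}"
      proof
        fix U assume U: "U \<in> P"
        then obtain g where "g \<in> carrier G" "U = H #> g" using P.subset by (auto simp: carrQ RCOSETS_def)
        with U ker show "U \<in> (\<lambda>g. H #> g) ` {g \<in> carrier G. \<chi> g = \<one>\<^bsub>?Y\<^esub>}" by auto
      qed
    qed
    then show "card ((\<lambda>g. H #> g) ` {g \<in> carrier G. \<chi> g = \<one>\<^bsub>?Y\<^esub>}) = p ^ k" using P(2) by simp
  qed
qed

end

context presented_group
begin

abbreviation "subgroup_bound p H \<equiv> linear_bound p X R coset_act (rcosets H)"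

text \<open>The cosets of the kernel cover the cosets of L cyclically with degree p. The deck
  transformation is left multiplication by an element t of L whose image generates Y; it permutes
  right cosets because t normalises K.\<close>

lemma subgroup_bound_kernel:
  assumes p: "prime p" and L: "finite_index_subgroup L G" and Y: "group Y" "Coset.order Y = p"
    and \<chi>: "\<chi> \<in> hom (G\<lparr>carrier := L\<rparr>) Y" "\<chi> ` L = carrier Y"
    and K: "K = {l \<in> L. \<chi> l = \<one>\<^bsub>Y\<^esub>}" "finite_index_subgroup K G"
    and bound: "subgroup_bound p L a b" "b \<ge> 0"
  shows "subgroup_bound p K a b"
proof -
  interpret Y: group Y by (rule Y)
  have Ls: "subgroup L G" and Ks: "subgroup K G" using L K by (auto simp: finite_index_subgroup_def)
  interpret \<chi>: group_hom "G\<lparr>carrier := L\<rparr>" Y \<chi>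
    using \<chi>(1) Y(1) subgroup.subgroup_is_group[OF Ls is_group] by (simp add: group_hom_def group_hom_axioms_def)
  have LG: "L \<subseteq> carrier G" using subgroup.subset[OF Ls] .
  have finY: "finite (carrier Y)" using Y(2) p prime_gt_0_nat unfolding Coset.order_def by (metis card_gt_0_iff)
  have p1: "p > 1" using p prime_gt_1_nat by blast
  have "card (carrier Y) \<noteq> 1" using Y(2) p1 by (simp add: Coset.order_def)
  then have "carrier Y \<noteq> {\<one>\<^bsub>Y\<^esub>}" by auto
  then obtain y where y: "y \<in> carrier Y" "y \<noteq> \<one>\<^bsub>Y\<^esub>" using Y.one_closed by blast
  have ordy: "Y.ord y = p"
    using Y.ord_dvd_group_order[OF y(1)] Y(2) p y Y.pow_eq_id[OF y(1), of 1]
    by (metis Y.nat_pow_eone dvd_refl prime_nat_iff)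
  have powy: "inj_on (\<lambda>k. y [^]\<^bsub>Y\<^esub> k) {..<p}"
    using inj_on_subset[OF Y.ord_inj[OF y(1), unfolded ordy], of "{..<p}"] by force
  have "(\<lambda>k. y [^]\<^bsub>Y\<^esub> k) ` {..<p} = carrier Y"
    using powy finY y(1) Y(2) by (intro card_subset_eq) (auto simp: card_image Coset.order_def)
  then have surjy: "\<exists>k<p. y [^]\<^bsub>Y\<^esub> k = z" if "z \<in> carrier Y" for z using that by (metis imageE lessThan_iff)
  obtain t where t: "t \<in> L" "\<chi> t = y" using y \<chi>(2) by (metis imageE)
  have tG: "t \<in> carrier G" using t LG by auto
  have powL: "t [^] k \<in> L" and \<chi>pow: "\<chi> (t [^] k) = y [^]\<^bsub>Y\<^esub> k" for k :: nat
  proof -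
    have "t [^]\<^bsub>G\<lparr>carrier := L\<rparr>\<^esub> k \<in> L" using \<chi>.G.nat_pow_closed[of t k] t by simp
    then show "t [^] k \<in> L" by (simp add: nat_pow_consistent[symmetric])
    show "\<chi> (t [^] k) = y [^]\<^bsub>Y\<^esub> k"
      using \<chi>.hom_nat_pow[of t k] t by (simp add: nat_pow_consistent[symmetric])
  qed
  have \<chi>mult: "\<chi> (l \<otimes> l') = \<chi> l \<otimes>\<^bsub>Y\<^esub> \<chi> l'" if "l \<in> L" "l' \<in> L" for l l'
    using \<chi>.hom_mult[of l l'] that by simp
  have \<chi>inv: "\<chi> (inv l) = inv\<^bsub>Y\<^esub> (\<chi> l)" if "l \<in> L" for l
    using \<chi>.hom_inv[of l] that m_inv_consistent[OF Ls] by simp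
  have \<chi>c: "\<chi> l \<in> carrier Y" if "l \<in> L" for l using \<chi>.hom_closed[of l] that by simp
  have Lm: "l \<otimes> l' \<in> L" and Li: "inv l \<in> L" if "l \<in> L" "l' \<in> L" for l l'
    using that Ls by (auto intro: subgroup.m_closed subgroup.m_inv_closed)
  interpret CK: connected_complex p X coset_act "rcosets K" R by (rule connected_complex_rcosets[OF p K(2)])
  interpret CL: connected_complex p X coset_act "rcosets L" R by (rule connected_complex_rcosets[OF p L])
  have KL: "K \<subseteq> L" using K by auto
  have KG: "K \<subseteq> carrier G" using KL LG by auto
  define \<tau> where "\<tau> U = t <# U" for U
  define \<pi>' where "\<pi>' U = L <#> U" for U
  have \<pi>: "\<pi>' (K #> g) = L #> g" if "g \<in> carrier G" for g
    unfolding \<pi>'_def by (rule set_mult_rcos_absorb[OF Ls KL subgroup.one_closed[OF Ks] that])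
  have conj: "t \<otimes> k \<otimes> inv t \<in> K" "inv t \<otimes> k \<otimes> t \<in> K" if "k \<in> K" for k
  proof -
    have k: "k \<in> L" "\<chi> k = \<one>\<^bsub>Y\<^esub>" using that K by auto
    have ti: "inv t \<in> L" using Li[OF t(1) t(1)] .
    show "t \<otimes> k \<otimes> inv t \<in> K" "inv t \<otimes> k \<otimes> t \<in> K"
      using k t ti y(1) by (simp_all add: K Lm \<chi>mult \<chi>inv)
  qed
  have \<tau>: "\<tau> (K #> g) = K #> (t \<otimes> g)" if g: "g \<in> carrier G" for g
  proof
    show "\<tau> (K #> g) \<subseteq> K #> (t \<otimes> g)"
    proof
      fix u assume "u \<in> \<tau> (K #> g)"
      then obtain k where k: "k \<in> K" "u = t \<otimes> (k \<otimes> g)" by (auto simp: \<tau>_def l_coset_def r_coset_def)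
      have kG: "k \<in> carrier G" using k KG by auto
      have "inv t \<otimes> (t \<otimes> g) = g" using tG g by (simp add: m_assoc[symmetric])
      then have "u = (t \<otimes> k \<otimes> inv t) \<otimes> (t \<otimes> g)" using k kG tG g by (simp add: m_assoc)
      then show "u \<in> K #> (t \<otimes> g)" using conj(1)[OF k(1)] unfolding r_coset_def by blast
    qed
    show "K #> (t \<otimes> g) \<subseteq> \<tau> (K #> g)"
    proof
      fix u assume "u \<in> K #> (t \<otimes> g)"
      then obtain k where k: "k \<in> K" "u = k \<otimes> (t \<otimes> g)" by (auto simp: r_coset_def)
      have kG: "k \<in> carrier G" using k KG by auto
      have "t \<otimes> (inv t \<otimes> (k \<otimes> (t \<otimes> g))) = k \<otimes> (t \<otimes> g)"
        using kG tG g by (simp add: m_assoc[symmetric])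
      then have "u = t \<otimes> ((inv t \<otimes> k \<otimes> t) \<otimes> g)" using k kG tG g by (simp add: m_assoc)
      then show "u \<in> \<tau> (K #> g)" using conj(2)[OF k(1)] unfolding \<tau>_def l_coset_def r_coset_def by blast
    qed
  qed
  have \<tau>pow: "(\<tau> ^^ k) (K #> g) = K #> (t [^] k \<otimes> g)" if g: "g \<in> carrier G" for g k
  proof (induction k)
    case (Suc k)
    then show ?case using \<tau>[of "t [^] k \<otimes> g"] g tG by (simp add: m_assoc[symmetric] nat_pow_Suc2[symmetric] del: nat_pow_Suc)
  qed (use g in simp)
  \<comment> \<open>The cosets of K inside the coset L g correspond to the elements of Y, and left
    multiplication by t becomes multiplication by y. Period, freeness and transitivity on the fibres
    are read off from the powers of y.\<close>
  have eqK: "K #> (t [^] i \<otimes> g) = K #> (l \<otimes> g) \<longleftrightarrow> y [^]\<^bsub>Y\<^esub> i = \<chi> l"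
    if g: "g \<in> carrier G" and l: "l \<in> L" for i :: nat and g l
  proof -
    have lG: "l \<in> carrier G" "t [^] i \<in> carrier G" using l LG tG by auto
    have "K #> (t [^] i \<otimes> g) = K #> (l \<otimes> g) \<longleftrightarrow> t [^] i \<otimes> g \<otimes> inv (l \<otimes> g) \<in> K"
      using g lG by (intro rcos_eq_iff Ks) auto
    also have "t [^] i \<otimes> g \<otimes> inv (l \<otimes> g) = t [^] i \<otimes> inv l"
    proof -
      have "g \<otimes> (inv g \<otimes> inv l) = inv l" using g lG by (simp add: m_assoc[symmetric])
      then show ?thesis using g lG by (simp add: inv_mult_group m_assoc)
    qed
    also have "t [^] i \<otimes> inv l \<in> K \<longleftrightarrow> y [^]\<^bsub>Y\<^esub> i \<otimes>\<^bsub>Y\<^esub> inv\<^bsub>Y\<^esub> (\<chi> l) = \<one>\<^bsub>Y\<^esub>"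
      using powL[of i] l Li[OF l l] by (simp add: K Lm \<chi>mult \<chi>inv \<chi>pow)
    also have "\<dots> \<longleftrightarrow> y [^]\<^bsub>Y\<^esub> i = \<chi> l"
    proof
      assume *: "y [^]\<^bsub>Y\<^esub> i \<otimes>\<^bsub>Y\<^esub> inv\<^bsub>Y\<^esub> (\<chi> l) = \<one>\<^bsub>Y\<^esub>"
      have "y [^]\<^bsub>Y\<^esub> i = (y [^]\<^bsub>Y\<^esub> i \<otimes>\<^bsub>Y\<^esub> inv\<^bsub>Y\<^esub> (\<chi> l)) \<otimes>\<^bsub>Y\<^esub> \<chi> l"
        using y(1) \<chi>c[OF l] by (simp add: Y.m_assoc)
      then show "y [^]\<^bsub>Y\<^esub> i = \<chi> l" unfolding * using \<chi>c[OF l] by simp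
    qed (use \<chi>c[OF l] in simp)
    finally show ?thesis .
  qed
  have coset: "\<exists>g\<in>carrier G. U = K #> g" if "U \<in> rcosets K" for U using that by (auto simp: RCOSETS_def)
  have act: "coset_act a (K #> g) = K #> (g \<otimes> gen a)" "coset_act a (L #> g) = L #> (g \<otimes> gen a)"
    if "fst a \<in> X" "g \<in> carrier G" for a g
    using that KG LG by (simp_all add: coset_act_def coset_mult_assoc)
  interpret cyclic_cover p X coset_act "rcosets K" "rcosets L" R \<tau> \<pi>'
  proof
    fix U assume U: "U \<in> rcosets K"
    then obtain g where g: "g \<in> carrier G" "U = K #> g" using coset by blast
    show "\<tau> U \<in> rcosets K" using \<tau>[OF g(1)] g tG KG by (simp add: rcosetsI)
    show "\<pi>' (\<tau> U) = \<pi>' U"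
      using \<pi>[of "t \<otimes> g"] \<pi>[OF g(1)] g tG coset_join2[OF tG Ls t(1)] coset_mult_assoc[OF LG tG g(1)] by (simp add: \<tau>)
    show "(\<tau> ^^ p) U = U"
      using eqK[OF g(1) subgroup.one_closed[OF Ls], of p] \<tau>pow[OF g(1), of p] g Y.pow_ord_eq_1[OF y(1)]
        \<chi>.hom_one ordy by simp
    show "inj_on (\<lambda>k. (\<tau> ^^ k) U) {..<p}"
    proof (rule inj_onI)
      fix i j assume ij: "i \<in> {..<p}" "j \<in> {..<p}" "(\<tau> ^^ i) U = (\<tau> ^^ j) U"
      then have "y [^]\<^bsub>Y\<^esub> i = y [^]\<^bsub>Y\<^esub> j"
        using eqK[OF g(1) powL[of j], of i] \<tau>pow[OF g(1)] g by (simp add: \<chi>pow)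
      then show "i = j" using powy ij by (auto dest: inj_onD)
    qed
    show "coset_act a (\<tau> U) = \<tau> (coset_act a U)" if "fst a \<in> X" for a :: "'x \<times> bool"
      using that g tG by (simp add: \<tau> act m_assoc)
    show "\<pi>' (coset_act a U) = coset_act a (\<pi>' U)" if "fst a \<in> X" for a :: "'x \<times> bool"
      using that g by (simp add: \<pi> act)
    show "\<exists>k<p. U' = (\<tau> ^^ k) U" if U': "U' \<in> rcosets K" "\<pi>' U = \<pi>' U'" for U'
    proof -
      obtain g' where g': "g' \<in> carrier G" "U' = K #> g'" using U'(1) coset by blast
      have "L #> g' = L #> g" using U'(2) \<pi> g g' by simp
      then have l: "g' \<otimes> inv g \<in> L" using rcos_eq_iff[OF Ls g'(1) g(1)] by simp
      then obtain k where k: "k < p" "y [^]\<^bsub>Y\<^esub> k = \<chi> (g' \<otimes> inv g)" using surjy \<chi>c by blast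
      have "g' \<otimes> inv g \<otimes> g = g'" using g g' by (simp add: m_assoc)
      then have "K #> (t [^] k \<otimes> g) = K #> g'" using eqK[OF g(1) l, of k] k(2) by simp
      then show ?thesis using k(1) \<tau>pow[OF g(1)] g g' by auto
    qed
  next
    show "\<pi>' ` (rcosets K) = rcosets L"
    proof -
      have "rcosets K = (\<lambda>g. K #> g) ` carrier G" "rcosets L = (\<lambda>g. L #> g) ` carrier G"
        by (auto simp: RCOSETS_def)
      then show ?thesis using \<pi> by (simp add: image_image)
    qed
  qed
  show ?thesis by (rule linear_bound_lift[OF bound])
qed

text \<open>Descends from L to H through subgroups of index p: each kernel still contains H as a
  normal subgroup, with one factor p less in the index.\<close>

lemma subgroup_bound_prime_power:
  assumes p: "prime p" and b: "b \<ge> 0" and H: "finite_index_subgroup H G"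
    and L: "finite_index_subgroup L G" "H \<lhd> G\<lparr>carrier := L\<rparr>" "index (G\<lparr>carrier := L\<rparr>) H = p ^ k"
    and bound: "subgroup_bound p L a b"
  shows "subgroup_bound p H a b"
  using L bound
proof (induction k arbitrary: L)
  case 0
  have Ls: "subgroup L G" using 0 by (simp add: finite_index_subgroup_def)
  have Hs: "subgroup H G" using H by (simp add: finite_index_subgroup_def)
  interpret L: group "G\<lparr>carrier := L\<rparr>" by (rule subgroup.subgroup_is_group[OF Ls is_group])
  interpret HL: normal H "G\<lparr>carrier := L\<rparr>" by (rule 0(2))
  have HsL: "H \<subseteq> L" using HL.subset by simp
  have "card (rcosets\<^bsub>G\<lparr>carrier := L\<rparr>\<^esub> H) = 1" using 0(3) by (simp add: index_def)
  then obtain U where U: "rcosets\<^bsub>G\<lparr>carrier := L\<rparr>\<^esub> H = {U}" using card_1_singletonE by blast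
  have "L \<subseteq> H"
  proof
    fix l assume l: "l \<in> L"
    have "H #>\<^bsub>G\<lparr>carrier := L\<rparr>\<^esub> l \<in> {U}" "H #>\<^bsub>G\<lparr>carrier := L\<rparr>\<^esub> \<one> \<in> {U}"
      unfolding U[symmetric] using l subgroup.one_closed[OF Ls] by (auto simp: RCOSETS_def)
    then have "H #> l = H #> \<one>" by (simp add: r_coset_def)
    then show "l \<in> H" using rcos_eq_iff[OF Hs _ one_closed, of l] l subgroup.subset[OF Ls] by auto
  qed
  then show ?case using 0(4) HsL by (metis subset_antisym)
next
  case (Suc k)
  have Ls: "subgroup L G" using Suc.prems by (simp add: finite_index_subgroup_def)
  have Hs: "subgroup H G" using H by (simp add: finite_index_subgroup_def)
  interpret L: group "G\<lparr>carrier := L\<rparr>" by (rule subgroup.subgroup_is_group[OF Ls is_group])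
  have card: "card (rcosets\<^bsub>G\<lparr>carrier := L\<rparr>\<^esub> H) = p ^ Suc k" using Suc.prems(3) by (simp add: index_def)
  obtain Y :: "'a set set monoid" and \<chi> where Y: "group Y" "Coset.order Y = p" "\<chi> \<in> hom (G\<lparr>carrier := L\<rparr>) Y"
    "\<chi> ` L = carrier Y" "H \<subseteq> {g \<in> L. \<chi> g = \<one>\<^bsub>Y\<^esub>}"
    "card ((\<lambda>g. H #> g) ` {g \<in> L. \<chi> g = \<one>\<^bsub>Y\<^esub>}) = p ^ k"
    using L.prime_power_quotient[OF p Suc.prems(2) card] by (auto simp: r_coset_def)
  define K where "K = {g \<in> L. \<chi> g = \<one>\<^bsub>Y\<^esub>}"
  interpret \<chi>: group_hom "G\<lparr>carrier := L\<rparr>" Y \<chi>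
    using Y(1,3) L.group_axioms by (simp add: group_hom_def group_hom_axioms_def)
  have "subgroup K (G\<lparr>carrier := L\<rparr>)"
    using \<chi>.subgroup_kernel by (simp add: K_def kernel_def)
  then have Ks: "subgroup K G" using incl_subgroup[OF Ls] by simp
  have HK: "H \<subseteq> K" using Y(5) by (simp add: K_def)
  have Kfi: "finite_index_subgroup K G" by (rule finite_index_supergroup[OF H Ks HK])
  have Kbound: "subgroup_bound p K a b"
    by (rule subgroup_bound_kernel[OF p Suc.prems(1) Y(1,2,3,4) K_def Kfi Suc.prems(4) b])
  have "H \<lhd> G\<lparr>carrier := K\<rparr>"
  proof -
    interpret K: group "G\<lparr>carrier := K\<rparr>" by (rule subgroup.subgroup_is_group[OF Ks is_group])
    interpret HL: normal H "G\<lparr>carrier := L\<rparr>" by (rule Suc.prems(2))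
    show ?thesis
    proof (rule K.normal_invI)
      show "subgroup H (G\<lparr>carrier := K\<rparr>)" by (rule subgroup_incl[OF Hs Ks HK])
      fix x h assume x: "x \<in> carrier (G\<lparr>carrier := K\<rparr>)" and h: "h \<in> H"
      have xL: "x \<in> L" "x \<in> K" using x by (auto simp: K_def)
      have "x \<otimes>\<^bsub>G\<lparr>carrier := L\<rparr>\<^esub> h \<otimes>\<^bsub>G\<lparr>carrier := L\<rparr>\<^esub> inv\<^bsub>G\<lparr>carrier := L\<rparr>\<^esub> x \<in> H"
        using HL.inv_op_closed2[of x h] xL h by simp
      then show "x \<otimes>\<^bsub>G\<lparr>carrier := K\<rparr>\<^esub> h \<otimes>\<^bsub>G\<lparr>carrier := K\<rparr>\<^esub> inv\<^bsub>G\<lparr>carrier := K\<rparr>\<^esub> x \<in> H"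
        using m_inv_consistent[OF Ls xL(1)] m_inv_consistent[OF Ks xL(2)] by simp
    qed
  qed
  moreover have "index (G\<lparr>carrier := K\<rparr>) H = p ^ k"
  proof -
    have "rcosets\<^bsub>G\<lparr>carrier := K\<rparr>\<^esub> H = (\<lambda>g. H #> g) ` {g \<in> L. \<chi> g = \<one>\<^bsub>Y\<^esub>}"
      by (auto simp: RCOSETS_def K_def r_coset_def)
    then show ?thesis using Y(6) by (simp add: index_def)
  qed
  ultimately show ?case using Suc.IH[OF Kfi] Kbound by blast
qed

end

section \<open>Counting cocycles of a finite index subgroup\<close>

lemma (in group) telescope3:
  assumes "r \<in> carrier G" "g \<in> carrier G" "r' \<in> carrier G" "w \<in> carrier G" "r'' \<in> carrier G"
  shows "(r \<otimes> g \<otimes> inv r') \<otimes> (r' \<otimes> w \<otimes> inv r'') = r \<otimes> (g \<otimes> w) \<otimes> inv r''"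
proof -
  have "inv r' \<otimes> (r' \<otimes> (w \<otimes> inv r'')) = w \<otimes> inv r''" using assms by (simp add: m_assoc[symmetric])
  then show ?thesis using assms by (simp add: m_assoc)
qed

context presented_group
begin

text \<open>The subgroup itself is represented by one. Hence a word that evaluates to an element of
  H is rewritten to that very element and not to a conjugate.\<close>

definition rep :: "'a set \<Rightarrow> 'a set \<Rightarrow> 'a" where
  "rep H U = (if U = H then \<one> else SOME g. g \<in> U)"

definition schreier :: "'a set \<Rightarrow> 'a set \<Rightarrow> 'x \<times> bool \<Rightarrow> 'a" where
  "schreier H U a = rep H U \<otimes> gen a \<otimes> inv (rep H (coset_act a U))"

lemma rep:
  assumes H: "subgroup H G" and U: "U \<in> rcosets H"
  shows "rep H U \<in> carrier G" "U = H #> rep H U"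
proof -
  obtain g where g: "g \<in> carrier G" "U = H #> g" using U by (auto simp: RCOSETS_def)
  have "rep H U \<in> carrier G \<and> U = H #> rep H U"
  proof (cases "U = H")
    case True
    then show ?thesis using coset_mult_one[OF subgroup.subset[OF H]] by (simp add: rep_def)
  next
    case False
    have "g \<in> U" using rcos_self[OF g(1) H] g(2) by simp
    then have "rep H U \<in> U" using False by (auto simp: rep_def intro: someI)
    then show ?thesis
      using repr_independence[OF _ g(1) H, of "rep H U"] g(2) rcosets_sub[OF H U] by auto
  qed
  then show "rep H U \<in> carrier G" "U = H #> rep H U" by auto
qed

lemma coset_act_closed: "subgroup H G \<Longrightarrow> U \<in> rcosets H \<Longrightarrow> fst a \<in> X \<Longrightarrow> coset_act a U \<in> rcosets H"
  using subgroup.subset[of H G] by (auto simp: RCOSETS_def coset_act_def coset_mult_assoc)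

lemma fold_coset_closed: "subgroup H G \<Longrightarrow> w \<in> words X \<Longrightarrow> U \<in> rcosets H \<Longrightarrow> fold coset_act w U \<in> rcosets H"
proof (induction w arbitrary: U)
  case (Cons a w)
  then show ?case using coset_act_closed[of H U a] by simp
qed simp

lemma subgroup_in_rcosets: "subgroup H G \<Longrightarrow> H \<in> rcosets H"
  using rcosetsI[OF subgroup.subset one_closed, of H] coset_mult_one[OF subgroup.subset, of H] by simp

lemma schreier_closed:
  assumes H: "subgroup H G" and U: "U \<in> rcosets H" and a: "fst a \<in> X"
  shows "schreier H U a \<in> H"
proof -
  note r = rep[OF H U] and r' = rep[OF H coset_act_closed[OF H U a]]
  have "coset_act a U = H #> (rep H U \<otimes> gen a)"
    using r subgroup.subset[OF H] a coset_mult_assoc[of H "rep H U" "gen a"] by (simp add: coset_act_def)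
  then have "H #> (rep H U \<otimes> gen a) = H #> rep H (coset_act a U)" using r'(2) by simp
  moreover have "rep H U \<otimes> gen a \<in> carrier G" using r(1) a by simp
  ultimately show ?thesis using iffD1[OF rcos_eq_iff[OF H _ r'(1)]] unfolding schreier_def by blast
qed

lemma rep_word_closed:
  assumes H: "subgroup H G" and U: "U \<in> rcosets H" and w: "w \<in> words X"
  shows "rep H U \<otimes> word_val w \<otimes> inv (rep H (fold coset_act w U)) \<in> H"
proof -
  note r = rep[OF H U] and r' = rep[OF H fold_coset_closed[OF H w U]]
  have "fold coset_act w U = H #> (rep H U \<otimes> word_val w)"
    using fold_coset_act[OF rcosets_sub[OF H U] w] r subgroup.subset[OF H] w
      coset_mult_assoc[of H "rep H U" "word_val w"] by simp
  then have "H #> (rep H U \<otimes> word_val w) = H #> rep H (fold coset_act w U)" using r'(2) by simp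
  moreover have "rep H U \<otimes> word_val w \<in> carrier G" using r(1) w by simp
  ultimately show ?thesis using iffD1[OF rcos_eq_iff[OF H _ r'(1)]] by blast
qed

text \<open>One step of the Reidemeister-Schreier rewriting: inserting a representative and its
  inverse after the first letter splits off a Schreier generator.\<close>

lemma rep_word_Cons:
  assumes H: "subgroup H G" and U: "U \<in> rcosets H" and aw: "fst a \<in> X" "w \<in> words X"
  shows "rep H U \<otimes> word_val (a # w) \<otimes> inv (rep H (fold coset_act (a # w) U)) =
    schreier H U a \<otimes> (rep H (coset_act a U) \<otimes> word_val w \<otimes> inv (rep H (fold coset_act w (coset_act a U))))"
  using telescope3[of "rep H U" "gen a" "rep H (coset_act a U)" "word_val w" "rep H (fold coset_act w (coset_act a U))"]
    rep[OF H U] rep[OF H coset_act_closed[OF H U aw(1)]]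
    rep[OF H fold_coset_closed[OF H aw(2) coset_act_closed[OF H U aw(1)]]] aw
  by (simp add: schreier_def)

lemma loop_word:
  assumes H: "subgroup H G" and h: "h \<in> H"
  obtains w where "w \<in> words X" "word_val w = h" "fold coset_act w H = H"
    "rep H H \<otimes> word_val w \<otimes> inv (rep H (fold coset_act w H)) = h"
proof -
  have hG: "h \<in> carrier G" using h subgroup.subset[OF H] by auto
  obtain w where w: "w \<in> words X" "word_val w = h" using word_val_surj[OF hG] by blast
  have "fold coset_act w H = H"
    using fold_coset_act[OF subgroup.subset[OF H] w(1)] w coset_join2[OF hG H h] by simp
  then show ?thesis using that[OF w] hG w by (simp add: rep_def)
qed

definition schreier_gens :: "'a set \<Rightarrow> 'a set" where
  "schreier_gens H = (\<lambda>(U, a). schreier H U a) ` ((rcosets H) \<times> (X \<times> UNIV))"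

lemma finite_schreier_gens: "finite_index_subgroup H G \<Longrightarrow> finite (schreier_gens H)"
  using finite_X by (simp add: schreier_gens_def finite_index_subgroup_def)

lemma schreier_gens_sub: "subgroup H G \<Longrightarrow> schreier_gens H \<subseteq> H"
  using schreier_closed by (auto simp: schreier_gens_def)

text \<open>Schreier's lemma, from rewriting a word for h along its path from the coset H back to H.
  Letters of both signs are used, so no inverses of the generators occur in the product.\<close>

lemma schreier_generate:
  assumes H: "subgroup H G" and h: "h \<in> H"
  shows "\<exists>ss. set ss \<subseteq> schreier_gens H \<and> h = foldr (\<otimes>) ss \<one>"
proof -
  have "\<exists>ss. set ss \<subseteq> schreier_gens H \<and>
      rep H U \<otimes> word_val w \<otimes> inv (rep H (fold coset_act w U)) = foldr (\<otimes>) ss \<one>"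
    if "w \<in> words X" "U \<in> rcosets H" for w U
    using that
  proof (induction w arbitrary: U)
    case Nil
    then show ?case using rep[OF H] by (intro exI[of _ "[]"]) simp
  next
    case (Cons a w)
    then have aw: "fst a \<in> X" "w \<in> words X" by auto
    obtain ss where ss: "set ss \<subseteq> schreier_gens H"
      "rep H (coset_act a U) \<otimes> word_val w \<otimes> inv (rep H (fold coset_act w (coset_act a U))) = foldr (\<otimes>) ss \<one>"
      using Cons.IH[OF aw(2) coset_act_closed[OF H Cons.prems(2) aw(1)]] by blast
    have "schreier H U a \<in> schreier_gens H"
      unfolding schreier_gens_def by (rule image_eqI[of _ _ "(U, a)"]) (use Cons.prems aw in \<open>auto simp: mem_Times_iff\<close>)
    then show ?case using rep_word_Cons[OF H Cons.prems(2) aw] ss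
      by (intro exI[of _ "schreier H U a # ss"]) simp
  qed
  note word = this
  obtain w where w: "w \<in> words X" "rep H H \<otimes> word_val w \<otimes> inv (rep H (fold coset_act w H)) = h"
    by (rule loop_word[OF H h])
  show ?thesis using word[OF w(1) subgroup_in_rcosets[OF H]] unfolding w(2) .
qed

lemma mod_p_rank_dual_subgroup:
  assumes p: "prime p" and H: "finite_index_subgroup H G"
  obtains B and \<phi> :: "'a \<Rightarrow> 'a \<Rightarrow> int" where "B \<subseteq> H" "finite B" "card B = mod_p_rank p (G\<lparr>carrier := H\<rparr>)"
    "\<And>b g h. b \<in> B \<Longrightarrow> g \<in> H \<Longrightarrow> h \<in> H \<Longrightarrow> \<phi> b (g \<otimes> h) = (\<phi> b g + \<phi> b h) mod int p"
    "\<And>b b'. b \<in> B \<Longrightarrow> b' \<in> B \<Longrightarrow> \<phi> b b' = (if b = b' then 1 else 0)"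
proof -
  have Hs: "subgroup H G" using H by (simp add: finite_index_subgroup_def)
  have gen: "\<exists>w. set w \<subseteq> schreier_gens H \<and> h = foldr (\<otimes>\<^bsub>G\<lparr>carrier := H\<rparr>\<^esub>) w \<one>\<^bsub>G\<lparr>carrier := H\<rparr>\<^esub>"
    if "h \<in> carrier (G\<lparr>carrier := H\<rparr>)" for h
    using schreier_generate[OF Hs, of h] that by simp
  have sub: "schreier_gens H \<subseteq> carrier (G\<lparr>carrier := H\<rparr>)" using schreier_gens_sub[OF Hs] by simp
  have gr: "group (G\<lparr>carrier := H\<rparr>)" by (rule subgroup.subgroup_is_group[OF Hs is_group])
  show thesis
  proof (rule mod_p_rank_dual[OF p gr finite_schreier_gens[OF H] sub gen])
    fix B \<phi>
    assume B: "B \<subseteq> carrier (G\<lparr>carrier := H\<rparr>)" "finite B" "card B = mod_p_rank p (G\<lparr>carrier := H\<rparr>)"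
      and hom: "\<And>b g h. b \<in> B \<Longrightarrow> g \<in> carrier (G\<lparr>carrier := H\<rparr>) \<Longrightarrow> h \<in> carrier (G\<lparr>carrier := H\<rparr>) \<Longrightarrow>
        \<phi> b (g \<otimes>\<^bsub>G\<lparr>carrier := H\<rparr>\<^esub> h) = (\<phi> b g + \<phi> b h) mod int p"
      and dual: "\<And>b b'. b \<in> B \<Longrightarrow> b' \<in> B \<Longrightarrow> \<phi> b b' = (if b = b' then 1 else 0)"
    show thesis
    proof (rule that)
      show "B \<subseteq> H" "finite B" "card B = mod_p_rank p (G\<lparr>carrier := H\<rparr>)" using B by simp_all
      show "\<phi> b (g \<otimes> h) = (\<phi> b g + \<phi> b h) mod int p" if "b \<in> B" "g \<in> H" "h \<in> H" for b g h
        using hom[of b g h] that by simp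
      show "\<phi> b b' = (if b = b' then 1 else 0)" if "b \<in> B" "b' \<in> B" for b b'
        by (rule dual[OF that])
    qed
  qed
qed

lemma mod_p_rank_ge_subgroup:
  fixes \<phi> :: "'a \<Rightarrow> 'a \<Rightarrow> int"
  assumes p: "prime p" and H: "finite_index_subgroup H G" and B: "B \<subseteq> H" "finite B"
    and hom: "\<And>b g h. b \<in> B \<Longrightarrow> g \<in> H \<Longrightarrow> h \<in> H \<Longrightarrow> \<phi> b (g \<otimes> h) = \<phi> b g + \<phi> b h"
    and dual: "\<And>b b'. b \<in> B \<Longrightarrow> b' \<in> B \<Longrightarrow> \<phi> b b' = (if b = b' then 1 else 0)"
  shows "card B \<le> mod_p_rank p (G\<lparr>carrier := H\<rparr>)"
proof -
  have Hs: "subgroup H G" using H by (simp add: finite_index_subgroup_def)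
  have gen: "\<exists>w. set w \<subseteq> schreier_gens H \<and> h = foldr (\<otimes>\<^bsub>G\<lparr>carrier := H\<rparr>\<^esub>) w \<one>\<^bsub>G\<lparr>carrier := H\<rparr>\<^esub>"
    if "h \<in> carrier (G\<lparr>carrier := H\<rparr>)" for h
    using schreier_generate[OF Hs, of h] that by simp
  have sub: "schreier_gens H \<subseteq> carrier (G\<lparr>carrier := H\<rparr>)" using schreier_gens_sub[OF Hs] by simp
  have gr: "group (G\<lparr>carrier := H\<rparr>)" by (rule subgroup.subgroup_is_group[OF Hs is_group])
  show ?thesis
  proof (rule mod_p_rank_ge[OF p gr finite_schreier_gens[OF H] sub gen])
    show "B \<subseteq> carrier (G\<lparr>carrier := H\<rparr>)" "finite B" using B by simp_all
    show "\<phi> b (g \<otimes>\<^bsub>G\<lparr>carrier := H\<rparr>\<^esub> h) = \<phi> b g + \<phi> b h"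
      if "b \<in> B" "g \<in> carrier (G\<lparr>carrier := H\<rparr>)" "h \<in> carrier (G\<lparr>carrier := H\<rparr>)" for b g h
      using hom[of b g h] that by simp
    show "\<phi> b b' = (if b = b' then 1 else 0)" if "b \<in> B" "b' \<in> B" for b b'
      by (rule dual[OF that])
  qed
qed

abbreviation "subgroup_cocycle_dim p H \<equiv> cocycle_dim p X R coset_act (rcosets H) (rcosets H)"

text \<open>A combination of dual homomorphisms, evaluated on the Schreier elements of the edges,
  plus the coboundary of a vertex function is a cocycle. The homomorphisms contribute the homology
  rank and the vertex functions, normalised at one vertex, the remaining |V| - 1.\<close>

lemma cocycle_dim_ge:
  assumes p: "prime p" and H: "finite_index_subgroup H G"
  shows "real (mod_p_rank p (G\<lparr>carrier := H\<rparr>)) + real (card (rcosets H)) - 1 \<le> subgroup_cocycle_dim p H"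
proof -
  let ?V = "rcosets H"
  have Hs: "subgroup H G" using H by (simp add: finite_index_subgroup_def)
  interpret C: connected_complex p X coset_act ?V R by (rule connected_complex_rcosets[OF p H])
  have p1: "int p > 1" using prime_gt_1_nat[OF p] by simp
  obtain B and \<phi> :: "'a \<Rightarrow> 'a \<Rightarrow> int" where B: "B \<subseteq> H" "finite B" "card B = mod_p_rank p (G\<lparr>carrier := H\<rparr>)"
    and hom: "\<And>b g h. b \<in> B \<Longrightarrow> g \<in> H \<Longrightarrow> h \<in> H \<Longrightarrow> \<phi> b (g \<otimes> h) = (\<phi> b g + \<phi> b h) mod int p"
    and dual: "\<And>b b'. b \<in> B \<Longrightarrow> b' \<in> B \<Longrightarrow> \<phi> b b' = (if b = b' then 1 else 0)"
  proof (rule mod_p_rank_dual_subgroup[OF p H], goal_cases)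
    case (1 B \<phi>)
    show thesis by (rule that[OF 1(2-6)])
  qed
  define \<Phi> where "\<Phi> s g = (\<Sum>b\<in>B. s b * \<phi> b g)" for s g
  have \<Phi>_mult: "\<Phi> s (g \<otimes> h) mod int p = (\<Phi> s g + \<Phi> s h) mod int p" if "g \<in> H" "h \<in> H" for s g h
  proof -
    have "\<Phi> s (g \<otimes> h) mod int p = (\<Sum>b\<in>B. (s b * \<phi> b (g \<otimes> h)) mod int p) mod int p"
      unfolding \<Phi>_def by (rule mod_sum_eq[symmetric])
    also have "(\<Sum>b\<in>B. (s b * \<phi> b (g \<otimes> h)) mod int p) = (\<Sum>b\<in>B. (s b * (\<phi> b g + \<phi> b h)) mod int p)"
      by (intro sum.cong) (simp_all add: hom that mod_mult_right_eq)
    also have "\<dots> mod int p = (\<Sum>b\<in>B. s b * (\<phi> b g + \<phi> b h)) mod int p" by (rule mod_sum_eq)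
    finally show ?thesis by (simp add: \<Phi>_def distrib_left sum.distrib)
  qed
  have H1: "\<one> \<in> H" using subgroup.one_closed[OF Hs] .
  have \<Phi>_one: "\<Phi> s \<one> mod int p = 0" for s
  proof -
    have "(\<Phi> s \<one> + \<Phi> s \<one>) mod int p = \<Phi> s \<one> mod int p" using \<Phi>_mult[OF H1 H1, of s] by simp
    then have "int p dvd (\<Phi> s \<one> + \<Phi> s \<one>) - \<Phi> s \<one>" by (simp only: mod_eq_dvd_iff)
    then show ?thesis by simp
  qed
  have \<Phi>_dual: "\<Phi> s b = s b" if "b \<in> B" for s b
  proof -
    have "\<Phi> s b = (\<Sum>b'\<in>B. if b' = b then s b' else 0)"
      unfolding \<Phi>_def using dual that by (intro sum.cong) auto
    then show ?thesis using that B(2) by simp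
  qed
  define zz where "zz = (\<lambda>(s, f) (U, x). if U \<in> ?V \<and> x \<in> X
    then (\<Phi> s (schreier H U (x, True)) + f (coset_act (x, True) U) - f U) mod int p else (0 :: int))"
  define rw where "rw U w = rep H U \<otimes> word_val w \<otimes> inv (rep H (fold coset_act w U))" for U w
  \<comment> \<open>An inverse letter reads its edge backwards. The Schreier elements of the two
    directions are inverse to each other, as the word consisting of a letter and its inverse is
    rewritten to one.\<close>
  have edge: "((if snd a then 1 else - 1) * zz (s, f) (edge_of coset_act U a)) mod int p =
      (\<Phi> s (schreier H U a) + f (coset_act a U) - f U) mod int p"
    if U: "U \<in> ?V" and a: "fst a \<in> X" for s f U a
  proof (cases a)
    case (Pair x e)
    show ?thesis
    proof (cases e)
      case True
      then show ?thesis using U a Pair by (simp add: zz_def)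
    next
      case False
      let ?U = "coset_act a U"
      have a': "a = (x, False)" using Pair False by simp
      have U': "?U \<in> ?V" using C.act_closed[OF a U] .
      have ret: "coset_act (x, True) ?U = U" using C.act_inv[OF a U] by (simp add: a' inv_letter_def)
      have "rw U [a, inv_letter a] = schreier H U a \<otimes> schreier H ?U (inv_letter a)"
        using rep_word_Cons[OF Hs U a, of "[inv_letter a]"] a schreier_def[of H ?U "inv_letter a"]
        by (simp add: rw_def)
      moreover have "rw U [a, inv_letter a] = \<one>"
        using rep[OF Hs U] gen_inv[OF a] C.act_inv[OF a U] a by (simp add: rw_def)
      ultimately have "(\<Phi> s (schreier H U a) + \<Phi> s (schreier H ?U (x, True))) mod int p = 0"
        using \<Phi>_mult[OF schreier_closed[OF Hs U a] schreier_closed[OF Hs U', of "inv_letter a"], of s] \<Phi>_one[of s] a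
        by (simp add: a' inv_letter_def)
      then have "int p dvd - (\<Phi> s (schreier H ?U (x, True)) + f U - f ?U) - (\<Phi> s (schreier H U a) + f ?U - f U)"
      proof -
        have "- (\<Phi> s (schreier H ?U (x, True)) + f U - f ?U) - (\<Phi> s (schreier H U a) + f ?U - f U) =
            - (\<Phi> s (schreier H U a) + \<Phi> s (schreier H ?U (x, True)))" by simp
        moreover have "int p dvd \<Phi> s (schreier H U a) + \<Phi> s (schreier H ?U (x, True))"
          using \<open>(\<Phi> s (schreier H U a) + \<Phi> s (schreier H ?U (x, True))) mod int p = 0\<close> by (rule mod_0_imp_dvd)
        ultimately show ?thesis by (simp only: dvd_minus_iff)
      qed
      then have "(- (\<Phi> s (schreier H ?U (x, True)) + f U - f ?U)) mod int p = (\<Phi> s (schreier H U a) + f ?U - f U) mod int p"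
        by (simp only: mod_eq_dvd_iff)
      moreover have "zz (s, f) (edge_of coset_act U a) = (\<Phi> s (schreier H ?U (x, True)) + f U - f ?U) mod int p"
        using U' a ret by (simp add: zz_def a')
      ultimately show ?thesis using False Pair by (simp add: mod_minus_eq)
    qed
  qed
  have psum: "psum coset_act (zz (s, f)) U w mod int p = (\<Phi> s (rw U w) + f (fold coset_act w U) - f U) mod int p"
    if "U \<in> ?V" "w \<in> words X" for s f U w
    using that
  proof (induction w arbitrary: U)
    case Nil
    then show ?case using rep[OF Hs Nil(1)] \<Phi>_one by (simp add: rw_def)
  next
    case (Cons a w)
    then have aw: "fst a \<in> X" "w \<in> words X" by auto
    let ?U = "coset_act a U"
    have U': "?U \<in> ?V" using C.act_closed[OF aw(1) Cons.prems(1)] .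
    have "\<Phi> s (rw U (a # w)) mod int p = (\<Phi> s (schreier H U a) + \<Phi> s (rw ?U w)) mod int p"
      using rep_word_Cons[OF Hs Cons.prems(1) aw] \<Phi>_mult[OF schreier_closed[OF Hs Cons.prems(1) aw(1)] rep_word_closed[OF Hs U' aw(2)]]
      by (simp add: rw_def)
    then have "(\<Phi> s (rw U (a # w)) + (f (fold coset_act w ?U) - f U)) mod int p =
        ((\<Phi> s (schreier H U a) + \<Phi> s (rw ?U w)) + (f (fold coset_act w ?U) - f U)) mod int p"
      by (rule mod_add_cong) simp
    also have "\<dots> = ((\<Phi> s (schreier H U a) + f ?U - f U) + (\<Phi> s (rw ?U w) + f (fold coset_act w ?U) - f ?U)) mod int p"
      by (simp add: algebra_simps)
    also have "\<dots> = ((if snd a then 1 else - 1) * zz (s, f) (edge_of coset_act U a) +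
        psum coset_act (zz (s, f)) ?U w) mod int p"
      by (rule mod_add_cong[OF edge[OF Cons.prems(1) aw(1), symmetric] Cons.IH[OF U' aw(2), symmetric]])
    finally show ?case by (simp add: algebra_simps)
  qed
  \<comment> \<open>Vertex functions are made to vanish at H, because constants have trivial
    coboundary; this is the origin of the -1.\<close>
  let ?D = "cochains p B \<times> cochains p (?V - {H})"
  have HV: "H \<in> ?V" by (rule subgroup_in_rcosets[OF Hs])
  have inner: "C.inner ?V = ?V \<times> X" using C.act_closed by (auto simp: inner_edges_def)
  have "zz sf \<in> cocycles_on p X R coset_act ?V ?V" if "sf \<in> ?D" for sf
    unfolding cocycles_on_def
  proof (intro CollectI conjI ballI)
    obtain s f where sf: "sf = (s, f)" by (cases sf)
    show "zz sf \<in> cochains p (C.inner ?V)"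
      using p1 unfolding inner by (intro cochainsI) (auto simp: zz_def sf split: prod.splits)
    fix U r assume U: "U \<in> ?V" and r: "r \<in> R"
    have "rw U r = \<one>" using rep[OF Hs U] C.R_trivial[OF r U] word_val_relator[OF r] by (simp add: rw_def)
    then have "psum coset_act (zz sf) U r mod int p = 0"
      using psum[OF U C.R_word[OF r], of s f] C.R_trivial[OF r U] \<Phi>_one[of s] by (simp add: sf)
    then show "int p dvd psum coset_act (zz sf) U r" by auto
  qed
  moreover have "inj_on zz ?D"
  proof (rule inj_onI)
    fix sf sf' assume sf: "sf \<in> ?D" "sf' \<in> ?D" and eq: "zz sf = zz sf'"
    obtain s f s' f' where e: "sf = (s, f)" "sf' = (s', f')" using prod.exhaust by metis
    have cs: "s \<in> cochains p B" "s' \<in> cochains p B" and cf: "f \<in> cochains p (?V - {H})" "f' \<in> cochains p (?V - {H})"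
      using sf unfolding e mem_Sigma_iff by blast+
    have fH: "f H = 0" "f' H = 0" by (rule cochains_outside[OF cf(1)], simp) (rule cochains_outside[OF cf(2)], simp)
    \<comment> \<open>On a loop at H representing b the potential drops out, and duality leaves the
      coefficient at b. With the coefficients known, walks from H to U recover the potential at
      U.\<close>
    have "s = s'"
    proof (rule cochains_eqI[OF cs])
      fix b assume b: "b \<in> B"
      then have "b \<in> H" using B by auto
      obtain w where w: "w \<in> words X" "fold coset_act w H = H" "rw H w = b"
        by (rule loop_word[OF Hs \<open>b \<in> H\<close>]) (simp add: rw_def)
      have "s b mod int p = s' b mod int p"
        using psum[OF HV w(1), of s f] psum[OF HV w(1), of s' f'] eq w(2,3) \<Phi>_dual[OF b] by (simp add: e)
      then show "int p dvd s b - s' b" by (simp only: mod_eq_dvd_iff)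
    qed
    moreover have "f = f'"
    proof (rule cochains_eqI[OF cf])
      fix U assume "U \<in> ?V - {H}"
      then obtain w where w: "w \<in> words X" "fold coset_act w H = U" using C.connected[OF HV] by blast
      have "(\<Phi> s (rw H w) + f U) mod int p = (\<Phi> s (rw H w) + f' U) mod int p"
        using psum[OF HV w(1), of s f] psum[OF HV w(1), of s' f'] eq w(2) fH \<open>s = s'\<close> by (simp add: e)
      then show "int p dvd f U - f' U" by (simp add: mod_eq_dvd_iff)
    qed
    ultimately show "sf = sf'" by (simp add: e)
  qed
  ultimately have "card ?D \<le> card (cocycles_on p X R coset_act ?V ?V)"
    by (intro card_inj_on_le[of zz] C.finite_cocycles subset_refl) auto
  moreover have "card ?D = p ^ (card B + (card ?V - 1))"
    using B(2) C.finite_V HV by (simp add: card_cartesian_product card_cochains power_add)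
  ultimately have "real p ^ (card B + (card ?V - 1)) \<le> real (card (cocycles_on p X R coset_act ?V ?V))"
    unfolding of_nat_power[symmetric] of_nat_le_iff by simp
  then have "log p (real p ^ (card B + (card ?V - 1))) \<le> subgroup_cocycle_dim p H"
    unfolding cocycle_dim_def using p1 C.card_cocycles_pos[OF subset_refl, of R]
    by (subst log_le_cancel_iff) auto
  moreover have "log p (real p ^ (card B + (card ?V - 1))) = real (card B + (card ?V - 1))"
    using p1 by (simp add: log_nat_power)
  moreover have "card ?V \<ge> 1" using HV C.finite_V card_gt_0_iff[of ?V] by force
  ultimately show ?thesis using B(3) by (simp add: of_nat_diff)
qed

end

section \<open>Descending a tower without expansion\<close>

lemma maximal_minimizer:
  fixes g :: "'v set \<Rightarrow> real"
  assumes "finite F" "F \<noteq> {}"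
  obtains D where "D \<in> F" "\<And>A. A \<in> F \<Longrightarrow> g D \<le> g A" "\<And>A. A \<in> F \<Longrightarrow> g A = g D \<Longrightarrow> card A \<le> card D"
proof -
  define F' where "F' = {A \<in> F. \<forall>B\<in>F. g A \<le> g B}"
  have "Min (g ` F) \<in> g ` F" using assms by simp
  then obtain A where A: "A \<in> F" "g A = Min (g ` F)" by auto
  have "A \<in> F'" using A assms(1) by (simp add: F'_def)
  moreover have "finite F'" using assms(1) by (simp add: F'_def)
  ultimately have "Max (card ` F') \<in> card ` F'" by (intro Max_in) auto
  then obtain D where D: "D \<in> F'" "card D = Max (card ` F')" by auto
  show ?thesis
  proof (rule that)
    show "D \<in> F" "\<And>A. A \<in> F \<Longrightarrow> g D \<le> g A" using D(1) by (auto simp: F'_def)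
    fix B assume "B \<in> F" "g B = g D"
    then have "B \<in> F'" using D(1) by (auto simp: F'_def)
    then show "card B \<le> card D" using D(2) \<open>finite F'\<close> by simp
  qed
qed

context connected_complex
begin

lemma cocycle_dim_le:
  assumes "B \<subseteq> V"
  shows "cocycle_dim p X R act V B \<le> real (card X) * real (card B)"
proof -
  have p1: "1 < real p" using prime_gt_1_nat[OF prime] by simp
  have "card (cocycles_on p X R act V B) \<le> card (cochains p (inner B))"
    by (rule card_mono[OF finite_cochains[OF finite_inner[OF assms]]]) (auto simp: cocycles_on_def)
  also have "\<dots> = p ^ card (inner B)" by (rule card_cochains[OF finite_inner[OF assms]])
  also have "\<dots> \<le> p ^ (card X * card B)"
    using card_inner[OF assms] p_pos by (intro power_increasing) auto
  finally have "real (card (cocycles_on p X R act V B)) \<le> real (p ^ (card X * card B))"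
    by (simp only: of_nat_le_iff)
  then have "real (card (cocycles_on p X R act V B)) \<le> real p powr real (card X * card B)"
    using p1 by (simp only: powr_realpow of_nat_power)
  then have "cocycle_dim p X R act V B \<le> real (card X * card B)"
    unfolding cocycle_dim_def using p1 card_cocycles_pos[OF assms, of R] by (subst log_le_iff) auto
  then show ?thesis by simp
qed

text \<open>With this a the bound is an equality for B = V. Any other non-empty B has a boundary
  edge by connectedness, and b is so large that a single edge pays for all cochains. Only this b
  makes the later constants depend on the starting level.\<close>

lemma trivial_linear_bound:
  assumes V: "V \<noteq> {}"
  shows "linear_bound p X R act V (cocycle_dim p X R act V V / real (card V)) (real (card X) * real (card V))"
  unfolding linear_bound_def
proof (intro allI impI)
  fix B assume B: "B \<subseteq> V"
  let ?a = "cocycle_dim p X R act V V / real (card V)" and ?b = "real (card X) * real (card V)"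
  have p1: "1 < real p" using prime_gt_1_nat[OF prime] by simp
  have nn: "0 \<le> cocycle_dim p X R act V V"
    unfolding cocycle_dim_def using p1 card_cocycles_pos[OF subset_refl, of R] by (subst zero_le_log_cancel_iff) auto
  have a: "0 \<le> ?a" using nn by simp
  have n: "real (card V) > 0" using V finite_V by (simp add: card_gt_0_iff)
  consider "B = V" | "B = {}" | "B \<noteq> V" "B \<noteq> {}" by blast
  then show "cocycle_dim p X R act V B \<le> ?a * real (card B) + ?b * real (card (bd B))"
  proof cases
    case 1
    have "?a * real (card V) = cocycle_dim p X R act V V" using n by simp
    moreover have "0 \<le> ?b * real (card (bd V))" by simp
    ultimately show ?thesis unfolding 1 by linarith
  next
    case 2
    have "0 \<le> ?b * real (card (bd {}))" by simp
    moreover have "cocycle_dim p X R act V {} \<le> 0" using cocycle_dim_le[OF B] unfolding 2 by simp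
    ultimately show ?thesis unfolding 2 card.empty of_nat_0 mult_zero_right by linarith
  next
    case 3
    have "real (card (bd B)) \<ge> 1" using card_boundary_pos[OF B 3(2) 3(1)] by simp
    then have "?b * 1 \<le> ?b * real (card (bd B))" by (intro mult_left_mono) auto
    moreover have "real (card B) \<le> real (card V)" using card_mono[OF finite_V B] by simp
    then have "real (card X) * real (card B) \<le> ?b" by (intro mult_left_mono) auto
    moreover have "0 \<le> ?a * real (card B)" using a by (rule mult_nonneg_nonneg) simp
    ultimately show ?thesis using cocycle_dim_le[OF B] by linarith
  qed
qed

section \<open>Minimizers of the boundary minus a multiple of the size\<close>

lemma boundary_submodular:
  "card (bd (S \<union> T)) + card (bd (S \<inter> T)) \<le> card (bd S) + card (bd T)"
proof -
  have "card (bd (S \<union> T)) + card (bd (S \<inter> T)) =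
      card (bd (S \<union> T) \<union> bd (S \<inter> T)) + card (bd (S \<union> T) \<inter> bd (S \<inter> T))"
    by (rule card_Un_Int) (rule finite_boundary)+
  also have "\<dots> \<le> card (bd S \<union> bd T) + card (bd S \<inter> bd T)"
    by (intro add_mono card_mono) (auto simp: boundary_def intro: finite_subset[OF _ finite_boundary])
  also have "\<dots> = card (bd S) + card (bd T)"
    by (rule card_Un_Int[symmetric]) (rule finite_boundary)+
  finally show ?thesis .
qed

definition automorphism :: "('b \<Rightarrow> 'b) \<Rightarrow> bool" where
  "automorphism \<sigma> \<longleftrightarrow> \<sigma> ` V \<subseteq> V \<and> inj_on \<sigma> V \<and> (\<forall>x\<in>X. \<forall>v\<in>V. act (x, True) (\<sigma> v) = \<sigma> (act (x, True) v))"

lemma card_boundary_automorphism: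
  assumes \<sigma>: "automorphism \<sigma>" and A: "A \<subseteq> V"
  shows "card (bd (\<sigma> ` A)) = card (bd A)"
proof -
  have inj: "inj_on \<sigma> V" and sub: "\<sigma> ` V \<subseteq> V"
    and comm: "\<And>x v. x \<in> X \<Longrightarrow> v \<in> V \<Longrightarrow> act (x, True) (\<sigma> v) = \<sigma> (act (x, True) v)"
    using \<sigma> by (auto simp: automorphism_def)
  have surj: "\<sigma> ` V = V" by (rule endo_inj_surj[OF finite_V sub inj])
  have mem: "\<sigma> v \<in> \<sigma> ` A \<longleftrightarrow> v \<in> A" if "v \<in> V" for v
    using inj_on_image_mem_iff[OF inj that A] .
  have closed: "act (x, True) v \<in> V" if "x \<in> X" "v \<in> V" for x v
    using act_closed[of "(x, True)" v] that by simp
  have eq: "bd (\<sigma> ` A) = (\<lambda>(v, x). (\<sigma> v, x)) ` bd A"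
  proof (intro equalityI subsetI)
    fix e assume "e \<in> bd (\<sigma> ` A)"
    then obtain u x where e: "e = (u, x)" "u \<in> V" "x \<in> X" "(u \<in> \<sigma> ` A) \<noteq> (act (x, True) u \<in> \<sigma> ` A)"
      by (auto simp: boundary_def)
    obtain v where v: "v \<in> V" "u = \<sigma> v" using e(2) surj by blast
    have "(v, x) \<in> bd A" using e v mem closed comm by (simp add: boundary_def)
    then show "e \<in> (\<lambda>(v, x). (\<sigma> v, x)) ` bd A" using e v by (auto intro: image_eqI[of _ _ "(v, x)"])
  next
    fix e assume "e \<in> (\<lambda>(v, x). (\<sigma> v, x)) ` bd A"
    then obtain v x where e: "e = (\<sigma> v, x)" "v \<in> V" "x \<in> X" "(v \<in> A) \<noteq> (act (x, True) v \<in> A)"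
      by (auto simp: boundary_def)
    then show "e \<in> bd (\<sigma> ` A)" using mem closed comm sub by (auto simp: boundary_def)
  qed
  have "inj_on (\<lambda>(v, x). (\<sigma> v, x)) (bd A)"
    using inj by (auto simp: inj_on_def boundary_def)
  then show ?thesis unfolding eq by (rule card_image)
qed

text \<open>Among the minimizers of \<open>|\<partial>D| - \<tau>|D|\<close> a largest one is invariant: if \<open>D\<close> is small enough for
  \<open>D \<union> \<sigma>D\<close> to compete, submodularity makes \<open>D \<union> \<sigma>D\<close> a minimizer as well.\<close>

lemma balanced_or_invariant:
  assumes A: "A \<subseteq> V" "2 * card A \<le> card V" "real (card (bd A)) < \<tau> * real (card A)"
  obtains D where "D \<subseteq> V" "2 * card D \<le> card V" "real (card (bd D)) < \<tau> * real (card D)"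
    "card V < 4 * card D \<or> (\<forall>\<sigma>. automorphism \<sigma> \<longrightarrow> \<sigma> ` D \<subseteq> D)"
proof -
  define g where "g S = real (card (bd S)) - \<tau> * real (card S)" for S
  define F where "F = {S. S \<subseteq> V \<and> 2 * card S \<le> card V}"
  have AF: "A \<in> F" using A by (simp add: F_def)
  have "finite F" by (rule finite_subset[of _ "Pow V"]) (use finite_V in \<open>auto simp: F_def\<close>)
  moreover have "F \<noteq> {}" using AF by blast
  ultimately obtain D where D: "D \<in> F" and min: "\<And>S. S \<in> F \<Longrightarrow> g D \<le> g S"
    and max: "\<And>S. S \<in> F \<Longrightarrow> g S = g D \<Longrightarrow> card S \<le> card D"
    using maximal_minimizer[of F g] by metis
  have DV: "D \<subseteq> V" "2 * card D \<le> card V" using D by (auto simp: F_def)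
  have "\<sigma> ` D \<subseteq> D" if small: "\<not> card V < 4 * card D" and \<sigma>: "automorphism \<sigma>" for \<sigma>
  proof -
    let ?E = "\<sigma> ` D"
    have fin: "finite D" using DV(1) finite_V finite_subset by blast
    have EV: "?E \<subseteq> V" using \<sigma> DV(1) by (auto simp: automorphism_def)
    have "inj_on \<sigma> D" using \<sigma> DV(1) by (auto simp: automorphism_def intro: inj_on_subset)
    then have cE: "card ?E = card D" by (rule card_image)
    have sum: "card (D \<union> ?E) + card (D \<inter> ?E) = card D + card D"
      using card_Un_Int[OF fin finite_imageI[OF fin], of \<sigma>] cE by simp
    have UF: "D \<union> ?E \<in> F" using DV(1) EV small sum by (auto simp: F_def)
    have IF: "D \<inter> ?E \<in> F"
      using DV card_mono[OF fin, of "D \<inter> ?E"] by (auto simp: F_def)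
    have "real (card (bd (D \<union> ?E))) + real (card (bd (D \<inter> ?E))) \<le> real (card (bd D)) + real (card (bd D))"
      using boundary_submodular[of D ?E] card_boundary_automorphism[OF \<sigma> DV(1)] by linarith
    moreover have "\<tau> * real (card (D \<union> ?E)) + \<tau> * real (card (D \<inter> ?E)) = \<tau> * real (card D) + \<tau> * real (card D)"
      using arg_cong[OF sum, of "\<lambda>k. \<tau> * real k"] by (simp add: distrib_left)
    ultimately have "g (D \<union> ?E) \<le> g D" using min[OF IF] unfolding g_def by linarith
    then have "card (D \<union> ?E) \<le> card D" using max[OF UF] min[OF UF] by linarith
    then have "D \<union> ?E = D" using fin by (metis Un_upper1 card_seteq finite_UnI finite_imageI)
    then show ?thesis by blast
  qed
  moreover have "real (card (bd D)) < \<tau> * real (card D)" using min[OF AF] A(3) by (simp add: g_def)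
  ultimately show ?thesis using that[of D] DV by blast
qed

text \<open>The cocycles of V are bounded by the crossing edges and the relative cocycles of both
  sides. The linear bound limits V - S to about its share of the total, so S keeps at least its own
  share, which by linear growth exceeds |S| by a fixed proportion. A enters through its boundary
  alone, so the lemma applies to both sides of one cut.\<close>

lemma cut_rank:
  assumes A: "saturated A S" "saturated A (V - S)" "bd A \<subseteq> bd S"
    and bound: "linear_bound p X R act V a b" and b: "b \<ge> 0"
    and a: "a * real (card V) \<le> cocycle_dim p X R act V V + \<delta> * real (card V)"
    and growth: "(1 + c) * real (card V) - 1 \<le> cocycle_dim p X R act V V"
    and num: "c > 0" "8 * \<delta> \<le> c" "(real relator_weight + b + 2) * \<tau> \<le> c / 2" "\<tau> > 0" "1 \<le> \<tau> * real (card V)"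
    and S: "card V < 4 * card S" "real (card (bd A)) < \<tau> * real (card S)"
  shows "p ^ (card S + card (bd A)) < card (rel_cocycles A S)"
proof -
  have p1: "1 < real p" using prime_gt_1_nat[OF prime] by simp
  have SV: "S \<subseteq> V" using A by (simp add: saturated_def)
  let ?T = "V - S"
  define n \<alpha> \<beta> \<zeta> where "n = real (card V)" and "\<alpha> = real (card S)" and "\<beta> = real (card (bd A))"
    and "\<zeta> = cocycle_dim p X R act V V"
  have T: "real (card ?T) = n - \<alpha>"
    using card_Diff_subset[OF finite_subset[OF SV finite_V] SV] card_mono[OF finite_V SV] by (simp add: n_def \<alpha>_def of_nat_diff)
  define r where "r U = log p (real (card (rel_cocycles A U)))" for U
  have pos: "card (rel_cocycles A U) > 0" if "U \<subseteq> V" for U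
  proof -
    have "(\<lambda>e. 0) \<in> rel_cocycles A U" using zero_cocycle by (simp add: rel_cocycles_def)
    then show ?thesis using finite_rel_cocycles[OF that] by (auto simp: card_gt_0_iff)
  qed
  have V_eq: "S \<union> ?T = V" using SV by blast
  have "inner (S \<union> ?T) \<subseteq> inner S \<union> inner ?T \<union> crossing_edges A"
  proof
    fix e assume e: "e \<in> inner (S \<union> ?T)"
    then have "e \<in> inner S \<union> inner ?T \<union> bd S" using SV by (auto simp: inner_edges_def boundary_def)
    then show "e \<in> inner S \<union> inner ?T \<union> crossing_edges A"
      using A(1) by (auto simp: saturated_def crossing_edges_def)
  qed
  from card_rel_cocycles_union[OF A(1,2) this]
  have "card (rel_cocycles A V) \<le> card (rel_cocycles A S) * card (rel_cocycles A ?T)" unfolding V_eq .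
  then have "p ^ card (crossing_edges A) * card (rel_cocycles A V) \<le>
      p ^ card (crossing_edges A) * (card (rel_cocycles A S) * card (rel_cocycles A ?T))" by simp
  from order_trans[OF card_cocycles_le this]
  have "real (card (cocycles_on p X R act V V)) \<le>
      real (p ^ card (crossing_edges A) * (card (rel_cocycles A S) * card (rel_cocycles A ?T)))"
    by (simp only: of_nat_le_iff)
  then have "\<zeta> \<le> log p (real (p ^ card (crossing_edges A) * (card (rel_cocycles A S) * card (rel_cocycles A ?T))))"
    unfolding \<zeta>_def cocycle_dim_def using p1 card_cocycles_pos[OF subset_refl, of R] pos[OF SV] pos[of ?T]
    by (subst log_le_cancel_iff) auto
  also have "\<dots> = real (card (crossing_edges A)) + (r S + r ?T)"
    using p1 pos[OF SV] pos[of ?T] by (simp add: r_def log_mult log_nat_power)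
  finally have z1: "\<zeta> \<le> real (card (crossing_edges A)) + (r S + r ?T)" .
  have z2: "real (card (crossing_edges A)) \<le> real relator_weight * \<beta>"
    using card_crossing_edges[of A] unfolding \<beta>_def of_nat_mult[symmetric] of_nat_le_iff .
  have "card (rel_cocycles A ?T) \<le> card (cocycles_on p X R act V ?T)"
    by (rule card_mono[OF finite_cocycles]) (auto simp: rel_cocycles_def)
  then have "r ?T \<le> cocycle_dim p X R act V ?T"
    unfolding r_def cocycle_dim_def using p1 pos[of ?T] by (subst log_le_cancel_iff) auto
  also have "\<dots> \<le> a * real (card ?T) + b * real (card (bd ?T))"
    using bound by (simp add: linear_bound_def)
  also have "\<dots> \<le> a * (n - \<alpha>) + b * \<beta>"
  proof -
    have "card (bd ?T) \<le> card (bd A)" using A(2) by (intro card_mono finite_boundary) (simp add: saturated_def)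
    then have "b * real (card (bd ?T)) \<le> b * \<beta>" using b unfolding \<beta>_def by (intro mult_left_mono) auto
    then show ?thesis unfolding T by simp
  qed
  finally have rT: "r ?T \<le> a * (n - \<alpha>) + b * \<beta>" .
  have n: "n > 0" using num(5) unfolding n_def by (cases "card V = 0") simp_all
  have an: "a \<le> \<zeta> / n + \<delta>" using a n by (simp add: n_def[symmetric] \<zeta>_def[symmetric] field_simps)
  have \<alpha>n: "0 \<le> \<alpha>" "\<alpha> \<le> n" using card_mono[OF finite_V SV] by (auto simp: \<alpha>_def n_def)
  have \<alpha>4: "n < 4 * \<alpha>" using S(1) unfolding n_def \<alpha>_def by linarith
  have "a * (n - \<alpha>) \<le> (\<zeta> / n + \<delta>) * (n - \<alpha>)" using an \<alpha>n by (intro mult_right_mono) auto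
  also have "\<dots> = \<zeta> - \<zeta> * \<alpha> / n + \<delta> * (n - \<alpha>)" using n by (simp add: field_simps)
  also have "\<dots> \<le> \<zeta> - ((1 + c) * \<alpha> - \<alpha> / n) + c / 2 * \<alpha>"
  proof -
    have "(1 + c) * \<alpha> - \<alpha> / n = ((1 + c) * n - 1) * (\<alpha> / n)" using n by (simp add: field_simps)
    also have "\<dots> \<le> \<zeta> * (\<alpha> / n)" using growth \<alpha>n n by (intro mult_right_mono) (auto simp: \<zeta>_def n_def)
    finally have 1: "(1 + c) * \<alpha> - \<alpha> / n \<le> \<zeta> * \<alpha> / n" by simp
    \<comment> \<open>The error of the ratio concerns the other side, whose size may exceed that of
      S; the balance n < 4 \<alpha> and \<delta> \<le> c/8 turn it into at most c/2 per vertex of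
      S.\<close>
    have "\<delta> * (n - \<alpha>) \<le> c / 8 * (n - \<alpha>)" using num(2) \<alpha>n by (intro mult_right_mono) auto
    also have "\<dots> \<le> c / 8 * (4 * \<alpha>)" using num(1) \<alpha>4 \<alpha>n by (intro mult_left_mono) auto
    finally show ?thesis using 1 by linarith
  qed
  finally have aT: "a * (n - \<alpha>) \<le> \<zeta> - ((1 + c) * \<alpha> - \<alpha> / n) + c / 2 * \<alpha>" .
  have "\<alpha> / n \<le> \<tau> * \<alpha>"
  proof -
    have "1 / n \<le> \<tau>" using num(5) n by (simp add: n_def[symmetric] field_simps)
    then have "1 / n * \<alpha> \<le> \<tau> * \<alpha>" using \<alpha>n by (intro mult_right_mono) auto
    then show ?thesis by simp
  qed
  then have "r S \<ge> (1 + c / 2) * \<alpha> - \<tau> * \<alpha> - (real relator_weight + b) * \<beta>"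
    using z1 z2 rT aT by (simp add: algebra_simps)
  \<comment> \<open>In the constant \<open>relator_weight + b + 2\<close> of the hypothesis, one
    unit is for the term \<beta> in the conclusion and one for the loss \<alpha>/n \<le>
    \<tau>\<alpha> caused by the -1 in the growth bound.\<close>
  moreover have "(real relator_weight + b + 1) * \<beta> < (real relator_weight + b + 1) * (\<tau> * \<alpha>)"
    using S(2) b by (intro mult_strict_left_mono) (auto simp: \<beta>_def \<alpha>_def)
  moreover have "(real relator_weight + b + 2) * \<tau> * \<alpha> \<le> c / 2 * \<alpha>"
    using num(3) \<alpha>n by (intro mult_right_mono) auto
  ultimately have "r S > \<alpha> + \<beta>" by (simp add: algebra_simps)
  then have "log p (real p ^ (card S + card (bd A))) < log p (real (card (rel_cocycles A S)))"
    using p1 by (simp add: r_def \<alpha>_def \<beta>_def log_nat_power)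
  then have "real p ^ (card S + card (bd A)) < real (card (rel_cocycles A S))"
    using p1 pos[OF SV] by (subst (asm) log_less_cancel_iff) auto
  then show ?thesis unfolding of_nat_power[symmetric] of_nat_less_iff .
qed

end

section \<open>Equivariant maps of constant degree\<close>

locale equivariant_map =
  up: connected_complex p X act V R + down: connected_complex p X act W R
  for p :: nat and X :: "'x set" and act :: "'x \<times> bool \<Rightarrow> 'v \<Rightarrow> 'v" and V W :: "'v set"
    and R :: "('x \<times> bool) list set" +
  fixes q :: "'v \<Rightarrow> 'v"
  assumes q_closed: "\<And>v. v \<in> V \<Longrightarrow> q v \<in> W"
    and q_act: "\<And>a v. fst a \<in> X \<Longrightarrow> v \<in> V \<Longrightarrow> q (act a v) = act a (q v)"
    and V_nonempty: "V \<noteq> {}"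
begin

definition fibre :: "'v \<Rightarrow> 'v set" where
  "fibre u = {v \<in> V. q v = u}"

lemma finite_fibre [simp]: "finite (fibre u)"
  using up.finite_V by (simp add: fibre_def)

lemma card_fibre_act:
  assumes "fst a \<in> X"
  shows "card (fibre u) \<le> card (fibre (act a u))"
proof (rule card_inj_on_le)
  show "inj_on (act a) (fibre u)" by (rule inj_on_subset[OF up.act_inj[OF assms]]) (auto simp: fibre_def)
  show "act a ` fibre u \<subseteq> fibre (act a u)" using assms by (auto simp: fibre_def q_act up.act_closed)
qed simp

lemma card_fibre_le: "u \<in> W \<Longrightarrow> u' \<in> W \<Longrightarrow> card (fibre u) \<le> card (fibre u')"
proof -
  assume u: "u \<in> W" "u' \<in> W"
  have "card (fibre u) \<le> card (fibre (fold act w u))" if "w \<in> words X" for w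
    using that
  proof (induction w arbitrary: u)
    case (Cons a w)
    then have aw: "fst a \<in> X" "w \<in> words X" by auto
    show ?case using order_trans[OF card_fibre_act[OF aw(1), of u] Cons.IH[OF aw(2), of "act a u"]] by simp
  qed simp
  then show ?thesis using down.connected[OF u] by blast
qed

definition deg :: nat where
  "deg = card (fibre (SOME u. u \<in> W))"

lemma card_fibre: "u \<in> W \<Longrightarrow> card (fibre u) = deg"
  unfolding deg_def using card_fibre_le someI[of "\<lambda>u. u \<in> W"] by (intro order_antisym) blast+

lemma deg_pos: "deg > 0"
proof -
  obtain v where v: "v \<in> V" using V_nonempty by blast
  then have "v \<in> fibre (q v)" by (simp add: fibre_def)
  then have "card (fibre (q v)) > 0" by (auto simp: card_gt_0_iff)
  then show ?thesis using card_fibre[OF q_closed[OF v]] by simp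
qed

definition pullback :: "'v set \<Rightarrow> 'v set" where
  "pullback E = {v \<in> V. q v \<in> E}"

text \<open>The tag keeps the pieces disjoint even if several of them are the same fibre, so one
  count serves for vertices and for edges with a common origin.\<close>

lemma card_UN_fibres:
  assumes "finite I" "f ` I \<subseteq> W" "inj_on h I"
  shows "card (\<Union>i\<in>I. fibre (f i) \<times> {h i}) = deg * card I"
proof -
  have "card (\<Union>i\<in>I. fibre (f i) \<times> {h i}) = (\<Sum>i\<in>I. card (fibre (f i) \<times> {h i}))"
    using assms(1,3) by (intro card_UN_disjoint) (auto dest: inj_onD)
  also have "\<dots> = (\<Sum>i\<in>I. deg)"
    using assms(2) by (intro sum.cong) (auto simp: card_cartesian_product card_fibre)
  finally show ?thesis by (simp add: mult.commute)
qed

lemma card_pullback: "E \<subseteq> W \<Longrightarrow> card (pullback E) = deg * card E"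
proof -
  assume E: "E \<subseteq> W"
  have "card (pullback E) = card ((\<lambda>v. (v, q v)) ` pullback E)"
    by (rule card_image[symmetric]) (simp add: inj_on_def)
  also have "(\<lambda>v. (v, q v)) ` pullback E = (\<Union>u\<in>E. fibre (id u) \<times> {id u})"
    by (auto simp: pullback_def fibre_def)
  also have "card \<dots> = deg * card E"
    using E finite_subset[OF E down.finite_V] by (intro card_UN_fibres) auto
  finally show ?thesis .
qed

lemma card_boundary_pullback: "card (up.bd (pullback E)) = deg * card (down.bd E)"
proof -
  have "card (up.bd (pullback E)) = card ((\<lambda>(v, x). (v, (q v, x))) ` up.bd (pullback E))"
    by (rule card_image[symmetric]) (auto simp: inj_on_def)
  also have "(\<lambda>(v, x). (v, (q v, x))) ` up.bd (pullback E) = (\<Union>e\<in>down.bd E. fibre (fst e) \<times> {id e})"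
  proof (intro equalityI subsetI)
    fix y assume "y \<in> (\<lambda>(v, x). (v, (q v, x))) ` up.bd (pullback E)"
    then obtain v x where y: "y = (v, (q v, x))" "(v, x) \<in> up.bd (pullback E)" by auto
    then have "(q v, x) \<in> down.bd E"
      using up.act_closed[of "(x, True)" v] q_act[of "(x, True)" v] q_closed[of v]
      by (auto simp: boundary_def pullback_def)
    moreover have "v \<in> fibre (q v)" using y(2) by (auto simp: boundary_def fibre_def)
    ultimately show "y \<in> (\<Union>e\<in>down.bd E. fibre (fst e) \<times> {id e})" using y(1) by force
  next
    fix y assume "y \<in> (\<Union>e\<in>down.bd E. fibre (fst e) \<times> {id e})"
    then obtain v u x where y: "y = (v, (u, x))" "(u, x) \<in> down.bd E" "v \<in> V" "q v = u"
      by (auto simp: fibre_def)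
    then have "(v, x) \<in> up.bd (pullback E)"
      using up.act_closed[of "(x, True)" v] q_act[of "(x, True)" v] by (auto simp: boundary_def pullback_def)
    then show "y \<in> (\<lambda>(v, x). (v, (q v, x))) ` up.bd (pullback E)" using y by force
  qed
  also have "card \<dots> = deg * card (down.bd E)"
    by (intro card_UN_fibres down.finite_boundary) (auto simp: boundary_def)
  finally show ?thesis .
qed

text \<open>A union of fibres is a pullback, and all three quantities in the thinness condition
  scale by the same degree.\<close>

lemma descend:
  assumes D: "D \<subseteq> V" "2 * card D \<le> card V" "real (card (up.bd D)) < \<tau> * real (card D)"
    and sat: "\<And>v v'. v \<in> V \<Longrightarrow> v' \<in> D \<Longrightarrow> q v = q v' \<Longrightarrow> v \<in> D"
  obtains E where "E \<subseteq> W" "2 * card E \<le> card W" "real (card (down.bd E)) < \<tau> * real (card E)"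
proof (rule that)
  let ?E = "q ` D"
  have D_eq: "D = pullback ?E" using D(1) sat by (auto simp: pullback_def)
  have V_eq: "V = pullback W" using q_closed by (auto simp: pullback_def)
  show E: "?E \<subseteq> W" using D(1) q_closed by auto
  have cD: "card D = deg * card ?E" using card_pullback[OF E] D_eq by simp
  have cV: "card V = deg * card W" using card_pullback[OF subset_refl] V_eq by simp
  have "deg * (2 * card ?E) \<le> deg * card W" using D(2) cD cV by simp
  then show "2 * card ?E \<le> card W" using deg_pos by simp
  have "card (up.bd D) = deg * card (down.bd ?E)" using card_boundary_pullback[of ?E] D_eq by simp
  then have "real deg * real (card (down.bd ?E)) < real deg * (\<tau> * real (card ?E))"
    using D(3) unfolding cD by (simp add: algebra_simps)
  then show "real (card (down.bd ?E)) < \<tau> * real (card ?E)" using deg_pos by simp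
qed

end

context presented_group
begin

text \<open>The strict inequality excludes the empty set. Boundary edges are counted by letters,
  whereas the Schreier graph identifies letters with the same value in G; the two counts differ by a
  bounded factor.\<close>

definition thin :: "real \<Rightarrow> 'a set \<Rightarrow> bool" where
  "thin \<tau> H \<longleftrightarrow> (\<exists>A\<subseteq>rcosets H. 2 * card A \<le> card (rcosets H) \<and>
     real (card (boundary X coset_act (rcosets H) A)) < \<tau> * real (card A))"

text \<open>As L normalises K, left multiplication by elements of L maps right cosets of K to right
  cosets; these are the deck transformations over the cosets of L.\<close>

lemma left_translation:
  fixes p :: nat
  assumes p: "prime p" and K: "finite_index_subgroup K G" and L: "finite_index_subgroup L G" "K \<lhd> G\<lparr>carrier := L\<rparr>"
    and t: "t \<in> L"
  shows "connected_complex.automorphism X coset_act (rcosets K) (\<lambda>U. t <# U)"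
    and "g \<in> carrier G \<Longrightarrow> t <# (K #> g) = K #> (t \<otimes> g)"
proof -
  interpret C: connected_complex p X coset_act "rcosets K" R by (rule connected_complex_rcosets[OF p K])
  interpret N: normal K "G\<lparr>carrier := L\<rparr>" by (rule L(2))
  have Ks: "subgroup K G" and Ls: "subgroup L G" using K L by (auto simp: finite_index_subgroup_def)
  have KG: "K \<subseteq> carrier G" using subgroup.subset[OF Ks] .
  have tG: "t \<in> carrier G" using t subgroup.subset[OF Ls] by auto
  have "t <# K = K #> t" using N.coset_eq t by (simp add: l_coset_def r_coset_def)
  then have tr: "t <# (K #> g) = K #> (t \<otimes> g)" if "g \<in> carrier G" for g
    using coset_assoc[OF tG that KG] coset_mult_assoc[OF KG tG that] by simp
  then show "g \<in> carrier G \<Longrightarrow> t <# (K #> g) = K #> (t \<otimes> g)" .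
  show "C.automorphism (\<lambda>U. t <# U)"
    unfolding C.automorphism_def
  proof (intro conjI ballI)
    show "(\<lambda>U. t <# U) ` (rcosets K) \<subseteq> rcosets K"
      using tr tG KG by (auto simp: RCOSETS_def intro: rcosetsI)
    show "inj_on (\<lambda>U. t <# U) (rcosets K)"
    proof (rule inj_onI)
      fix U U' assume U: "U \<in> rcosets K" "U' \<in> rcosets K" and eq: "t <# U = t <# U'"
      have "inv t <# (t <# W) = W" if "W \<subseteq> carrier G" for W
        using lcos_m_assoc[OF that, of "inv t" t] lcos_mult_one[OF that] tG by simp
      then show "U = U'" using rcosets_sub[OF Ks] U eq by metis
    qed
    fix x U assume x: "x \<in> X" and "U \<in> rcosets K"
    then obtain g where g: "g \<in> carrier G" "U = K #> g" by (auto simp: RCOSETS_def)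
    show "coset_act (x, True) (t <# U) = t <# coset_act (x, True) U"
      using g x tG KG by (simp add: coset_act_def tr coset_mult_assoc m_assoc)
  qed
qed

lemma thin_step:
  fixes p :: nat
  assumes p: "prime p" and K: "finite_index_subgroup K G" and L: "finite_index_subgroup L G" "K \<lhd> G\<lparr>carrier := L\<rparr>"
    and thin: "thin \<tau> K" and not_thin: "\<not> thin \<tau> L"
  obtains D where "D \<subseteq> rcosets K" "2 * card D \<le> card (rcosets K)" "card (rcosets K) < 4 * card D"
    "real (card (boundary X coset_act (rcosets K) D)) < \<tau> * real (card D)"
proof -
  have Ks: "subgroup K G" and Ls: "subgroup L G" using K L by (auto simp: finite_index_subgroup_def)
  have KL: "K \<subseteq> L" using normal_imp_subgroup[OF L(2)] subgroup.subset by fastforce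
  interpret C: connected_complex p X coset_act "rcosets K" R by (rule connected_complex_rcosets[OF p K])
  have q: "L <#> (K #> g) = L #> g" if "g \<in> carrier G" for g
    by (rule set_mult_rcos_absorb[OF Ls KL subgroup.one_closed[OF Ks] that])
  interpret Q: equivariant_map p X coset_act "rcosets K" "rcosets L" R "\<lambda>U. L <#> U"
  proof (intro equivariant_map.intro equivariant_map_axioms.intro connected_complex_rcosets[OF p K]
      connected_complex_rcosets[OF p L(1)])
    show "L <#> U \<in> rcosets L" if "U \<in> rcosets K" for U
      using that q subgroup.subset[OF Ls] by (auto simp: RCOSETS_def)
    fix a :: "'x \<times> bool" and U assume a: "fst a \<in> X" and "U \<in> rcosets K"
    then obtain g where g: "g \<in> carrier G" "U = K #> g" by (auto simp: RCOSETS_def)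
    then show "L <#> coset_act a U = coset_act a (L <#> U)"
      using a subgroup.subset[OF Ks] subgroup.subset[OF Ls] by (simp add: coset_act_def q coset_mult_assoc)
  next
    show "rcosets K \<noteq> {}" using subgroup_in_rcosets[OF Ks] by blast
  qed
  obtain A where A: "A \<subseteq> rcosets K" "2 * card A \<le> card (rcosets K)"
    "real (card (C.bd A)) < \<tau> * real (card A)"
    using thin unfolding thin_def by blast
  obtain D where D: "D \<subseteq> rcosets K" "2 * card D \<le> card (rcosets K)" "real (card (C.bd D)) < \<tau> * real (card D)"
    and alt: "card (rcosets K) < 4 * card D \<or> (\<forall>\<sigma>. C.automorphism \<sigma> \<longrightarrow> \<sigma> ` D \<subseteq> D)"
    by (rule C.balanced_or_invariant[OF A])
  have "card (rcosets K) < 4 * card D"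
  proof (rule ccontr)
    assume "\<not> ?thesis"
    then have inv: "\<sigma> ` D \<subseteq> D" if "C.automorphism \<sigma>" for \<sigma> using alt that by blast
    \<comment> \<open>Two cosets of K over the same coset of L differ by left multiplication with an
      element of L, so invariance under automorphisms makes D a union of fibres.\<close>
    have "U \<in> D" if U: "U \<in> rcosets K" "U' \<in> D" "L <#> U = L <#> U'" for U U'
    proof -
      have "U' \<in> rcosets K" using U(2) D(1) by blast
      then obtain g g' where g: "g \<in> carrier G" "U = K #> g" "g' \<in> carrier G" "U' = K #> g'"
        using U(1) by (auto simp: RCOSETS_def)
      then have t: "g \<otimes> inv g' \<in> L" using U(3) q rcos_eq_iff[OF Ls, of g g'] by simp
      have "(g \<otimes> inv g') <# U' = K #> (g \<otimes> inv g' \<otimes> g')"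
        using left_translation(2)[OF p K L t g(3)] g(4) by simp
      also have "\<dots> = U" using g by (simp add: m_assoc)
      finally show ?thesis using inv[OF left_translation(1)[OF p K L t]] U(2) by blast
    qed
    then obtain E where "E \<subseteq> rcosets L" "2 * card E \<le> card (rcosets L)"
      "real (card (Q.down.bd E)) < \<tau> * real (card E)"
      using Q.descend[OF D] by blast
    then show False using not_thin unfolding thin_def by blast
  qed
  then show ?thesis using that D by blast
qed

end

context presented_group
begin

section \<open>From the tower to a free quotient\<close>

lemma linear_bound_tower:
  fixes p :: nat
  assumes p: "prime p" and Gs: "\<And>i. finite_index_subgroup (Gs i) G"
    and step: "\<And>i. Gs (Suc i) \<lhd> G\<lparr>carrier := Gs i\<rparr>" "\<And>i. \<exists>k. index (G\<lparr>carrier := Gs i\<rparr>) (Gs (Suc i)) = p ^ k"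
    and bound: "subgroup_bound p (Gs l) a b" "b \<ge> 0"
  shows "subgroup_bound p (Gs (l + m)) a b"
proof (induction m)
  case (Suc m)
  obtain k where "index (G\<lparr>carrier := Gs (l + m)\<rparr>) (Gs (Suc (l + m))) = p ^ k" using step(2) by blast
  from subgroup_bound_prime_power[OF p bound(2) Gs Gs step(1) this Suc.IH]
  show ?case by simp
qed (use bound in simp)

text \<open>Connectedness gives every admissible set at least one boundary edge. This pushes the
  first thin level beyond any prescribed finite stage.\<close>

lemma not_thin:
  fixes p :: nat
  assumes p: "prime p" and H: "finite_index_subgroup H G" and \<tau>: "\<tau> * real (card (rcosets H)) \<le> 1" "\<tau> > 0"
  shows "\<not> thin \<tau> H"
proof
  interpret C: connected_complex p X coset_act "rcosets H" R by (rule connected_complex_rcosets[OF p H])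
  assume "thin \<tau> H"
  then obtain A where A: "A \<subseteq> rcosets H" "2 * card A \<le> card (rcosets H)" "real (card (C.bd A)) < \<tau> * real (card A)"
    unfolding thin_def by blast
  have A0: "A \<noteq> {}" using A(3) by auto
  then have "card A > 0" using finite_subset[OF A(1) C.finite_V] by (simp add: card_gt_0_iff)
  then have "A \<noteq> rcosets H" using A(2) by auto
  then have "1 \<le> real (card (C.bd A))" using C.card_boundary_pos[OF A(1) A0] by simp
  moreover have "\<tau> * real (card A) \<le> \<tau> * real (card (rcosets H))"
    using card_mono[OF C.finite_V A(1)] \<tau>(2) by (intro mult_left_mono) auto
  ultimately show False using A(3) \<tau>(1) by linarith
qed

lemma free_quotient_of_tower:
  fixes p :: nat and Gs :: "nat \<Rightarrow> 'a set"
  assumes p: "prime p" and Gs: "\<And>i. finite_index_subgroup (Gs i) G"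
    and step: "\<And>i. Gs (Suc i) \<lhd> G\<lparr>carrier := Gs i\<rparr>" "\<And>i. \<exists>k. index (G\<lparr>carrier := Gs i\<rparr>) (Gs (Suc i)) = p ^ k"
    and thin: "\<And>\<tau>. \<tau> > 0 \<Longrightarrow> \<exists>i. thin \<tau> (Gs i)"
    and growth: "c > 0" "\<And>i. c * real (card (rcosets (Gs i))) \<le> real (mod_p_rank p (G\<lparr>carrier := Gs i\<rparr>))"
  obtains K and y1 y2 :: 'a where "y1 \<noteq> y2" "finite_index_subgroup K G"
    "epi (G\<lparr>carrier := K\<rparr>) (free_group {y1, y2}) \<noteq> {}"
proof -
  define n where "n i = real (card (rcosets (Gs i)))" for i
  define \<zeta> where "\<zeta> i = subgroup_cocycle_dim p (Gs i)" for i
  have Gs_sub: "subgroup (Gs i) G" for i using Gs by (simp add: finite_index_subgroup_def)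
  have ne: "rcosets (Gs i) \<noteq> {}" for i using subgroup_in_rcosets[OF Gs_sub] by blast
  have n: "n i \<ge> 1" for i
  proof -
    have "card (rcosets (Gs i)) > 0" using ne Gs[of i] by (simp add: card_gt_0_iff finite_index_subgroup_def)
    then show ?thesis unfolding n_def by linarith
  qed
  have \<zeta>: "(1 + c) * n i - 1 \<le> \<zeta> i" for i
    using cocycle_dim_ge[OF p Gs, of i] growth(2)[of i] by (simp add: n_def \<zeta>_def algebra_simps)
  define \<delta> where "\<delta> = c / 8"
  define I where "I = Inf (range (\<lambda>i. \<zeta> i / n i))"
  have "bdd_below (range (\<lambda>i. \<zeta> i / n i))"
  proof (rule bdd_belowI2)
    fix i
    have "n i \<le> (1 + c) * n i" using growth(1) n[of i] by (simp add: algebra_simps)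
    then have "0 \<le> \<zeta> i" using \<zeta>[of i] n[of i] by linarith
    then show "0 \<le> \<zeta> i / n i" using n[of i] by simp
  qed
  then have I_le: "I \<le> \<zeta> i / n i" for i unfolding I_def by (intro cInf_lower) auto
  \<comment> \<open>The infimum need not be attained; a level within c/8 of it suffices, and this is
    the error that the cut estimate tolerates.\<close>
  have "I < I + \<delta>" using growth(1) by (simp add: \<delta>_def)
  then obtain l where l: "\<zeta> l / n l < I + \<delta>"
    unfolding I_def using cInf_lessD[of "range (\<lambda>i. \<zeta> i / n i)"] by blast
  define b where "b = real (card X) * n l"
  have b: "b \<ge> 0" using n[of l] by (simp add: b_def)
  have bound: "subgroup_bound p (Gs l) (\<zeta> l / n l) b"
    unfolding \<zeta>_def n_def b_def
    by (rule connected_complex.trivial_linear_bound[OF connected_complex_rcosets[OF p Gs] ne])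
  define w where "w = real (connected_complex.relator_weight R)"
  have w: "w \<ge> 0" by (simp add: w_def)
  \<comment> \<open>Chosen after l, because b depends on the size of that level. The first entry
    makes the cut estimate work, the others prevent thinness of all levels up to l.\<close>
  define \<tau> where "\<tau> = Min (insert (c / (2 * (w + b + 2))) ((\<lambda>i. 1 / n i) ` {..l}))"
  have \<tau>_le: "\<tau> \<le> c / (2 * (w + b + 2))" "\<tau> \<le> 1 / n i" if "i \<le> l" for i
    unfolding \<tau>_def by (rule Min_le; use that in simp)+
  have n0: "n i > 0" for i using n[of i] by linarith
  have \<tau>: "\<tau> > 0" unfolding \<tau>_def using growth(1) w b n0 by (subst Min_gr_iff) auto
  have weight: "(w + b + 2) * \<tau> \<le> c / 2"
  proof -
    have "w + b + 2 > 0" using w b by linarith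
    then show ?thesis using \<tau>_le(1)[OF order_refl] by (simp add: field_simps)
  qed
  define j where "j = (LEAST i. thin \<tau> (Gs i))"
  have thin_j: "thin \<tau> (Gs j)" unfolding j_def by (rule LeastI_ex[OF thin[OF \<tau>]])
  have not_thin_less: "\<not> thin \<tau> (Gs i)" if "i < j" for i using that not_less_Least unfolding j_def by blast
  have "\<not> thin \<tau> (Gs i)" if "i \<le> l" for i
    using \<tau>_le(2)[OF that] n0[of i] by (intro not_thin[OF p Gs _ \<tau>]) (simp add: n_def field_simps)
  then have jl: "l < j" using thin_j by (meson not_le)
  then obtain j' where j': "j = Suc j'" by (cases j) auto
  have not_thin_j': "\<not> thin \<tau> (Gs j')" using not_thin_less j' by simp
  interpret C: connected_complex p X coset_act "rcosets (Gs j)" R by (rule connected_complex_rcosets[OF p Gs])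
  interpret P: presented_complex G X R \<pi> p coset_act "rcosets (Gs j)" ..
  obtain D where D: "D \<subseteq> rcosets (Gs j)" "2 * card D \<le> card (rcosets (Gs j))" "card (rcosets (Gs j)) < 4 * card D"
    "real (card (C.bd D)) < \<tau> * real (card D)"
    by (rule thin_step[OF p Gs Gs step(1)[of j'] thin_j[unfolded j'] not_thin_j', folded j'])
  define D' where "D' = rcosets (Gs j) - D"
  have finD: "finite D" using D(1) C.finite_V finite_subset by blast
  have cD': "card D' = card (rcosets (Gs j)) - card D" unfolding D'_def by (rule card_Diff_subset[OF finD D(1)])
  have D'V: "D' \<subseteq> rcosets (Gs j)" and D'_compl: "rcosets (Gs j) - D' = D" using D(1) by (auto simp: D'_def)
  have D'_card: "card D \<le> card D'" using cD' D(2) by linarith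
  have bdD': "C.bd D' = C.bd D" unfolding D'_def by (rule C.boundary_compl)
  have sat: "C.saturated D D" "C.saturated D D'" using D(1) D'V bdD' by (auto simp: C.saturated_def)
  obtain m where m: "j = l + m" using jl by (metis less_imp_add_positive)
  have bound_j: "subgroup_bound p (Gs j) (\<zeta> l / n l) b"
    unfolding m by (rule linear_bound_tower[OF p Gs step bound b])
  have a: "\<zeta> l / n l * real (card (rcosets (Gs j))) \<le> subgroup_cocycle_dim p (Gs j) + \<delta> * real (card (rcosets (Gs j)))"
  proof -
    have "\<zeta> l / n l \<le> \<zeta> j / n j + \<delta>" using l I_le[of j] by linarith
    then have "\<zeta> l / n l * n j \<le> (\<zeta> j / n j + \<delta>) * n j" using n[of j] by (intro mult_right_mono) auto
    also have "\<dots> = \<zeta> j + \<delta> * n j" using n0[of j] by (simp add: field_simps)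
    finally show ?thesis unfolding \<zeta>_def n_def .
  qed
  have growth_j: "(1 + c) * real (card (rcosets (Gs j))) - 1 \<le> subgroup_cocycle_dim p (Gs j)"
    using \<zeta>[of j] unfolding \<zeta>_def n_def .
  have D0: "D \<noteq> {}" using D(3) by auto
  have cD0: "card D > 0" using D0 finD by (simp add: card_gt_0_iff)
  then have DV: "D \<noteq> rcosets (Gs j)" using D(2) by auto
  have n_large: "1 \<le> \<tau> * real (card (rcosets (Gs j)))"
  proof -
    have "1 \<le> real (card (C.bd D))" using C.card_boundary_pos[OF D(1) D0 DV] by simp
    moreover have "\<tau> * real (card D) \<le> \<tau> * real (card (rcosets (Gs j)))"
      using card_mono[OF C.finite_V D(1)] \<tau> by (intro mult_left_mono) auto
    ultimately show ?thesis using D(4) by linarith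
  qed
  have \<delta>8: "8 * \<delta> \<le> c" by (simp add: \<delta>_def)
  have large1: "p ^ (card D + card (C.bd D)) < card (C.rel_cocycles D D)"
    using C.cut_rank[OF sat(1) sat(2)[unfolded D'_def] order_refl bound_j b a growth_j growth(1) \<delta>8
        weight[unfolded w_def] \<tau> n_large D(3,4)] .
  have D'4: "card (rcosets (Gs j)) < 4 * card D'" "real (card (C.bd D)) < \<tau> * real (card D')"
  proof -
    show "card (rcosets (Gs j)) < 4 * card D'" using D'_card D(3) by linarith
    have "\<tau> * real (card D) \<le> \<tau> * real (card D')" using D'_card \<tau> by (intro mult_left_mono) auto
    then show "real (card (C.bd D)) < \<tau> * real (card D')" using D(4) by linarith
  qed
  have sat': "C.saturated D (rcosets (Gs j) - D')" unfolding D'_compl by (rule sat(1))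
  have large2: "p ^ (card D' + card (C.bd D)) < card (C.rel_cocycles D D')"
    using C.cut_rank[OF sat(2) sat' _ bound_j b a growth_j growth(1) \<delta>8
        weight[unfolded w_def] \<tau> n_large D'4] bdD' by simp
  \<comment> \<open>Largeness asks for a basis in the type of the elements of G. Representatives of
    a coset in D and of one outside D are two distinct elements to use as letters.\<close>
  obtain U where U: "U \<in> rcosets (Gs j)" "U \<in> D" using D0 D(1) by blast
  obtain U' where U': "U' \<in> rcosets (Gs j)" "U' \<notin> D" using DV D(1) by blast
  obtain y1 y2 where "y1 \<in> carrier G" "y2 \<in> carrier G" "U = Gs j #> y1" "U' = Gs j #> y2"
    using U(1) U'(1) by (auto simp: RCOSETS_def)
  then have y: "y1 \<noteq> y2" using U(2) U'(2) by auto
  obtain K where "finite_index_subgroup K G" "epi (G\<lparr>carrier := K\<rparr>) (free_group {y1, y2}) \<noteq> {}"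
    using P.free_quotient_of_cut[OF D(1) D0 DV y large1 large2[unfolded D'_def]] by blast
  then show thesis using that y by blast
qed

lemma thin_of_not_tau:
  assumes ntau: "\<not> property_tau G (range Gs)" and \<tau>: "\<tau> > 0"
  shows "\<exists>i :: nat. thin \<tau> (Gs i)"
proof -
  let ?S = "gen ` (X \<times> {True})"
  have S: "finite ?S" "?S \<subseteq> carrier G" using finite_X by auto
  have gen_S: "gen a \<in> generate G ?S" if "fst a \<in> X" for a
  proof (cases "snd a")
    case True
    then have "gen a \<in> ?S" using that by (auto simp: mem_Times_iff)
    then show ?thesis by (rule generate.incl)
  next
    case False
    then have "gen (inv_letter a) \<in> ?S" using that by (auto simp: inv_letter_def)
    then have "inv (gen (inv_letter a)) \<in> generate G ?S" by (rule generate.inv)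
    moreover have "inv (gen (inv_letter a)) = gen a"
      using inv_equality[OF gen_inv[OF that]] that by simp
    ultimately show ?thesis by simp
  qed
  have "word_val w \<in> generate G ?S" if "w \<in> words X" for w
    using that
  proof (induction w)
    case (Cons a w)
    then show ?case using generate.eng[OF gen_S[of a], of "word_val w"] by simp
  qed (simp add: generate.one)
  then have "carrier G \<subseteq> generate G ?S" using word_val_surj by blast
  then have "generate G ?S = carrier G" using generate_incl[OF S(2)] by blast
  then have "\<not> (INF H\<in>range Gs. cheeger (schreier_graph G H ?S)) > 0"
    using ntau S unfolding property_tau_def by blast
  then have le0: "(INF H\<in>range Gs. cheeger (schreier_graph G H ?S)) \<le> 0" by (simp only: not_less)
  \<comment> \<open>A Schreier edge may stand for up to |X| letters with the same value in G; the
    summand 1 keeps the denominator positive when there are no letters.\<close>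
  define \<epsilon> where "\<epsilon> = \<tau> / (real (card X) + 1)"
  have \<epsilon>: "\<epsilon> > 0" using \<tau> by (simp add: \<epsilon>_def)
  have "(INF H\<in>range Gs. cheeger (schreier_graph G H ?S)) < ereal \<epsilon>"
    by (rule le_less_trans[OF le0]) (use \<epsilon> in simp)
  then obtain i where i: "cheeger (schreier_graph G (Gs i) ?S) < ereal \<epsilon>"
    unfolding INF_less_iff by blast
  then obtain A where A: "A \<subseteq> rcosets (Gs i)" "0 < card A" "2 * card A \<le> card (rcosets (Gs i))"
    "real (card (edge_boundary (schreier_graph G (Gs i) ?S) A)) / real (card A) < \<epsilon>"
    using i unfolding cheeger_def INF_less_iff by (auto simp: schreier_graph_def)
  let ?V = "rcosets (Gs i)" and ?E = "edge_boundary (schreier_graph G (Gs i) ?S) A"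
  have finV: "finite ?V" using A(2,3) card_gt_0_iff[of ?V] by linarith
  have finE: "finite ?E"
    by (rule finite_subset[of _ "?V \<times> ?S"]) (use finV S in \<open>auto simp: edge_boundary_def schreier_graph_def\<close>)
  have "card (boundary X coset_act ?V A) \<le> card (?E \<times> X)"
  proof (rule card_inj_on_le[of "\<lambda>(U, x). ((U, gen (x, True)), x)"])
    show "inj_on (\<lambda>(U, x). ((U, gen (x, True)), x)) (boundary X coset_act ?V A)" by (auto simp: inj_on_def)
    show "(\<lambda>(U, x). ((U, gen (x, True)), x)) ` boundary X coset_act ?V A \<subseteq> ?E \<times> X"
      by (auto simp: boundary_def edge_boundary_def schreier_graph_def coset_act_def)
  qed (use finE finite_X in simp)
  then have "card (boundary X coset_act ?V A) \<le> card X * card ?E"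
    by (simp add: card_cartesian_product mult.commute)
  then have "real (card (boundary X coset_act ?V A)) \<le> real (card X) * real (card ?E)"
    unfolding of_nat_mult[symmetric] of_nat_le_iff .
  also have "\<dots> \<le> (real (card X) + 1) * real (card ?E)" by (simp add: distrib_right)
  also have "\<dots> < (real (card X) + 1) * (\<epsilon> * real (card A))"
    using A(2,4) by (intro mult_strict_left_mono) (auto simp: field_simps)
  also have "\<dots> = \<tau> * real (card A)" by (simp add: \<epsilon>_def)
  finally show ?thesis using A(1,3) unfolding thin_def by blast
qed

end

lemma linear_mod_p_growthE:
  assumes growth: "linear_mod_p_growth p G (range Gs)"
    and fin: "\<And>i :: nat. card (rcosets\<^bsub>G\<^esub> (Gs i)) > 0"
  obtains c where "c > 0"
    "\<And>i. c * real (card (rcosets\<^bsub>G\<^esub> (Gs i))) \<le> real (mod_p_rank p (G\<lparr>carrier := Gs i\<rparr>))"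
proof -
  let ?f = "\<lambda>H. ereal (real (mod_p_rank p (G\<lparr>carrier := H\<rparr>)) / real (index G H))"
  have "0 < (INF H\<in>range Gs. ?f H)" using growth by (simp add: linear_mod_p_growth_def)
  then obtain c where c: "0 < ereal c" "ereal c < (INF H\<in>range Gs. ?f H)" using ereal_dense2 by blast
  show ?thesis
  proof (rule that)
    show "c > 0" using c(1) by simp
    fix i
    have "(INF H\<in>range Gs. ?f H) \<le> ?f (Gs i)" by (rule INF_lower) simp
    then have "ereal c \<le> ?f (Gs i)" using c(2) by order
    then have "c \<le> real (mod_p_rank p (G\<lparr>carrier := Gs i\<rparr>)) / real (card (rcosets\<^bsub>G\<^esub> (Gs i)))"
      by (simp add: index_def)
    then show "c * real (card (rcosets\<^bsub>G\<^esub> (Gs i))) \<le> real (mod_p_rank p (G\<lparr>carrier := Gs i\<rparr>))"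
      using fin[of i] by (simp add: pos_le_divide_eq)
  qed
qed

lemma free_group_not_comm:
  assumes "y1 \<noteq> y2"
  shows "\<not> comm_group (free_group {y1, y2})"
proof
  assume "comm_group (free_group {y1, y2})"
  then interpret F: comm_group "free_group {y1, y2}" .
  have "[(y1, True)] \<in> carrier (free_group {y1, y2})" "[(y2, True)] \<in> carrier (free_group {y1, y2})"
    by (auto simp: free_group_def reduced_def)
  from F.m_comm[OF this] assms show False by (simp add: free_group_def inv_letter_def)
qed

lemma large_of_tower:
  fixes G :: "('a, 'b) monoid_scheme"
  assumes "group G" "finitely_presented G" and p: "prime p" and Gs: "\<And>i :: nat. finite_index_subgroup (Gs i) G"
    and step: "\<And>i. Gs (Suc i) \<lhd> G\<lparr>carrier := Gs i\<rparr>" "\<And>i. \<exists>k. index (G\<lparr>carrier := Gs i\<rparr>) (Gs (Suc i)) = p ^ k"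
    and ntau: "\<not> property_tau G (range Gs)" and growth: "linear_mod_p_growth p G (range Gs)"
  shows "large G"
proof -
  obtain X :: "nat set" and R \<pi> where "presented_group G X R \<pi>"
    using finitely_presented_imp_presented[OF assms(1,2)] .
  then interpret P: presented_group G X R \<pi> .
  have "card (rcosets\<^bsub>G\<^esub> (Gs i)) > 0" for i
    using P.subgroup_in_rcosets[of "Gs i"] Gs[of i] by (auto simp: card_gt_0_iff finite_index_subgroup_def)
  then obtain c where c: "c > 0"
    "\<And>i. c * real (card (rcosets\<^bsub>G\<^esub> (Gs i))) \<le> real (mod_p_rank p (G\<lparr>carrier := Gs i\<rparr>))"
    using linear_mod_p_growthE[OF growth] by blast
  obtain K and y1 y2 :: 'a where "y1 \<noteq> y2" "finite_index_subgroup K G"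
    "epi (G\<lparr>carrier := K\<rparr>) (free_group {y1, y2}) \<noteq> {}"
    by (rule P.free_quotient_of_tower[OF p Gs step P.thin_of_not_tau[OF ntau] c])
  then show ?thesis unfolding large_def using free_group_not_comm[of y1 y2] by blast
qed

section \<open>The tower of a large group\<close>

text \<open>For \<open>\<psi> : H \<rightarrow> F\<close> onto a free group with basis elements \<open>a \<noteq> b\<close>, the intended instance is:
  \<open>E h\<close> is the exponent sum of \<open>a\<close> in \<open>\<psi> h\<close>, and \<open>C N k h\<close> counts with signs those letters \<open>b\<close> of
  \<open>\<psi> h\<close> in front of which the exponent sum of \<open>a\<close> is congruent to \<open>k\<close> modulo \<open>N\<close>.\<close>

locale counted_subgroup = presented_group G X R \<pi>
  for G :: "('a, 'b) monoid_scheme" (structure) and X :: "'x set" and R and \<pi> +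
  fixes H :: "'a set" and E :: "'a \<Rightarrow> int" and C :: "nat \<Rightarrow> int \<Rightarrow> 'a \<Rightarrow> int" and a b :: 'a
  assumes H: "finite_index_subgroup H G"
    and E_mult: "\<And>g h. g \<in> H \<Longrightarrow> h \<in> H \<Longrightarrow> E (g \<otimes> h) = E g + E h"
    and a: "a \<in> H" "E a = 1" and b: "b \<in> H" "E b = 0"
    and C_mult: "\<And>N k g h. g \<in> H \<Longrightarrow> h \<in> H \<Longrightarrow> C N k (g \<otimes> h) = C N k g + C N (k - E g) h"
    and C_period: "\<And>N k k' h. int N dvd k - k' \<Longrightarrow> C N k h = C N k' h"
    and C_a: "\<And>N k. C N k a = 0" and C_b: "\<And>N k. C N k b = (if int N dvd k then 1 else 0)"
begin

lemma Hs: "subgroup H G" and fin_H: "finite (rcosets H)"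
  using H by (auto simp: finite_index_subgroup_def)

lemma H_carrier: "h \<in> H \<Longrightarrow> h \<in> carrier G"
  using subgroup.subset[OF Hs] by blast

lemma E_one: "E \<one> = 0"
  using E_mult[OF subgroup.one_closed[OF Hs] subgroup.one_closed[OF Hs]] by simp

lemma E_inv: "h \<in> H \<Longrightarrow> E (inv h) = - E h"
  using E_mult[of h "inv h"] subgroup.m_inv_closed[OF Hs, of h] E_one H_carrier[of h] by simp

lemma a_pow: "a [^] (k :: nat) \<in> H" "E (a [^] k) = int k"
proof -
  have "a [^] k \<in> H \<and> E (a [^] k) = int k"
  proof (induction k)
    case 0
    then show ?case using subgroup.one_closed[OF Hs] E_one by simp
  next
    case (Suc k)
    then show ?case using subgroup.m_closed[OF Hs _ a(1)] E_mult[of "a [^] k" a] a by simp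
  qed
  then show "a [^] k \<in> H" "E (a [^] k) = int k" by auto
qed

section \<open>The subgroups of the tower and their cosets\<close>

definition level :: "nat \<Rightarrow> 'a set" where
  "level N = {h \<in> H. int N dvd E h}"

lemma level_sub: "level N \<subseteq> H" by (auto simp: level_def)

lemma subgroup_level: "subgroup (level N) G"
proof (rule subgroupI)
  show "level N \<subseteq> carrier G" using level_sub H_carrier by blast
  have "\<one> \<in> level N" using subgroup.one_closed[OF Hs] E_one by (simp add: level_def)
  then show "level N \<noteq> {}" by blast
  show "inv h \<in> level N" if "h \<in> level N" for h
    using that subgroup.m_inv_closed[OF Hs] by (simp add: level_def E_inv)
  show "g \<otimes> h \<in> level N" if "g \<in> level N" "h \<in> level N" for g h
    using that subgroup.m_closed[OF Hs] by (simp add: level_def E_mult)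
qed

lemma level_double_normal: "level (2 * N) \<lhd> G\<lparr>carrier := level N\<rparr>"
proof -
  interpret L: group "G\<lparr>carrier := level N\<rparr>" by (rule subgroup.subgroup_is_group[OF subgroup_level is_group])
  have sub: "level (2 * N) \<subseteq> level N" by (auto simp: level_def intro: dvd_trans[of "int N" "2 * int N"])
  have "subgroup (level (2 * N)) (G\<lparr>carrier := level N\<rparr>)"
    by (rule subgroup_incl[OF subgroup_level subgroup_level sub])
  then show ?thesis
  proof (rule L.normal_invI)
    fix x h assume "x \<in> carrier (G\<lparr>carrier := level N\<rparr>)" and h: "h \<in> level (2 * N)"
    then have x: "x \<in> level N" by simp
    have xH: "x \<in> H" "h \<in> H" "inv x \<in> H" using x h subgroup.m_inv_closed[OF Hs] by (auto simp: level_def)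
    then have "E (x \<otimes> h \<otimes> inv x) = E h"
      using subgroup.m_closed[OF Hs] by (simp add: E_mult E_inv)
    then have "x \<otimes> h \<otimes> inv x \<in> level (2 * N)"
      using h xH subgroup.m_closed[OF Hs] by (simp add: level_def)
    then show "x \<otimes>\<^bsub>G\<lparr>carrier := level N\<rparr>\<^esub> h \<otimes>\<^bsub>G\<lparr>carrier := level N\<rparr>\<^esub> inv\<^bsub>G\<lparr>carrier := level N\<rparr>\<^esub> x \<in> level (2 * N)"
      using m_inv_consistent[OF subgroup_level x] by simp
  qed
qed

lemma index_level_double:
  assumes N: "N > 0"
  shows "index (G\<lparr>carrier := level N\<rparr>) (level (2 * N)) = 2"
proof -
  let ?K = "level (2 * N)" and ?x = "a [^] N"
  have x: "?x \<in> level N" "?x \<in> carrier G" using a_pow[of N] H_carrier by (auto simp: level_def)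
  have xK: "?x \<notin> ?K" using a_pow[of N] N by (auto simp: level_def dest: zdvd_imp_le)
  have "rcosets\<^bsub>G\<lparr>carrier := level N\<rparr>\<^esub> ?K = {?K, ?K #> ?x}"
  proof
    show "{?K, ?K #> ?x} \<subseteq> rcosets\<^bsub>G\<lparr>carrier := level N\<rparr>\<^esub> ?K"
      using x(1) coset_mult_one[OF subgroup.subset[OF subgroup_level], of "2 * N"] subgroup.one_closed[OF subgroup_level, of N]
      unfolding RCOSETS_def by (auto simp: r_coset_def)
    show "rcosets\<^bsub>G\<lparr>carrier := level N\<rparr>\<^esub> ?K \<subseteq> {?K, ?K #> ?x}"
    proof
      fix U assume "U \<in> rcosets\<^bsub>G\<lparr>carrier := level N\<rparr>\<^esub> ?K"
      then obtain h where h: "h \<in> level N" "U = ?K #> h" by (auto simp: RCOSETS_def r_coset_def)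
      then have hH: "h \<in> H" "h \<in> carrier G" using level_sub H_carrier by blast+
      obtain c where c: "E h = int N * c" using h(1) by (auto simp: level_def)
      show "U \<in> {?K, ?K #> ?x}"
      proof (cases "even c")
        case True
        then have "h \<in> ?K" using c hH by (auto simp: level_def)
        then show ?thesis using h(2) coset_join2[OF hH(2) subgroup_level] by simp
      next
        case False
        have "h \<otimes> inv ?x \<in> H" using hH a_pow subgroup.m_closed[OF Hs] subgroup.m_inv_closed[OF Hs] by blast
        moreover have "E (h \<otimes> inv ?x) = int N * (c - 1)"
          using hH a_pow[of N] subgroup.m_inv_closed[OF Hs] c by (simp add: E_mult E_inv algebra_simps)
        moreover have "int (2 * N) dvd int N * (c - 1)" using False by simp
        ultimately have "h \<otimes> inv ?x \<in> ?K" by (simp add: level_def)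
        then show ?thesis using h(2) rcos_eq_iff[OF subgroup_level hH(2) x(2)] by simp
      qed
    qed
  qed
  moreover have "?K \<noteq> ?K #> ?x" using rcos_self[OF x(2) subgroup_level] xK by blast
  ultimately show ?thesis by (simp add: index_def)
qed

text \<open>Extends the exponent sum from H to all of G by means of coset representatives, so that
  left multiplication by h adds E h.\<close>

definition \<kappa> :: "'a \<Rightarrow> int" where
  "\<kappa> g = E (g \<otimes> inv (rep H (H #> g)))"

lemma rep_H:
  assumes "g \<in> carrier G"
  shows "rep H (H #> g) \<in> carrier G" "g \<otimes> inv (rep H (H #> g)) \<in> H"
proof -
  note r = rep[OF Hs rcosetsI[OF subgroup.subset[OF Hs] assms]]
  show "rep H (H #> g) \<in> carrier G" by (rule r(1))
  show "g \<otimes> inv (rep H (H #> g)) \<in> H" using r(2) rcos_eq_iff[OF Hs assms r(1)] by simp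
qed

lemma \<kappa>_mult:
  assumes h: "h \<in> H" and g: "g \<in> carrier G"
  shows "H #> (h \<otimes> g) = H #> g" "\<kappa> (h \<otimes> g) = E h + \<kappa> g"
proof -
  have hG: "h \<in> carrier G" by (rule H_carrier[OF h])
  show eq: "H #> (h \<otimes> g) = H #> g"
    using coset_mult_assoc[OF subgroup.subset[OF Hs] hG g] coset_join2[OF hG Hs h] by simp
  have "h \<otimes> g \<otimes> inv (rep H (H #> g)) = h \<otimes> (g \<otimes> inv (rep H (H #> g)))"
    using hG g rep_H[OF g] by (simp add: m_assoc)
  then show "\<kappa> (h \<otimes> g) = E h + \<kappa> g" unfolding \<kappa>_def eq using E_mult[OF h rep_H(2)[OF g]] by simp
qed

text \<open>Coordinates on the cosets of \<open>level N\<close>: a coset of H and a position on a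
  cycle of length N.\<close>

definition key :: "nat \<Rightarrow> 'a set \<Rightarrow> 'a set \<times> int" where
  "key N U = (H <#> U, \<kappa> (rep (level N) U) mod int N)"

lemma key_coset:
  assumes g: "g \<in> carrier G"
  shows "key N (level N #> g) = (H #> g, \<kappa> g mod int N)"
proof -
  let ?r = "rep (level N) (level N #> g)"
  note r = rep[OF subgroup_level[of N] rcosetsI[OF subgroup.subset[OF subgroup_level[of N]] g]]
  have k: "?r \<otimes> inv g \<in> level N" by (rule iffD1[OF rcos_eq_iff[OF subgroup_level[of N] r(1) g] r(2)[symmetric]])
  then have kH: "?r \<otimes> inv g \<in> H" and dvd: "int N dvd E (?r \<otimes> inv g)" by (auto simp: level_def)
  have "?r = (?r \<otimes> inv g) \<otimes> g" using r(1) g by (simp add: m_assoc)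
  then have "\<kappa> ?r = E (?r \<otimes> inv g) + \<kappa> g" using \<kappa>_mult(2)[OF kH g] by simp
  then have "int N dvd \<kappa> ?r - \<kappa> g" using dvd by simp
  then have "\<kappa> ?r mod int N = \<kappa> g mod int N" by (simp only: mod_eq_dvd_iff)
  then show ?thesis
    unfolding key_def using set_mult_rcos_absorb[OF Hs level_sub subgroup.one_closed[OF subgroup_level] g] by simp
qed

lemma key_bij:
  assumes N: "N > 0"
  shows "bij_betw (key N) (rcosets (level N)) ((rcosets H) \<times> {0..<int N})"
  unfolding bij_betw_def
proof
  show "inj_on (key N) (rcosets (level N))"
  proof (rule inj_onI)
    fix U U' assume "U \<in> rcosets (level N)" "U' \<in> rcosets (level N)" and eq: "key N U = key N U'"
    then obtain g g' where g: "g \<in> carrier G" "U = level N #> g" "g' \<in> carrier G" "U' = level N #> g'"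
      by (auto simp: RCOSETS_def)
    have H_eq: "H #> g = H #> g'" and mod: "\<kappa> g mod int N = \<kappa> g' mod int N"
      using eq g by (simp_all add: key_coset)
    have h: "g \<otimes> inv g' \<in> H" using H_eq rcos_eq_iff[OF Hs g(1,3)] by simp
    have "\<kappa> g = E (g \<otimes> inv g') + \<kappa> g'" using \<kappa>_mult(2)[OF h g(3)] g by (simp add: m_assoc)
    moreover have "int N dvd \<kappa> g - \<kappa> g'" using mod by (simp only: mod_eq_dvd_iff)
    ultimately have "g \<otimes> inv g' \<in> level N" using h by (simp add: level_def)
    then show "U = U'" using g rcos_eq_iff[OF subgroup_level g(1,3)] by simp
  qed
  show "key N ` (rcosets (level N)) = (rcosets H) \<times> {0..<int N}"
  proof (intro equalityI subsetI)
    fix y assume "y \<in> key N ` (rcosets (level N))"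
    then obtain g where g: "g \<in> carrier G" "y = key N (level N #> g)" by (auto simp: RCOSETS_def)
    then show "y \<in> (rcosets H) \<times> {0..<int N}"
      using N rcosetsI[OF subgroup.subset[OF Hs] g(1)] by (simp add: key_coset)
  next
    fix y assume "y \<in> (rcosets H) \<times> {0..<int N}"
    then obtain g r where g: "g \<in> carrier G" "y = (H #> g, r)" "0 \<le> r" "r < int N" by (auto simp: RCOSETS_def)
    define k where "k = nat ((r - \<kappa> g) mod int N)"
    have k: "int k = (r - \<kappa> g) mod int N" using N by (simp add: k_def)
    let ?g = "a [^] k \<otimes> g"
    have gG: "?g \<in> carrier G" using g(1) a_pow(1) H_carrier by blast
    have "\<kappa> ?g mod int N = ((r - \<kappa> g) mod int N + \<kappa> g) mod int N"
      using \<kappa>_mult(2)[OF a_pow(1) g(1), of k] a_pow(2)[of k] k by simp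
    also have "\<dots> = r" using g(3,4) by (simp add: mod_add_left_eq)
    finally have "key N (level N #> ?g) = y"
      using g(2) \<kappa>_mult(1)[OF a_pow(1) g(1), of k] by (simp add: key_coset[OF gG])
    then show "y \<in> key N ` (rcosets (level N))"
      using rcosetsI[OF subgroup.subset[OF subgroup_level] gG] by blast
  qed
qed

lemma card_rcosets_level: "N > 0 \<Longrightarrow> card (rcosets (level N)) = card (rcosets H) * N"
  using bij_betw_same_card[OF key_bij] by (simp add: card_cartesian_product)

lemma finite_index_level: "N > 0 \<Longrightarrow> finite_index_subgroup (level N) G"
  using bij_betw_finite[OF key_bij] fin_H subgroup_level by (simp add: finite_index_subgroup_def)

lemma H_in_rcosets: "card (rcosets H) > 0"
  using subgroup_in_rcosets[OF Hs] fin_H by (auto simp: card_gt_0_iff)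

text \<open>The conjugates of b by the powers a^k with k < N lie in every level and are dual to the
  counts at position k. On \<open>level N\<close> these counts are additive, as the shift by E g is
  a multiple of N there. They correspond to the N lifts of the loop b in the cyclic cover.\<close>

lemma mod_p_rank_level:
  assumes p: "prime p" and N: "N > 0"
  shows "N \<le> mod_p_rank p (G\<lparr>carrier := level N\<rparr>)"
proof -
  define x where "x k = a [^] k \<otimes> b \<otimes> inv (a [^] k)" for k :: nat
  have inv_H: "inv (a [^] k) \<in> H" for k :: nat using a_pow(1) subgroup.m_inv_closed[OF Hs] by blast
  have ab_H: "a [^] k \<otimes> b \<in> H" for k :: nat using a_pow(1) b(1) subgroup.m_closed[OF Hs] by blast
  have x: "x k \<in> level N" for k
    using subgroup.m_closed[OF Hs ab_H inv_H] a_pow b E_mult[OF ab_H inv_H, of k k] E_mult[OF a_pow(1) b(1), of k] E_inv[OF a_pow(1), of k]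
    by (simp add: level_def x_def)
  have C_one: "C N k \<one> = 0" for k
    using C_mult[OF subgroup.one_closed[OF Hs] subgroup.one_closed[OF Hs], of N k] E_one by simp
  have C_pow: "C N k (a [^] j) = 0" for k and j :: nat
  proof (induction j)
    case (Suc j)
    then show ?case using C_mult[OF a_pow(1) a(1), of N k j] C_a by simp
  qed (simp add: C_one)
  have C_inv: "C N k (inv (a [^] j)) = 0" for k and j :: nat
    using C_mult[OF inv_H a_pow(1), of N k j j] C_pow[of _ j] C_one[of k] H_carrier[OF a_pow(1), of j] by simp
  have C_x: "C N (int k) (x j) = (if j = k then 1 else 0)" if "j < N" "k < N" for j k
  proof -
    have "C N (int k) (x j) = (if int N dvd int k - int j then 1 else 0)"
      unfolding x_def using C_mult[OF ab_H inv_H, of N "int k" j j] C_mult[OF a_pow(1) b(1), of N "int k" j]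
        C_inv C_pow C_b a_pow(2)[of j] by simp
    moreover have "int N dvd int k - int j \<longleftrightarrow> j = k"
      using that zdvd_imp_le[of "int N" "int k - int j"] zdvd_imp_le[of "int N" "int j - int k"]
        dvd_diff_commute[of "int N" "int k" "int j"] by (cases "int k" "int j" rule: linorder_cases) auto
    ultimately show ?thesis by simp
  qed
  have inj: "inj_on x {..<N}"
  proof (rule inj_onI)
    fix j k assume "j \<in> {..<N}" "k \<in> {..<N}" "x j = x k"
    then show "j = k" using C_x[of j k] C_x[of k k] by (simp split: if_splits)
  qed
  \<comment> \<open>The dual family is to be indexed by group elements, so the position k is
    recovered from the conjugate.\<close>
  define \<phi> where "\<phi> y = C N (int (the_inv_into {..<N} x y))" for y
  have \<phi>_x: "\<phi> (x k) = C N (int k)" if "k < N" for k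
    using the_inv_into_f_f[OF inj, of k] that by (simp add: \<phi>_def)
  have "card (x ` {..<N}) \<le> mod_p_rank p (G\<lparr>carrier := level N\<rparr>)"
  proof (rule mod_p_rank_ge_subgroup[OF p finite_index_level[OF N], where \<phi> = \<phi>])
    show "x ` {..<N} \<subseteq> level N" using x by blast
    fix y g h assume "g \<in> level N" "h \<in> level N"
    then have gh: "g \<in> H" "h \<in> H" "int N dvd E g" by (auto simp: level_def)
    have "C N (k - E g) h = C N k h" for k by (rule C_period) (use gh(3) in simp)
    then show "\<phi> y (g \<otimes> h) = \<phi> y g + \<phi> y h" unfolding \<phi>_def using C_mult[OF gh(1,2)] by simp
  next
    fix y y' assume "y \<in> x ` {..<N}" "y' \<in> x ` {..<N}"
    then obtain j k where jk: "j < N" "k < N" "y = x j" "y' = x k" by auto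
    then have "y = y' \<longleftrightarrow> j = k" using inj_on_eq_iff[OF inj, of j k] by simp
    then show "\<phi> y y' = (if y = y' then 1 else 0)" using jk C_x[of k j] \<phi>_x[of j] by simp
  qed simp
  then show ?thesis using card_image[OF inj] by simp
qed

lemma growth_level: "prime p \<Longrightarrow> linear_mod_p_growth p G (range (\<lambda>i :: nat. level (2 ^ i)))"
proof -
  assume p: "prime p"
  let ?m = "real (card (rcosets H))"
  have m: "?m > 0" using H_in_rcosets by simp
  have "ereal (1 / ?m) \<le> ereal (real (mod_p_rank p (G\<lparr>carrier := level (2 ^ i)\<rparr>)) / real (index G (level (2 ^ i))))"
    for i :: nat
  proof -
    have "real (2 ^ i) \<le> real (mod_p_rank p (G\<lparr>carrier := level (2 ^ i)\<rparr>))"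
      using mod_p_rank_level[OF p, of "2 ^ i"] by (simp only: of_nat_le_iff) simp
    then have "real (2 ^ i) / (?m * real (2 ^ i)) \<le> real (mod_p_rank p (G\<lparr>carrier := level (2 ^ i)\<rparr>)) / (?m * real (2 ^ i))"
      by (rule divide_right_mono) simp
    moreover have "real (2 ^ i) / (?m * real (2 ^ i)) = 1 / ?m" by simp
    moreover have "real (index G (level (2 ^ i))) = ?m * real (2 ^ i)"
      using card_rcosets_level[of "2 ^ i"] by (simp add: index_def)
    ultimately show ?thesis by simp
  qed
  then have "ereal (1 / ?m) \<le> (INF K\<in>range (\<lambda>i :: nat. level (2 ^ i)).
      ereal (real (mod_p_rank p (G\<lparr>carrier := K\<rparr>)) / real (index G K)))"
    by (intro INF_greatest) auto
  moreover have "0 < ereal (1 / ?m)" using m by simp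
  ultimately show ?thesis unfolding linear_mod_p_growth_def by order
qed

text \<open>The change along an edge depends only on the coset of H and on s, not on the position on
  the cycle. It is therefore bounded uniformly over all levels.\<close>

lemma \<kappa>_edge:
  assumes g: "g \<in> carrier G" and s: "s \<in> carrier G"
  shows "\<kappa> (g \<otimes> s) = \<kappa> g + E (rep H (H #> g) \<otimes> s \<otimes> inv (rep H (H #> g #> s)))"
proof -
  let ?t = "rep H (H #> g)" and ?t' = "rep H (H #> g #> s)"
  have eq: "H #> (g \<otimes> s) = H #> g #> s" using coset_mult_assoc[OF subgroup.subset[OF Hs] g s] by simp
  have gs: "g \<otimes> s \<in> carrier G" using g s by simp
  note t = rep_H[OF g] and t' = rep_H[OF gs, unfolded eq]
  have tele: "(g \<otimes> inv ?t) \<otimes> (?t \<otimes> s \<otimes> inv ?t') = g \<otimes> s \<otimes> inv ?t'"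
    using telescope3[OF one_closed g t(1) s t'(1)] g s t t' by simp
  have cancel: "inv u \<otimes> (u \<otimes> v) = v" if "u \<in> carrier G" "v \<in> carrier G" for u v
    using that by (simp add: m_assoc[symmetric])
  have "inv (g \<otimes> inv ?t) \<otimes> (g \<otimes> s \<otimes> inv ?t') = ?t \<otimes> s \<otimes> inv ?t'"
    unfolding tele[symmetric] by (rule cancel) (use g s t(1) t'(1) in simp_all)
  then have "?t \<otimes> s \<otimes> inv ?t' \<in> H"
    using subgroup.m_closed[OF Hs subgroup.m_inv_closed[OF Hs t(2)] t'(2)] by simp
  from E_mult[OF t(2) this] show ?thesis unfolding tele \<kappa>_def eq .
qed

text \<open>A jump of length at most M passes from one half of a cycle of length 2N to the other
  only if it starts near 0 or near N. The exceptional residues number at most 4M, whatever N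
  is.\<close>

lemma mod_add_half:
  fixes r e M N :: int
  assumes r: "0 \<le> r" "r < 2 * N" and e: "\<bar>e\<bar> \<le> M"
    and out: "r \<notin> {0..<M} \<union> {N - M..<N + M} \<union> {2 * N - M..<2 * N}"
  shows "(r + e) mod (2 * N) < N \<longleftrightarrow> r < N"
proof -
  have "0 \<le> r + e" "r + e < 2 * N" "r + e < N \<longleftrightarrow> r < N" using assms by auto
  then show ?thesis by simp
qed

text \<open>For any generating set, half of each cycle is a set whose size grows with N while the
  number of its boundary edges stays bounded. All generating sets have to be treated, because the
  property asks for some set with positive infimum.\<close>

lemma not_tau_level: "\<not> property_tau G (range (\<lambda>i :: nat. level (2 ^ i)))"
proof
  assume "property_tau G (range (\<lambda>i :: nat. level (2 ^ i)))"
  then obtain S where S: "finite S" "S \<subseteq> carrier G"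
    and pos: "0 < (INF K\<in>range (\<lambda>i :: nat. level (2 ^ i)). cheeger (schreier_graph G K S))"
    unfolding property_tau_def by blast
  obtain \<epsilon> where \<epsilon>: "0 < ereal \<epsilon>" "ereal \<epsilon> < (INF K\<in>range (\<lambda>i :: nat. level (2 ^ i)). cheeger (schreier_graph G K S))"
    using ereal_dense2[OF pos] by blast
  have \<epsilon>0: "\<epsilon> > 0" using \<epsilon>(1) by simp
  define e where "e U s = E (rep H U \<otimes> s \<otimes> inv (rep H (U #> s)))" for U s
  define M where "M = Max (insert 0 ((\<lambda>(U, s). \<bar>e U s\<bar>) ` ((rcosets H) \<times> S)))"
  have fin: "finite (insert 0 ((\<lambda>(U, s). \<bar>e U s\<bar>) ` ((rcosets H) \<times> S)))" using fin_H S by simp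
  have M: "\<bar>e U s\<bar> \<le> M" if "U \<in> rcosets H" "s \<in> S" for U s
    unfolding M_def by (rule Max_ge[OF fin]) (use that in force)
  have M0: "M \<ge> 0" unfolding M_def by (rule Max_ge[OF fin]) simp
  \<comment> \<open>Bounds the boundary at every level: cosets of H, exceptional positions on the
    cycle, and generators.\<close>
  define c where "c = real (card (rcosets H)) * (4 * real_of_int M) * real (card S)"
  have pos': "0 < \<epsilon> * real (card (rcosets H))" using \<epsilon>0 H_in_rcosets by simp
  have "\<exists>i. c / (\<epsilon> * real (card (rcosets H))) < 2 ^ i" by (rule real_arch_pow) simp
  then obtain i where "c / (\<epsilon> * real (card (rcosets H))) < 2 ^ i" by blast
  then have "c < 2 ^ i * (\<epsilon> * real (card (rcosets H)))"
    unfolding pos_divide_less_eq[OF pos'] .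
  then have i: "c < \<epsilon> * (real (card (rcosets H)) * 2 ^ i)" by (simp only: mult_ac)
  define N :: nat where "N = 2 ^ i"
  have N: "N > 0" "2 * N = 2 ^ Suc i" by (simp_all add: N_def)
  have N2: "2 * N > 0" using N by simp
  let ?K = "level (2 * N)" and ?k = "key (2 * N)"
  \<comment> \<open>The cosets in the first half of each cycle, which make up exactly half of all
    cosets.\<close>
  define A where "A = {U \<in> rcosets ?K. snd (?k U) < int N}"
  define B where "B = {0..<M} \<union> {int N - M..<int N + M} \<union> {2 * int N - M..<2 * int N}"
  note bij = key_bij[OF N2]
  have "?k ` A = (rcosets H) \<times> {0..<int N}"
  proof
    show "?k ` A \<subseteq> (rcosets H) \<times> {0..<int N}"
    proof
      fix y assume "y \<in> ?k ` A"
      then obtain U where U: "U \<in> rcosets ?K" "snd (?k U) < int N" "y = ?k U" by (auto simp: A_def)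
      then have "y \<in> (rcosets H) \<times> {0..<int (2 * N)}" using bij_betw_imp_surj_on[OF bij] by blast
      then show "y \<in> (rcosets H) \<times> {0..<int N}" using U(2,3) by (simp add: mem_Times_iff)
    qed
    show "(rcosets H) \<times> {0..<int N} \<subseteq> ?k ` A"
    proof
      fix y assume y: "y \<in> (rcosets H) \<times> {0..<int N}"
      then have "y \<in> (rcosets H) \<times> {0..<int (2 * N)}" by auto
      then obtain U where "U \<in> rcosets ?K" "y = ?k U" using bij_betw_imp_surj_on[OF bij] by blast
      then show "y \<in> ?k ` A" using y by (auto simp: A_def)
    qed
  qed
  moreover have inj: "inj_on ?k (rcosets ?K)" by (rule bij_betw_imp_inj_on[OF bij])
  have "inj_on ?k A" by (rule inj_on_subset[OF inj]) (simp add: A_def)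
  ultimately have cA: "card A = card (rcosets H) * N"
    using card_image[of ?k A] by (simp add: card_cartesian_product)
  have AK: "A \<subseteq> rcosets ?K" unfolding A_def by (rule Collect_restrict)
  have A: "0 < card A" "2 * card A \<le> card (rcosets ?K)"
    unfolding cA card_rcosets_level[OF N2] using H_in_rcosets N(1) by simp_all
  let ?E = "edge_boundary (schreier_graph G ?K S) A"
  have edges: "fst (?k U) \<in> rcosets H \<and> snd (?k U) \<in> B" if "(U, s) \<in> ?E" for U s
  proof -
    have U: "U \<in> rcosets ?K" "s \<in> S" "(U \<in> A) \<noteq> (U #> s \<in> A)"
      using that by (auto simp: edge_boundary_def schreier_graph_def)
    then obtain g where g: "g \<in> carrier G" "U = ?K #> g" by (auto simp: RCOSETS_def)
    have sG: "s \<in> carrier G" using U(2) S(2) by blast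
    have Us: "U #> s = ?K #> (g \<otimes> s)" "g \<otimes> s \<in> carrier G"
      using g sG coset_mult_assoc[OF subgroup.subset[OF subgroup_level]] by auto
    have Hg: "H #> g \<in> rcosets H" by (rule rcosetsI[OF subgroup.subset[OF Hs] g(1)])
    have Us_in: "U #> s \<in> rcosets ?K"
      unfolding Us(1) by (rule rcosetsI[OF subgroup.subset[OF subgroup_level] Us(2)])
    let ?r = "\<kappa> g mod (2 * int N)"
    have kU: "?k U = (H #> g, ?r)" using key_coset[OF g(1), of "2 * N"] g(2) by simp
    have "snd (?k (U #> s)) = (?r + e (H #> g) s) mod (2 * int N)"
      using key_coset[OF Us(2), of "2 * N"] \<kappa>_edge[OF g(1) sG] unfolding Us(1) e_def by (simp add: mod_add_left_eq)
    then have "(?r < int N) \<noteq> ((?r + e (H #> g) s) mod (2 * int N) < int N)"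
      using U(1,3) Us_in kU by (simp add: A_def)
    moreover have "0 \<le> ?r" "?r < 2 * int N" using N by auto
    ultimately have "?r \<in> B"
      using mod_add_half[of ?r "int N" "e (H #> g) s" M] M[OF Hg U(2)] unfolding B_def by blast
    then show ?thesis using kU Hg by simp
  qed
  have finB: "finite B" by (simp add: B_def)
  have "card ?E \<le> card (((rcosets H) \<times> B) \<times> S)"
  proof (rule card_inj_on_le[of "\<lambda>(U, s). (?k U, s)"])
    show "inj_on (\<lambda>(U, s). (?k U, s)) ?E"
      using inj by (auto simp: inj_on_def edge_boundary_def schreier_graph_def)
    show "(\<lambda>(U, s). (?k U, s)) ` ?E \<subseteq> ((rcosets H) \<times> B) \<times> S"
    proof
      fix y assume "y \<in> (\<lambda>(U, s). (?k U, s)) ` ?E"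
      then obtain U s where y: "y = (?k U, s)" "(U, s) \<in> ?E" by auto
      then have "s \<in> S" by (simp add: edge_boundary_def schreier_graph_def)
      then show "y \<in> ((rcosets H) \<times> B) \<times> S" using edges[OF y(2)] y(1) by (simp add: mem_Times_iff)
    qed
  qed (use fin_H finB S in simp)
  also have "\<dots> = card (rcosets H) * card B * card S" by (simp add: card_cartesian_product)
  finally have cE: "real (card ?E) \<le> real (card (rcosets H) * card B * card S)" by (simp only: of_nat_le_iff)
  have "card B \<le> card {0..<M} + card {int N - M..<int N + M} + card {2 * int N - M..<2 * int N}"
    unfolding B_def by (intro order_trans[OF card_Un_le] add_mono order_refl card_Un_le)
  then have "real (card B) \<le> 4 * real_of_int M" using M0 by (simp add: nat_le_iff)
  then have "real (card (rcosets H) * card B * card S) \<le> c"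
    unfolding c_def of_nat_mult by (intro mult_right_mono mult_left_mono) auto
  then have "real (card ?E) < \<epsilon> * real (card A)" using cE i cA by (simp add: N_def)
  then have "real (card ?E) / real (card A) < \<epsilon>" using A(1) by (simp add: pos_divide_less_eq)
  moreover have "cheeger (schreier_graph G ?K S) \<le> ereal (real (card ?E) / real (card A))"
    unfolding cheeger_def by (rule INF_lower) (use A AK in \<open>simp add: schreier_graph_def\<close>)
  moreover have "(INF K\<in>range (\<lambda>i :: nat. level (2 ^ i)). cheeger (schreier_graph G K S)) \<le> cheeger (schreier_graph G ?K S)"
    unfolding N(2) by (rule INF_lower) blast
  ultimately have "(INF K\<in>range (\<lambda>i :: nat. level (2 ^ i)). cheeger (schreier_graph G K S)) \<le> ereal \<epsilon>"
    by (meson ereal_less_eq(3) less_imp_le order_trans)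
  then show False using \<epsilon>(2) by simp
qed

end

text \<open>Used in contrapositive form: a non-abelian free group has two distinct basis
  elements.\<close>

lemma comm_group_free_group:
  assumes Y: "\<And>x y. x \<in> Y \<Longrightarrow> y \<in> Y \<Longrightarrow> x = y"
  shows "comm_group (free_group Y)"
proof -
  have push: "push_letter l (push_letter m w) = push_letter m (push_letter l w)"
    if "fst l \<in> Y" "fst m \<in> Y" "reduced w" for l m w
  proof (cases "l = m")
    case False
    have "fst l = fst m" using Y that by blast
    then have m: "m = inv_letter l" using False by (cases l, cases m) (auto simp: inv_letter_def)
    show ?thesis
      using push_inv_push[OF that(3), of l] push_inv_push[OF that(3), of "inv_letter l"] unfolding m by simp
  qed simp
  have push_foldr: "push_letter l (foldr push_letter v w) = foldr push_letter v (push_letter l w)"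
    if "fst l \<in> Y" "fst ` set v \<subseteq> Y" "reduced w" for l v w
    using that
  proof (induction v)
    case (Cons m v)
    then show ?case using push[of l m "foldr push_letter v w"] reduced_foldr[of w v] by simp
  qed simp
  have swap: "foldr push_letter u (foldr push_letter v w) = foldr push_letter v (foldr push_letter u w)"
    if "fst ` set u \<subseteq> Y" "fst ` set v \<subseteq> Y" "reduced w" for u v w
    using that
  proof (induction u)
    case (Cons l u)
    then show ?case using push_foldr[of l v "foldr push_letter u w"] reduced_foldr[of w u] by simp
  qed simp
  show ?thesis
  proof (rule group.group_comm_groupI[OF group_free_group])
    fix u v assume "u \<in> carrier (free_group Y)" "v \<in> carrier (free_group Y)"
    then have uv: "fst ` set u \<subseteq> Y" "fst ` set v \<subseteq> Y" "reduced u" "reduced v" by (auto simp: free_group_def)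
    have "foldr push_letter u v = foldr push_letter v u"
      using swap[OF uv(1,2), of "[]"] foldr_one[OF uv(3)] foldr_one[OF uv(4)] by (simp add: reduced_def)
    then show "u \<otimes>\<^bsub>free_group Y\<^esub> v = v \<otimes>\<^bsub>free_group Y\<^esub> u" by (simp add: free_group_def)
  qed
qed

section \<open>Exponent sums and signed counts of words\<close>

definition letter_exponent :: "'x \<Rightarrow> 'x \<times> bool \<Rightarrow> int" where
  "letter_exponent a l = (if fst l = a then if snd l then 1 else - 1 else 0)"

definition exponent_sum :: "'x \<Rightarrow> ('x \<times> bool) list \<Rightarrow> int" where
  "exponent_sum a w = (\<Sum>l\<leftarrow>w. letter_exponent a l)"

text \<open>For a \<noteq> b this is the coefficient at position k of the Fox derivative with
  respect to b, mapped to the group ring of the integers modulo N by the exponent sum of a. The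
  position k is lowered while letters a are read, so an occurrence counts when the remainder is
  divisible by N.\<close>

fun signed_count :: "'x \<Rightarrow> 'x \<Rightarrow> nat \<Rightarrow> int \<Rightarrow> ('x \<times> bool) list \<Rightarrow> int" where
  "signed_count a b N k [] = 0"
| "signed_count a b N k (l # w) =
    (if int N dvd k then letter_exponent b l else 0) + signed_count a b N (k - letter_exponent a l) w"

lemma letter_exponent_inv: "letter_exponent a (inv_letter l) = - letter_exponent a l"
  by (simp add: letter_exponent_def inv_letter_def)

lemma exponent_sum_foldr: "exponent_sum a (foldr push_letter u v) = exponent_sum a u + exponent_sum a v"
proof (induction u)
  case (Cons l u)
  have "exponent_sum a (push_letter l w) = letter_exponent a l + exponent_sum a w" for w
    by (cases w) (auto simp: exponent_sum_def letter_exponent_inv)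
  with Cons show ?case by (simp add: exponent_sum_def)
qed (simp add: exponent_sum_def)

text \<open>A letter that is counted does not move the position, since a \<noteq> b. So the two
  letters of a cancelling pair contribute opposite values at the same position.\<close>

lemma signed_count_push:
  assumes "a \<noteq> b"
  shows "signed_count a b N k (push_letter l w) = signed_count a b N k (l # w)"
proof (cases w)
  case (Cons m v)
  have "letter_exponent a l = 0 \<or> letter_exponent b l = 0" using assms by (simp add: letter_exponent_def)
  then show ?thesis using Cons by (auto simp: letter_exponent_inv)
qed simp

lemma signed_count_foldr:
  assumes "a \<noteq> b"
  shows "signed_count a b N k (foldr push_letter u v) =
    signed_count a b N k u + signed_count a b N (k - exponent_sum a u) v"
proof (induction u arbitrary: k)
  case (Cons l u)
  then show ?case using signed_count_push[OF assms, of N k l "foldr push_letter u v"]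
    by (simp add: exponent_sum_def diff_diff_eq)
qed (simp add: exponent_sum_def)

lemma signed_count_period: "int N dvd k - k' \<Longrightarrow> signed_count a b N k w = signed_count a b N k' w"
proof (induction w arbitrary: k k')
  case (Cons l w)
  have "int N dvd k \<longleftrightarrow> int N dvd k'" using Cons.prems dvd_add_right_iff[of "int N" "k - k'" k'] by simp
  moreover have "int N dvd (k - letter_exponent a l) - (k' - letter_exponent a l)" using Cons.prems by simp
  ultimately show ?case using Cons.IH by simp
qed simp

lemma tower_of_large:
  fixes G :: "('a, 'b) monoid_scheme"
  assumes "group G" "finitely_presented G" "large G"
  obtains Gs :: "nat \<Rightarrow> 'a set" where "\<And>i. finite_index_subgroup (Gs i) G"
    "\<And>i. Gs (Suc i) \<lhd> G\<lparr>carrier := Gs i\<rparr>" "\<And>i. index (G\<lparr>carrier := Gs i\<rparr>) (Gs (Suc i)) = 2"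
    "\<not> property_tau G (range Gs)" "linear_mod_p_growth 2 G (range Gs)"
proof -
  obtain X :: "nat set" and R \<pi> where "presented_group G X R \<pi>"
    using finitely_presented_imp_presented[OF assms(1,2)] .
  then interpret P: presented_group G X R \<pi> .
  obtain H and Y :: "'a set" and \<psi> where H: "finite_index_subgroup H G" and Y: "\<not> comm_group (free_group Y)"
    and \<psi>: "\<psi> \<in> epi (G\<lparr>carrier := H\<rparr>) (free_group Y)"
    using assms(3) unfolding large_def by blast
  obtain a b where ab: "a \<in> Y" "b \<in> Y" "a \<noteq> b" using comm_group_free_group[of Y] Y by blast
  have \<psi>_image: "\<psi> ` H = carrier (free_group Y)" and \<psi>_hom: "\<psi> \<in> hom (G\<lparr>carrier := H\<rparr>) (free_group Y)"
    using \<psi> by (simp_all add: epi_def)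
  have letters: "[(a, True)] \<in> carrier (free_group Y)" "[(b, True)] \<in> carrier (free_group Y)"
    using ab by (simp_all add: free_group_def reduced_def)
  obtain g where g: "g \<in> H" "\<psi> g = [(a, True)]" using letters(1) \<psi>_image by (metis imageE)
  obtain h where h: "h \<in> H" "\<psi> h = [(b, True)]" using letters(2) \<psi>_image by (metis imageE)
  have mult: "\<psi> (u \<otimes>\<^bsub>G\<^esub> v) = foldr push_letter (\<psi> u) (\<psi> v)" if "u \<in> H" "v \<in> H" for u v
    using hom_mult[OF \<psi>_hom, of u v] that by (simp add: free_group_def)
  interpret C: counted_subgroup G X R \<pi> H "\<lambda>u. exponent_sum a (\<psi> u)" "\<lambda>N k u. signed_count a b N k (\<psi> u)" g h
  proof
    show "finite_index_subgroup H G" by (rule H)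
    show "g \<in> H" "h \<in> H" by (rule g(1), rule h(1))
    show "exponent_sum a (\<psi> g) = 1" "exponent_sum a (\<psi> h) = 0"
      using g h ab by (simp_all add: exponent_sum_def letter_exponent_def)
    fix u v N k assume uv: "u \<in> H" "v \<in> H"
    show "exponent_sum a (\<psi> (u \<otimes>\<^bsub>G\<^esub> v)) = exponent_sum a (\<psi> u) + exponent_sum a (\<psi> v)"
      unfolding mult[OF uv] by (rule exponent_sum_foldr)
    show "signed_count a b N k (\<psi> (u \<otimes>\<^bsub>G\<^esub> v)) =
        signed_count a b N k (\<psi> u) + signed_count a b N (k - exponent_sum a (\<psi> u)) (\<psi> v)"
      unfolding mult[OF uv] by (rule signed_count_foldr[OF ab(3)])
  next
    show "signed_count a b N k (\<psi> u) = signed_count a b N k' (\<psi> u)" if "int N dvd k - k'" for N k k' u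
      by (rule signed_count_period[OF that])
    show "signed_count a b N k (\<psi> g) = 0" "signed_count a b N k (\<psi> h) = (if int N dvd k then 1 else 0)" for N k
      using g h ab by (simp_all add: letter_exponent_def)
  qed
  show thesis
  proof (rule that[of "\<lambda>i. C.level (2 ^ i)"])
    fix i :: nat
    show "finite_index_subgroup (C.level (2 ^ i)) G" by (rule C.finite_index_level) simp
    show "C.level (2 ^ Suc i) \<lhd> G\<lparr>carrier := C.level (2 ^ i)\<rparr>"
      using C.level_double_normal[of "2 ^ i"] by simp
    show "index (G\<lparr>carrier := C.level (2 ^ i)\<rparr>) (C.level (2 ^ Suc i)) = 2"
      using C.index_level_double[of "2 ^ i"] by simp
  next
    show "\<not> property_tau G (range (\<lambda>i. C.level (2 ^ i)))" by (rule C.not_tau_level)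
    show "linear_mod_p_growth 2 G (range (\<lambda>i. C.level (2 ^ i)))" by (rule C.growth_level) simp
  qed
qed

theorem theorem1p2:
  fixes G :: "('a, 'b) monoid_scheme"
  assumes "group G" and "finitely_presented G"
  shows "large G \<longleftrightarrow>
    (\<exists>(Gs :: nat \<Rightarrow> 'a set) (p :: nat).
       (\<forall>i. finite_index_subgroup (Gs i) G) \<and> prime p \<and>
       (\<forall>i. Gs (Suc i) \<lhd> G\<lparr>carrier := Gs i\<rparr> \<and>
            (\<exists>k. index (G\<lparr>carrier := Gs i\<rparr>) (Gs (Suc i)) = p ^ k)) \<and>
       \<not> property_tau G (range Gs) \<and>
       linear_mod_p_growth p G (range Gs))"
proof
  assume "large G"
  then obtain Gs :: "nat \<Rightarrow> 'a set" where Gs: "\<And>i. finite_index_subgroup (Gs i) G"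
    "\<And>i. Gs (Suc i) \<lhd> G\<lparr>carrier := Gs i\<rparr>" "\<And>i. index (G\<lparr>carrier := Gs i\<rparr>) (Gs (Suc i)) = 2"
    "\<not> property_tau G (range Gs)" "linear_mod_p_growth 2 G (range Gs)"
    using tower_of_large[OF assms] by blast
  have "\<exists>k. index (G\<lparr>carrier := Gs i\<rparr>) (Gs (Suc i)) = 2 ^ k" for i
    by (rule exI[of _ 1]) (simp add: Gs(3))
  with Gs two_is_prime_nat show "\<exists>(Gs :: nat \<Rightarrow> 'a set) (p :: nat).
       (\<forall>i. finite_index_subgroup (Gs i) G) \<and> prime p \<and>
       (\<forall>i. Gs (Suc i) \<lhd> G\<lparr>carrier := Gs i\<rparr> \<and>
            (\<exists>k. index (G\<lparr>carrier := Gs i\<rparr>) (Gs (Suc i)) = p ^ k)) \<and>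
       \<not> property_tau G (range Gs) \<and>
       linear_mod_p_growth p G (range Gs)"
    by (intro exI[of _ Gs] exI[of _ "2 :: nat"]) blast
next
  assume "\<exists>(Gs :: nat \<Rightarrow> 'a set) (p :: nat).
       (\<forall>i. finite_index_subgroup (Gs i) G) \<and> prime p \<and>
       (\<forall>i. Gs (Suc i) \<lhd> G\<lparr>carrier := Gs i\<rparr> \<and>
            (\<exists>k. index (G\<lparr>carrier := Gs i\<rparr>) (Gs (Suc i)) = p ^ k)) \<and>
       \<not> property_tau G (range Gs) \<and>
       linear_mod_p_growth p G (range Gs)"
  then obtain Gs :: "nat \<Rightarrow> 'a set" and p :: nat where "prime p" "\<And>i. finite_index_subgroup (Gs i) G"
    "\<And>i. Gs (Suc i) \<lhd> G\<lparr>carrier := Gs i\<rparr>" "\<And>i. \<exists>k. index (G\<lparr>carrier := Gs i\<rparr>) (Gs (Suc i)) = p ^ k"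
    "\<not> property_tau G (range Gs)" "linear_mod_p_growth p G (range Gs)"
    by blast
  then show "large G" by (rule large_of_tower[OF assms])
qed

end
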